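(* Let $l\ge0$ and $f_0\in H_l$. Then there exists a unique solution $f(t,x,\mathbf q)$, global in time, of the linearized relativistic BGK equation $$\partial_tf+\hat q\cdot\nabla_xf=Lf,\qquad f(0)=f_0,$$ satisfying $f(t)\in H_l$ and $\|f(t)\|_l\le\|f_0\|_l$ for all $t\ge0$.
   Context: Dimensionless setting: $q^0=\sqrt{1+|\mathbf q|^2}$, $\hat q=\mathbf q/q^0$, $K_j(\beta)=\int_0^\infty\cosh(jr)e^{-\beta\cosh r}dr$, $M(\beta)=\int_{\mathbb{R}^3}e^{-\beta\sqrt{1+|\mathbf p|^2}}d\mathbf p$, $\Psi(\beta)=\frac3\beta+\frac{K_1(\beta)}{K_2(\beta)}$. Fix $\beta_0>0$, $J^0=e^{-\beta_0q^0}/M(\beta_0)$, $\alpha_0=K_1(\beta_0)/K_2(\beta_0)$, $\kappa_0=\frac{3\alpha_0}{\beta_0}+\alpha_0^2-1$. For $h=f\sqrt{J^0}$: $n_h\sqrt{1+|\mathbf u_h|^2}:=\int h\,d\mathbf q$, $n_h\alpha_h:=\int h\,d\mathbf q/q^0$, $n_h\mathbf u_h:=\int\mathbf qh\,d\mathbf q/q^0$; $P(f)=\big[\frac{\alpha_0q^0-1}{\kappa_0}n_h\sqrt{1+|\mathbf u_h|^2}+\frac{\Psi(\beta_0)-q^0}{\kappa_0}n_h\alpha_h+\beta_0n_h\mathbf u_h\cdot\mathbf q\big]\sqrt{J^0}$ and $Lf=\frac{P(f)-f}{q^0}$ (acting in $\mathbf q$). $H^l(x)$ is the Sobolev space on $\mathbb{R}^3_x$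 with norm $\|(1+|\zeta|)^{l/2}\hat f(\zeta)\|_{L^2(\zeta)}$ ($\hat f$ the Fourier transform in $x$), and $H_l=L^2(\mathbb{R}^3_{\mathbf q};H^l(x))$ with norm $\|f\|_l=\big(\int_{\mathbb{R}^3}\|f(\cdot,\mathbf q)\|^2_{H^l(x)}d\mathbf q\big)^{1/2}$. Solutions are understood in the semigroup sense: $f(t)=\exp(tB)f_0$, where $B=L-\hat q\cdot\nabla_x$ on $H_l$ with domain $\{f\in H_l:\hat q\cdot\nabla_xf+f/q^0\in H_l\}$. *)

theory Defs
  imports "HOL-Analysis.Analysis"
begin

type_synonym vec3 = "real ^ 3"
text \<open>Phase-space functions f x q (x = position, q = momentum), complex valued
  (complex values are needed because H^l is defined through the Fourier transform).\<close>
type_synonym pfun = "vec3 \<Rightarrow> vec3 \<Rightarrow> complex"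

definition q0 :: "vec3 \<Rightarrow> real" where
  "q0 q = sqrt (1 + (norm q)\<^sup>2)"

definition qhat :: "vec3 \<Rightarrow> vec3" where
  "qhat q = (1 / q0 q) *\<^sub>R q"

definition Kfun :: "real \<Rightarrow> real \<Rightarrow> real" where
  "Kfun j \<beta> = (LINT r:{0..}|lborel. cosh (j * r) * exp (- \<beta> * cosh r))"

definition Mfun :: "real \<Rightarrow> real" where
  "Mfun \<beta> = (LINT p|(lborel :: vec3 measure). exp (- \<beta> * q0 p))"

definition Psi :: "real \<Rightarrow> real" where
  "Psi \<beta> = 3 / \<beta> + Kfun 1 \<beta> / Kfun 2 \<beta>"

definition alpha0 :: "real \<Rightarrow> real" where
  "alpha0 \<beta>0 = Kfun 1 \<beta>0 / Kfun 2 \<beta>0"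

definition kappa0 :: "real \<Rightarrow> real" where
  "kappa0 \<beta>0 = 3 * alpha0 \<beta>0 / \<beta>0 + (alpha0 \<beta>0)\<^sup>2 - 1"

definition J0 :: "real \<Rightarrow> vec3 \<Rightarrow> real" where
  "J0 \<beta>0 q = exp (- \<beta>0 * q0 q) / Mfun \<beta>0"

text \<open>The projection P(f); h = f sqrt J0, and the three moments
  n_h sqrt(1+|u_h|^2), n_h alpha_h, n_h u_h are the integrals below.\<close>
definition Pop :: "real \<Rightarrow> pfun \<Rightarrow> pfun" where
  "Pop \<beta>0 f x q =
     (let h = (\<lambda>p. f x p * complex_of_real (sqrt (J0 \<beta>0 p)));
          a = (LINT p|lborel. h p);
          b = (LINT p|lborel. h p / complex_of_real (q0 p));
          c = (\<lambda>i. LINT p|lborel. complex_of_real (p $ i) * h p / complex_of_real (q0 p))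
      in (complex_of_real ((alpha0 \<beta>0 * q0 q - 1) / kappa0 \<beta>0) * a
          + complex_of_real ((Psi \<beta>0 - q0 q) / kappa0 \<beta>0) * b
          + complex_of_real \<beta>0 * (\<Sum>i\<in>UNIV. complex_of_real (q $ i) * c i))
         * complex_of_real (sqrt (J0 \<beta>0 q)))"

definition Lop :: "real \<Rightarrow> pfun \<Rightarrow> pfun" where
  "Lop \<beta>0 f x q = (Pop \<beta>0 f x q - f x q) / complex_of_real (q0 q)"

definition sq_int :: "(vec3 \<Rightarrow> complex) \<Rightarrow> bool" where
  "sq_int \<phi> \<longleftrightarrow> \<phi> \<in> borel_measurable lborel \<and> integrable lborel (\<lambda>x. (cmod (\<phi> x))\<^sup>2)"

definition ft3 :: "(vec3 \<Rightarrow> complex) \<Rightarrow> vec3 \<Rightarrow> complex" where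
  "ft3 \<phi> \<zeta> = (LINT x|lborel. exp (- \<i> * complex_of_real (x \<bullet> \<zeta>)) * \<phi> x)"

text \<open>g is the (L^2, Plancherel) Fourier transform of f, characterised by the
  multiplication formula against the dense class of test functions phi in
  L^1 \<inter> L^2 with Fourier transform in L^1 \<inter> L^2.\<close>
definition is_ft :: "(vec3 \<Rightarrow> complex) \<Rightarrow> (vec3 \<Rightarrow> complex) \<Rightarrow> bool" where
  "is_ft f g \<longleftrightarrow> sq_int f \<and> sq_int g \<and>
     (\<forall>\<phi>. integrable lborel \<phi> \<and> sq_int \<phi> \<and> integrable lborel (ft3 \<phi>) \<and> sq_int (ft3 \<phi>) \<longrightarrow>
        (LINT \<zeta>|lborel. g \<zeta> * \<phi> \<zeta>) = (LINT x|lborel. f x * ft3 \<phi> x))"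

definition Hl_rep :: "real \<Rightarrow> pfun \<Rightarrow> pfun \<Rightarrow> bool" where
  "Hl_rep l f g \<longleftrightarrow>
     case_prod f \<in> borel_measurable (lborel \<Otimes>\<^sub>M lborel) \<and>
     case_prod g \<in> borel_measurable (lborel \<Otimes>\<^sub>M lborel) \<and>
     (AE q in lborel. is_ft (\<lambda>x. f x q) (\<lambda>\<zeta>. g \<zeta> q)) \<and>
     integrable (lborel \<Otimes>\<^sub>M lborel) (\<lambda>(\<zeta>, q). (1 + norm \<zeta>) powr l * (cmod (g \<zeta> q))\<^sup>2)"

definition Hl :: "real \<Rightarrow> pfun set" where
  "Hl l = {f. \<exists>g. Hl_rep l f g}"

definition hl_norm :: "real \<Rightarrow> pfun \<Rightarrow> real" where
  "hl_norm l f = (let g = (SOME g. Hl_rep l f g) in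
     sqrt (LINT z|(lborel \<Otimes>\<^sub>M lborel). (case z of (\<zeta>, q) \<Rightarrow> (1 + norm \<zeta>) powr l * (cmod (g \<zeta> q))\<^sup>2)))"

definition fsub :: "pfun \<Rightarrow> pfun \<Rightarrow> pfun" where
  "fsub f g = (\<lambda>x q. f x q - g x q)"

definition fscale :: "complex \<Rightarrow> pfun \<Rightarrow> pfun" where
  "fscale c f = (\<lambda>x q. c * f x q)"

definition flin :: "complex \<Rightarrow> pfun \<Rightarrow> complex \<Rightarrow> pfun \<Rightarrow> pfun" where
  "flin a f b g = (\<lambda>x q. a * f x q + b * g x q)"

definition hl_dist :: "real \<Rightarrow> pfun \<Rightarrow> pfun \<Rightarrow> real" where
  "hl_dist l f g = hl_norm l (fsub f g)"

definition partial :: "nat \<Rightarrow> (vec3 \<Rightarrow> complex) \<Rightarrow> vec3 \<Rightarrow> complex" where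
  "partial i \<phi> x = vector_derivative (\<lambda>t. \<phi> (x + t *\<^sub>R axis (of_nat i) 1)) (at 0)"

fun iter_partial :: "nat list \<Rightarrow> (vec3 \<Rightarrow> complex) \<Rightarrow> vec3 \<Rightarrow> complex" where
  "iter_partial [] \<phi> = \<phi>"
| "iter_partial (i # is) \<phi> = partial i (iter_partial is \<phi>)"

definition test_fun :: "(vec3 \<Rightarrow> complex) \<Rightarrow> bool" where
  "test_fun \<phi> \<longleftrightarrow>
     (\<forall>is. set is \<subseteq> {0,1,2} \<longrightarrow> continuous_on UNIV (iter_partial is \<phi>) \<and>
        (\<forall>i\<in>{0,1,2}. \<forall>x. ((\<lambda>t. iter_partial is \<phi> (x + t *\<^sub>R axis (of_nat i) 1))
             has_vector_derivative iter_partial (i # is) \<phi> x) (at 0))) \<and>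
     (\<exists>R. \<forall>x. norm x > R \<longrightarrow> \<phi> x = 0)"

text \<open>w = qhat . grad_x f + f / q0 in the sense of distributions in x (for a.e. q).\<close>
definition transport_weak :: "pfun \<Rightarrow> pfun \<Rightarrow> bool" where
  "transport_weak f w \<longleftrightarrow>
     (AE q in lborel. \<forall>\<phi>. test_fun \<phi> \<longrightarrow>
        (LINT x|lborel. w x q * \<phi> x) =
        (LINT x|lborel. f x q * (\<phi> x / complex_of_real (q0 q)
            - (\<Sum>i\<in>{0::nat,1,2}. complex_of_real (qhat q $ of_nat i) * partial i \<phi> x))))"

definition domB :: "real \<Rightarrow> pfun set" where
  "domB l = {f \<in> Hl l. \<exists>w \<in> Hl l. transport_weak f w}"

text \<open>B f = L f - qhat . grad_x f = P(f)/q0 - (qhat . grad_x f + f/q0).\<close>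
definition Bop :: "real \<Rightarrow> real \<Rightarrow> pfun \<Rightarrow> pfun" where
  "Bop \<beta>0 l f = (let w = (SOME w. w \<in> Hl l \<and> transport_weak f w) in
     (\<lambda>x q. Pop \<beta>0 f x q / complex_of_real (q0 q) - w x q))"

section \<open>Strongly continuous semigroups on H_l (elements identified up to norm zero)\<close>

definition C0_semigroup :: "real \<Rightarrow> (real \<Rightarrow> pfun \<Rightarrow> pfun) \<Rightarrow> bool" where
  "C0_semigroup l T \<longleftrightarrow>
     (\<forall>t\<ge>0. \<forall>f\<in>Hl l. T t f \<in> Hl l) \<and>
     (\<forall>t\<ge>0. \<exists>C. \<forall>f\<in>Hl l. hl_norm l (T t f) \<le> C * hl_norm l f) \<and>
     (\<forall>t\<ge>0. \<forall>f\<in>Hl l. \<forall>g\<in>Hl l. \<forall>a b.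
        hl_dist l (T t (flin a f b g)) (flin a (T t f) b (T t g)) = 0) \<and>
     (\<forall>f\<in>Hl l. hl_dist l (T 0 f) f = 0) \<and>
     (\<forall>s\<ge>0. \<forall>t\<ge>0. \<forall>f\<in>Hl l. hl_dist l (T (s + t) f) (T s (T t f)) = 0) \<and>
     (\<forall>f\<in>Hl l. ((\<lambda>t. hl_dist l (T t f) f) \<longlongrightarrow> 0) (at_right 0))"

definition generates :: "real \<Rightarrow> (real \<Rightarrow> pfun \<Rightarrow> pfun) \<Rightarrow> (pfun \<Rightarrow> pfun) \<Rightarrow> pfun set \<Rightarrow> bool" where
  "generates l T A D \<longleftrightarrow>
     D \<subseteq> Hl l \<and>
     (\<forall>f\<in>Hl l. f \<in> D \<longleftrightarrow>
        (\<exists>v\<in>Hl l. ((\<lambda>t. hl_dist l (fscale (complex_of_real (1 / t)) (fsub (T t f) f)) v)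
                     \<longlongrightarrow> 0) (at_right 0))) \<and>
     (\<forall>f\<in>D. A f \<in> Hl l \<and>
        ((\<lambda>t. hl_dist l (fscale (complex_of_real (1 / t)) (fsub (T t f) f)) (A f))
           \<longlongrightarrow> 0) (at_right 0))"

end

theory Submission imports Defs "HOL-Probability.Probability" begin

text \<open>
  After the Fourier transform in \<open>x\<close> the operator \<open>B\<close> acts separately at each frequency \<open>y\<close>, on \<open>L\<^sup>2\<close> of the momentum
  variable, as multiplication by \<open>- symb q y\<close>, of size at most \<open>1 + \<bar>y\<bar>\<close>, plus an operator of rank five. It is therefore
  bounded, and its exponential series converges. As \<open>P\<close> is the orthogonal projection of \<open>L\<^sup>2(dq / q0)\<close> onto the collision
  invariants times \<open>sqrt J0\<close>, the bounded operator is dissipative, so that its exponential is a contraction, uniformly in the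
  frequency. Integration over the frequencies with the weight \<open>(1 + \<bar>y\<bar>) powr l\<close> gives a contraction semigroup; strong continuity
  and the generator follow by dominated convergence. Two strongly continuous semigroups \<open>S\<close>, \<open>T\<close> with the same
  generator agree because \<open>s \<mapsto> norm (S s u - T s u)\<close> is continuous with increments \<open>o(h)\<close> for \<open>u\<close> in the domain: both
  increments are \<open>h * B\<close> plus \<open>o(h)\<close>, and \<open>T\<close> is a contraction.
\<close>

text \<open>\<open>Hl\<close> consists of functions rather than classes, its norm is that of a
  chosen transform, and \<open>is_ft\<close> is defined by duality. All statements are therefore
  moved through the relation \<open>rep\<close> to the weighted space \<open>L2 (MW l)\<close>. This
  takes a jointly measurable inverse transform of every square integrable function, and uniqueness
  almost everywhere in both directions. The distributional definition of the domain has to be shown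
  equal to multiplication by the symbol: inverse transforms of test functions must decay enough to
  be admissible in \<open>is_ft\<close>, and there must be enough test functions to determine a
  function. Working at a fixed frequency avoids resolvents of the unbounded operator, and pointwise
  convergence of the exponential series makes the semigroup jointly measurable. The projection
  property rests on moments of the equilibrium, where the Bessel functions enter through radial
  integration and integration by parts. A competing semigroup is known to be bounded only at each
  separate time, so a bound uniform near time zero has to be derived for it.\<close>

section \<open>Square integrable functions, Cauchy-Schwarz and the triangle inequality\<close>

definition L2 :: "'a measure \<Rightarrow> ('a \<Rightarrow> complex) set" where
  "L2 M = {u \<in> borel_measurable M. integrable M (\<lambda>x. (cmod (u x))\<^sup>2)}"

definition nrm :: "'a measure \<Rightarrow> ('a \<Rightarrow> complex) \<Rightarrow> real" where
  "nrm M u = sqrt (LINT x|M. (cmod (u x))\<^sup>2)"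

lemma L2_meas [measurable_dest]: "u \<in> L2 M \<Longrightarrow> u \<in> borel_measurable M"
  by (simp add: L2_def)

lemma L2_integrable: "u \<in> L2 M \<Longrightarrow> integrable M (\<lambda>x. (cmod (u x))\<^sup>2)"
  by (simp add: L2_def)

lemma nrm_nonneg [simp]: "0 \<le> nrm M u"
  by (simp add: nrm_def)

lemma nrm_sq: "(nrm M u)\<^sup>2 = (LINT x|M. (cmod (u x))\<^sup>2)"
  by (simp add: nrm_def)

text \<open>The majorant \<open>h\<close> bounds the square itself, so that any integrable function
  can serve, such as a Gaussian or a multiple of the indicator of a ball.\<close>

lemma L2_dom:
  assumes "u \<in> borel_measurable M" "integrable M h" "AE x in M. (cmod (u x))\<^sup>2 \<le> h x"
  shows "u \<in> L2 M"
proof -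
  have "integrable M (\<lambda>x. (cmod (u x))\<^sup>2)"
    by (rule Bochner_Integration.integrable_bound[OF assms(2)]) (use assms in auto)
  then show ?thesis using assms by (simp add: L2_def)
qed

lemma L2_zero [simp]: "(\<lambda>x. 0) \<in> L2 M" by (simp add: L2_def)

lemma L2_add: assumes "u \<in> L2 M" "v \<in> L2 M" shows "(\<lambda>x. u x + v x) \<in> L2 M"
proof (rule L2_dom)
  show "integrable M (\<lambda>x. 2 * (cmod (u x))\<^sup>2 + 2 * (cmod (v x))\<^sup>2)"
    using assms by (auto simp: L2_def)
  have "(cmod (u x + v x))\<^sup>2 \<le> 2 * (cmod (u x))\<^sup>2 + 2 * (cmod (v x))\<^sup>2" for x
  proof -
    have "(cmod (u x + v x))\<^sup>2 \<le> (cmod (u x) + cmod (v x))\<^sup>2" by (simp add: norm_triangle_ineq power_mono)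
    also have "\<dots> \<le> 2 * (cmod (u x))\<^sup>2 + 2 * (cmod (v x))\<^sup>2"
      using zero_le_power2[of "cmod (u x) - cmod (v x)"] by (simp add: power2_eq_square algebra_simps)
    finally show ?thesis .
  qed
  then show "AE x in M. (cmod (u x + v x))\<^sup>2 \<le> 2 * (cmod (u x))\<^sup>2 + 2 * (cmod (v x))\<^sup>2" by simp
qed (use assms L2_meas in measurable)

lemma L2_cmult: assumes "u \<in> L2 M" shows "(\<lambda>x. c * u x) \<in> L2 M"
  using assms by (auto simp: L2_def norm_mult power_mult_distrib)

lemma L2_minus: assumes "u \<in> L2 M" shows "(\<lambda>x. - u x) \<in> L2 M"
  using assms by (auto simp: L2_def)

lemma borel_measurable_cnj [measurable (raw)]: "u \<in> borel_measurable M \<Longrightarrow> (\<lambda>x. cnj (u x)) \<in> borel_measurable M"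
  by (rule borel_measurable_continuous_on[where f=cnj]) (auto intro: continuous_intros)

lemma L2_cnj: assumes "u \<in> L2 M" shows "(\<lambda>x. cnj (u x)) \<in> L2 M"
  using assms by (auto simp: L2_def)

lemma L2_diff: assumes "u \<in> L2 M" "v \<in> L2 M" shows "(\<lambda>x. u x - v x) \<in> L2 M"
  using L2_add[OF assms(1) L2_minus[OF assms(2)]] by simp

lemma L2_sum: assumes "\<And>i. i \<in> I \<Longrightarrow> u i \<in> L2 M" shows "(\<lambda>x. \<Sum>i\<in>I. u i x) \<in> L2 M"
  using assms by (induction I rule: infinite_finite_induct) (auto intro: L2_add)

lemma L2_mult_bounded:
  assumes "u \<in> L2 M" "m \<in> borel_measurable M" "\<And>x. cmod (m x) \<le> B"
  shows "(\<lambda>x. m x * u x) \<in> L2 M"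
proof (rule L2_dom)
  show "integrable M (\<lambda>x. B\<^sup>2 * (cmod (u x))\<^sup>2)" using assms by (auto simp: L2_def)
  show "AE x in M. (cmod (m x * u x))\<^sup>2 \<le> B\<^sup>2 * (cmod (u x))\<^sup>2"
    using assms by (auto simp: norm_mult power_mult_distrib intro!: mult_right_mono power_mono)
qed (use assms L2_meas in measurable)

lemma L2_cong_AE: assumes "u \<in> L2 M" "v \<in> borel_measurable M" "AE x in M. u x = v x"
  shows "v \<in> L2 M"
  by (rule L2_dom[OF assms(2) L2_integrable[OF assms(1)]]) (use assms(3) in auto)

lemma nrm_cong_AE: assumes "u \<in> borel_measurable M" "v \<in> borel_measurable M" "AE x in M. u x = v x"
  shows "nrm M u = nrm M v"
  unfolding nrm_def using assms by (auto intro!: arg_cong[where f=sqrt] integral_cong_AE)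

lemma nrm_scale: "nrm M (\<lambda>x. c * u x) = cmod c * nrm M u"
  by (simp add: nrm_def norm_mult power_mult_distrib real_sqrt_mult)

lemma nrm_minus_commute: "nrm M (\<lambda>x. u x - v x) = nrm M (\<lambda>x. v x - u x)"
  by (simp add: nrm_def norm_minus_commute)

lemma nrm_mono: assumes "v \<in> L2 M" "u \<in> borel_measurable M" "AE x in M. cmod (u x) \<le> cmod (v x)"
  shows "nrm M u \<le> nrm M v"
proof -
  have "AE x in M. (cmod (u x))\<^sup>2 \<le> (cmod (v x))\<^sup>2" using assms(3) by eventually_elim (simp add: power_mono)
  then show ?thesis unfolding nrm_def
    using assms L2_dom[OF assms(2) L2_integrable[OF assms(1)]]
    by (auto intro!: integral_mono_AE L2_integrable)
qed

lemma nrm_eq_0: assumes "u \<in> L2 M" shows "nrm M u = 0 \<longleftrightarrow> (AE x in M. u x = 0)"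
proof -
  have "(LINT x|M. (cmod (u x))\<^sup>2) = 0 \<longleftrightarrow> (AE x in M. (cmod (u x))\<^sup>2 = 0)"
    by (rule integral_nonneg_eq_0_iff_AE) (use assms in \<open>auto simp: L2_def\<close>)
  then show ?thesis by (simp add: nrm_def)
qed

lemma L2_mult_norm_integrable: assumes "u \<in> L2 M" "v \<in> L2 M" shows "integrable M (\<lambda>x. cmod (u x) * cmod (v x))"
proof (rule Bochner_Integration.integrable_bound)
  show "integrable M (\<lambda>x. (cmod (u x))\<^sup>2 + (cmod (v x))\<^sup>2)" using assms by (auto simp: L2_def)
  have "cmod (u x) * cmod (v x) \<le> (cmod (u x))\<^sup>2 + (cmod (v x))\<^sup>2" for x
    using sum_squares_bound[of "cmod (u x)" "cmod (v x)"] mult_nonneg_nonneg[OF norm_ge_zero norm_ge_zero, of "u x" "v x"]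
    by linarith
  then show "AE x in M. norm (cmod (u x) * cmod (v x)) \<le> norm ((cmod (u x))\<^sup>2 + (cmod (v x))\<^sup>2)"
    by auto
qed (use assms L2_meas in measurable)

lemma L2_mult_integrable: assumes "u \<in> L2 M" "v \<in> L2 M" shows "integrable M (\<lambda>x. u x * v x)"
  by (rule Bochner_Integration.integrable_bound[OF L2_mult_norm_integrable[OF assms]])
     (use assms L2_meas in \<open>auto simp: norm_mult\<close>)

text \<open>The inequality is available for nonnegative extended integrals; square integrability
  makes all three of them finite, so that it can be read in the reals.\<close>

lemma CS_norm: assumes "u \<in> L2 M" "v \<in> L2 M"
  shows "(LINT x|M. cmod (u x) * cmod (v x)) \<le> nrm M u * nrm M v"
proof -
  let ?U = "\<lambda>x. ennreal (cmod (u x))" and ?V = "\<lambda>x. ennreal (cmod (v x))"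
  have "(\<integral>\<^sup>+x. ?U x * ?V x \<partial>M)\<^sup>2 \<le> (\<integral>\<^sup>+x. (?U x)\<^sup>2 \<partial>M) * (\<integral>\<^sup>+x. (?V x)\<^sup>2 \<partial>M)"
    by (rule Cauchy_Schwarz_nn_integral) (use assms L2_meas in measurable)
  also have "(\<integral>\<^sup>+x. ?U x * ?V x \<partial>M) = ennreal (LINT x|M. cmod (u x) * cmod (v x))"
    using L2_mult_norm_integrable[OF assms]
    by (subst nn_integral_eq_integral[symmetric]) (auto simp: ennreal_mult')
  also have "(\<integral>\<^sup>+x. (?U x)\<^sup>2 \<partial>M) = ennreal ((nrm M u)\<^sup>2)"
    unfolding nrm_sq using L2_integrable[OF assms(1)]
    by (subst nn_integral_eq_integral[symmetric]) (auto simp: ennreal_power)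
  also have "(\<integral>\<^sup>+x. (?V x)\<^sup>2 \<partial>M) = ennreal ((nrm M v)\<^sup>2)"
    unfolding nrm_sq using L2_integrable[OF assms(2)]
    by (subst nn_integral_eq_integral[symmetric]) (auto simp: ennreal_power)
  finally have "(LINT x|M. cmod (u x) * cmod (v x))\<^sup>2 \<le> (nrm M u * nrm M v)\<^sup>2"
    by (simp add: ennreal_power ennreal_mult'[symmetric] power_mult_distrib)
  then show ?thesis by (rule power2_le_imp_le) simp
qed

lemma CS: assumes "u \<in> L2 M" "v \<in> L2 M"
  shows "cmod (LINT x|M. u x * v x) \<le> nrm M u * nrm M v"
proof -
  have "cmod (LINT x|M. u x * v x) \<le> (LINT x|M. cmod (u x * v x))" by (rule integral_norm_bound)
  then show ?thesis using CS_norm[OF assms] by (simp add: norm_mult)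
qed

lemma nrm_triangle: assumes "u \<in> L2 M" "v \<in> L2 M"
  shows "nrm M (\<lambda>x. u x + v x) \<le> nrm M u + nrm M v"
proof -
  have "(nrm M (\<lambda>x. u x + v x))\<^sup>2 \<le> (LINT x|M. (cmod (u x))\<^sup>2 + 2 * (cmod (u x) * cmod (v x)) + (cmod (v x))\<^sup>2)"
    unfolding nrm_sq
  proof (rule integral_mono)
    show "(cmod (u x + v x))\<^sup>2 \<le> (cmod (u x))\<^sup>2 + 2 * (cmod (u x) * cmod (v x)) + (cmod (v x))\<^sup>2" for x
      using power_mono[OF norm_triangle_ineq[of "u x" "v x"], of 2] by (simp add: power2_sum algebra_simps)
  qed (use assms in \<open>auto intro!: L2_integrable L2_add L2_mult_norm_integrable Bochner_Integration.integrable_add\<close>)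
  also have "\<dots> = (nrm M u)\<^sup>2 + 2 * (LINT x|M. cmod (u x) * cmod (v x)) + (nrm M v)\<^sup>2"
    using assms by (simp add: nrm_sq L2_integrable L2_mult_norm_integrable)
  also have "\<dots> \<le> (nrm M u + nrm M v)\<^sup>2"
    using CS_norm[OF assms] by (simp add: power2_sum)
  finally show ?thesis by (rule power2_le_imp_le) simp
qed

lemma nrm_triangle_diff: assumes "u \<in> L2 M" "v \<in> L2 M"
  shows "nrm M (\<lambda>x. u x - v x) \<le> nrm M u + nrm M v"
proof -
  have "nrm M (\<lambda>x. - v x) = nrm M v" by (simp add: nrm_def)
  then show ?thesis using nrm_triangle[OF assms(1) L2_minus[OF assms(2)]] by simp
qed

lemma nrm_triangle3: assumes "u \<in> L2 M" "v \<in> L2 M" "w \<in> L2 M"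
  shows "nrm M (\<lambda>x. u x - w x) \<le> nrm M (\<lambda>x. u x - v x) + nrm M (\<lambda>x. v x - w x)"
  using nrm_triangle[OF L2_diff[OF assms(1,2)] L2_diff[OF assms(2,3)]] by simp

lemma nrm_zero [simp]: "nrm M (\<lambda>x. 0) = 0" by (simp add: nrm_def)

lemma nrm_le_diff: assumes "u \<in> L2 M" "v \<in> L2 M"
  shows "nrm M u \<le> nrm M v + nrm M (\<lambda>x. u x - v x)"
  using nrm_triangle[OF assms(2) L2_diff[OF assms]] by simp

lemma nrm_sum: assumes "\<And>i. i \<in> I \<Longrightarrow> u i \<in> L2 M"
  shows "nrm M (\<lambda>x. \<Sum>i\<in>I. u i x) \<le> (\<Sum>i\<in>I. nrm M (u i))"
  using assms
proof (induction I rule: infinite_finite_induct)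
  case (insert i I)
  then show ?case using nrm_triangle[of "u i" M "\<lambda>x. \<Sum>i\<in>I. u i x"] L2_sum[of I u M] by simp
qed simp_all

text \<open>The weights \<open>2 ^ k\<close> turn the Riesz-Fischer argument into one application of
  Cauchy-Schwarz for series: \<open>(\<Sum>k. a k)\<^sup>2 \<le> 2 * (\<Sum>k. 2 ^ k * (a k)\<^sup>2)\<close>.\<close>

lemma sum_sq_le_weighted:
  fixes a :: "nat \<Rightarrow> real"
  shows "(\<Sum>k<n. a k)\<^sup>2 \<le> 2 * (\<Sum>k<n. 2 ^ k * (a k)\<^sup>2)"
proof -
  have "(\<Sum>k<n. a k)\<^sup>2 = (\<Sum>k<n. sqrt ((1/2)^k) * (sqrt (2^k) * a k))\<^sup>2"
    by (intro arg_cong[where f="\<lambda>x. x\<^sup>2"] sum.cong) (auto simp: real_sqrt_mult[symmetric] power_divide)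
  also have "\<dots> \<le> (\<Sum>k<n. (sqrt ((1/2)^k))\<^sup>2) * (\<Sum>k<n. (sqrt (2^k) * a k)\<^sup>2)"
    by (rule Cauchy_Schwarz_ineq_sum)
  also have "\<dots> = (\<Sum>k<n. (1/2)^k) * (\<Sum>k<n. 2 ^ k * (a k)\<^sup>2)"
    by (simp add: power_mult_distrib)
  also have "\<dots> \<le> 2 * (\<Sum>k<n. 2 ^ k * (a k)\<^sup>2)"
    by (intro mult_right_mono sum_nonneg) (simp_all add: sum_gp_strict)
  finally show ?thesis .
qed

lemma L2_series:
  assumes u: "\<And>n. u n \<in> L2 M" and bd: "\<And>n. (nrm M (u n))\<^sup>2 \<le> c * (1/4)^n"
  shows "\<exists>w\<in>L2 M. (\<exists>H. integrable M H \<and> (AE x in M. (\<lambda>n. u n x) sums w x \<and> (\<forall>n. (cmod (\<Sum>k<n. u k x))\<^sup>2 \<le> H x)))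
     \<and> (\<lambda>n. nrm M (\<lambda>x. (\<Sum>k<n. u k x) - w x)) \<longlonglongrightarrow> 0"
proof -
  define h where "h k x = 2 ^ k * (cmod (u k x))\<^sup>2" for k x
  define H where "H x = 2 * (\<Sum>k. h k x)" for x
  define w where "w x = (\<Sum>k. u k x)" for x
  have [measurable]: "u n \<in> borel_measurable M" for n using u L2_meas by blast
  have hi: "integrable M (h k)" for k unfolding h_def using L2_integrable[OF u] by simp
  have hn: "norm (h k x) = h k x" "0 \<le> h k x" for k x by (simp_all add: h_def)
  \<comment> \<open>Against the decay \<open>(1/4)^k\<close> of the squared norms the weight
    \<open>2 ^ k\<close> still leaves the convergent \<open>(1/2)^k\<close>.\<close>
  have hint: "(LINT x|M. norm (h k x)) \<le> c * (1/2)^k" for k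
  proof -
    have "(LINT x|M. norm (h k x)) = 2 ^ k * (nrm M (u k))\<^sup>2" by (simp add: h_def[abs_def] nrm_sq)
    also have "\<dots> \<le> 2 ^ k * (c * (1/4)^k)" by (intro mult_left_mono bd) simp
    also have "\<dots> = c * (1/2)^k" by (simp add: field_simps flip: power_mult_distrib)
    finally show ?thesis .
  qed
  have summ: "summable (\<lambda>k. LINT x|M. norm (h k x))"
    by (rule summable_comparison_test'[where g="\<lambda>k. c * (1/2)^k" and N=0])
       (use hint in \<open>auto intro!: summable_mult summable_geometric\<close>)
  have "(\<integral>\<^sup>+x. (\<Sum>k. ennreal (h k x)) \<partial>M) = (\<Sum>k. \<integral>\<^sup>+x. ennreal (h k x) \<partial>M)"
    by (rule nn_integral_suminf) (simp add: h_def)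
  also have "\<dots> = (\<Sum>k. ennreal (LINT x|M. norm (h k x)))"
    by (intro suminf_cong, subst nn_integral_eq_integral) (use hi hn in auto)
  also have "\<dots> = ennreal (\<Sum>k. LINT x|M. norm (h k x))"
    by (rule suminf_ennreal2) (use summ in auto)
  finally have "(\<integral>\<^sup>+x. (\<Sum>k. ennreal (h k x)) \<partial>M) \<noteq> \<infinity>" by simp
  then have "AE x in M. (\<Sum>k. ennreal (h k x)) \<noteq> \<infinity>"
    by (intro nn_integral_noteq_infinite) (auto simp: h_def)
  then have AEs: "AE x in M. summable (\<lambda>k. h k x)"
    by eventually_elim (rule summable_suminf_not_top, auto simp: h_def)
  have "integrable M (\<lambda>x. \<Sum>k. h k x)"
    by (rule integrable_suminf) (use hi AEs summ hn in auto)
  then have Hi: "integrable M H" unfolding H_def by simp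
  \<comment> \<open>Partial sums and limit are each bounded by \<open>sqrt (H x)\<close>, their
    difference by twice that; \<open>4 * H\<close> is then a majorant for dominated convergence of
    the squares.\<close>
  have key: "(\<lambda>n. u n x) sums w x \<and> (\<forall>n. (cmod (\<Sum>k<n. u k x))\<^sup>2 \<le> H x) \<and> (\<forall>n. (cmod ((\<Sum>k<n. u k x) - w x))\<^sup>2 \<le> 4 * H x)"
    if s: "summable (\<lambda>k. h k x)" for x
  proof -
    have b: "(\<Sum>k<n. cmod (u k x))\<^sup>2 \<le> H x" for n
    proof -
      have "(\<Sum>k<n. cmod (u k x))\<^sup>2 \<le> 2 * (\<Sum>k<n. h k x)"
        unfolding h_def by (rule sum_sq_le_weighted)
      also have "\<dots> \<le> H x" unfolding H_def
        by (intro mult_left_mono sum_le_suminf s) (auto simp: h_def)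
      finally show ?thesis .
    qed
    then have b': "(\<Sum>k<n. cmod (u k x)) \<le> sqrt (H x)" for n by (rule real_le_rsqrt)
    have b'': "(\<Sum>k\<le>n. cmod (u k x)) \<le> sqrt (H x)" for n
      using b'[of "Suc n"] by (simp only: lessThan_Suc_atMost)
    have "summable (\<lambda>k. cmod (u k x))"
      by (rule bounded_imp_summable[where B="sqrt (H x)"]) (rule norm_ge_zero, rule b'')
    then have "summable (\<lambda>k. u k x)" by (rule summable_norm_cancel)
    then have su: "(\<lambda>n. u n x) sums w x" unfolding w_def by (rule summable_sums)
    have c1: "cmod (\<Sum>k<n. u k x) \<le> sqrt (H x)" for n
      by (rule order_trans[OF norm_sum b'])
    have c2: "cmod (w x) \<le> sqrt (H x)"
      by (rule LIMSEQ_le_const2[OF tendsto_norm[OF su[unfolded sums_def]]]) (use c1 in auto)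
    have H0: "H x \<ge> 0" using b[of 0] by simp
    have "(cmod (\<Sum>k<n. u k x))\<^sup>2 \<le> H x" for n using power_mono[OF c1, of n 2] H0 by simp
    moreover have "(cmod ((\<Sum>k<n. u k x) - w x))\<^sup>2 \<le> 4 * H x" for n
    proof -
      have "cmod ((\<Sum>k<n. u k x) - w x) \<le> 2 * sqrt (H x)" using c1[of n] c2 norm_triangle_ineq4[of "\<Sum>k<n. u k x" "w x"] by linarith
      from power_mono[OF this, of 2] show ?thesis using H0 by (simp add: power_mult_distrib)
    qed
    ultimately show ?thesis using su by blast
  qed
  have AE1: "AE x in M. (\<lambda>n. u n x) sums w x \<and> (\<forall>n. (cmod (\<Sum>k<n. u k x))\<^sup>2 \<le> H x)"
    using AEs by eventually_elim (use key in blast)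
  have AE2: "AE x in M. (cmod ((\<Sum>k<n. u k x) - w x))\<^sup>2 \<le> 4 * H x" for n
    using AEs by eventually_elim (use key in blast)
  have [measurable]: "w \<in> borel_measurable M" unfolding w_def by measurable
  have w: "w \<in> L2 M"
  proof (rule L2_dom)
    show "integrable M (\<lambda>x. 4 * H x)" using Hi by simp
    show "AE x in M. (cmod (w x))\<^sup>2 \<le> 4 * H x" using AE2[of 0] by simp
  qed simp
  have "(\<lambda>n. LINT x|M. (cmod ((\<Sum>k<n. u k x) - w x))\<^sup>2) \<longlonglongrightarrow> (LINT x|M. 0)"
  proof (rule integral_dominated_convergence)
    show "integrable M (\<lambda>x. 4 * H x)" using Hi by simp
    show "AE x in M. (\<lambda>n. (cmod ((\<Sum>k<n. u k x) - w x))\<^sup>2) \<longlonglongrightarrow> 0"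
      using AE1
    proof eventually_elim
      case (elim x)
      then have "(\<lambda>n. (\<Sum>k<n. u k x) - w x) \<longlonglongrightarrow> 0" by (simp add: sums_def LIM_zero)
      from tendsto_power[OF tendsto_norm[OF this], of 2] show ?case by simp
    qed
  qed (use AE2 in auto)
  then have "(\<lambda>n. nrm M (\<lambda>x. (\<Sum>k<n. u k x) - w x)) \<longlonglongrightarrow> sqrt 0" unfolding nrm_def
    by (intro tendsto_real_sqrt) simp
  then have "(\<lambda>n. nrm M (\<lambda>x. (\<Sum>k<n. u k x) - w x)) \<longlonglongrightarrow> 0" by simp
  then show ?thesis using w Hi AE1 by blast
qed

section \<open>Gaussians and their Fourier transforms\<close>

text \<open>Lebesgue measure is the image of a finite product of one-dimensional Lebesgue measures
  under the recombination of coordinates, so Fubini for finite products applies.\<close>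

lemma integrable_lborel_prod:
  fixes f :: "'a::euclidean_space \<Rightarrow> real \<Rightarrow> complex"
  assumes "\<And>b. b \<in> Basis \<Longrightarrow> integrable lborel (f b)"
  shows "integrable lborel (\<lambda>x. \<Prod>b\<in>Basis. f b (x \<bullet> b))"
    and "(LINT x|lborel. (\<Prod>b\<in>Basis. f b (x \<bullet> b))) = (\<Prod>b\<in>Basis. (LINT t|lborel. f b t))"
proof -
  interpret product_sigma_finite "\<lambda>_::'a. lborel :: real measure" by standard
  have m: "(\<lambda>f. \<Sum>b\<in>Basis. f b *\<^sub>R b) \<in> measurable (\<Pi>\<^sub>M b\<in>(Basis::'a set). lborel) (borel :: 'a measure)"
    by measurable
  have [measurable]: "b \<in> Basis \<Longrightarrow> f b \<in> borel_measurable borel" for b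
    using borel_measurable_integrable[OF assms] by simp
  have m2: "(\<lambda>x. \<Prod>b\<in>Basis. f b (x \<bullet> b)) \<in> borel_measurable borel" by measurable
  have eq: "(\<Prod>b\<in>Basis. f b ((\<Sum>c\<in>Basis. g c *\<^sub>R c) \<bullet> b)) = (\<Prod>b\<in>Basis. f b (g b))" for g :: "'a \<Rightarrow> real"
    by (intro prod.cong) (auto simp: inner_sum_left inner_Basis if_distrib cong: if_cong)
  show "integrable lborel (\<lambda>x. \<Prod>b\<in>Basis. f b (x \<bullet> b))"
    unfolding lborel_eq[where 'a='a]
    by (subst integrable_distr_eq[OF m m2]) (simp only: eq, rule product_integrable_prod[OF finite_Basis assms])
  show "(LINT x|lborel. (\<Prod>b\<in>Basis. f b (x \<bullet> b))) = (\<Prod>b\<in>Basis. (LINT t|lborel. f b t))"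
    unfolding lborel_eq[where 'a='a]
    by (subst integral_distr[OF m m2]) (simp only: eq, rule product_integral_prod[OF finite_Basis assms])
qed

text \<open>For \<open>e = 1\<close> this is the characteristic function of the standard normal
  distribution; the substitution of \<open>sqrt e * x\<close> gives the other cases.\<close>

lemma gauss_ft_real:
  fixes e t :: real assumes e: "e > 0"
  shows "integrable lborel (\<lambda>x. cis (t * x) * of_real (exp (- e * x\<^sup>2 / 2)))"
    and "(LINT x|lborel. cis (t * x) * of_real (exp (- e * x\<^sup>2 / 2))) = of_real (sqrt (2 * pi / e) * exp (- t\<^sup>2 / (2 * e)))"
proof -
  have base: "integrable lborel (\<lambda>x::real. exp (- x\<^sup>2 / 2))"
  proof -
    have "integrable lborel (\<lambda>x. sqrt (2 * pi) * normal_density 0 1 x)"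
      using integrable_normal_density[of 1 0] by (intro integrable_mult_right) simp
    then show ?thesis by (simp add: normal_density_def)
  qed
  have i0: "integrable lborel (\<lambda>x. cis (s * x) * of_real (exp (- x\<^sup>2 / 2)))" for s
    by (rule Bochner_Integration.integrable_bound[OF base]) (auto simp: norm_mult cis_conv_exp)
  have c: "(LINT x|lborel. cis (s * x) * of_real (exp (- x\<^sup>2 / 2))) = of_real (sqrt (2 * pi) * exp (- s\<^sup>2 / 2))" for s
  proof -
    have "of_real (exp (- (s^2) / 2)) = char std_normal_distribution s"
      by (simp add: char_std_normal_distribution)
    also have "\<dots> = (LINT x|lborel. std_normal_density x *\<^sub>R iexp (s * x))"
      unfolding char_def by (subst integral_density) auto
    also have "\<dots> = (LINT x|lborel. of_real (1 / sqrt (2 * pi)) * (cis (s * x) * of_real (exp (- x\<^sup>2 / 2))))"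
      by (intro Bochner_Integration.integral_cong) (auto simp: std_normal_density_def scaleR_conv_of_real cis_conv_exp)
    also have "\<dots> = of_real (1 / sqrt (2 * pi)) * (LINT x|lborel. cis (s * x) * of_real (exp (- x\<^sup>2 / 2)))"
      by simp
    finally show ?thesis by (simp add: field_simps)
  qed
  have sc: "cis (t / sqrt e * (sqrt e * x)) * of_real (exp (- (sqrt e * x)\<^sup>2 / 2)) = cis (t * x) * of_real (exp (- e * x\<^sup>2 / 2))" for x
    using e by (simp add: power_mult_distrib)
  show "integrable lborel (\<lambda>x. cis (t * x) * of_real (exp (- e * x\<^sup>2 / 2)))"
    using lborel_integrable_real_affine[OF i0[of "t / sqrt e"], of "sqrt e" 0] e by (simp only: sc add_0) simp
  have "of_real (sqrt (2 * pi) * exp (- (t / sqrt e)\<^sup>2 / 2)) = \<bar>sqrt e\<bar> *\<^sub>R (LINT x|lborel. cis (t * x) * of_real (exp (- e * x\<^sup>2 / 2)))"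
    using lborel_integral_real_affine[of "sqrt e" "\<lambda>x. cis (t / sqrt e * x) * of_real (exp (- x\<^sup>2 / 2))" 0] e
    unfolding c[of "t / sqrt e"] by (simp only: sc add_0) simp
  then show "(LINT x|lborel. cis (t * x) * of_real (exp (- e * x\<^sup>2 / 2))) = of_real (sqrt (2 * pi / e) * exp (- t\<^sup>2 / (2 * e)))"
    using e by (simp add: scaleR_conv_of_real real_sqrt_divide power_divide field_simps)
qed

definition gk :: "real \<Rightarrow> vec3 \<Rightarrow> real" where "gk e x = exp (- e * (norm x)\<^sup>2 / 2)"

text \<open>The integral of \<open>gk e\<close>, one factor for each of the three dimensions; it is
  also the constant in the Fourier transform of \<open>gk e\<close>.\<close>

definition gc :: "real \<Rightarrow> real" where "gc e = (sqrt (2 * pi / e)) ^ 3"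

lemma gk_pos: "gk e x > 0" by (simp add: gk_def)
lemma gk_nonneg [simp]: "gk e x \<ge> 0" by (simp add: gk_def)
lemma gk_le_1: "e \<ge> 0 \<Longrightarrow> gk e x \<le> 1" by (simp add: gk_def)
lemma gk_minus: "gk e (x - y) = gk e (y - x)" by (simp add: gk_def norm_minus_commute)
lemma gk_meas [measurable]: "gk e \<in> borel_measurable borel" unfolding gk_def by measurable
lemma gc_pos: "e > 0 \<Longrightarrow> gc e > 0" by (simp add: gc_def)
lemma gc_mult: "e > 0 \<Longrightarrow> gc e * gc (1 / e) = (2 * pi) ^ 3"
proof -
  assume e: "e > 0"
  have "sqrt (2 * pi / e) * sqrt (2 * pi / (1 / e)) = sqrt ((2 * pi)\<^sup>2)"
    unfolding real_sqrt_mult[symmetric] using e by (simp add: power2_eq_square)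
  also have "\<dots> = 2 * pi" by (rule real_sqrt_unique) auto
  finally show ?thesis unfolding gc_def power_mult_distrib[symmetric] by simp
qed

lemma cis_sum: "finite A \<Longrightarrow> cis (\<Sum>a\<in>A. f a) = (\<Prod>a\<in>A. cis (f a))"
  by (induction A rule: finite_induct) (auto simp: cis_mult[symmetric])

lemma cis_measurable [measurable (raw)]: "f \<in> borel_measurable M \<Longrightarrow> (\<lambda>x. cis (f x)) \<in> borel_measurable M"
  unfolding cis_conv_exp by measurable

text \<open>Both the Gaussian and the character factor over the coordinates, which reduces the claim
  to \<open>gauss_ft_real\<close>.\<close>

lemma gk_ft:
  fixes y :: vec3 assumes e: "e > 0"
  shows "integrable lborel (\<lambda>x. cis (y \<bullet> x) * of_real (gk e x))" (is ?A)
    and "(LINT x|lborel. cis (y \<bullet> x) * of_real (gk e x)) = of_real (gc e * gk (1 / e) y)" (is ?B)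
proof -
  define f where "f b t = cis ((y \<bullet> b) * t) * complex_of_real (exp (- e * t\<^sup>2 / 2))" for b t
  have nsq: "(norm x)\<^sup>2 = (\<Sum>b\<in>Basis. (x \<bullet> b)\<^sup>2)" for x :: vec3
    unfolding power2_norm_eq_inner by (subst euclidean_inner) (simp add: power2_eq_square)
  have eq: "(\<lambda>x. cis (y \<bullet> x) * of_real (gk e x)) = (\<lambda>x. \<Prod>b\<in>Basis. f b (x \<bullet> b))"
  proof
    fix x :: vec3
    have "cis (y \<bullet> x) = (\<Prod>b\<in>Basis. cis ((y \<bullet> b) * (x \<bullet> b)))"
      by (subst euclidean_inner) (simp add: cis_sum)
    moreover have "gk e x = (\<Prod>b\<in>Basis. exp (- e * (x \<bullet> b)\<^sup>2 / 2))"
      unfolding gk_def nsq by (simp add: exp_sum[symmetric] sum_distrib_left sum_divide_distrib sum_negf)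
    ultimately show "cis (y \<bullet> x) * of_real (gk e x) = (\<Prod>b\<in>Basis. f b (x \<bullet> b))"
      by (simp add: f_def prod.distrib)
  qed
  have i: "integrable lborel (f b)" for b unfolding f_def by (rule gauss_ft_real[OF e])
  have fi: "(LINT t|lborel. f b t) = of_real (sqrt (2 * pi / e) * exp (- (y \<bullet> b)\<^sup>2 / (2 * e)))" for b
    unfolding f_def by (rule gauss_ft_real[OF e])
  show ?A unfolding eq by (rule integrable_lborel_prod[OF i])
  have "(LINT x|lborel. (\<Prod>b\<in>Basis. f b (x \<bullet> b))) = (\<Prod>b\<in>(Basis::vec3 set). of_real (sqrt (2 * pi / e) * exp (- (y \<bullet> b)\<^sup>2 / (2 * e))))"
    by (subst integrable_lborel_prod(2)[OF i]) (intro prod.cong refl, rule fi)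
  also have "\<dots> = of_real (\<Prod>b\<in>(Basis::vec3 set). sqrt (2 * pi / e) * exp (- (y \<bullet> b)\<^sup>2 / (2 * e)))"
    by simp
  also have "(\<Prod>b\<in>(Basis::vec3 set). sqrt (2 * pi / e) * exp (- (y \<bullet> b)\<^sup>2 / (2 * e))) = gc e * gk (1 / e) y"
    unfolding gk_def nsq gc_def prod.distrib
    by (simp add: exp_sum[symmetric] sum_divide_distrib[symmetric] sum_negf)
  finally show ?B unfolding eq .
qed

lemma gk_integrable: assumes "e > 0" shows "integrable lborel (gk e)" "(LINT x|lborel. gk e x) = gc e"
proof -
  have "integrable lborel (\<lambda>x. complex_of_real (gk e x))" using gk_ft(1)[OF assms, of 0] by simp
  then show *: "integrable lborel (gk e)" by (simp add: complex_of_real_integrable_eq)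
  show "(LINT x|lborel. gk e x) = gc e" using gk_ft(2)[OF assms, of 0] by (simp add: gk_def) 
qed

section \<open>Translations, dilations and reflections of Lebesgue measure\<close>

lemma lborel_translate:
  fixes f :: "vec3 \<Rightarrow> 'b::{banach, second_countable_topology}"
  assumes "f \<in> borel_measurable borel"
  shows "integrable lborel (\<lambda>x. f (x + c)) \<longleftrightarrow> integrable lborel f"
    and "(LINT x|lborel. f (x + c)) = (LINT x|lborel. f x)"
proof -
  have m: "(+) c \<in> measurable lborel borel" by simp
  show "integrable lborel (\<lambda>x. f (x + c)) \<longleftrightarrow> integrable lborel f"
    using integrable_distr_eq[OF m assms] by (simp add: lborel_distr_plus add.commute)
  show "(LINT x|lborel. f (x + c)) = (LINT x|lborel. f x)"
    using integral_distr[OF m assms] by (simp add: lborel_distr_plus add.commute)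
qed

lemma lborel_scale:
  fixes f :: "vec3 \<Rightarrow> 'b::{banach, second_countable_topology}"
  assumes [measurable]: "f \<in> borel_measurable borel" and c: "c \<noteq> 0" 
  shows "integrable lborel f \<Longrightarrow> integrable lborel (\<lambda>x. f (c *\<^sub>R x))"
    and "(LINT x|lborel. f x) = \<bar>c\<bar> ^ 3 *\<^sub>R (LINT x|lborel. f (c *\<^sub>R x))"
proof -
  have eq: "lborel = density (distr lborel borel (\<lambda>x::vec3. c *\<^sub>R x)) (\<lambda>_. ennreal (\<bar>c\<bar> ^ 3))"
    using lborel_affine[OF c, of "0::vec3"] by simp
  have "integrable lborel f \<longleftrightarrow> integrable (density (distr lborel borel (\<lambda>x::vec3. c *\<^sub>R x)) (\<lambda>_. ennreal (\<bar>c\<bar> ^ 3))) f"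
    using eq by simp
  also have "\<dots> \<longleftrightarrow> integrable lborel (\<lambda>x. \<bar>c\<bar> ^ 3 *\<^sub>R f (c *\<^sub>R x))"
    by (subst integrable_density) (auto simp: integrable_distr_eq)
  finally have iff: "integrable lborel f \<longleftrightarrow> integrable lborel (\<lambda>x. \<bar>c\<bar> ^ 3 *\<^sub>R f (c *\<^sub>R x))" .
  show "integrable lborel (\<lambda>x. f (c *\<^sub>R x))" if "integrable lborel f"
  proof -
    have "integrable lborel (\<lambda>x. (1 / \<bar>c\<bar> ^ 3) *\<^sub>R \<bar>c\<bar> ^ 3 *\<^sub>R f (c *\<^sub>R x))"
      using that unfolding iff by (rule integrable_scaleR_right)
    then show ?thesis using c by simp
  qed
  have "(LINT x|lborel. f x) = (LINT x|density (distr lborel borel (\<lambda>x::vec3. c *\<^sub>R x)) (\<lambda>_. ennreal (\<bar>c\<bar> ^ 3)). f x)"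
    using eq by simp
  also have "\<dots> = \<bar>c\<bar> ^ 3 *\<^sub>R (LINT x|lborel. f (c *\<^sub>R x))"
    by (subst integral_density) (auto simp: integral_distr)
  finally show "(LINT x|lborel. f x) = \<bar>c\<bar> ^ 3 *\<^sub>R (LINT x|lborel. f (c *\<^sub>R x))" .
qed

lemma lborel_reflect:
  fixes f :: "vec3 \<Rightarrow> 'b::{banach, second_countable_topology}"
  assumes "f \<in> borel_measurable borel"
  shows "integrable lborel f \<Longrightarrow> integrable lborel (\<lambda>x. f (- x))"
    and "(LINT x|lborel. f (- x)) = (LINT x|lborel. f x)"
  using lborel_scale[OF assms, of "-1"] by simp_all

lemma gk_translate_integrable: assumes "e > 0" 
  shows "integrable lborel (\<lambda>x. gk e (x - z))" "(LINT x|lborel. gk e (x - z)) = gc e"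
  using lborel_translate[OF gk_meas, of e "- z"] gk_integrable[OF assms] by simp_all

section \<open>Translated Gaussians separate functions\<close>

text \<open>The sets over which \<open>G\<close> integrates to zero are stable under complements and
  countable disjoint unions. The closed sets are stable under intersection and generate the Borel
  sets, hence all Borel sets are among them.\<close>

lemma integrable_zero_on_closed:
  fixes G :: "vec3 \<Rightarrow> real"
  assumes G: "integrable lborel G" and cl: "\<And>S. closed S \<Longrightarrow> (LINT x|lborel. indicator S x * G x) = 0"
  shows "AE x in lborel. G x = 0"
proof (rule density_unique_real[where f'="\<lambda>_. 0", OF G])
  show "integrable lborel (\<lambda>_::vec3. 0::real)" by simp
  have si: "A \<in> sets borel \<Longrightarrow> set_integrable lborel A G" for A
    unfolding set_integrable_def by (rule integrable_mult_indicator[OF _ G]) simp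
  fix A :: "vec3 set" assume "A \<in> sets lborel"
  then have sA: "A \<in> sigma_sets UNIV (Collect closed)" by (simp add: borel_eq_closed sets_measure_of)
  have "Int_stable (Collect closed :: vec3 set set)" by (auto simp: Int_stable_def)
  moreover have "Collect closed \<subseteq> Pow (UNIV :: vec3 set)" by simp
  moreover note sA
  ultimately have "set_lebesgue_integral lborel A G = 0"
  proof (induction A rule: sigma_sets_induct_disjoint)
    case (basic A) then show ?case using cl by (simp add: set_lebesgue_integral_def)
  next
    case empty then show ?case by (simp add: set_lebesgue_integral_def)
  next
    case (compl A)
    then have A: "A \<in> sets borel" by (simp add: borel_eq_closed sets_measure_of)
    have "set_lebesgue_integral lborel (A \<union> (UNIV - A)) G = set_lebesgue_integral lborel A G + set_lebesgue_integral lborel (UNIV - A) G"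
      by (rule set_integral_Un) (use A si in auto)
    moreover have "set_lebesgue_integral lborel (A \<union> (UNIV - A)) G = 0"
      using cl[of UNIV] by (simp add: set_lebesgue_integral_def)
    ultimately show ?case using compl by simp
  next
    case (union A)
    then have A: "A i \<in> sets borel" for i by (auto simp: borel_eq_closed sets_measure_of)
    have "set_lebesgue_integral lborel (\<Union>i. A i) G = (\<Sum>i. set_lebesgue_integral lborel (A i) G)"
      by (rule lebesgue_integral_countable_add) (use A si union in \<open>auto simp: disjoint_family_on_def\<close>)
    then show ?case using union by simp
  qed
  then show "set_lebesgue_integral lborel A G = set_lebesgue_integral lborel A (\<lambda>_. 0)"
    by (simp add: set_lebesgue_integral_def)
qed

text \<open>The indicator of a closed set is the pointwise limit of the continuous functions
  \<open>max 0 (1 - n * infdist x S)\<close>, so vanishing against continuous functions passes to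
  closed sets.\<close>

lemma integrable_zero_if_bounded_continuous:
  fixes G :: "vec3 \<Rightarrow> complex"
  assumes G: "integrable lborel G" 
    and z: "\<And>h. continuous_on UNIV h \<Longrightarrow> (\<And>x. \<bar>h x\<bar> \<le> 1) \<Longrightarrow> (LINT x|lborel. G x * of_real (h x)) = 0"
  shows "AE x in lborel. G x = 0"
proof -
  have cl: "(LINT x|lborel. indicator S x *\<^sub>R G x) = 0" if S: "closed S" for S
  \<comment> \<open>The distance to the empty set is 0 by convention, so that \<open>h n\<close>
    would be constantly 1 there.\<close>
  proof (cases "S = {}")
    case False
    define h where "h n x = max 0 (1 - real n * infdist x S)" for n x
    have [measurable]: "S \<in> sets borel" using S by simp
    have hc: "continuous_on UNIV (h n)" for n unfolding h_def by (intro continuous_intros)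
    have [measurable]: "h n \<in> borel_measurable borel" for n using hc borel_measurable_continuous_onI by blast
    have h1: "\<bar>h n x\<bar> \<le> 1" for n x by (auto simp: h_def infdist_nonneg)
    have "(\<lambda>n. LINT x|lborel. G x * of_real (h n x)) \<longlonglongrightarrow> (LINT x|lborel. indicator S x *\<^sub>R G x)"
    proof (rule integral_dominated_convergence[where w="\<lambda>x. norm (G x)"])
      show "AE x in lborel. (\<lambda>n. G x * of_real (h n x)) \<longlonglongrightarrow> indicator S x *\<^sub>R G x"
      proof (rule AE_I2)
        fix x
        have "(\<lambda>n. h n x) \<longlonglongrightarrow> indicator S x"
        proof (cases "x \<in> S")
          case True then show ?thesis by (simp add: h_def)
        next
          case False
          then have p: "infdist x S > 0" using S \<open>S \<noteq> {}\<close> in_closed_iff_infdist_zero infdist_nonneg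
            by (metis less_eq_real_def)
          obtain N :: nat where N: "1 < real N * infdist x S" using p by (metis ex_less_of_nat_mult)
          have "h n x = 0" if "n \<ge> N" for n
          proof -
            have "real N * infdist x S \<le> real n * infdist x S" using that p by (intro mult_right_mono) auto
            then show ?thesis using N by (simp add: h_def)
          qed
          then have "eventually (\<lambda>n. h n x = 0) sequentially" using eventually_sequentially by blast
          then show ?thesis using False by (simp add: tendsto_eventually)
        qed
        then have "(\<lambda>n. G x * of_real (h n x)) \<longlonglongrightarrow> G x * of_real (indicator S x)" by (intro tendsto_intros)
        then show "(\<lambda>n. G x * of_real (h n x)) \<longlonglongrightarrow> indicator S x *\<^sub>R G x" by (simp add: scaleR_conv_of_real mult.commute)
      qed
      show "AE x in lborel. norm (G x * of_real (h n x)) \<le> norm (G x)" for n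
        using h1 by (auto simp: norm_mult intro!: mult_left_le)
    qed (use G in \<open>auto simp: borel_measurable_integrable\<close>)
    moreover have "(LINT x|lborel. G x * of_real (h n x)) = 0" for n by (rule z[OF hc h1])
    ultimately show ?thesis using LIMSEQ_unique[OF _ tendsto_const] by force
  qed simp
  have i: "S \<in> sets borel \<Longrightarrow> integrable lborel (\<lambda>x. indicator S x *\<^sub>R G x)" for S
    using G by (intro integrable_mult_indicator) auto
  have "AE x in lborel. Re (G x) = 0"
  proof (rule integrable_zero_on_closed)
    fix S :: "vec3 set" assume "closed S"
    then show "(LINT x|lborel. indicator S x * Re (G x)) = 0"
      using cl integral_Re[OF i[of S]] by simp
  qed (use G in auto)
  moreover have "AE x in lborel. Im (G x) = 0"
  proof (rule integrable_zero_on_closed)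
    fix S :: "vec3 set" assume "closed S"
    then show "(LINT x|lborel. indicator S x * Im (G x)) = 0"
      using cl integral_Im[OF i[of S]] by simp
  qed (use G in auto)
  ultimately show ?thesis by eventually_elim (simp add: complex_eq_iff)
qed

text \<open>Multiplication by a Gaussian maps translated Gaussians to multiples of translated Gaussians
  (complete the square); so \<open>H * gk 1\<close>, an integrable function, is annihilated by all mollifiers.\<close>

lemma gauss_separation:
  fixes H :: "vec3 \<Rightarrow> complex"
  assumes [measurable]: "H \<in> borel_measurable borel" and Hi: "integrable lborel (\<lambda>x. H x * of_real (gk 1 x))"
    and z: "\<And>e z. e > 0 \<Longrightarrow> (LINT x|lborel. H x * of_real (gk e (x - z))) = 0"
  shows "AE x in lborel. H x = 0"
proof -
  define G where "G x = H x * of_real (gk 1 x)" for x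
  have Gi: "integrable lborel G" using Hi by (simp add: G_def[abs_def])
  have [measurable]: "G \<in> borel_measurable borel" unfolding G_def by measurable
  have Gz: "(LINT x|lborel. G x * of_real (gk e (x - z))) = 0" if e: "e > 0" for e z
  proof -
    \<comment> \<open>The factors \<open>gk 1\<close> and \<open>gk e\<close> have precisions 1 and
      \<open>e\<close> and centres 0 and \<open>z\<close>. Precisions add, and the centre of the
      product is the weighted mean of the two centres.\<close>
    define w where "w = (e / (e + 1)) *\<^sub>R z"
    have "gk 1 x * gk e (x - z) = gk (e + 1) (x - w) * exp (- (e / (e + 1)) * (norm z)\<^sup>2 / 2)" for x
    proof -
      define a where "a = e / (e + 1)"
      have ea: "(e + 1) * a = e" using e by (simp add: a_def)
      have ns: "(norm (x - b *\<^sub>R z))\<^sup>2 = (norm x)\<^sup>2 - 2 * b * (x \<bullet> z) + b\<^sup>2 * (norm z)\<^sup>2" for b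
        by (simp add: power2_norm_eq_inner inner_diff_left inner_diff_right inner_commute[of z x])
           (simp add: power2_eq_square algebra_simps)
      have n1: "(norm (x - z))\<^sup>2 = (norm x)\<^sup>2 - 2 * (x \<bullet> z) + (norm z)\<^sup>2" using ns[of 1] by simp
      have "(e + 1) * (norm (x - w))\<^sup>2 + a * (norm z)\<^sup>2
        = (e + 1) * (norm x)\<^sup>2 - 2 * ((e + 1) * a) * (x \<bullet> z) + (((e + 1) * a) * a + a) * (norm z)\<^sup>2"
        unfolding w_def a_def[symmetric] ns by (simp add: algebra_simps power2_eq_square)
      also have "((e + 1) * a) * a + a = (e + 1) * a" using ea by (simp add: algebra_simps)
      finally have "(e + 1) * (norm (x - w))\<^sup>2 + a * (norm z)\<^sup>2 = (norm x)\<^sup>2 + e * (norm (x - z))\<^sup>2"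
        unfolding ea n1 by (simp add: algebra_simps)
      then show ?thesis unfolding gk_def exp_add[symmetric] a_def[symmetric]
        by (simp add: field_simps)
    qed
    then have "G x * of_real (gk e (x - z)) = of_real (exp (- (e / (e + 1)) * (norm z)\<^sup>2 / 2)) * (H x * of_real (gk (e + 1) (x - w)))" for x
      unfolding G_def by (simp add: mult.assoc flip: of_real_mult)
    then show ?thesis using z[of "e + 1" w] e by simp
  qed
  have "AE x in lborel. G x = 0"
  proof (rule integrable_zero_if_bounded_continuous[OF Gi])
    fix h :: "vec3 \<Rightarrow> real" assume hc: "continuous_on UNIV h" and h1: "\<And>x. \<bar>h x\<bar> \<le> 1"
    have [measurable]: "h \<in> borel_measurable borel" using hc borel_measurable_continuous_onI by blast
    \<comment> \<open>The mollifier \<open>gk e\<close> with \<open>e = Suc n\<close> has width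
      \<open>c n\<close>. Substituting \<open>x - c n *\<^sub>R u\<close> turns its convolution with
      \<open>h\<close> into an average of \<open>h\<close> near \<open>x\<close> against the fixed
      Gaussian \<open>gk 1\<close>.\<close>
    define c where "c n = 1 / sqrt (real (Suc n))" for n
    have cpos: "c n > 0" for n by (simp add: c_def)
    have hg: "integrable lborel (\<lambda>u. h (x - c n *\<^sub>R u) * gk 1 u)" for x n
      by (rule Bochner_Integration.integrable_bound[OF gk_integrable(1)[of 1]]) (auto simp: abs_mult intro!: mult_right_le_one_le mult_left_le_one_le h1)
    define k where "k n x = (LINT u|lborel. h (x - c n *\<^sub>R u) * gk 1 u)" for n x
    have [measurable]: "k n \<in> borel_measurable borel" for n unfolding k_def by measurable
    have kb: "\<bar>k n x\<bar> \<le> gc 1" for n x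
    proof -
      have "\<bar>k n x\<bar> \<le> (LINT u|lborel. \<bar>h (x - c n *\<^sub>R u) * gk 1 u\<bar>)" unfolding k_def by (rule integral_abs_bound)
      also have "\<dots> \<le> (LINT u|lborel. gk 1 u)"
        by (rule integral_mono[OF integrable_abs[OF hg]])
           (use h1 in \<open>auto simp: abs_mult gk_integrable intro!: mult_left_le_one_le\<close>)
      finally show ?thesis by (simp add: gk_integrable)
    qed
    have klim: "(\<lambda>n. k n x) \<longlonglongrightarrow> (LINT u|lborel. h x * gk 1 u)" for x
      unfolding k_def
    proof (rule integral_dominated_convergence[where w="gk 1"])
      show "AE u in lborel. (\<lambda>n. h (x - c n *\<^sub>R u) * gk 1 u) \<longlonglongrightarrow> h x * gk 1 u"
      proof (rule AE_I2)
        fix u :: vec3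
        have "c \<longlonglongrightarrow> 0" unfolding c_def by real_asymp
        then have "(\<lambda>n. x - c n *\<^sub>R u) \<longlonglongrightarrow> x - 0 *\<^sub>R u" by (intro tendsto_intros)
        then have "(\<lambda>n. h (x - c n *\<^sub>R u)) \<longlonglongrightarrow> h x"
          using hc by (intro isCont_tendsto_compose[where g=h and l=x]) (auto simp: continuous_on_eq_continuous_at)
        then show "(\<lambda>n. h (x - c n *\<^sub>R u) * gk 1 u) \<longlonglongrightarrow> h x * gk 1 u" by (intro tendsto_intros)
      qed
    qed (use h1 in \<open>auto simp: gk_integrable abs_mult intro!: mult_left_le_one_le\<close>)
    have "(LINT x|lborel. G x * of_real (k n x)) = 0" for n
    proof -
      define e where "e = real (Suc n)"
      have e: "e > 0" "c n = 1 / sqrt e" by (auto simp: e_def c_def)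
      have kk: "k n x = sqrt e ^ 3 * (LINT y|lborel. h y * gk e (x - y))" for x
      proof -
        have "(LINT y|lborel. h y * gk e (x - y)) = (LINT y|lborel. h (y + x) * gk e (x - (y + x)))"
          by (rule lborel_translate(2)[symmetric]) measurable
        also have "\<dots> = (LINT y|lborel. h (x + y) * gk e y)" by (simp add: gk_def add.commute)
        also have "\<dots> = \<bar>- c n\<bar> ^ 3 *\<^sub>R (LINT u|lborel. h (x + (- c n) *\<^sub>R u) * gk e ((- c n) *\<^sub>R u))"
          by (rule lborel_scale(2)) (use cpos[of n] in auto)
        also have "(LINT u|lborel. h (x + (- c n) *\<^sub>R u) * gk e ((- c n) *\<^sub>R u)) = k n x"
          unfolding k_def using e by (simp add: gk_def power_mult_distrib power_divide)
        finally show ?thesis using e by (simp add: power_divide)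
      qed
      have fub: "integrable (lborel \<Otimes>\<^sub>M lborel) (\<lambda>(x, y). G x * of_real (h y * gk e (x - y)))"
      proof (rule lborel_pair.Fubini_integrable)
        show "(\<lambda>(x, y). G x * of_real (h y * gk e (x - y))) \<in> borel_measurable (lborel \<Otimes>\<^sub>M lborel)" by measurable
        have i: "integrable lborel (\<lambda>y. of_real (h y * gk e (x - y)) :: complex)" for x
        proof (rule Bochner_Integration.integrable_bound)
          show "integrable lborel (\<lambda>y. gk e (y - x))" using gk_translate_integrable e by auto
          show "AE y in lborel. norm (complex_of_real (h y * gk e (x - y))) \<le> norm (gk e (y - x))"
            using h1 by (auto simp: norm_mult abs_mult gk_minus[of e x] intro!: mult_left_le_one_le)
        qed measurable
        show "AE x in lborel. integrable lborel (\<lambda>y. case (x, y) of (x, y) \<Rightarrow> G x * of_real (h y * gk e (x - y)))"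
          using i by (auto simp del: of_real_mult)
        show "integrable lborel (\<lambda>x. LINT y|lborel. norm (case (x, y) of (x, y) \<Rightarrow> G x * of_real (h y * gk e (x - y))))"
        proof (rule Bochner_Integration.integrable_bound)
          show "integrable lborel (\<lambda>x. gc e * norm (G x))" using Gi by simp
          have "norm (LINT y|lborel. norm (G x * of_real (h y * gk e (x - y)))) \<le> gc e * norm (G x)" for x
          proof -
            have "(LINT y|lborel. norm (complex_of_real (h y * gk e (x - y)))) \<le> (LINT y|lborel. gk e (y - x))"
              by (rule integral_mono[OF integrable_norm[OF i]]) (use h1 gk_translate_integrable e in 
                  \<open>auto simp: norm_mult abs_mult gk_minus[of e x] intro!: mult_left_le_one_le simp del: of_real_mult\<close>)
            then have le: "(LINT y|lborel. norm (complex_of_real (h y * gk e (x - y)))) \<le> gc e"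
              using gk_translate_integrable(2)[OF e(1)] by simp
            have "(LINT y|lborel. norm (G x * complex_of_real (h y * gk e (x - y)))) = norm (G x) * (LINT y|lborel. norm (complex_of_real (h y * gk e (x - y))))"
              by (simp only: norm_mult[of "G x"] integral_mult_right_zero)
            also have "\<dots> \<le> norm (G x) * gc e" by (rule mult_left_mono[OF le norm_ge_zero])
            finally show ?thesis by (simp add: mult.commute)
          qed
          then show "AE x in lborel. norm (LINT y|lborel. norm (case (x, y) of (x, y) \<Rightarrow> G x * of_real (h y * gk e (x - y)))) \<le> norm (gc e * norm (G x))"
            using gc_pos[OF e(1)] by auto
        qed measurable
      qed
      have "(LINT x|lborel. G x * of_real (k n x)) = (LINT x|lborel. of_real (sqrt e ^ 3) * (LINT y|lborel. G x * of_real (h y * gk e (x - y))))"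
        by (intro Bochner_Integration.integral_cong refl)
           (simp only: kk integral_mult_right_zero integral_complex_of_real of_real_mult[of "sqrt e ^ 3"] mult.left_commute)
      also have "\<dots> = of_real (sqrt e ^ 3) * (LINT x|lborel. (LINT y|lborel. G x * of_real (h y * gk e (x - y))))"
        by simp
      also have "(LINT x|lborel. (LINT y|lborel. G x * of_real (h y * gk e (x - y)))) = (LINT y|lborel. (LINT x|lborel. G x * of_real (h y * gk e (x - y))))"
        by (rule lborel_pair.Fubini_integral[OF fub, symmetric])
      also have "\<dots> = (LINT y|lborel. of_real (h y) * (LINT x|lborel. G x * of_real (gk e (x - y))))"
        by (intro Bochner_Integration.integral_cong) (auto simp: mult_ac simp flip: integral_mult_right_zero)
      also have "\<dots> = 0" using Gz[OF e(1)] by simp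
      finally show ?thesis by simp
    qed
    moreover have "(\<lambda>n. LINT x|lborel. G x * of_real (k n x)) \<longlonglongrightarrow> (LINT x|lborel. G x * of_real (LINT u|lborel. h x * gk 1 u))"
    proof (rule integral_dominated_convergence[where w="\<lambda>x. norm (G x) * gc 1"])
      show "AE x in lborel. (\<lambda>n. G x * of_real (k n x)) \<longlonglongrightarrow> G x * of_real (LINT u|lborel. h x * gk 1 u)"
        using klim by (intro AE_I2 tendsto_intros)
      show "AE x in lborel. norm (G x * of_real (k n x)) \<le> norm (G x) * gc 1" for n
        using kb[of n] by (auto simp: norm_mult intro!: mult_left_mono)
    qed (use Gi in auto)
    ultimately have "(LINT x|lborel. G x * of_real (LINT u|lborel. h x * gk 1 u)) = 0"
      using LIMSEQ_unique[OF _ tendsto_const] by force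
    then have "(LINT x|lborel. of_real (gc 1) * (G x * of_real (h x))) = 0"
      by (simp add: gk_integrable mult_ac)
    then show "(LINT x|lborel. G x * of_real (h x)) = 0" using gc_pos[of 1] by simp
  qed
  then show ?thesis by eventually_elim (use gk_pos[of 1] in \<open>simp add: G_def less_imp_neq[symmetric]\<close>)
qed

section \<open>The Fourier transform on integrable and square integrable functions\<close>

text \<open>The sign of the exponent is opposite to that of \<open>ft3\<close>.\<close>

definition Fp :: "(vec3 \<Rightarrow> complex) \<Rightarrow> vec3 \<Rightarrow> complex" where
  "Fp u y = (LINT x|lborel. cis (y \<bullet> x) * u x)"

lemma ft3_eq: "ft3 u y = Fp u (- y)"
  by (simp add: ft3_def Fp_def cis_conv_exp inner_commute)

lemma sq_int_iff: "sq_int u \<longleftrightarrow> u \<in> L2 lborel"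
  by (simp add: sq_int_def L2_def)

lemma Fp_integrand: assumes "integrable lborel u" shows "integrable lborel (\<lambda>x. cis (y \<bullet> x) * u x)"
  by (rule Bochner_Integration.integrable_bound[OF assms]) (use assms in \<open>auto simp: norm_mult\<close>)

lemma Fp_measurable [measurable (raw)]:
  assumes [measurable]: "u \<in> borel_measurable borel" "f \<in> borel_measurable M"
  shows "(\<lambda>x. Fp u (f x)) \<in> borel_measurable M"
proof -
  have "Fp u \<in> borel_measurable borel" unfolding Fp_def by measurable
  then show ?thesis by measurable
qed

lemma ft3_measurable:
  assumes [measurable]: "u \<in> borel_measurable borel" shows "ft3 u \<in> borel_measurable borel"
  unfolding ft3_def by measurable

lemma Fp_bound: assumes "integrable lborel u" shows "cmod (Fp u y) \<le> (LINT x|lborel. cmod (u x))"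
proof -
  have "cmod (Fp u y) \<le> (LINT x|lborel. cmod (cis (y \<bullet> x) * u x))" unfolding Fp_def by (rule integral_norm_bound)
  then show ?thesis by (simp add: norm_mult)
qed

text \<open>Fubini, with a kernel that is symmetric in \<open>x\<close> and
  \<open>y\<close>.\<close>

lemma Fp_mult_formula:
  assumes u: "integrable lborel u" and v: "integrable lborel v"
  shows "(LINT y|lborel. Fp u y * v y) = (LINT x|lborel. u x * Fp v x)"
proof -
  note [measurable] = borel_measurable_integrable[OF u] borel_measurable_integrable[OF v]
  have "integrable (lborel \<Otimes>\<^sub>M lborel) (\<lambda>(x, y). u x * v y)"
  proof (rule lborel_pair.Fubini_integrable)
    show "(\<lambda>(x, y). u x * v y) \<in> borel_measurable (lborel \<Otimes>\<^sub>M lborel)" by measurable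
  qed (use u v in \<open>auto simp: norm_mult\<close>)
  then have i: "integrable (lborel \<Otimes>\<^sub>M lborel) (\<lambda>(x, y). cis (y \<bullet> x) * (u x * v y))"
  proof (rule Bochner_Integration.integrable_bound)
    show "(\<lambda>(x, y). cis (y \<bullet> x) * (u x * v y)) \<in> borel_measurable (lborel \<Otimes>\<^sub>M lborel)" by measurable
  qed (auto simp: norm_mult)
  have "(LINT y|lborel. Fp u y * v y) = (LINT y|lborel. (LINT x|lborel. cis (y \<bullet> x) * (u x * v y)))"
    unfolding Fp_def by (intro Bochner_Integration.integral_cong) (simp_all add: mult.assoc[symmetric])
  also have "\<dots> = (LINT x|lborel. (LINT y|lborel. cis (y \<bullet> x) * (u x * v y)))"
    by (rule lborel_pair.Fubini_integral[OF i])
  also have "\<dots> = (LINT x|lborel. u x * Fp v x)"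
    unfolding Fp_def
    by (intro Bochner_Integration.integral_cong refl, subst integral_mult_right_zero[symmetric],
        rule Bochner_Integration.integral_cong[OF refl]) (simp add: mult_ac inner_commute)
  finally show ?thesis .
qed

lemma ft3_mult_formula:
  assumes u: "integrable lborel u" and v: "integrable lborel v"
  shows "(LINT y|lborel. ft3 u y * v y) = (LINT x|lborel. u x * ft3 v x)"
proof -
  note [measurable] = borel_measurable_integrable[OF u] borel_measurable_integrable[OF v]
  have F: "Fp (\<lambda>x. v (- x)) y = Fp v (- y)" for y
    unfolding Fp_def by (subst lborel_reflect(2)[symmetric]) auto
  have "(LINT y|lborel. ft3 u y * v y) = (LINT y|lborel. Fp u y * v (- y))"
    unfolding ft3_eq by (subst lborel_reflect(2)[symmetric]) auto
  also have "\<dots> = (LINT x|lborel. u x * Fp (\<lambda>x. v (- x)) x)"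
    by (rule Fp_mult_formula[OF u lborel_reflect(1)[OF _ v]]) simp
  finally show ?thesis unfolding F ft3_eq .
qed

text \<open>The inverse of \<open>ft3\<close>; as \<open>ft3\<close> carries no normalising factor,
  the whole power of \<open>2 * pi\<close> is placed here.\<close>

definition inv3 :: "(vec3 \<Rightarrow> complex) \<Rightarrow> vec3 \<Rightarrow> complex" where
  "inv3 u y = Fp u y / of_real ((2 * pi) ^ 3)"

lemma inv3_measurable [measurable (raw)]:
  assumes [measurable]: "u \<in> borel_measurable borel" "f \<in> borel_measurable M"
  shows "(\<lambda>x. inv3 u (f x)) \<in> borel_measurable M"
  unfolding inv3_def by measurable

definition gt :: "real \<Rightarrow> vec3 \<Rightarrow> vec3 \<Rightarrow> complex" where
  "gt e z x = of_real (gk e (x - z))"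

lemma gt_measurable [measurable]: "gt e z \<in> borel_measurable borel"
  unfolding gt_def by measurable

lemma gt_integrable: "e > 0 \<Longrightarrow> integrable lborel (gt e z)"
  unfolding gt_def using gk_translate_integrable by simp

lemma Fp_gt:
  assumes "e > 0" shows "Fp (gt e z) y = of_real (gc e) * cis (y \<bullet> z) * of_real (gk (1 / e) y)"
proof -
  have "Fp (gt e z) y = (LINT x|lborel. cis (y \<bullet> (x + z)) * gt e z (x + z))"
    unfolding Fp_def by (rule lborel_translate(2)[symmetric]) measurable
  also have "\<dots> = (LINT x|lborel. cis (y \<bullet> z) * (cis (y \<bullet> x) * of_real (gk e x)))"
    by (simp add: gt_def inner_add_right cis_mult[symmetric] mult_ac)
  also have "\<dots> = cis (y \<bullet> z) * of_real (gc e * gk (1 / e) y)"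
    by (simp add: gk_ft(2)[OF assms])
  finally show ?thesis by (simp add: mult_ac)
qed

text \<open>The preimage of a translated Gaussian under \<open>ft3\<close>, explicitly a modulated
  Gaussian. In \<open>is_ft\<close> the function \<open>f\<close> is paired with transforms, so
  testing it against \<open>gt e z\<close> requires this preimage.\<close>

definition gm :: "real \<Rightarrow> vec3 \<Rightarrow> vec3 \<Rightarrow> complex" where
  "gm e z y = inv3 (gt e z) y"

lemma gm_eq: "e > 0 \<Longrightarrow> gm e z y = of_real (gc e / (2 * pi) ^ 3) * (cis (y \<bullet> z) * of_real (gk (1 / e) y))"
  by (simp add: gm_def inv3_def Fp_gt)

lemma ft3_gt: "e > 0 \<Longrightarrow> ft3 (gt e z) y = of_real (gc e) * cis (- (y \<bullet> z)) * of_real (gk (1 / e) y)"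
  by (simp add: ft3_eq Fp_gt gk_def)

lemma ft3_gm: assumes "e > 0" shows "ft3 (gm e z) = gt e z"
proof
  fix x
  have c: "cis ((z - x) \<bullet> y) = cis (y \<bullet> z) * cis (- x \<bullet> y)" for y
    by (simp add: cis_mult inner_diff_left inner_commute[of y z])
  have "ft3 (gm e z) x = (LINT y|lborel. of_real (gc e / (2 * pi) ^ 3) * (cis ((z - x) \<bullet> y) * of_real (gk (1 / e) y)))"
    unfolding ft3_eq Fp_def
    by (intro Bochner_Integration.integral_cong)
       (simp_all add: gm_eq assms c mult_ac)
  also have "\<dots> = of_real (gc e / (2 * pi) ^ 3) * of_real (gc (1 / e) * gk e (z - x))"
    using gk_ft(2)[of "1 / e" "z - x"] assms by simp
  also have "\<dots> = of_real ((gc e * gc (1 / e)) / (2 * pi) ^ 3 * gk e (z - x))"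
    by (simp add: mult_ac)
  also have "\<dots> = gt e z x" unfolding gc_mult[OF assms] by (simp add: gt_def gk_minus)
  finally show "ft3 (gm e z) x = gt e z x" .
qed

lemma L2_of_gk: assumes "e > 0" shows "(\<lambda>x. of_real (gk e (x - z))) \<in> L2 lborel"
proof (rule L2_dom)
  show "integrable lborel (\<lambda>x. gk e (x - z))" using gk_translate_integrable[OF assms] by simp
  show "AE x in lborel. (cmod (of_real (gk e (x - z))))\<^sup>2 \<le> gk e (x - z)"
    using gk_le_1[of e] assms by (auto simp: power2_eq_square mult_left_le_one_le)
qed measurable

lemma gt_L2: "e > 0 \<Longrightarrow> gt e z \<in> L2 lborel" unfolding gt_def by (rule L2_of_gk)

lemma gm_integrable: assumes "e > 0" shows "integrable lborel (gm e z)"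
proof -
  have "integrable lborel (\<lambda>y. of_real (gc e / (2 * pi) ^ 3) * (cis (z \<bullet> y) * complex_of_real (gk (1 / e) y)))"
    using gk_ft(1)[of "1 / e" z] assms by (intro integrable_mult_right) simp
  then show ?thesis by (simp add: gm_eq[OF assms, abs_def] inner_commute)
qed

lemma gm_L2: assumes "e > 0" shows "gm e z \<in> L2 lborel"
proof -
  have "(\<lambda>y. cis (y \<bullet> z) * complex_of_real (gk (1 / e) y)) \<in> L2 lborel"
    by (rule L2_mult_bounded[where B=1]) (use L2_of_gk[of "1 / e" 0] assms in auto)
  then show ?thesis unfolding gm_eq[OF assms, abs_def] by (rule L2_cmult)
qed

definition adm :: "(vec3 \<Rightarrow> complex) \<Rightarrow> bool" where
  "adm \<phi> \<longleftrightarrow> integrable lborel \<phi> \<and> sq_int \<phi> \<and> integrable lborel (ft3 \<phi>) \<and> sq_int (ft3 \<phi>)"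

lemma is_ft_adm: "is_ft f g \<longleftrightarrow> f \<in> L2 lborel \<and> g \<in> L2 lborel \<and>
    (\<forall>\<phi>. adm \<phi> \<longrightarrow> (LINT \<zeta>|lborel. g \<zeta> * \<phi> \<zeta>) = (LINT x|lborel. f x * ft3 \<phi> x))"
  by (simp add: is_ft_def adm_def sq_int_iff)

lemma adm_gm: "e > 0 \<Longrightarrow> adm (gm e z)"
  by (simp add: adm_def sq_int_iff ft3_gm gm_integrable gm_L2 gt_integrable gt_L2)

lemma adm_gt: assumes "e > 0" shows "adm (gt e z)"
proof -
  have eq: "ft3 (gt e z) = (\<lambda>y. (2 * pi) ^ 3 * gm e (- z) y)"
    by (rule ext) (simp add: ft3_gt gm_eq assms)
  show ?thesis unfolding adm_def sq_int_iff eq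
    using assms by (auto simp: gt_integrable gt_L2 intro!: gm_integrable gm_L2 L2_cmult)
qed

lemma L2_gk_integrable: assumes "H \<in> L2 lborel" shows "integrable lborel (\<lambda>x. H x * complex_of_real (gk 1 x))"
  using L2_mult_integrable[OF assms L2_of_gk[of 1 0]] by simp

lemma L2_separation:
  assumes H: "H \<in> L2 lborel" and z: "\<And>e z. e > 0 \<Longrightarrow> (LINT x|lborel. H x * gt e z x) = 0"
  shows "AE x in lborel. H x = 0"
  by (rule gauss_separation) (use L2_meas[OF H] L2_gk_integrable[OF H] z in \<open>auto simp: gt_def\<close>)

lemma is_ft_unique_ft: assumes "is_ft f g1" "is_ft f g2" shows "AE x in lborel. g1 x = g2 x"
proof -
  have L: "g1 \<in> L2 lborel" "g2 \<in> L2 lborel" using assms by (auto simp: is_ft_adm)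
  have "AE x in lborel. g1 x - g2 x = 0"
  proof (rule L2_separation[OF L2_diff[OF L]])
    fix e :: real and z :: vec3 assume e: "e > 0"
    have "(LINT x|lborel. g1 x * gt e z x) = (LINT x|lborel. g2 x * gt e z x)"
      using assms adm_gt[OF e] by (simp add: is_ft_adm)
    then show "(LINT x|lborel. (g1 x - g2 x) * gt e z x) = 0"
      using L2_mult_integrable[OF L(1) gt_L2[OF e]] L2_mult_integrable[OF L(2) gt_L2[OF e]]
      by (simp add: left_diff_distrib)
  qed
  then show ?thesis by eventually_elim simp
qed

text \<open>The test function is \<open>gm e z\<close>, whose transform is \<open>gt e z\<close>;
  thus it is \<open>f\<close> that is paired with all translated Gaussians.\<close>

lemma is_ft_unique_fun: assumes "is_ft f1 g" "is_ft f2 g" shows "AE x in lborel. f1 x = f2 x"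
proof -
  have L: "f1 \<in> L2 lborel" "f2 \<in> L2 lborel" using assms by (auto simp: is_ft_adm)
  have "AE x in lborel. f1 x - f2 x = 0"
  proof (rule L2_separation[OF L2_diff[OF L]])
    fix e :: real and z :: vec3 assume e: "e > 0"
    have "(LINT x|lborel. f1 x * gt e z x) = (LINT x|lborel. f2 x * gt e z x)"
    proof -
      have "(LINT x|lborel. f x * gt e z x) = (LINT x|lborel. g x * gm e z x)" if "is_ft f g" for f
        using that[unfolded is_ft_adm] adm_gm[OF e, of z] unfolding ft3_gm[OF e, of z, symmetric] by simp
      from this[OF assms(1)] this[OF assms(2)] show ?thesis by simp
    qed
    then show "(LINT x|lborel. (f1 x - f2 x) * gt e z x) = 0"
      using L2_mult_integrable[OF L(1) gt_L2[OF e]] L2_mult_integrable[OF L(2) gt_L2[OF e]]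
      by (simp add: left_diff_distrib)
  qed
  then show ?thesis by eventually_elim simp
qed

lemma is_ft_lin: assumes "is_ft f1 g1" "is_ft f2 g2"
  shows "is_ft (\<lambda>x. a * f1 x + b * f2 x) (\<lambda>x. a * g1 x + b * g2 x)"
proof -
  have L: "f1 \<in> L2 lborel" "f2 \<in> L2 lborel" "g1 \<in> L2 lborel" "g2 \<in> L2 lborel"
    using assms by (auto simp: is_ft_adm)
  show ?thesis unfolding is_ft_adm
  proof (intro conjI allI impI)
    fix \<phi> assume a: "adm \<phi>"
    then have p: "\<phi> \<in> L2 lborel" "ft3 \<phi> \<in> L2 lborel" by (auto simp: adm_def sq_int_iff)
    note i = L2_mult_integrable[OF L(1) p(2)] L2_mult_integrable[OF L(2) p(2)]
      L2_mult_integrable[OF L(3) p(1)] L2_mult_integrable[OF L(4) p(1)]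
    have "(LINT x|lborel. (a * g1 x + b * g2 x) * \<phi> x) = a * (LINT x|lborel. g1 x * \<phi> x) + b * (LINT x|lborel. g2 x * \<phi> x)"
      using i by (simp add: distrib_right mult.assoc)
    also have "\<dots> = a * (LINT x|lborel. f1 x * ft3 \<phi> x) + b * (LINT x|lborel. f2 x * ft3 \<phi> x)"
      using assms a by (simp add: is_ft_adm)
    also have "\<dots> = (LINT x|lborel. (a * f1 x + b * f2 x) * ft3 \<phi> x)"
      using i by (simp add: distrib_right mult.assoc)
    finally show "(LINT x|lborel. (a * g1 x + b * g2 x) * \<phi> x) = (LINT x|lborel. (a * f1 x + b * f2 x) * ft3 \<phi> x)" .
  qed (use L in \<open>auto intro!: L2_add L2_cmult\<close>)
qed

section \<open>Fourier inversion\<close>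

text \<open>The multiplication formula moves the transforms on to the Gaussian, where inversion is
  explicit, so both sides have the same integrals against every \<open>gt e z\<close>. The left side
  is only known to be bounded, which is why \<open>gauss_separation\<close> is used rather than its
  version for \<open>L2\<close>.\<close>

lemma inv3_ft3:
  assumes u: "integrable lborel u" and fu: "integrable lborel (ft3 u)"
  shows "AE x in lborel. inv3 (ft3 u) x = u x"
proof -
  note [measurable] = borel_measurable_integrable[OF u] borel_measurable_integrable[OF fu]
  have um [measurable]: "u \<in> borel_measurable borel" "ft3 u \<in> borel_measurable borel" by measurable
  define \<Phi> where "\<Phi> = inv3 (ft3 u)"
  have [measurable]: "\<Phi> \<in> borel_measurable borel" unfolding \<Phi>_def by measurable
  have \<Phi>b: "cmod (\<Phi> x) \<le> (LINT x|lborel. cmod (ft3 u x)) / (2 * pi) ^ 3" for x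
    unfolding \<Phi>_def inv3_def using Fp_bound[OF fu, of x] by (simp add: norm_divide norm_power norm_mult divide_right_mono)
  have \<Phi>g: "integrable lborel (\<lambda>x. \<Phi> x * gt e z x)" if "e > 0" for e z
  proof (rule Bochner_Integration.integrable_bound)
    show "integrable lborel (\<lambda>x. (LINT x|lborel. cmod (ft3 u x)) / (2 * pi) ^ 3 * cmod (gt e z x))"
      using gt_integrable[OF that] by simp
    have "norm (\<Phi> x * gt e z x) \<le> norm ((LINT x|lborel. cmod (ft3 u x)) / (2 * pi) ^ 3 * cmod (gt e z x))" for x
      using mult_right_mono[OF \<Phi>b norm_ge_zero, of x "gt e z x"] by (simp only: norm_mult real_norm_def)
    then show "AE x in lborel. norm (\<Phi> x * gt e z x) \<le> norm ((LINT x|lborel. cmod (ft3 u x)) / (2 * pi) ^ 3 * cmod (gt e z x))"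
      by simp
  qed measurable
  have ug: "integrable lborel (\<lambda>x. u x * gt e z x)" if "e > 0" for e z
    by (rule Bochner_Integration.integrable_bound[OF u]) (use gk_le_1 that in \<open>auto simp: gt_def norm_mult intro!: mult_left_le\<close>)
  have "AE x in lborel. \<Phi> x - u x = 0"
  proof (rule gauss_separation)
    show "integrable lborel (\<lambda>x. (\<Phi> x - u x) * of_real (gk 1 x))"
      using Bochner_Integration.integrable_diff[OF \<Phi>g[of 1 0] ug[of 1 0]] by (simp add: gt_def left_diff_distrib)
    fix e :: real and z :: vec3 assume e: "e > 0"
    have "(LINT x|lborel. \<Phi> x * gt e z x) = (LINT x|lborel. Fp (ft3 u) x * gt e z x) / of_real ((2 * pi) ^ 3)"
      unfolding \<Phi>_def inv3_def by simp
    also have "\<dots> = (LINT x|lborel. ft3 u x * Fp (gt e z) x) / of_real ((2 * pi) ^ 3)"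
      by (subst Fp_mult_formula[OF fu gt_integrable[OF e]]) simp
    also have "\<dots> = (LINT x|lborel. ft3 u x * gm e z x)"
      unfolding gm_def inv3_def by simp
    also have "\<dots> = (LINT x|lborel. u x * gt e z x)"
      by (simp only: ft3_mult_formula[OF u gm_integrable[OF e]] ft3_gm[OF e])
    finally have "(LINT x|lborel. (\<Phi> x - u x) * gt e z x) = 0"
      using \<Phi>g[OF e] ug[OF e] by (simp add: left_diff_distrib)
    then show "(LINT x|lborel. (\<Phi> x - u x) * of_real (gk e (x - z))) = 0" by (simp add: gt_def)
  qed measurable
  then show ?thesis by eventually_elim (simp add: \<Phi>_def)
qed

text \<open>Reflection of the argument exchanges the two orders of composition.\<close>

lemma ft3_inv3:
  assumes u: "integrable lborel u" and fu: "integrable lborel (inv3 u)"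
  shows "AE x in lborel. ft3 (inv3 u) x = u x"
proof -
  note [measurable] = borel_measurable_integrable[OF u] borel_measurable_integrable[OF fu]
  have ft: "ft3 u x = of_real ((2 * pi) ^ 3) * inv3 u (- x)" for x by (simp add: ft3_eq inv3_def)
  have fi: "integrable lborel (ft3 u)"
    unfolding ft[abs_def] using lborel_reflect(1)[OF _ fu] by (intro integrable_mult_right) simp
  have "ft3 (inv3 u) x = inv3 (ft3 u) x" for x
  proof -
    have "ft3 (inv3 u) x = (LINT y|lborel. cis (x \<bullet> y) * inv3 u (- y))"
      unfolding ft3_eq Fp_def by (subst lborel_reflect(2)[symmetric]) auto
    also have "\<dots> = inv3 (ft3 u) x" unfolding inv3_def[of "ft3 u"] Fp_def ft
      by (subst integral_divide_zero[symmetric]) simp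
    finally show ?thesis .
  qed
  then show ?thesis using inv3_ft3[OF u fi] by simp
qed

text \<open>Admissibility of \<open>\<phi>\<close> gives it the inversion formula; the
  multiplication formula then shifts \<open>inv3\<close> from \<open>g\<close> to
  \<open>ft3 \<phi>\<close>.\<close>

lemma is_ft_inv3:
  assumes g: "integrable lborel g" "g \<in> L2 lborel" and i: "inv3 g \<in> L2 lborel"
  shows "is_ft (inv3 g) g"
  unfolding is_ft_adm
proof (intro conjI allI impI g i)
  fix \<phi> assume a: "adm \<phi>"
  then have p: "integrable lborel \<phi>" "integrable lborel (ft3 \<phi>)" by (auto simp: adm_def)
  note [measurable] = borel_measurable_integrable[OF p(1)] borel_measurable_integrable[OF p(2)] borel_measurable_integrable[OF g(1)]
  have "(LINT x|lborel. inv3 g x * ft3 \<phi> x) = (LINT x|lborel. Fp g x * ft3 \<phi> x) / of_real ((2 * pi) ^ 3)"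
    unfolding inv3_def by simp
  also have "\<dots> = (LINT x|lborel. g x * inv3 (ft3 \<phi>) x)"
    unfolding Fp_mult_formula[OF g(1) p(2)] inv3_def by simp
  also have "\<dots> = (LINT x|lborel. g x * \<phi> x)"
  proof (rule integral_cong_AE)
    show "AE x in lborel. g x * inv3 (ft3 \<phi>) x = g x * \<phi> x" using inv3_ft3[OF p] by eventually_elim simp
  qed measurable
  finally show "(LINT x|lborel. g x * \<phi> x) = (LINT x|lborel. inv3 g x * ft3 \<phi> x)" ..
qed

section \<open>The Plancherel inequality for integrable functions\<close>

lemma Fp_cnj: "cnj (Fp u y) = ft3 (\<lambda>x. cnj (u x)) y"
proof -
  have "cnj (Fp u y) = (LINT x|lborel. cnj (cis (y \<bullet> x) * u x))" unfolding Fp_def by (rule Bochner_Integration.integral_cnj[symmetric])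
  then show ?thesis by (simp add: ft3_eq Fp_def cis_cnj)
qed

text \<open>The Gaussian weight makes the integral finite. By the multiplication formula it equals
  the double integral of \<open>g z * cnj (g x) * w (z - x)\<close>, where \<open>w\<close> is the
  transform of the weight and has total mass \<open>(2 * pi) ^ 3\<close> for every \<open>e\<close>.
  Bounding the product of absolute values by half the sum of their squares gives a bound independent
  of \<open>e\<close>.\<close>

lemma Fp_gauss_bound:
  assumes g: "integrable lborel g" "g \<in> L2 lborel" and e: "e > 0"
  shows "(\<integral>\<^sup>+y. ennreal ((cmod (Fp g y))\<^sup>2 * gk e y) \<partial>lborel) \<le> ennreal ((2 * pi) ^ 3 * (nrm lborel g)\<^sup>2)"
proof -
  note [measurable] = borel_measurable_integrable[OF g(1)]
  have gm [measurable]: "g \<in> borel_measurable borel" by measurable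
  define U where "U = Fp g"
  have [measurable]: "U \<in> borel_measurable borel" unfolding U_def by measurable
  define N where "N = (LINT x|lborel. cmod (g x))"
  have Ub: "cmod (U y) \<le> N" for y unfolding U_def N_def by (rule Fp_bound[OF g(1)])
  have N0: "N \<ge> 0" using Ub[of 0] norm_ge_zero order_trans by blast
  define v where "v y = cnj (U y) * of_real (gk e y)" for y
  have [measurable]: "v \<in> borel_measurable borel" unfolding v_def by measurable
  have vi: "integrable lborel v"
  proof (rule Bochner_Integration.integrable_bound)
    show "integrable lborel (\<lambda>y. N * gk e y)" using gk_integrable[OF e] by simp
    show "AE y in lborel. norm (v y) \<le> norm (N * gk e y)"
      using Ub N0 by (auto simp: v_def norm_mult abs_mult intro!: mult_right_mono)
  qed measurable
  \<comment> \<open>The transform of \<open>gk e\<close>. Its mass is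
    \<open>gc e * gc (1 / e)\<close>, in which \<open>e\<close> cancels.\<close>
  define w where "w x = gc e * gk (1 / e) x" for x
  have w0: "w x \<ge> 0" for x using gc_pos[OF e] by (simp add: w_def)
  have [measurable]: "w \<in> borel_measurable borel" unfolding w_def by measurable
  have wb: "w x \<le> gc e" for x using gc_pos[OF e] gk_le_1[of "1 / e" x] e by (simp add: w_def mult_left_le)
  have wi: "integrable lborel (\<lambda>y. w (x - y))" "(LINT y|lborel. w (x - y)) = (2 * pi) ^ 3" for x
    using gk_translate_integrable[of "1 / e" x] gc_mult[OF e] e by (simp_all add: w_def gk_minus[of _ x])
  have nnw: "(\<integral>\<^sup>+y. ennreal (w (x - y)) \<partial>lborel) = ennreal ((2 * pi) ^ 3)"
    "(\<integral>\<^sup>+y. ennreal (w (y - x)) \<partial>lborel) = ennreal ((2 * pi) ^ 3)" for x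
  proof -
    show "(\<integral>\<^sup>+y. ennreal (w (x - y)) \<partial>lborel) = ennreal ((2 * pi) ^ 3)"
      using nn_integral_eq_integral[OF wi(1)[of x]] w0 by (simp add: wi)
    then show "(\<integral>\<^sup>+y. ennreal (w (y - x)) \<partial>lborel) = ennreal ((2 * pi) ^ 3)"
      by (simp add: w_def gk_minus[of _ x])
  qed
  have Fv: "Fp v z = (LINT x|lborel. cnj (g x) * of_real (w (z - x)))" for z
  proof -
    define a where "a y = cis (z \<bullet> y) * complex_of_real (gk e y)" for y
    have ai: "integrable lborel a" unfolding a_def by (rule gk_ft(1)[OF e])
    have fa: "ft3 a x = of_real (w (z - x))" for x
    proof -
      have "cis (- x \<bullet> y) * a y = cis ((z - x) \<bullet> y) * of_real (gk e y)" for y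
        by (simp add: a_def inner_diff_left mult.assoc[symmetric] cis_mult add.commute)
      then show ?thesis unfolding ft3_eq Fp_def w_def using gk_ft(2)[OF e, of "z - x"] by simp
    qed
    have "Fp v z = (LINT y|lborel. ft3 (\<lambda>x. cnj (g x)) y * a y)"
      unfolding Fp_def[of v] v_def U_def Fp_cnj a_def by (simp add: mult_ac)
    also have "\<dots> = (LINT x|lborel. cnj (g x) * of_real (w (z - x)))"
      unfolding fa[symmetric] by (rule ft3_mult_formula[OF _ ai]) (use g(1) in simp)
    finally show ?thesis .
  qed
  have Fvn: "ennreal (cmod (Fp v z)) \<le> (\<integral>\<^sup>+x. ennreal (cmod (g x) * w (z - x)) \<partial>lborel)" for z
  proof -
    have i: "integrable lborel (\<lambda>x. cnj (g x) * of_real (w (z - x)))"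
      by (rule Bochner_Integration.integrable_bound[OF integrable_mult_right[OF g(1), of "of_real (gc e)"]])
         (use wb w0 gc_pos[OF e] in \<open>auto simp: norm_mult mult.commute[of "cmod (g _)"] intro!: mult_right_mono\<close>)
    have "ennreal (cmod (Fp v z)) \<le> (\<integral>\<^sup>+x. ennreal (cmod (cnj (g x) * of_real (w (z - x)))) \<partial>lborel)"
      unfolding Fv by (rule integral_norm_bound_ennreal[OF i])
    then show ?thesis using w0 by (simp add: norm_mult)
  qed
  have gFv: "integrable lborel (\<lambda>z. g z * Fp v z)"
  proof (rule Bochner_Integration.integrable_bound)
    show "integrable lborel (\<lambda>z. cmod (g z) * (LINT x|lborel. cmod (v x)))" using g(1) by simp
    have "0 \<le> (LINT x|lborel. cmod (v x))" by simp
    then show "AE z in lborel. norm (g z * Fp v z) \<le> norm (cmod (g z) * (LINT x|lborel. cmod (v x)))"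
      using Fp_bound[OF vi] by (auto simp: norm_mult abs_mult intro!: mult_left_mono)
  qed measurable
  have "(\<integral>\<^sup>+y. ennreal ((cmod (U y))\<^sup>2 * gk e y) \<partial>lborel) = ennreal (cmod (LINT y|lborel. U y * v y))"
  proof -
    have eq: "U y * v y = of_real ((cmod (U y))\<^sup>2 * gk e y)" for y
      unfolding v_def mult.assoc[symmetric] of_real_mult complex_norm_square ..
    have "integrable lborel (\<lambda>y. U y * v y)"
    proof (rule Bochner_Integration.integrable_bound)
      show "integrable lborel (\<lambda>y. N * cmod (v y))" using vi by simp
      show "AE y in lborel. norm (U y * v y) \<le> norm (N * cmod (v y))"
        using Ub N0 by (auto simp: norm_mult abs_mult intro!: mult_right_mono)
    qed measurable
    then have i: "integrable lborel (\<lambda>y. (cmod (U y))\<^sup>2 * gk e y)"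
      unfolding eq by (simp only: complex_of_real_integrable_eq)
    have "(\<integral>\<^sup>+y. ennreal ((cmod (U y))\<^sup>2 * gk e y) \<partial>lborel) = ennreal (LINT y|lborel. (cmod (U y))\<^sup>2 * gk e y)"
      by (rule nn_integral_eq_integral[OF i]) simp
    also have "(LINT y|lborel. (cmod (U y))\<^sup>2 * gk e y) = cmod (LINT y|lborel. U y * v y)"
      unfolding eq by (simp only: integral_complex_of_real norm_of_real) (simp add: abs_of_nonneg)
    finally show ?thesis .
  qed
  also have "(LINT y|lborel. U y * v y) = (LINT z|lborel. g z * Fp v z)"
    unfolding U_def by (rule Fp_mult_formula[OF g(1) vi])
  also have "ennreal (cmod (LINT z|lborel. g z * Fp v z)) \<le> (\<integral>\<^sup>+z. ennreal (cmod (g z * Fp v z)) \<partial>lborel)"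
    by (rule integral_norm_bound_ennreal[OF gFv])
  also have "\<dots> \<le> (\<integral>\<^sup>+z. ennreal (cmod (g z)) * (\<integral>\<^sup>+x. ennreal (cmod (g x) * w (z - x)) \<partial>lborel) \<partial>lborel)"
    by (intro nn_integral_mono) (use Fvn in \<open>auto simp: norm_mult ennreal_mult' intro!: mult_left_mono\<close>)
  also have "\<dots> = (\<integral>\<^sup>+z. (\<integral>\<^sup>+x. ennreal (cmod (g z) * (cmod (g x) * w (z - x))) \<partial>lborel) \<partial>lborel)"
    using w0 by (simp add: nn_integral_cmult ennreal_mult)
  also have "\<dots> \<le> (\<integral>\<^sup>+z. (\<integral>\<^sup>+x. ennreal ((cmod (g z))\<^sup>2 / 2) * ennreal (w (z - x)) + ennreal ((cmod (g x))\<^sup>2 / 2) * ennreal (w (z - x)) \<partial>lborel) \<partial>lborel)"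
  proof (intro nn_integral_mono)
    fix z x
    have "cmod (g z) * (cmod (g x) * w (z - x)) = (cmod (g z) * cmod (g x)) * w (z - x)" by simp
    also have "\<dots> \<le> ((cmod (g z))\<^sup>2 / 2 + (cmod (g x))\<^sup>2 / 2) * w (z - x)"
      using sum_squares_bound[of "cmod (g z)" "cmod (g x)"] w0 by (intro mult_right_mono) auto
    finally show "ennreal (cmod (g z) * (cmod (g x) * w (z - x))) \<le> ennreal ((cmod (g z))\<^sup>2 / 2) * ennreal (w (z - x)) + ennreal ((cmod (g x))\<^sup>2 / 2) * ennreal (w (z - x))"
      using w0 by (simp add: ennreal_mult[symmetric] ennreal_plus[symmetric] distrib_right del: ennreal_plus)
  qed
  also have "\<dots> = (\<integral>\<^sup>+z. (\<integral>\<^sup>+x. ennreal ((cmod (g z))\<^sup>2 / 2) * ennreal (w (z - x)) \<partial>lborel) \<partial>lborel)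
     + (\<integral>\<^sup>+z. (\<integral>\<^sup>+x. ennreal ((cmod (g x))\<^sup>2 / 2) * ennreal (w (z - x)) \<partial>lborel) \<partial>lborel)"
    by (simp add: nn_integral_add)
  also have "(\<integral>\<^sup>+z. (\<integral>\<^sup>+x. ennreal ((cmod (g x))\<^sup>2 / 2) * ennreal (w (z - x)) \<partial>lborel) \<partial>lborel)
     = (\<integral>\<^sup>+x. (\<integral>\<^sup>+z. ennreal ((cmod (g x))\<^sup>2 / 2) * ennreal (w (z - x)) \<partial>lborel) \<partial>lborel)"
    by (rule lborel_pair.Fubini') measurable
  also have "(\<integral>\<^sup>+z. (\<integral>\<^sup>+x. ennreal ((cmod (g z))\<^sup>2 / 2) * ennreal (w (z - x)) \<partial>lborel) \<partial>lborel)
     + (\<integral>\<^sup>+x. (\<integral>\<^sup>+z. ennreal ((cmod (g x))\<^sup>2 / 2) * ennreal (w (z - x)) \<partial>lborel) \<partial>lborel)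
     = 2 * ((\<integral>\<^sup>+x. ennreal ((cmod (g x))\<^sup>2 / 2) \<partial>lborel) * ennreal ((2 * pi) ^ 3))"
  proof -
    have c1: "(\<integral>\<^sup>+x. ennreal ((cmod (g z))\<^sup>2 / 2) * ennreal (w (z - x)) \<partial>lborel) = ennreal ((cmod (g z))\<^sup>2 / 2) * ennreal ((2 * pi) ^ 3)" for z
      by (subst nn_integral_cmult) (measurable, simp only: nnw)
    have c2: "(\<integral>\<^sup>+z. ennreal ((cmod (g x))\<^sup>2 / 2) * ennreal (w (z - x)) \<partial>lborel) = ennreal ((cmod (g x))\<^sup>2 / 2) * ennreal ((2 * pi) ^ 3)" for x
      by (subst nn_integral_cmult) (measurable, simp only: nnw)
    have c3: "(\<integral>\<^sup>+z. ennreal ((cmod (g z))\<^sup>2 / 2) * ennreal ((2 * pi) ^ 3) \<partial>lborel)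
       = (\<integral>\<^sup>+z. ennreal ((cmod (g z))\<^sup>2 / 2) \<partial>lborel) * ennreal ((2 * pi) ^ 3)"
      by (rule nn_integral_multc) measurable
    show ?thesis unfolding c1 c2 c3 by (rule mult_2[symmetric])
  qed
  also have "(\<integral>\<^sup>+x. ennreal ((cmod (g x))\<^sup>2 / 2) \<partial>lborel) = ennreal ((nrm lborel g)\<^sup>2 / 2)"
    by (subst nn_integral_eq_integral) (use L2_integrable[OF g(2)] in \<open>auto simp: nrm_sq\<close>)
  also have "2 * (ennreal ((nrm lborel g)\<^sup>2 / 2) * ennreal ((2 * pi) ^ 3)) = ennreal (2 * ((nrm lborel g)\<^sup>2 / 2 * (2 * pi) ^ 3))"
    using pi_ge_zero by (simp add: ennreal_mult[symmetric] flip: ennreal_numeral)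
  also have "2 * ((nrm lborel g)\<^sup>2 / 2 * (2 * pi) ^ 3) = (2 * pi) ^ 3 * (nrm lborel g)\<^sup>2" by simp
  finally show ?thesis unfolding U_def .
qed

text \<open>Fatou along \<open>e = 1 / (n + 1)\<close> removes the Gaussian weight. The resulting
  constant \<open>1 / (2 * pi) ^ 3\<close> is relaxed to 1, because only convergence of a series of
  transforms is to be derived from it.\<close>

lemma inv3_nn_bound:
  assumes g: "integrable lborel g" "g \<in> L2 lborel"
  shows "(\<integral>\<^sup>+y. ennreal ((cmod (inv3 g y))\<^sup>2) \<partial>lborel) \<le> ennreal ((nrm lborel g)\<^sup>2)"
proof -
  note [measurable] = borel_measurable_integrable[OF g(1)]
  have [measurable]: "g \<in> borel_measurable borel" by measurable
  have "(\<integral>\<^sup>+y. ennreal ((cmod (Fp g y))\<^sup>2) \<partial>lborel) = (\<integral>\<^sup>+y. liminf (\<lambda>n. ennreal ((cmod (Fp g y))\<^sup>2 * gk (1 / real (Suc n)) y)) \<partial>lborel)"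
  proof (intro nn_integral_cong)
    fix y
    have "(\<lambda>n. gk (1 / real (Suc n)) y) \<longlonglongrightarrow> exp (- 0 * (norm y)\<^sup>2 / 2)"
      unfolding gk_def by (intro tendsto_intros LIMSEQ_Suc[OF lim_1_over_n])  simp
    then have "(\<lambda>n. ennreal ((cmod (Fp g y))\<^sup>2 * gk (1 / real (Suc n)) y)) \<longlonglongrightarrow> ennreal ((cmod (Fp g y))\<^sup>2 * exp (- 0 * (norm y)\<^sup>2 / 2))"
      by (intro tendsto_intros)
    from lim_imp_Liminf[OF _ this] show "ennreal ((cmod (Fp g y))\<^sup>2) = liminf (\<lambda>n. ennreal ((cmod (Fp g y))\<^sup>2 * gk (1 / real (Suc n)) y))"
      by simp
  qed
  also have "\<dots> \<le> liminf (\<lambda>n. \<integral>\<^sup>+y. ennreal ((cmod (Fp g y))\<^sup>2 * gk (1 / real (Suc n)) y) \<partial>lborel)"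
    by (rule nn_integral_liminf) measurable
  also have "\<dots> \<le> ennreal ((2 * pi) ^ 3 * (nrm lborel g)\<^sup>2)"
    by (rule order_trans[OF Liminf_mono[OF always_eventually, of _ "\<lambda>_. ennreal ((2 * pi) ^ 3 * (nrm lborel g)\<^sup>2)"]])
       (use Fp_gauss_bound[OF g] in \<open>auto simp: Liminf_const simp del: of_nat_Suc\<close>)
  finally have F: "(\<integral>\<^sup>+y. ennreal ((cmod (Fp g y))\<^sup>2) \<partial>lborel) \<le> ennreal ((2 * pi) ^ 3 * (nrm lborel g)\<^sup>2)" .
  have p1: "1 \<le> (2 * pi) ^ 3" by (rule one_le_power) (use pi_gt3 in auto)
  define P where "P = (2 * pi) ^ 3"
  have P1: "P \<ge> 1" using p1 by (simp add: P_def)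
  have "(\<integral>\<^sup>+y. ennreal ((cmod (inv3 g y))\<^sup>2) \<partial>lborel) = (\<integral>\<^sup>+y. ennreal (1 / P\<^sup>2) * ennreal ((cmod (Fp g y))\<^sup>2) \<partial>lborel)"
    unfolding inv3_def P_def[symmetric]
    using P1 by (intro nn_integral_cong) (simp add: norm_divide power_divide ennreal_mult[symmetric])
  also have "\<dots> = ennreal (1 / P\<^sup>2) * (\<integral>\<^sup>+y. ennreal ((cmod (Fp g y))\<^sup>2) \<partial>lborel)"
    by (rule nn_integral_cmult) measurable
  also have "\<dots> \<le> ennreal (1 / P\<^sup>2) * ennreal (P * (nrm lborel g)\<^sup>2)"
    using F by (intro mult_left_mono) (auto simp: P_def)
  also have "\<dots> = ennreal ((1 / P) * (nrm lborel g)\<^sup>2)"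
    using P1 by (subst ennreal_mult[symmetric]) (auto simp: power2_eq_square)
  also have "\<dots> \<le> ennreal ((nrm lborel g)\<^sup>2)"
    using P1 by (intro ennreal_leI mult_left_le_one_le) auto
  finally show ?thesis .
qed

lemma L2_nn_iff: "u \<in> L2 M \<longleftrightarrow> u \<in> borel_measurable M \<and> (\<integral>\<^sup>+x. ennreal ((cmod (u x))\<^sup>2) \<partial>M) < \<infinity>"
  by (auto simp: L2_def integrable_iff_bounded)

lemma nrm_nn: "u \<in> L2 M \<Longrightarrow> (\<integral>\<^sup>+x. ennreal ((cmod (u x))\<^sup>2) \<partial>M) = ennreal ((nrm M u)\<^sup>2)"
  unfolding nrm_sq by (rule nn_integral_eq_integral) (auto simp: L2_integrable)

lemma inv3_L2: assumes "integrable lborel g" "g \<in> L2 lborel" shows "inv3 g \<in> L2 lborel"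
proof -
  note [measurable] = borel_measurable_integrable[OF assms(1)]
  have [measurable]: "g \<in> borel_measurable borel" by measurable
  show ?thesis unfolding L2_nn_iff using inv3_nn_bound[OF assms] le_less_trans by fastforce
qed

section \<open>The inverse Fourier transform with a parameter\<close>

abbreviation P6 :: "(vec3 \<times> vec3) measure" where "P6 \<equiv> lborel \<Otimes>\<^sub>M lborel"

lemma AE_pair_snd:
  assumes "AE z in P6. P z" shows "AE q in lborel. AE x in lborel. P (x, q)"
proof -
  obtain N where N: "{z\<in>space P6. \<not> P z} \<subseteq> N" "emeasure P6 N = 0" "N \<in> sets P6" 
    using AE_E[OF assms] by blast
  have "(\<integral>\<^sup>+q. emeasure lborel ((\<lambda>x. (x, q)) -` N) \<partial>lborel) = 0"
    using lborel_pair.emeasure_pair_measure_alt2[OF N(3)] N(2) by simp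
  then have "AE q in lborel. emeasure lborel ((\<lambda>x. (x, q)) -` N) = 0"
    using N(3) by (subst (asm) nn_integral_0_iff_AE) (auto intro!: lborel_pair.measurable_emeasure_Pair2)
  then show ?thesis
  proof eventually_elim
    case (elim q)
    show ?case
    proof (rule AE_I[OF _ elim])
      show "{x \<in> space lborel. \<not> P (x, q)} \<subseteq> (\<lambda>x. (x, q)) -` N" using N(1) by (auto simp: space_pair_measure)
      show "(\<lambda>x. (x, q)) -` N \<in> sets lborel" using sets_Pair2[OF N(3)] by simp
    qed
  qed
qed

lemma L2_sections:
  assumes "u \<in> L2 P6" shows "AE q in lborel. (\<lambda>x. u (x, q)) \<in> L2 lborel"
proof -
  have [measurable]: "u \<in> borel_measurable P6" using assms L2_meas by auto
  have "(\<integral>\<^sup>+q. (\<integral>\<^sup>+x. ennreal ((cmod (u (x, q)))\<^sup>2) \<partial>lborel) \<partial>lborel) < \<infinity>"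
    by (subst lborel_pair.nn_integral_snd) (use assms in \<open>auto simp: L2_nn_iff\<close>)
  then have "AE q in lborel. (\<integral>\<^sup>+x. ennreal ((cmod (u (x, q)))\<^sup>2) \<partial>lborel) \<noteq> \<infinity>"
    by (intro nn_integral_noteq_infinite) auto
  then show ?thesis by eventually_elim (simp add: L2_nn_iff top.not_eq_extremum)
qed

lemma L2_sections':
  assumes "u \<in> L2 P6" shows "AE x in lborel. (\<lambda>q. u (x, q)) \<in> L2 lborel"
proof -
  have [measurable]: "u \<in> borel_measurable P6" using assms L2_meas by auto
  have "(\<integral>\<^sup>+x. (\<integral>\<^sup>+q. ennreal ((cmod (u (x, q)))\<^sup>2) \<partial>lborel) \<partial>lborel) < \<infinity>"
    by (subst lborel.nn_integral_fst) (use assms in \<open>auto simp: L2_nn_iff\<close>)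
  then have "AE x in lborel. (\<integral>\<^sup>+q. ennreal ((cmod (u (x, q)))\<^sup>2) \<partial>lborel) \<noteq> \<infinity>"
    by (intro nn_integral_noteq_infinite) auto
  then show ?thesis by eventually_elim (simp add: L2_nn_iff top.not_eq_extremum)
qed

text \<open>Joint measurability is visible from the integral formula, and the inequality is
  integrated over the sections with \<open>q\<close> fixed.\<close>

lemma inv3_joint:
  assumes u: "u \<in> L2 P6" and i: "AE q in lborel. integrable lborel (\<lambda>x. u (x, q))"
  shows "(\<lambda>(x, q). inv3 (\<lambda>y. u (y, q)) x) \<in> L2 P6" "nrm P6 (\<lambda>(x, q). inv3 (\<lambda>y. u (y, q)) x) \<le> nrm P6 u"
proof -
  have [measurable]: "u \<in> borel_measurable P6" using assms L2_meas by auto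
  let ?F = "\<lambda>(x, q). inv3 (\<lambda>y. u (y, q)) x"
  have [measurable]: "?F \<in> borel_measurable P6" unfolding inv3_def Fp_def by measurable
  have "(\<integral>\<^sup>+z. ennreal ((cmod (?F z))\<^sup>2) \<partial>P6) = (\<integral>\<^sup>+q. (\<integral>\<^sup>+x. ennreal ((cmod (inv3 (\<lambda>y. u (y, q)) x))\<^sup>2) \<partial>lborel) \<partial>lborel)"
    by (subst lborel_pair.nn_integral_snd[symmetric]) auto
  also have "\<dots> \<le> (\<integral>\<^sup>+q. (\<integral>\<^sup>+x. ennreal ((cmod (u (x, q)))\<^sup>2) \<partial>lborel) \<partial>lborel)"
  proof (rule nn_integral_mono_AE)
    show "AE q in lborel. (\<integral>\<^sup>+x. ennreal ((cmod (inv3 (\<lambda>y. u (y, q)) x))\<^sup>2) \<partial>lborel) \<le> (\<integral>\<^sup>+x. ennreal ((cmod (u (x, q)))\<^sup>2) \<partial>lborel)"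
      using i L2_sections[OF u] by eventually_elim (simp add: nrm_nn inv3_nn_bound)
  qed
  also have "\<dots> = ennreal ((nrm P6 u)\<^sup>2)"
    by (subst lborel_pair.nn_integral_snd) (auto simp: nrm_nn[OF u])
  finally have le: "(\<integral>\<^sup>+z. ennreal ((cmod (?F z))\<^sup>2) \<partial>P6) \<le> ennreal ((nrm P6 u)\<^sup>2)" .
  then show F: "?F \<in> L2 P6" unfolding L2_nn_iff using le_less_trans by fastforce
  show "nrm P6 ?F \<le> nrm P6 u"
    using le unfolding nrm_nn[OF F] by (auto intro: power2_le_imp_le)
qed

text \<open>A square integrable \<open>g\<close> need not be integrable. It is cut into spherical shells in the frequency, on which it is,
  with radii growing so fast that the inverse transforms of the pieces form an almost everywhere convergent series;
  this keeps the inverse transform jointly measurable.\<close>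

lemma is_ft_exists:
  assumes g: "case_prod g \<in> L2 P6"
  shows "\<exists>f. case_prod f \<in> L2 P6 \<and> (AE q in lborel. is_ft (\<lambda>x. f x q) (\<lambda>\<zeta>. g \<zeta> q))"
proof -
  have gm [measurable]: "case_prod g \<in> borel_measurable P6" using L2_meas[OF g] .
  define G where "G S z = indicator S (fst z) * case_prod g z" for S and z :: "vec3 \<times> vec3"
  have G[measurable]: "G S \<in> borel_measurable P6" if S[measurable]: "S \<in> sets borel" for S
    unfolding G_def by (intro borel_measurable_times gm) measurable
  have GL: "G S \<in> L2 P6" if "S \<in> sets borel" for S
    by (rule L2_dom[OF G[OF that] L2_integrable[OF g]]) (auto simp: G_def indicator_def)
  define out where "out r = {x::vec3. r \<le> norm x}" for r :: real
  have [measurable]: "out r \<in> sets borel" for r unfolding out_def by measurable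
  have "(\<lambda>n. LINT z|P6. (cmod (G (out (real n)) z))\<^sup>2) \<longlonglongrightarrow> (LINT z|P6. 0)"
  proof (rule integral_dominated_convergence[OF _ _ L2_integrable[OF g]])
    show "AE z in P6. (\<lambda>n. (cmod (G (out (real n)) z))\<^sup>2) \<longlonglongrightarrow> 0"
    proof (rule AE_I2)
      fix z :: "vec3 \<times> vec3"
      have "eventually (\<lambda>n. real n > norm (fst z)) sequentially"
        using filterlim_real_sequentially by (auto simp: filterlim_at_top_dense)
      then have "eventually (\<lambda>n. (cmod (G (out (real n)) z))\<^sup>2 = 0) sequentially"
        by eventually_elim (simp add: G_def out_def)
      then show "(\<lambda>n. (cmod (G (out (real n)) z))\<^sup>2) \<longlonglongrightarrow> 0" by (rule tendsto_eventually)
    qed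
    show "AE z in P6. norm ((cmod (G (out (real n)) z))\<^sup>2) \<le> (cmod (case_prod g z))\<^sup>2" for n
      by (auto simp: G_def indicator_def)
  qed measurable
  then have lim: "(\<lambda>n. (nrm P6 (G (out (real n))))\<^sup>2) \<longlonglongrightarrow> 0" by (simp add: nrm_sq)
  have "\<exists>N::nat. (nrm P6 (G (out (real N))))\<^sup>2 < (1/4)^k" for k :: nat
    using order_tendstoD(2)[OF lim, of "(1/4)^k"] by (auto simp: eventually_sequentially)
  then obtain N :: "nat \<Rightarrow> nat" where N: "\<And>k. (nrm P6 (G (out (real (N k)))))\<^sup>2 < (1/4)^k" by metis
  \<comment> \<open>Since \<open>a (Suc k)\<close> exceeds \<open>N k\<close>, the part of
    \<open>g\<close> in shell \<open>Suc k\<close> has squared norm below \<open>(1/4)^k\<close>;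
    the added 1 makes the radii strictly increasing and unbounded.\<close>
  define a :: "nat \<Rightarrow> nat" where "a n = (\<Sum>k<n. N k + 1)" for n
  have an: "n \<le> a n" for n by (induction n) (auto simp: a_def)
  have amono: "a n < a (Suc n)" "N n < a (Suc n)" for n by (auto simp: a_def)
  have sm: "strict_mono a" by (rule strict_mono_Suc_iff[THEN iffD2]) (use amono in auto)
  define sh where "sh n = {x::vec3. real (a n) \<le> norm x \<and> norm x < real (a (Suc n))}" for n
  have [measurable]: "sh n \<in> sets borel" for n unfolding sh_def by measurable
  have shell: "\<exists>n. x \<in> sh n" for x
  proof -
    define n where "n = (LEAST n. norm x < real (a (Suc n)))"
    obtain m :: nat where m: "norm x < real m" using reals_Archimedean2 by blast
    have "norm x < real (a (Suc m))" using m an[of "Suc m"] by (smt (verit) Suc_leD of_nat_mono)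
    then have n1: "norm x < real (a (Suc n))" unfolding n_def by (rule LeastI)
    have "real (a n) \<le> norm x"
    proof (cases n)
      case 0 then show ?thesis by (simp add: a_def)
    next
      case (Suc k)
      then have "\<not> norm x < real (a (Suc k))" using not_less_Least[of k "\<lambda>n. norm x < real (a (Suc n))"] by (simp add: n_def)
      then show ?thesis using Suc by simp
    qed
    then show ?thesis using n1 by (auto simp: sh_def)
  qed
  have sums_ind: "(\<Sum>k<n. indicator (sh k) x) = (indicator {x. norm x < real (a n)} x :: complex)" for n x
  proof (induction n)
    case 0 show ?case by (simp add: a_def)
  next
    case (Suc n)
    have "real (a n) < real (a (Suc n))" using amono by simp
    then show ?case unfolding sum.lessThan_Suc Suc by (auto simp: sh_def indicator_def)
  qed
  \<comment> \<open>The 4 compensates the shift from \<open>k\<close> to \<open>Suc k\<close> in the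
    exponent; the squared norm of \<open>g\<close> takes care of shell 0, about which the choice of
    radii says nothing.\<close>
  define c where "c = 4 + (nrm P6 (case_prod g))\<^sup>2"
  have Gsq: "(nrm P6 (G (sh n)))\<^sup>2 \<le> c * (1/4)^n" for n
  proof (cases n)
    case 0
    have "nrm P6 (G (sh n)) \<le> nrm P6 (case_prod g)"
      by (rule nrm_mono[OF g G]) (auto simp: G_def indicator_def)
    then have "(nrm P6 (G (sh n)))\<^sup>2 \<le> (nrm P6 (case_prod g))\<^sup>2" by (intro power_mono) auto
    moreover have "c * (1/4) ^ n = 4 + (nrm P6 (case_prod g))\<^sup>2" using 0 by (simp add: c_def)
    ultimately show ?thesis by linarith
  next
    case (Suc k)
    have "real (N k) \<le> real (a n)" using amono(2)[of k] Suc by simp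
    then have "nrm P6 (G (sh n)) \<le> nrm P6 (G (out (real (N k))))"
      by (intro nrm_mono[OF GL G]) (auto simp: G_def indicator_def sh_def out_def)
    then have "(nrm P6 (G (sh n)))\<^sup>2 \<le> (nrm P6 (G (out (real (N k)))))\<^sup>2" by (intro power_mono) auto
    also have "\<dots> \<le> (1/4)^k" using N[of k] by simp
    also have "\<dots> = 4 * (1/4)^n" using Suc by simp
    also have "\<dots> \<le> c * (1/4)^n" by (intro mult_right_mono) (auto simp: c_def)
    finally show ?thesis .
  qed
  have sec: "integrable lborel (\<lambda>x. G (sh n) (x, q))" "(\<lambda>x. G (sh n) (x, q)) \<in> L2 lborel"
    if q: "(\<lambda>x. g x q) \<in> L2 lborel" for n q
  proof -
    have il: "(\<lambda>x. complex_of_real (indicator (sh n) x)) \<in> L2 lborel"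
    proof -
      have "sh n \<subseteq> cball 0 (real (a (Suc n)))" by (auto simp: sh_def)
      then have "emeasure lborel (sh n) < \<infinity>"
        using emeasure_mono[of "sh n" "cball 0 (real (a (Suc n)))" lborel] emeasure_lborel_cball_finite[of 0 "real (a (Suc n))"] by (auto intro: le_less_trans)
      then have "integrable lborel (indicator (sh n) :: vec3 \<Rightarrow> real)" by (intro integrable_real_indicator) auto
      then show ?thesis by (rule L2_dom[rotated]) (auto simp: indicator_def)
    qed
    have eq: "G (sh n) (x, q) = complex_of_real (indicator (sh n) x) * g x q" for x by (simp add: G_def indicator_def)
    show "integrable lborel (\<lambda>x. G (sh n) (x, q))" unfolding eq by (rule L2_mult_integrable[OF il q])
    show "(\<lambda>x. G (sh n) (x, q)) \<in> L2 lborel" unfolding eq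
      by (rule L2_mult_bounded[OF q, where B=1]) (auto simp: indicator_def)
  qed
  have AEq: "AE q in lborel. (\<lambda>x. g x q) \<in> L2 lborel" using L2_sections[OF g] by simp
  define F where "F n = (\<lambda>(x, q). inv3 (\<lambda>y. G (sh n) (y, q)) x)" for n
  have Gi: "AE q in lborel. integrable lborel (\<lambda>x. G (sh n) (x, q))" for n
    using AEq by eventually_elim (rule sec)
  have FL: "F n \<in> L2 P6" and Fn: "nrm P6 (F n) \<le> nrm P6 (G (sh n))" for n
    unfolding F_def by (rule inv3_joint[OF GL Gi], simp)+
  have "(nrm P6 (F n))\<^sup>2 \<le> c * (1/4)^n" for n
    by (rule order_trans[OF power_mono[OF Fn nrm_nonneg] Gsq])
  from L2_series[OF FL this] obtain w H where w: "w \<in> L2 P6" and H: "integrable P6 H"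
    and AEz: "AE z in P6. (\<lambda>n. F n z) sums w z \<and> (\<forall>n. (cmod (\<Sum>k<n. F k z))\<^sup>2 \<le> H z)" by blast
  define f where "f = curry w"
  have Hq: "AE q in lborel. integrable lborel (\<lambda>x. H (x, q))"
    using lborel_pair.AE_integrable_snd[of "\<lambda>x q. H (x, q)"] H by simp
  have "AE q in lborel. is_ft (\<lambda>x. f x q) (\<lambda>\<zeta>. g \<zeta> q)"
    using AEq AE_pair_snd[OF AEz] Hq L2_sections[OF w]
  proof eventually_elim
    case (elim q)
    have wq: "(\<lambda>x. w (x, q)) \<in> L2 lborel" by (rule elim)
    show ?case unfolding is_ft_adm
    proof (intro conjI allI impI)
      show "(\<lambda>x. f x q) \<in> L2 lborel" using wq by (simp add: f_def)
      show "(\<lambda>\<zeta>. g \<zeta> q) \<in> L2 lborel" by (rule elim)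
      fix \<phi> assume a: "adm \<phi>"
      then have p: "\<phi> \<in> L2 lborel" "ft3 \<phi> \<in> L2 lborel" by (auto simp: adm_def sq_int_iff)
      have ft: "is_ft (\<lambda>x. F n (x, q)) (\<lambda>x. G (sh n) (x, q))" for n
        using is_ft_inv3[OF sec[OF elim(1)] inv3_L2[OF sec[OF elim(1)]]] by (simp add: F_def)
      then have FqL: "(\<lambda>x. F n (x, q)) \<in> L2 lborel" "(\<lambda>x. G (sh n) (x, q)) \<in> L2 lborel" for n
        by (auto simp: is_ft_adm)
      have part: "(LINT x|lborel. (\<Sum>k<n. G (sh k) (x, q)) * \<phi> x) = (LINT x|lborel. (\<Sum>k<n. F k (x, q)) * ft3 \<phi> x)" for n
      proof -
        have "(LINT x|lborel. (\<Sum>k<n. G (sh k) (x, q)) * \<phi> x) = (\<Sum>k<n. LINT x|lborel. G (sh k) (x, q) * \<phi> x)"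
          unfolding sum_distrib_right by (rule Bochner_Integration.integral_sum) (rule L2_mult_integrable[OF FqL(2) p(1)])
        also have "\<dots> = (\<Sum>k<n. LINT x|lborel. F k (x, q) * ft3 \<phi> x)"
          using ft a by (simp add: is_ft_adm)
        also have "\<dots> = (LINT x|lborel. (\<Sum>k<n. F k (x, q)) * ft3 \<phi> x)"
          unfolding sum_distrib_right by (rule Bochner_Integration.integral_sum[symmetric]) (rule L2_mult_integrable[OF FqL(1) p(2)])
        finally show ?thesis .
      qed
      note [measurable] = L2_meas[OF FqL(1)] L2_meas[OF FqL(2)] L2_meas[OF p(1)] L2_meas[OF p(2)] L2_meas[OF wq] L2_meas[OF elim(1)]
      have "(\<lambda>n. LINT x|lborel. (\<Sum>k<n. F k (x, q)) * ft3 \<phi> x) \<longlonglongrightarrow> (LINT x|lborel. w (x, q) * ft3 \<phi> x)"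
      proof (rule integral_dominated_convergence)
        \<comment> \<open>\<open>sqrt\<close> is odd, so this estimate covers either sign of
          \<open>H\<close>.\<close>
        have sq: "(sqrt y)\<^sup>2 \<le> \<bar>y\<bar>" for y
        proof (cases "y \<ge> 0")
          case False
          then show ?thesis using real_sqrt_minus[of "- y"] by simp
        qed simp
        have "(\<lambda>x. complex_of_real (sqrt (H (x, q)))) \<in> L2 lborel"
          by (rule L2_dom[where h="\<lambda>x. \<bar>H (x, q)\<bar>"]) (use elim(3) in \<open>auto simp: borel_measurable_integrable sq\<close>)
        from L2_mult_norm_integrable[OF this p(2)]
        show "integrable lborel (\<lambda>x. cmod (complex_of_real (sqrt (H (x, q)))) * cmod (ft3 \<phi> x))" .
        show "AE x in lborel. (\<lambda>n. (\<Sum>k<n. F k (x, q)) * ft3 \<phi> x) \<longlonglongrightarrow> w (x, q) * ft3 \<phi> x"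
          using elim(2) by eventually_elim (intro tendsto_mult tendsto_const, simp add: sums_def)
        show "AE x in lborel. norm ((\<Sum>k<n. F k (x, q)) * ft3 \<phi> x) \<le> cmod (complex_of_real (sqrt (H (x, q)))) * cmod (ft3 \<phi> x)" for n
          using elim(2)
        proof eventually_elim
          case (elim x)
          then have "cmod (\<Sum>k<n. F k (x, q)) \<le> sqrt (H (x, q))" using real_le_rsqrt by blast
          then show ?case unfolding norm_mult by (intro mult_right_mono) auto
        qed
      qed measurable
      moreover have "(\<lambda>n. LINT x|lborel. (\<Sum>k<n. G (sh k) (x, q)) * \<phi> x) \<longlonglongrightarrow> (LINT x|lborel. g x q * \<phi> x)"
      proof (rule integral_dominated_convergence[OF _ _ L2_mult_norm_integrable[OF elim(1) p(1)]])
        have eq: "(\<Sum>k<n. G (sh k) (x, q)) = indicator {x. norm x < real (a n)} x * g x q" for n and x :: vec3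
          by (simp add: G_def sum_distrib_right[symmetric] sums_ind)
        show "AE x in lborel. (\<lambda>n. (\<Sum>k<n. G (sh k) (x, q)) * \<phi> x) \<longlonglongrightarrow> g x q * \<phi> x"
        proof (rule AE_I2)
          fix x :: vec3
          have "eventually (\<lambda>n. real n > norm x) sequentially"
            using filterlim_real_sequentially by (auto simp: filterlim_at_top_dense)
          then have "eventually (\<lambda>n. (\<Sum>k<n. G (sh k) (x, q)) * \<phi> x = g x q * \<phi> x) sequentially"
          proof eventually_elim
            case (elim n)
            then have "norm x < real (a n)" using an[of n] by linarith
            then show ?case by (simp add: eq)
          qed
          then show "(\<lambda>n. (\<Sum>k<n. G (sh k) (x, q)) * \<phi> x) \<longlonglongrightarrow> g x q * \<phi> x" by (rule tendsto_eventually)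
        qed
        show "AE x in lborel. norm ((\<Sum>k<n. G (sh k) (x, q)) * \<phi> x) \<le> cmod (g x q) * cmod (\<phi> x)" for n
          unfolding eq by (auto simp: indicator_def norm_mult)
      qed measurable
      ultimately show "(LINT \<zeta>|lborel. g \<zeta> q * \<phi> \<zeta>) = (LINT x|lborel. f x q * ft3 \<phi> x)"
        unfolding part by (auto intro: LIMSEQ_unique simp: f_def)
    qed
  qed
  moreover have "case_prod f \<in> L2 P6" using w by (simp add: f_def)
  ultimately show ?thesis by blast
qed

section \<open>The exponential of a bounded multiplication operator plus a finite rank operator\<close>

text \<open>The addition law of the exponential in scalar form, to be applied to
  \<open>a n = (A ^^ n) u q\<close>. The growth condition makes the double series absolutely
  summable, so it may be summed along diagonals.\<close>

lemma exp_series_add: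
  fixes a :: "nat \<Rightarrow> complex" and s t B C :: real
  assumes a: "\<And>n. cmod (a n) \<le> C ^ n * B" and s: "s \<ge> 0" and t: "t \<ge> 0" and C: "C \<ge> 0" and B: "B \<ge> 0"
  shows "(\<Sum>n. of_real (s ^ n / fact n) * (\<Sum>k. of_real (t ^ k / fact k) * a (n + k)))
       = (\<Sum>N. of_real ((s + t) ^ N / fact N) * a N)"
proof -
  define f where "f = (\<lambda>(n, k). of_real (s ^ n / fact n) * (of_real (t ^ k / fact k) * a (n + k)))"
  define x where "x r n = (r * C) ^ n / fact n" for r and n :: nat
  have x0: "x r n \<ge> 0" if "r \<ge> 0" for r n using that C by (simp add: x_def)
  have xs: "summable (x r)" for r unfolding x_def using summable_exp[of "r * C"] by (simp add: field_simps)
  have xs': "x r summable_on UNIV" if "r \<ge> 0" for r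
    by (rule norm_summable_imp_summable_on) (use xs[of r] x0[OF that] in simp)
  have fb: "norm (f (n, k)) \<le> norm (x s n * (x t k * B))" for n k
  proof -
    have "norm (f (n, k)) = s ^ n / fact n * (t ^ k / fact k * cmod (a (n + k)))"
      using s t by (simp add: f_def norm_mult norm_divide norm_power)
    also have "\<dots> \<le> s ^ n / fact n * (t ^ k / fact k * (C ^ (n + k) * B))"
      using s t a by (intro mult_left_mono) auto
    also have "\<dots> = x s n * (x t k * B)" by (simp add: x_def power_mult_distrib power_add)
    finally show ?thesis using x0 s t B by simp
  qed
  have fx: "(\<lambda>z. norm (f z)) summable_on UNIV \<times> UNIV"
  proof (rule Infinite_Sum.abs_summable_on_comparison_test)
    show "(\<lambda>z. norm (case z of (n, k) \<Rightarrow> x s n * (x t k * B))) summable_on UNIV \<times> UNIV"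
      unfolding Infinite_Sum.abs_summable_on_Sigma_iff
    proof (intro conjI ballI)
      have i: "(\<lambda>k. norm (x s n * (x t k * B))) = (\<lambda>k. (x s n * B) * x t k)" for n
        using x0 s t B by (auto simp: abs_mult)
      show "(\<lambda>k. norm (case (n, k) of (n, k) \<Rightarrow> x s n * (x t k * B))) summable_on UNIV" for n
        by (simp only: prod.case i) (intro summable_on_cmult_right xs'[OF t])
      have "norm (infsum (\<lambda>k. norm (x s n * (x t k * B))) UNIV) = x s n * (B * infsum (x t) UNIV)" for n
      proof -
        have "infsum (\<lambda>k. norm (x s n * (x t k * B))) UNIV = (x s n * B) * infsum (x t) UNIV"
          unfolding i by (rule infsum_cmult_right) (use xs'[OF t] in auto)
        moreover have "infsum (x t) UNIV \<ge> 0" by (rule infsum_nonneg) (use x0 t in auto)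
        ultimately show ?thesis using x0[OF s, of n] B by (simp add: mult.assoc)
      qed
      then show "(\<lambda>n. norm (infsum (\<lambda>k. norm (case (n, k) of (n, k) \<Rightarrow> x s n * (x t k * B))) UNIV)) summable_on UNIV"
        by (simp only: prod.case) (intro summable_on_cmult_left xs'[OF s])
    qed
    fix z :: "nat \<times> nat" assume "z \<in> UNIV \<times> UNIV"
    show "norm (f z) \<le> norm (case z of (n, k) \<Rightarrow> x s n * (x t k * B))"
      using fb by (cases z) simp
  qed
  have fs: "f summable_on UNIV \<times> UNIV" by (rule Infinite_Sum.abs_summable_summable[OF fx])
  have sumeq: "infsum g UNIV = suminf g" if "summable (\<lambda>n. norm (g n))" for g :: "nat \<Rightarrow> complex"
    using norm_summable_imp_has_sum[OF that summable_sums] that summable_norm_cancel by (blast intro: infsumI)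
  have row: "summable (\<lambda>k. norm (of_real (t ^ k / fact k) * a (n + k)))" for n
  proof (rule summable_comparison_test'[where N=0])
    show "summable (\<lambda>k. x t k * (C ^ n * B))" using xs by (intro summable_mult2)
    show "norm (norm (of_real (t ^ k / fact k) * a (n + k))) \<le> x t k * (C ^ n * B)" for k
    proof -
      have "norm (of_real (t ^ k / fact k) * a (n + k)) \<le> t ^ k / fact k * (C ^ (n + k) * B)"
        using t a by (simp add: norm_mult norm_divide norm_power) (intro divide_right_mono mult_left_mono, auto)
      then show ?thesis by (simp add: x_def power_mult_distrib power_add mult_ac)
    qed
  qed
  have tot: "summable (\<lambda>N. norm (of_real ((s + t) ^ N / fact N) * a N))"
  proof (rule summable_comparison_test'[where N=0])
    show "summable (\<lambda>k. x (s + t) k * B)" using xs by (intro summable_mult2)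
    show "norm (norm (of_real ((s + t) ^ k / fact k) * a k)) \<le> x (s + t) k * B" for k
    proof -
      have "norm (of_real ((s + t) ^ k / fact k) * a k) \<le> (s + t) ^ k / fact k * (C ^ k * B)"
        using t s a unfolding norm_mult norm_of_real by (intro mult_mono) auto
      then show ?thesis by (simp add: x_def power_mult_distrib mult_ac)
    qed
  qed
  define S where "S n = (\<Sum>k. of_real (t ^ k / fact k) * a (n + k))" for n
  have inner: "infsum (\<lambda>k. f (n, k)) UNIV = of_real (s ^ n / fact n) * S n" for n
  proof -
    have "infsum (\<lambda>k. f (n, k)) UNIV = of_real (s ^ n / fact n) * infsum (\<lambda>k. of_real (t ^ k / fact k) * a (n + k)) UNIV"
      unfolding f_def prod.case by (rule infsum_cmult_right) (use norm_summable_imp_summable_on[OF row] in auto)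
    then show ?thesis unfolding sumeq[OF row] S_def .
  qed
  have Sb: "norm (S n) \<le> C ^ n * (B * suminf (x t))" for n
  proof -
    have "norm (S n) \<le> (\<Sum>k. norm (of_real (t ^ k / fact k) * a (n + k)))" unfolding S_def by (rule summable_norm[OF row])
    also have "\<dots> \<le> (\<Sum>k. x t k * (C ^ n * B))"
    proof (rule suminf_le[OF _ row])
      show "summable (\<lambda>k. x t k * (C ^ n * B))" using xs by (intro summable_mult2)
      show "norm (of_real (t ^ k / fact k) * a (n + k)) \<le> x t k * (C ^ n * B)" for k
      proof -
        have "norm (of_real (t ^ k / fact k) * a (n + k)) \<le> t ^ k / fact k * (C ^ (n + k) * B)"
          using t a unfolding norm_mult norm_of_real by (intro mult_mono) auto
        then show ?thesis by (simp add: x_def power_mult_distrib power_add mult_ac)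
      qed
    qed
    also have "\<dots> = suminf (x t) * (C ^ n * B)" using xs by (simp add: suminf_mult2)
    finally show ?thesis by (simp add: mult_ac)
  qed
  have outer: "summable (\<lambda>n. norm (of_real (s ^ n / fact n) * S n))"
  proof (rule summable_comparison_test'[where N=0])
    show "summable (\<lambda>n. x s n * (B * suminf (x t)))" using xs by (intro summable_mult2)
    show "norm (norm (of_real (s ^ n / fact n) * S n)) \<le> x s n * (B * suminf (x t))" for n
    proof -
      have "norm (of_real (s ^ n / fact n) * S n) \<le> s ^ n / fact n * (C ^ n * (B * suminf (x t)))"
        using s Sb unfolding norm_mult norm_of_real by (intro mult_mono) auto
      then show ?thesis by (simp add: x_def power_mult_distrib mult_ac)
    qed
  qed
  have L: "infsum f (UNIV \<times> UNIV) = (\<Sum>n. of_real (s ^ n / fact n) * S n)"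
    unfolding infsum_Sigma_banach[OF fs, symmetric] inner by (rule sumeq[OF outer])
  \<comment> \<open>On the diagonal \<open>n + k = N\<close> the factor \<open>a N\<close> is
    constant and the binomial theorem sums the coefficients.\<close>
  define h where "h = (\<lambda>(N, i). f (i, N - i))"
  have bij: "infsum f (UNIV \<times> UNIV) = infsum h (Sigma UNIV (\<lambda>N. {..N}))"
    by (rule infsum_reindex_bij_witness[where i="\<lambda>(N, i). (i, N - i)" and j="\<lambda>(n, k). (n + k, n)"]) (auto simp: h_def)
  have hs: "h summable_on (Sigma UNIV (\<lambda>N. {..N}))"
    by (rule summable_on_reindex_bij_witness[where i="\<lambda>(N, i). (i, N - i)" and j="\<lambda>(n, k). (n + k, n)" and T="Sigma UNIV (\<lambda>N. {..N})" and S="UNIV \<times> UNIV" and g=f, THEN iffD1])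
       (use fs in \<open>auto simp: h_def\<close>)
  have hi: "infsum (\<lambda>i. h (N, i)) {..N} = of_real ((s + t) ^ N / fact N) * a N" for N
  proof -
    have "(s + t) ^ N / fact N = (\<Sum>i\<le>N. s ^ i / fact i * (t ^ (N - i) / fact (N - i)))"
      unfolding binomial_ring sum_divide_distrib
      by (intro sum.cong) (auto simp: binomial_fact field_simps)
    then have "of_real ((s + t) ^ N / fact N) * a N = (\<Sum>i\<le>N. of_real (s ^ i / fact i) * (of_real (t ^ (N - i) / fact (N - i)) * a N))"
      by (simp only: of_real_sum sum_distrib_right of_real_mult mult.assoc)
    also have "\<dots> = (\<Sum>i\<le>N. h (N, i))" by (intro sum.cong) (auto simp: h_def f_def)
    finally show ?thesis by simp
  qed
  have "infsum h (Sigma UNIV (\<lambda>N. {..N})) = (\<Sum>N. of_real ((s + t) ^ N / fact N) * a N)"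
    unfolding infsum_Sigma_banach[OF hs, symmetric] hi by (rule sumeq[OF tot])
  then show ?thesis using L bij by (simp add: S_def)
qed

text \<open>The situation at one frequency: \<open>m\<close> is the symbol and the functions
  \<open>e\<close>, \<open>d\<close> form the kernel of the collision part. The functionals are
  bilinear integrals without conjugation. As the kernel is given by functions, estimates can hold at
  every point \<open>q\<close> and not merely almost everywhere.\<close>

locale finite_rank_gen =
  fixes M :: "'q measure" and m :: "'q \<Rightarrow> complex" and e d :: "'j \<Rightarrow> 'q \<Rightarrow> complex" and I :: "'j set" and c :: real
  assumes fin: "finite I" and mm: "m \<in> borel_measurable M" and mb: "\<And>q. cmod (m q) \<le> c" and c0: "0 \<le> c"
    and eL: "\<And>j. j \<in> I \<Longrightarrow> e j \<in> L2 M" and dL: "\<And>j. j \<in> I \<Longrightarrow> d j \<in> L2 M"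
    and dissip: "\<And>u. u \<in> L2 M \<Longrightarrow>
       Re (LINT q|M. ((\<Sum>j\<in>I. e j q * (LINT p|M. u p * d j p)) - m q * u q) * cnj (u q)) \<le> 0"
begin

definition A :: "('q \<Rightarrow> complex) \<Rightarrow> 'q \<Rightarrow> complex" where
  "A u q = (\<Sum>j\<in>I. e j q * (LINT p|M. u p * d j p)) - m q * u q"

definition T :: "real \<Rightarrow> ('q \<Rightarrow> complex) \<Rightarrow> 'q \<Rightarrow> complex" where
  "T t u q = (\<Sum>n. of_real (t ^ n / fact n) * (A ^^ n) u q)"

definition E :: "'q \<Rightarrow> real" where "E q = (\<Sum>j\<in>I. cmod (e j q) * nrm M (d j))"
definition \<epsilon> :: real where "\<epsilon> = nrm M (\<lambda>q. of_real (E q))"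
definition C :: real where "C = c + 1 + \<epsilon>"
text \<open>A pointwise majorant that survives iteration: \<open>E q * nrm M u\<close> bounds the
  finite rank part at \<open>q\<close>, and one application of \<open>A\<close> costs at most the
  factor \<open>C\<close>. In \<open>C\<close> the summand 1 absorbs the term with \<open>E\<close>,
  and \<open>\<epsilon>\<close> bounds the finite rank part in norm.\<close>

definition Bd :: "('q \<Rightarrow> complex) \<Rightarrow> 'q \<Rightarrow> real" where "Bd u q = cmod (u q) + E q * nrm M u"

lemma E0: "E q \<ge> 0" unfolding E_def by (intro sum_nonneg) simp
lemma \<epsilon>0: "\<epsilon> \<ge> 0" by (simp add: \<epsilon>_def)
lemma C1: "C \<ge> 1" using c0 \<epsilon>0 by (simp add: C_def)
lemma Bd0: "Bd u q \<ge> 0" using E0 by (simp add: Bd_def)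

lemma EL: "(\<lambda>q. complex_of_real (E q)) \<in> L2 M"
proof -
  have "(\<lambda>q. complex_of_real (cmod (e j q))) \<in> L2 M" if "j \<in> I" for j
    using eL[OF that] by (auto simp: L2_def)
  then have "(\<lambda>q. \<Sum>j\<in>I. complex_of_real (nrm M (d j)) * complex_of_real (cmod (e j q))) \<in> L2 M"
    by (intro L2_sum L2_cmult)
  then show ?thesis by (simp add: E_def mult.commute)
qed

lemma BdL: assumes "u \<in> L2 M" shows "(\<lambda>q. complex_of_real (Bd u q)) \<in> L2 M"
proof -
  have "(\<lambda>q. complex_of_real (cmod (u q))) \<in> L2 M" using assms by (auto simp: L2_def)
  from L2_add[OF this L2_cmult[OF EL, of "of_real (nrm M u)"]] show ?thesis by (simp add: Bd_def mult.commute)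
qed

lemma Bd_nrm: assumes "u \<in> L2 M" shows "nrm M (\<lambda>q. complex_of_real (Bd u q)) \<le> (1 + \<epsilon>) * nrm M u"
proof -
  have L: "(\<lambda>q. complex_of_real (cmod (u q))) \<in> L2 M" using assms by (auto simp: L2_def)
  have "nrm M (\<lambda>q. complex_of_real (cmod (u q)) + of_real (nrm M u) * complex_of_real (E q)) \<le> nrm M u + nrm M u * \<epsilon>"
    using nrm_triangle[OF L L2_cmult[OF EL, of "of_real (nrm M u)"]] unfolding nrm_scale \<epsilon>_def
    by (simp add: nrm_def[of M "\<lambda>q. complex_of_real (cmod (u q))"] nrm_def[of M u])
  then show ?thesis by (simp add: Bd_def algebra_simps)
qed

lemma AL: assumes "u \<in> L2 M" shows "A u \<in> L2 M"
proof -
  have "(\<lambda>q. \<Sum>j\<in>I. (LINT p|M. u p * d j p) * e j q) \<in> L2 M" by (intro L2_sum L2_cmult eL)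
  from L2_diff[OF this L2_mult_bounded[OF assms mm mb]] show ?thesis by (simp add: A_def[abs_def] mult.commute)
qed

lemma A_bound: assumes "u \<in> L2 M" shows "cmod (A u q) \<le> c * cmod (u q) + E q * nrm M u"
proof -
  have "cmod (\<Sum>j\<in>I. e j q * (LINT p|M. u p * d j p)) \<le> (\<Sum>j\<in>I. cmod (e j q) * (nrm M u * nrm M (d j)))"
    by (rule sum_norm_le) (use CS[OF assms dL] in \<open>auto simp: norm_mult intro!: mult_left_mono\<close>)
  also have "\<dots> = E q * nrm M u" by (simp add: E_def sum_distrib_left mult_ac)
  finally have 1: "cmod (\<Sum>j\<in>I. e j q * (LINT p|M. u p * d j p)) \<le> E q * nrm M u" .
  have 2: "cmod (m q * u q) \<le> c * cmod (u q)" using mb by (auto simp: norm_mult intro!: mult_right_mono)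
  show ?thesis unfolding A_def using norm_triangle_ineq4[of "\<Sum>j\<in>I. e j q * (LINT p|M. u p * d j p)" "m q * u q"] 1 2 by linarith
qed

lemma A_nrm: assumes "u \<in> L2 M" shows "nrm M (A u) \<le> C * nrm M u"
proof -
  have L: "(\<lambda>q. complex_of_real (cmod (u q))) \<in> L2 M" using assms by (auto simp: L2_def)
  have L': "(\<lambda>q. of_real c * complex_of_real (cmod (u q)) + of_real (nrm M u) * complex_of_real (E q)) \<in> L2 M"
    by (intro L2_add L2_cmult L EL)
  have "nrm M (A u) \<le> nrm M (\<lambda>q. of_real c * complex_of_real (cmod (u q)) + of_real (nrm M u) * complex_of_real (E q))"
  proof (rule nrm_mono[OF L'])
    show "A u \<in> borel_measurable M" using AL[OF assms] L2_meas by auto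
    have eq: "cmod (of_real c * complex_of_real (cmod (u q)) + of_real (nrm M u) * complex_of_real (E q)) = c * cmod (u q) + E q * nrm M u" for q
    proof -
      have "of_real c * complex_of_real (cmod (u q)) + of_real (nrm M u) * complex_of_real (E q) = complex_of_real (c * cmod (u q) + E q * nrm M u)"
        by (simp add: mult.commute)
      then show ?thesis using c0 E0[of q] by (simp only: norm_of_real) simp
    qed
    show "AE q in M. cmod (A u q) \<le> cmod (of_real c * complex_of_real (cmod (u q)) + of_real (nrm M u) * complex_of_real (E q))"
      unfolding eq using A_bound[OF assms] by simp
  qed
  also have "\<dots> \<le> c * nrm M u + nrm M u * \<epsilon>"
    using nrm_triangle[OF L2_cmult[OF L, of "of_real c"] L2_cmult[OF EL, of "of_real (nrm M u)"]] c0 unfolding nrm_scale \<epsilon>_def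
    by (simp add: nrm_def[of M "\<lambda>q. complex_of_real (cmod (u q))"] nrm_def[of M u])
  also have "\<dots> \<le> C * nrm M u" by (simp add: C_def algebra_simps)
  finally show ?thesis .
qed

lemma A_lin: assumes "u \<in> L2 M" "v \<in> L2 M"
  shows "A (\<lambda>q. a * u q + b * v q) = (\<lambda>q. a * A u q + b * A v q)"
proof
  fix q
  have "(LINT p|M. (a * u p + b * v p) * d j p) = a * (LINT p|M. u p * d j p) + b * (LINT p|M. v p * d j p)" if "j \<in> I" for j
    using L2_mult_integrable[OF assms(1) dL[OF that]] L2_mult_integrable[OF assms(2) dL[OF that]]
    by (simp add: distrib_right mult.assoc)
  then show "A (\<lambda>q. a * u q + b * v q) q = a * A u q + b * A v q"
    by (simp add: A_def sum_distrib_left algebra_simps sum.distrib)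
qed

text \<open>The norm bound and the pointwise bound are proved together, because the value of the
  finite rank part at a point depends on the norm of its argument.\<close>

lemma An: assumes "u \<in> L2 M"
  shows "(A ^^ n) u \<in> L2 M" "nrm M ((A ^^ n) u) \<le> C ^ n * nrm M u" "cmod ((A ^^ n) u q) \<le> C ^ n * Bd u q"
proof -
  have "(A ^^ n) u \<in> L2 M \<and> nrm M ((A ^^ n) u) \<le> C ^ n * nrm M u \<and> (\<forall>q. cmod ((A ^^ n) u q) \<le> C ^ n * Bd u q)"
  proof (induction n)
    case 0 then show ?case using assms E0 by (simp add: Bd_def)
  next
    case (Suc n)
    let ?v = "(A ^^ n) u"
    have v: "?v \<in> L2 M" using Suc by simp
    have n: "nrm M (A ?v) \<le> C ^ Suc n * nrm M u"
    proof -
      have "C * nrm M ?v \<le> C * (C ^ n * nrm M u)" using Suc C1 by (intro mult_left_mono) auto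
      then show ?thesis using A_nrm[OF v] by (simp add: mult.assoc)
    qed
    have "cmod (A ?v q) \<le> C ^ Suc n * Bd u q" for q
    proof -
      have "cmod (A ?v q) \<le> c * cmod (?v q) + E q * nrm M ?v" by (rule A_bound[OF v])
      also have "\<dots> \<le> c * (C ^ n * Bd u q) + E q * (C ^ n * nrm M u)"
        using Suc c0 E0[of q] by (intro add_mono mult_left_mono) auto
      also have "\<dots> \<le> c * (C ^ n * Bd u q) + C ^ n * Bd u q"
        using C1 by (simp add: Bd_def mult_left_mono)
      also have "\<dots> = (c + 1) * (C ^ n * Bd u q)" by (simp add: algebra_simps)
      also have "\<dots> \<le> C * (C ^ n * Bd u q)" using \<epsilon>0 C1 Bd0[of u q] by (intro mult_right_mono) (auto simp: C_def)
      finally show ?thesis by simp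
    qed
    then show ?case using AL[OF v] n by simp
  qed
  then show "(A ^^ n) u \<in> L2 M" "nrm M ((A ^^ n) u) \<le> C ^ n * nrm M u" "cmod ((A ^^ n) u q) \<le> C ^ n * Bd u q" by auto
qed

lemma An_lin: assumes "u \<in> L2 M" "v \<in> L2 M"
  shows "(A ^^ n) (\<lambda>q. a * u q + b * v q) = (\<lambda>q. a * (A ^^ n) u q + b * (A ^^ n) v q)"
  by (induction n) (simp_all add: A_lin An(1)[OF assms(1)] An(1)[OF assms(2)])

lemma exp_summable: "summable (\<lambda>n. x ^ n / fact n :: real)"
  using summable_exp[of x] by (simp add: field_simps)

lemma T_summable: assumes "u \<in> L2 M" "t \<ge> 0"
  shows "summable (\<lambda>n. cmod (of_real (t ^ n / fact n) * (A ^^ n) u q))"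
    and "summable (\<lambda>n. of_real (t ^ n / fact n) * (A ^^ n) u q)"
    and "cmod (of_real (t ^ n / fact n) * (A ^^ n) u q) \<le> (t * C) ^ n / fact n * Bd u q"
proof -
  have b: "cmod (of_real (t ^ n / fact n) * (A ^^ n) u q) \<le> (t * C) ^ n / fact n * Bd u q" for n
  proof -
    have "cmod (of_real (t ^ n / fact n) * (A ^^ n) u q) \<le> t ^ n / fact n * (C ^ n * Bd u q)"
      using assms(2) An(3)[OF assms(1)] unfolding norm_mult norm_of_real by (intro mult_mono) auto
    then show ?thesis by (simp add: power_mult_distrib)
  qed
  show s: "summable (\<lambda>n. cmod (of_real (t ^ n / fact n) * (A ^^ n) u q))"
    by (rule summable_comparison_test'[OF summable_mult2[OF exp_summable], where N=0]) (use b in auto)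
  show "summable (\<lambda>n. of_real (t ^ n / fact n) * (A ^^ n) u q)" by (rule summable_norm_cancel[OF s])
  show "cmod (of_real (t ^ n / fact n) * (A ^^ n) u q) \<le> (t * C) ^ n / fact n * Bd u q" by (rule b)
qed

lemma exp_suminf: "(\<Sum>n. x ^ n / fact n) = exp (x::real)"
  by (simp add: exp_def divide_inverse mult.commute)

lemma T_bound: assumes "u \<in> L2 M" "t \<ge> 0" shows "cmod (T t u q) \<le> exp (t * C) * Bd u q"
proof -
  have "cmod (T t u q) \<le> (\<Sum>n. cmod (of_real (t ^ n / fact n) * (A ^^ n) u q))"
    unfolding T_def by (rule summable_norm[OF T_summable(1)[OF assms]])
  also have "\<dots> \<le> (\<Sum>n. (t * C) ^ n / fact n * Bd u q)"
    by (rule suminf_le[OF T_summable(3)[OF assms] T_summable(1)[OF assms] summable_mult2[OF exp_summable]])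
  also have "\<dots> = exp (t * C) * Bd u q" by (simp only: suminf_mult2[OF exp_summable, symmetric] exp_suminf)
  finally show ?thesis .
qed

lemma T_meas [measurable]: assumes "u \<in> L2 M" shows "T t u \<in> borel_measurable M"
proof -
  have [measurable]: "(A ^^ n) u \<in> borel_measurable M" for n using An(1)[OF assms] L2_meas by blast
  show ?thesis unfolding T_def[abs_def] by measurable
qed

lemma TL: assumes "u \<in> L2 M" "t \<ge> 0" shows "T t u \<in> L2 M"
proof -
  have L: "(\<lambda>q. of_real (exp (t * C)) * complex_of_real (Bd u q)) \<in> L2 M" by (intro L2_cmult BdL assms)
  show ?thesis
  proof (rule L2_dom[OF T_meas[OF assms(1)] L2_integrable[OF L]], rule AE_I2)
    fix q
    have "cmod (T t u q) \<le> cmod (of_real (exp (t * C)) * complex_of_real (Bd u q))"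
      using T_bound[OF assms] Bd0[of u q] by (simp add: norm_mult)
    then show "(cmod (T t u q))\<^sup>2 \<le> (cmod (of_real (exp (t * C)) * complex_of_real (Bd u q)))\<^sup>2" by (rule power_mono) simp
  qed
qed

lemma T_lin: assumes "u \<in> L2 M" "v \<in> L2 M" "t \<ge> 0"
  shows "T t (\<lambda>q. a * u q + b * v q) = (\<lambda>q. a * T t u q + b * T t v q)"
proof
  fix q
  have "T t (\<lambda>q. a * u q + b * v q) q = (\<Sum>n. a * (of_real (t ^ n / fact n) * (A ^^ n) u q) + b * (of_real (t ^ n / fact n) * (A ^^ n) v q))"
    unfolding T_def An_lin[OF assms(1,2)] by (intro suminf_cong) (simp add: algebra_simps)
  also have "\<dots> = a * T t u q + b * T t v q"
    unfolding T_def by (rule sums_unique[symmetric]) (intro sums_add sums_mult summable_sums T_summable assms)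
  finally show "T t (\<lambda>q. a * u q + b * v q) q = a * T t u q + b * T t v q" .
qed

lemma T_0: "T 0 u = u"
proof
  fix q
  have "T 0 u q = (\<Sum>n\<in>{0}. of_real (0 ^ n / fact n) * (A ^^ n) u q)"
    unfolding T_def by (rule suminf_finite) auto
  then show "T 0 u q = u q" by simp
qed

text \<open>Multiplication by \<open>m\<close> passes through the series at each point; the
  functionals pass through it because the integrals of the absolute values of the terms are
  summable.\<close>

lemma A_T: assumes "u \<in> L2 M" "t \<ge> 0" shows "A (T t u) = T t (A u)"
proof
  fix q
  have An': "(A ^^ n) (A u) = (A ^^ Suc n) u" for n by (simp add: funpow_swap1)
  let ?x = "\<lambda>n. complex_of_real (t ^ n / fact n)"
  have int: "(\<lambda>n. ?x n * (LINT p|M. (A ^^ n) u p * d j p)) sums (LINT p|M. T t u p * d j p)" if j: "j \<in> I" for j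
  proof -
    let ?f = "\<lambda>n p. ?x n * (A ^^ n) u p * d j p"
    have i: "integrable M (?f n)" for n
      using L2_mult_integrable[OF An(1)[OF assms(1)] dL[OF j]] by (simp add: mult.assoc)
    have "(\<lambda>n. LINT p|M. ?f n p) sums (LINT p|M. (\<Sum>n. ?f n p))"
    proof (rule sums_integral[OF i])
      show "AE p in M. summable (\<lambda>n. norm (?f n p))"
      proof (rule AE_I2)
        fix p
        have "(\<lambda>n. norm (?f n p)) = (\<lambda>n. cmod (?x n * (A ^^ n) u p) * cmod (d j p))"
          by (rule ext) (rule norm_mult)
        then show "summable (\<lambda>n. norm (?f n p))" by (simp only: summable_mult2[OF T_summable(1)[OF assms]])
      qed
      show "summable (\<lambda>n. LINT p|M. norm (?f n p))"
      proof (rule summable_comparison_test'[OF summable_mult2[OF exp_summable], where N=0])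
        fix n
        have "(LINT p|M. norm (?f n p)) = t ^ n / fact n * (LINT p|M. cmod ((A ^^ n) u p) * cmod (d j p))"
          using assms(2) by (simp add: norm_mult norm_divide norm_power mult.assoc)
        also have "\<dots> \<le> t ^ n / fact n * (nrm M ((A ^^ n) u) * nrm M (d j))"
          using assms(2) by (intro mult_left_mono CS_norm An(1) assms dL j) auto
        also have "\<dots> \<le> t ^ n / fact n * ((C ^ n * nrm M u) * nrm M (d j))"
          using assms(2) by (intro mult_left_mono mult_right_mono An assms) auto
        finally show "norm (LINT p|M. norm (?f n p)) \<le> (t * C) ^ n / fact n * (nrm M u * nrm M (d j))"
          by (simp add: power_mult_distrib mult_ac)
      qed
    qed
    moreover have "(\<Sum>n. ?f n p) = T t u p * d j p" for p
      unfolding T_def by (rule suminf_mult2[OF T_summable(2)[OF assms], symmetric])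
    ultimately show ?thesis by (simp add: mult.assoc)
  qed
  have "(\<lambda>n. \<Sum>j\<in>I. e j q * (?x n * (LINT p|M. (A ^^ n) u p * d j p))) sums (\<Sum>j\<in>I. e j q * (LINT p|M. T t u p * d j p))"
    by (intro sums_sum sums_mult int)
  moreover have "(\<lambda>n. m q * (?x n * (A ^^ n) u q)) sums (m q * T t u q)"
    unfolding T_def by (intro sums_mult summable_sums T_summable assms)
  ultimately have "(\<lambda>n. (\<Sum>j\<in>I. e j q * (?x n * (LINT p|M. (A ^^ n) u p * d j p))) - m q * (?x n * (A ^^ n) u q)) sums A (T t u) q"
    unfolding A_def[of "T t u"] by (rule sums_diff)
  moreover have "(\<Sum>j\<in>I. e j q * (?x n * (LINT p|M. (A ^^ n) u p * d j p))) - m q * (?x n * (A ^^ n) u q) = ?x n * (A ^^ n) (A u) q" for n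
    unfolding An' funpow.simps o_apply A_def[of "(A ^^ n) u"] by (simp only: right_diff_distrib sum_distrib_left mult.left_commute)
  ultimately show "A (T t u) q = T t (A u) q" unfolding T_def[of t "A u"] by (simp add: sums_iff)
qed

lemma An_T: assumes "u \<in> L2 M" "t \<ge> 0" shows "(A ^^ n) (T t u) = T t ((A ^^ n) u)"
  by (induction n) (simp_all add: A_T An(1) assms)

lemma T_semigroup: assumes "u \<in> L2 M" "s \<ge> 0" "t \<ge> 0" shows "T s (T t u) = T (s + t) u"
proof
  fix q
  have "T s (T t u) q = (\<Sum>n. of_real (s ^ n / fact n) * (\<Sum>k. of_real (t ^ k / fact k) * (A ^^ (n + k)) u q))"
  proof -
    have "(A ^^ k) ((A ^^ n) u) = (A ^^ (n + k)) u" for n k by (subst add.commute) (simp add: funpow_add)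
    then show ?thesis unfolding T_def[of s] An_T[OF assms(1,3)] T_def[of t] by (simp only:)
  qed
  also have "\<dots> = T (s + t) u q" unfolding T_def[of "s + t"]
    by (rule exp_series_add[OF An(3)[OF assms(1)] assms(2,3)]) (use C1 Bd0 in auto)
  finally show "T s (T t u) q = T (s + t) u q" .
qed

text \<open>\<open>C\<^sup>2\<close> controls the second order term in the norm of
  \<open>u + t * A u\<close>, the other summand the remainder of the exponential series; one
  constant serves both.\<close>

definition D :: real where "D = C\<^sup>2 + exp C * (1 + \<epsilon>)"

lemma D0: "D \<ge> 0" using \<epsilon>0 by (simp add: D_def)

lemma T_remainder: assumes "u \<in> L2 M" "0 \<le> t" "t \<le> 1"
  shows "cmod (T t u q - (u q + of_real t * A u q)) \<le> t\<^sup>2 * exp C * Bd u q"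
    and "nrm M (\<lambda>q. T t u q - (u q + of_real t * A u q)) \<le> D * t\<^sup>2 * nrm M u"
proof -
  have rem: "cmod (T t u q - (u q + of_real t * A u q)) \<le> t\<^sup>2 * exp C * Bd u q" for q
  proof -
    let ?f = "\<lambda>n. of_real (t ^ n / fact n) * (A ^^ n) u q"
    have "T t u q = (\<Sum>n. ?f (n + 2)) + (\<Sum>n<2. ?f n)"
      unfolding T_def by (rule suminf_split_initial_segment[OF T_summable(2)[OF assms(1,2)]])
    then have "T t u q - (u q + of_real t * A u q) = (\<Sum>n. ?f (n + 2))"
      by (simp add: numeral_2_eq_2)
    also have "cmod \<dots> \<le> (\<Sum>n. cmod (?f (n + 2)))"
      by (rule summable_norm) (use T_summable(1)[OF assms(1,2)] summable_iff_shift[of "\<lambda>n. cmod (?f n)" 2] in simp)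
    also have "\<dots> \<le> (\<Sum>n. t\<^sup>2 * Bd u q * (C ^ (n + 2) / fact (n + 2)))"
    proof (rule suminf_le)
      fix n
      have "cmod (?f (n + 2)) \<le> (t * C) ^ (n + 2) / fact (n + 2) * Bd u q" by (rule T_summable(3)[OF assms(1,2)])
      also have "(t * C) ^ (n + 2) / fact (n + 2) * Bd u q = t ^ (n + 2) * (C ^ (n + 2) / fact (n + 2) * Bd u q)"
        by (simp add: power_mult_distrib)
      \<comment> \<open>Here \<open>t \<le> 1\<close> turns all higher powers of \<open>t\<close>
        into the common factor of second order.\<close>
      also have "\<dots> \<le> t\<^sup>2 * (C ^ (n + 2) / fact (n + 2) * Bd u q)"
        using assms C1 Bd0[of u q] by (intro mult_right_mono power_decreasing) auto
      finally show "cmod (?f (n + 2)) \<le> t\<^sup>2 * Bd u q * (C ^ (n + 2) / fact (n + 2))" by (simp add: mult_ac)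
    next
      show "summable (\<lambda>n. cmod (?f (n + 2)))"
        using T_summable(1)[OF assms(1,2)] summable_iff_shift[of "\<lambda>n. cmod (?f n)" 2] by simp
      show "summable (\<lambda>n. t\<^sup>2 * Bd u q * (C ^ (n + 2) / fact (n + 2)))"
        by (rule summable_mult) (use exp_summable[of C] summable_iff_shift[of "\<lambda>n. C ^ n / fact n" 2] in simp)
    qed
    also have "\<dots> = t\<^sup>2 * Bd u q * (\<Sum>n. C ^ (n + 2) / fact (n + 2))"
      by (rule suminf_mult) (use exp_summable[of C] summable_iff_shift[of "\<lambda>n. C ^ n / fact n" 2] in simp)
    also have "\<dots> \<le> t\<^sup>2 * Bd u q * exp C"
    proof (rule mult_left_mono)
      have "(\<Sum>n. C ^ n / fact n) = (\<Sum>n. C ^ (n + 2) / fact (n + 2)) + (\<Sum>n<2. C ^ n / fact n)"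
        by (rule suminf_split_initial_segment[OF exp_summable])
      moreover have "(\<Sum>n<2. C ^ n / fact n) \<ge> 0" using C1 by (intro sum_nonneg) auto
      ultimately show "(\<Sum>n. C ^ (n + 2) / fact (n + 2)) \<le> exp C" unfolding exp_suminf by linarith
    qed (use Bd0 in simp)
    finally show ?thesis by (simp add: mult_ac)
  qed
  show "cmod (T t u q - (u q + of_real t * A u q)) \<le> t\<^sup>2 * exp C * Bd u q" by (rule rem)
  have L: "(\<lambda>q. of_real (t\<^sup>2 * exp C) * complex_of_real (Bd u q)) \<in> L2 M" by (intro L2_cmult BdL assms)
  have "nrm M (\<lambda>q. T t u q - (u q + of_real t * A u q)) \<le> nrm M (\<lambda>q. of_real (t\<^sup>2 * exp C) * complex_of_real (Bd u q))"
  proof (rule nrm_mono[OF L])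
    show "(\<lambda>q. T t u q - (u q + of_real t * A u q)) \<in> borel_measurable M"
      by (rule L2_meas) (intro L2_diff L2_add L2_cmult TL AL assms)
    show "AE q in M. cmod (T t u q - (u q + of_real t * A u q)) \<le> cmod (of_real (t\<^sup>2 * exp C) * complex_of_real (Bd u q))"
      using rem Bd0[of u] by (auto simp: norm_mult norm_power)
  qed
  also have "\<dots> \<le> t\<^sup>2 * exp C * ((1 + \<epsilon>) * nrm M u)"
    unfolding nrm_scale using Bd_nrm[OF assms(1)] by (simp add: norm_mult norm_power mult_left_mono)
  also have "\<dots> \<le> D * t\<^sup>2 * nrm M u"
    unfolding D_def using mult_nonneg_nonneg[of "C\<^sup>2 * t\<^sup>2" "nrm M u"] by (simp add: algebra_simps)
  finally show "nrm M (\<lambda>q. T t u q - (u q + of_real t * A u q)) \<le> D * t\<^sup>2 * nrm M u" .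
qed

text \<open>By dissipativity the square of the norm of \<open>u + t * A u\<close> has no term of first order in \<open>t\<close>; composing \<open>n\<close>
  steps of length \<open>t / n\<close> then yields the contraction.\<close>

lemma step_bound: assumes u: "u \<in> L2 M" and "0 \<le> t" "t \<le> 1"
  shows "nrm M (T t u) \<le> (1 + 2 * D * t\<^sup>2) * nrm M u"
proof -
  let ?v = "\<lambda>q. u q + of_real t * A u q"
  have v: "?v \<in> L2 M" by (intro L2_add L2_cmult AL u)
  have i1: "integrable M (\<lambda>q. A u q * cnj (u q))" by (rule L2_mult_integrable[OF AL[OF u] L2_cnj[OF u]])
  have "(nrm M ?v)\<^sup>2 = (LINT q|M. (cmod (u q))\<^sup>2 + 2 * t * Re (A u q * cnj (u q)) + t\<^sup>2 * (cmod (A u q))\<^sup>2)"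
    unfolding nrm_sq
    by (intro Bochner_Integration.integral_cong refl) (simp only: cmod_power2, simp add: power2_eq_square algebra_simps)
  also have "\<dots> = (nrm M u)\<^sup>2 + 2 * t * Re (LINT q|M. A u q * cnj (u q)) + t\<^sup>2 * (nrm M (A u))\<^sup>2"
  proof -
    define R where "R q = Re (A u q * cnj (u q))" for q
    have "integrable M R" "(LINT q|M. R q) = Re (LINT q|M. A u q * cnj (u q))"
      unfolding R_def using i1 by (rule integrable_Re, intro integral_Re i1)
    then show ?thesis unfolding nrm_sq R_def[symmetric] using L2_integrable[OF u] L2_integrable[OF AL[OF u]] by simp
  qed
  also have "\<dots> \<le> (nrm M u)\<^sup>2 + t\<^sup>2 * (C * nrm M u)\<^sup>2"
  proof -
    have "Re (LINT q|M. A u q * cnj (u q)) \<le> 0" using dissip[OF u] by (simp add: A_def)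
    then have "2 * t * Re (LINT q|M. A u q * cnj (u q)) \<le> 0" using assms by (simp add: mult_nonneg_nonpos)
    moreover have "t\<^sup>2 * (nrm M (A u))\<^sup>2 \<le> t\<^sup>2 * (C * nrm M u)\<^sup>2" by (intro mult_left_mono power_mono A_nrm u) auto
    ultimately show ?thesis by linarith
  qed
  also have "\<dots> = (1 + C\<^sup>2 * t\<^sup>2) * (nrm M u)\<^sup>2" by (simp add: power_mult_distrib algebra_simps)
  also have "\<dots> \<le> (1 + D * t\<^sup>2)\<^sup>2 * (nrm M u)\<^sup>2"
  proof (rule mult_right_mono)
    have "C\<^sup>2 \<le> D" using \<epsilon>0 by (simp add: D_def)
    then have a: "C\<^sup>2 * t\<^sup>2 \<le> D * t\<^sup>2" by (rule mult_right_mono) simp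
    have b: "0 \<le> D * t\<^sup>2" using D0 by simp
    have "(1 + D * t\<^sup>2)\<^sup>2 = 1 + 2 * (D * t\<^sup>2) + (D * t\<^sup>2)\<^sup>2" by (simp add: power2_sum)
    then show "1 + C\<^sup>2 * t\<^sup>2 \<le> (1 + D * t\<^sup>2)\<^sup>2" using a b zero_le_power2[of "D * t\<^sup>2"] by linarith
  qed simp
  also have "\<dots> = ((1 + D * t\<^sup>2) * nrm M u)\<^sup>2" by (simp add: power_mult_distrib)
  finally have nv: "nrm M ?v \<le> (1 + D * t\<^sup>2) * nrm M u"
    by (rule power2_le_imp_le) (use D0 in simp)
  have "nrm M (T t u) \<le> nrm M ?v + nrm M (\<lambda>q. T t u q - ?v q)" by (rule nrm_le_diff[OF TL[OF u assms(2)] v])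
  also have "\<dots> \<le> (1 + D * t\<^sup>2) * nrm M u + D * t\<^sup>2 * nrm M u"
    by (intro add_mono nv T_remainder(2) assms)
  finally show ?thesis by (simp add: algebra_simps)
qed

lemma T_contraction: assumes u: "u \<in> L2 M" and t: "t \<ge> 0" shows "nrm M (T t u) \<le> nrm M u"
proof -
  have it: "nrm M (T (real k * h) u) \<le> (1 + 2 * D * h\<^sup>2) ^ k * nrm M u" if h: "0 \<le> h" "h \<le> 1" for k h
  proof (induction k)
    case 0 then show ?case by (simp add: T_0)
  next
    case (Suc k)
    have "T (real (Suc k) * h) u = T h (T (real k * h) u)"
      using T_semigroup[OF u, of h "real k * h"] h by (simp add: algebra_simps)
    then have "nrm M (T (real (Suc k) * h) u) \<le> (1 + 2 * D * h\<^sup>2) * nrm M (T (real k * h) u)"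
      using step_bound[OF TL[OF u] h] h by simp
    also have "\<dots> \<le> (1 + 2 * D * h\<^sup>2) * ((1 + 2 * D * h\<^sup>2) ^ k * nrm M u)"
      using Suc D0 by (intro mult_left_mono) auto
    finally show ?case by (simp add: mult.assoc)
  qed
  \<comment> \<open>There are \<open>n\<close> errors of second order in \<open>t / n\<close>;
    together they are of order \<open>1 / n\<close> and disappear in the limit. The condition
    \<open>n \<ge> t\<close> keeps the step length at most 1.\<close>
  have bd: "nrm M (T t u) \<le> exp (2 * D * t\<^sup>2 / real n) * nrm M u" if n: "n \<ge> 1" "real n \<ge> t" for n
  proof -
    define h where "h = t / real n"
    have h: "0 \<le> h" "h \<le> 1" "real n * h = t" using n t by (auto simp: h_def)
    have "nrm M (T t u) \<le> (1 + 2 * D * h\<^sup>2) ^ n * nrm M u" using it[OF h(1,2), of n] h(3) by simp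
    also have "(1 + 2 * D * h\<^sup>2) ^ n \<le> exp (2 * D * h\<^sup>2) ^ n" using D0 by (intro power_mono exp_ge_add_one_self) auto
    also have "\<dots> = exp (2 * D * t\<^sup>2 / real n)"
      using n by (simp add: exp_of_nat_mult[symmetric] h_def power_divide power2_eq_square)
    finally show ?thesis by (simp add: mult_right_mono)
  qed
  have "(\<lambda>n. exp (2 * D * t\<^sup>2 / real n) * nrm M u) \<longlonglongrightarrow> exp 0 * nrm M u"
    by (intro tendsto_intros lim_const_over_n)
  moreover obtain N :: nat where "real N \<ge> t" using real_arch_simple by blast
  then have "\<forall>n\<ge>max 1 N. nrm M (T t u) \<le> exp (2 * D * t\<^sup>2 / real n) * nrm M u" using bd by force
  then have "\<exists>k. \<forall>n\<ge>k. nrm M (T t u) \<le> exp (2 * D * t\<^sup>2 / real n) * nrm M u" by blast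
  ultimately have "nrm M (T t u) \<le> exp 0 * nrm M u" by (rule LIMSEQ_le_const)
  then show ?thesis by simp
qed

lemma T_diff: assumes "u \<in> L2 M" "v \<in> L2 M" "t \<ge> 0"
  shows "T t (\<lambda>q. u q - v q) = (\<lambda>q. T t u q - T t v q)"
  using T_lin[OF assms, of 1 "-1"] by simp

text \<open>Telescoping over \<open>n\<close> steps of length \<open>t / n\<close>: by contraction
  each increment is at most the first, which is \<open>t / n * nrm M (A u)\<close> up to second
  order. The bound contains neither \<open>C\<close> nor \<open>D\<close>, which grow with the
  frequency, and can therefore serve as a majorant over all frequencies.\<close>

lemma T_increment: assumes u: "u \<in> L2 M" and t: "t \<ge> 0"
  shows "nrm M (\<lambda>q. T t u q - u q) \<le> t * nrm M (A u)"
proof -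
  have it: "nrm M (\<lambda>q. T (real k * h) u q - u q) \<le> real k * nrm M (\<lambda>q. T h u q - u q)" if h: "0 \<le> h" for k h
  proof (induction k)
    case 0 then show ?case by (simp add: T_0)
  next
    case (Suc k)
    have L: "T (real k * h) u \<in> L2 M" "T h u \<in> L2 M" using h by (auto intro!: TL u)
    have eq: "T (real (Suc k) * h) u = T h (T (real k * h) u)"
      using T_semigroup[OF u, of h "real k * h"] h by (simp add: algebra_simps)
    have "nrm M (\<lambda>q. T (real (Suc k) * h) u q - u q) \<le> nrm M (\<lambda>q. T h (T (real k * h) u) q - T h u q) + nrm M (\<lambda>q. T h u q - u q)"
      unfolding eq by (rule nrm_triangle3) (auto intro!: TL u L h)
    also have "nrm M (\<lambda>q. T h (T (real k * h) u) q - T h u q) \<le> nrm M (\<lambda>q. T (real k * h) u q - u q)"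
      unfolding T_diff[OF L(1) u h, symmetric] by (rule T_contraction[OF L2_diff[OF L(1) u] h])
    finally show ?case using Suc by (simp add: algebra_simps)
  qed
  have bd: "nrm M (\<lambda>q. T t u q - u q) \<le> t * nrm M (A u) + D * t\<^sup>2 * nrm M u / real n" if n: "n \<ge> 1" "real n \<ge> t" for n
  proof -
    define h where "h = t / real n"
    have h: "0 \<le> h" "h \<le> 1" "real n * h = t" using n t by (auto simp: h_def)
    have "nrm M (\<lambda>q. T h u q - u q) \<le> nrm M (\<lambda>q. T h u q - (u q + of_real h * A u q)) + nrm M (\<lambda>q. of_real h * A u q)"
    proof -
      have "nrm M (\<lambda>q. (T h u q - (u q + of_real h * A u q)) + of_real h * A u q) \<le> nrm M (\<lambda>q. T h u q - (u q + of_real h * A u q)) + nrm M (\<lambda>q. of_real h * A u q)"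
        by (rule nrm_triangle) (intro L2_diff L2_add L2_cmult TL AL u h)+
      then show ?thesis by (simp add: algebra_simps)
    qed
    also have "\<dots> \<le> D * h\<^sup>2 * nrm M u + h * nrm M (A u)"
      using T_remainder(2)[OF u h(1,2)] h by (simp add: nrm_scale)
    finally have "real n * nrm M (\<lambda>q. T h u q - u q) \<le> real n * (D * h\<^sup>2 * nrm M u + h * nrm M (A u))"
      by (rule mult_left_mono) simp
    also have "\<dots> = t * nrm M (A u) + D * t\<^sup>2 * nrm M u / real n"
      using n by (simp add: h_def field_simps power2_eq_square)
    finally show ?thesis using it[OF h(1), of n] h(3) by simp
  qed
  have "(\<lambda>n. t * nrm M (A u) + D * t\<^sup>2 * nrm M u / real n) \<longlonglongrightarrow> t * nrm M (A u) + 0"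
    by (intro tendsto_intros lim_const_over_n)
  moreover obtain N :: nat where "real N \<ge> t" using real_arch_simple by blast
  then have "\<forall>n\<ge>max 1 N. nrm M (\<lambda>q. T t u q - u q) \<le> t * nrm M (A u) + D * t\<^sup>2 * nrm M u / real n" using bd by force
  then have "\<exists>k. \<forall>n\<ge>k. nrm M (\<lambda>q. T t u q - u q) \<le> t * nrm M (A u) + D * t\<^sup>2 * nrm M u / real n" by blast
  ultimately have "nrm M (\<lambda>q. T t u q - u q) \<le> t * nrm M (A u) + 0" by (rule LIMSEQ_le_const)
  then show ?thesis by simp
qed

text \<open>The constant \<open>D\<close> depends on the frequency, so this yields the limit at each
  fixed frequency only.\<close>

lemma T_quotient: assumes u: "u \<in> L2 M" and t: "0 < t" "t \<le> 1"
  shows "nrm M (\<lambda>q. of_real (1 / t) * (T t u q - u q) - A u q) \<le> D * t * nrm M u"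
proof -
  have "(\<lambda>q. of_real (1 / t) * (T t u q - u q) - A u q) = (\<lambda>q. of_real (1 / t) * (T t u q - (u q + of_real t * A u q)))"
    using t by (auto simp: field_simps)
  then have "nrm M (\<lambda>q. of_real (1 / t) * (T t u q - u q) - A u q) = (1 / t) * nrm M (\<lambda>q. T t u q - (u q + of_real t * A u q))"
    using t by (simp only: nrm_scale) (simp add: norm_divide)
  also have "\<dots> \<le> (1 / t) * (D * t\<^sup>2 * nrm M u)"
    using t by (intro mult_left_mono T_remainder(2) u) auto
  also have "\<dots> = D * t * nrm M u" using t by (simp add: power2_eq_square)
  finally show ?thesis .
qed

end

section \<open>Moments of the equilibrium\<close>

lemma q0_ge_1: "q0 q \<ge> 1" by (simp add: q0_def)
lemma q0_pos: "q0 q > 0" using q0_ge_1[of q] by linarith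
lemma q0_sq: "(q0 q)\<^sup>2 = 1 + (norm q)\<^sup>2" by (simp add: q0_def)
lemma norm_le_q0: "norm q \<le> q0 q" by (simp add: q0_def real_le_rsqrt)
lemma component_le_q0: "\<bar>q $ i\<bar> \<le> q0 q" using component_le_norm_cart[of q i] norm_le_q0[of q] by linarith
lemma q0_measurable [measurable]: "q0 \<in> borel_measurable borel" unfolding q0_def by measurable

text \<open>\<open>q0 q\<close> is the norm of \<open>(q, 1)\<close>, so both bounds come from the
  triangle inequality.\<close>

lemma q0_shift: assumes "norm y \<le> 1" shows "q0 (q + y) \<le> 2 * q0 q" "q0 q - 1 \<le> q0 (q + y)"
proof -
  have q0n: "q0 x = norm (x, 1::real)" for x by (simp add: q0_def norm_Pair add.commute)
  have 1: "q0 (q + y) \<le> q0 q + 1" if "norm y \<le> 1" for q y :: vec3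
    using norm_triangle_ineq[of "(q, 1::real)" "(y, 0)"] that by (simp add: q0n norm_Pair)
  show "q0 (q + y) \<le> 2 * q0 q" using 1[of y q] assms q0_ge_1[of q] by linarith
  show "q0 q - 1 \<le> q0 (q + y)" using 1[of "- y" "q + y"] assms by simp
qed

lemma inverse_1_plus_square_integrable: "integrable lborel (\<lambda>x::real. 1 / (1 + x\<^sup>2))"
  using integrable_inverse_1_plus_square by (simp add: set_integrable_def inverse_eq_divide)

lemma prod_decay_integrable: "integrable lborel (\<lambda>q::vec3. \<Prod>b\<in>Basis. 1 / (1 + (q \<bullet> b)\<^sup>2))"
proof -
  have "integrable lborel (\<lambda>q::vec3. \<Prod>b\<in>Basis. complex_of_real (1 / (1 + (q \<bullet> b)\<^sup>2)))"
    by (rule integrable_lborel_prod) (use inverse_1_plus_square_integrable in \<open>simp only: complex_of_real_integrable_eq\<close>)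
  then show ?thesis by (simp only: of_real_prod[symmetric] complex_of_real_integrable_eq)
qed

text \<open>Each of the three factors \<open>1 + (q \<bullet> b)\<^sup>2\<close> is at most
  \<open>(q0 q)\<^sup>2\<close>, hence the exponent 6.\<close>

lemma q0_decay_integrable: "integrable lborel (\<lambda>q. 1 / (q0 q) ^ 6)"
proof (rule Bochner_Integration.integrable_bound[OF prod_decay_integrable])
  have "1 / (q0 q) ^ 6 \<le> (\<Prod>b\<in>Basis. 1 / (1 + (q \<bullet> b)\<^sup>2))" for q
  proof -
    have "(\<Prod>b\<in>Basis. (1 + (q \<bullet> b)\<^sup>2)) \<le> (\<Prod>b\<in>(Basis::vec3 set). (q0 q)\<^sup>2)"
    proof (intro prod_mono conjI)
      fix b :: vec3 assume b: "b \<in> Basis"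
      have "\<bar>q \<bullet> b\<bar>\<^sup>2 \<le> (norm q)\<^sup>2" by (intro power_mono Basis_le_norm b) auto
      then show "1 + (q \<bullet> b)\<^sup>2 \<le> (q0 q)\<^sup>2" by (simp add: q0_sq)
    qed simp
    also have "\<dots> = (q0 q) ^ 6" by (simp add: power_mult[symmetric])
    finally have "(\<Prod>b\<in>Basis. (1 + (q \<bullet> b)\<^sup>2)) \<le> (q0 q) ^ 6" .
    moreover have "0 < (\<Prod>b\<in>Basis. (1 + (q \<bullet> b)\<^sup>2))" by (intro prod_pos) (simp add: add_pos_nonneg)
    ultimately have "1 / (q0 q) ^ 6 \<le> 1 / (\<Prod>b\<in>Basis. (1 + (q \<bullet> b)\<^sup>2))" by (intro divide_left_mono) (use q0_pos[of q] in auto)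
    then show ?thesis by (simp add: prod_dividef)
  qed
  moreover have "0 \<le> (\<Prod>b\<in>Basis. 1 / (1 + (q \<bullet> b)\<^sup>2))" for q :: vec3 by (intro prod_nonneg) (simp add: add_nonneg_nonneg)
  moreover have "0 \<le> 1 / (q0 q) ^ 6" for q using q0_pos[of q] by simp
  ultimately show "AE q in lborel. norm (1 / (q0 q) ^ 6) \<le> norm (\<Prod>b\<in>Basis. 1 / (1 + (q \<bullet> b)\<^sup>2))"
    by (intro AE_I2) (simp only: real_norm_def abs_of_nonneg)
qed measurable

text \<open>A single term of the exponential series is at most its sum.\<close>

lemma pow_exp_bound: fixes s \<beta> :: real assumes "\<beta> > 0" "s \<ge> 0" shows "s ^ N * exp (- \<beta> * s) \<le> fact N / \<beta> ^ N"
proof -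
  have "(\<beta> * s) ^ N / fact N \<le> exp (\<beta> * s)"
  proof -
    have "(\<Sum>n\<in>{N}. (\<beta> * s) ^ n / fact n) \<le> (\<Sum>n. (\<beta> * s) ^ n / fact n)"
      by (rule sum_le_suminf) (use summable_exp[of "\<beta> * s"] assms in \<open>auto simp: field_simps\<close>)
    then show ?thesis by (simp add: exp_def divide_inverse mult.commute)
  qed
  then show ?thesis using assms by (simp add: exp_minus field_simps power_mult_distrib)
qed

lemma q0_exp_integrable: assumes "\<beta> > 0" shows "integrable lborel (\<lambda>q. q0 q ^ k * exp (- \<beta> * q0 q))"
proof (rule Bochner_Integration.integrable_bound)
  show "integrable lborel (\<lambda>q. fact (k + 6) / \<beta> ^ (k + 6) * (1 / (q0 q) ^ 6))"
    by (intro integrable_mult_right q0_decay_integrable)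
  have "q0 q ^ k * exp (- \<beta> * q0 q) \<le> fact (k + 6) / \<beta> ^ (k + 6) * (1 / (q0 q) ^ 6)" for q
  proof -
    have "q0 q ^ k * exp (- \<beta> * q0 q) = (q0 q ^ (k + 6) * exp (- \<beta> * q0 q)) * (1 / (q0 q) ^ 6)"
      using q0_pos[of q] by (simp add: power_add)
    also have "\<dots> \<le> fact (k + 6) / \<beta> ^ (k + 6) * (1 / (q0 q) ^ 6)"
      using q0_pos[of q] by (intro mult_right_mono pow_exp_bound assms) auto
    finally show ?thesis .
  qed
  moreover have "0 \<le> q0 q ^ k * exp (- \<beta> * q0 q)" for q using q0_pos[of q] by simp
  ultimately show "AE q in lborel. norm (q0 q ^ k * exp (- \<beta> * q0 q)) \<le> norm (fact (k + 6) / \<beta> ^ (k + 6) * (1 / (q0 q) ^ 6))"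
    by (intro AE_I2) (smt (verit) real_norm_def)
qed measurable

lemma q0_exp_dominated:
  fixes f :: "vec3 \<Rightarrow> real"
  assumes "\<beta> > 0" and [measurable]: "f \<in> borel_measurable borel" and b: "\<And>q. \<bar>f q\<bar> \<le> K * (q0 q ^ k * exp (- \<beta> * q0 q))"
  shows "integrable lborel f"
proof (rule Bochner_Integration.integrable_bound[OF integrable_mult_right[OF q0_exp_integrable[OF assms(1)], of K k]])
  show "AE q in lborel. norm (f q) \<le> norm (K * (q0 q ^ k * exp (- \<beta> * q0 q)))"
    using b by (intro AE_I2) (metis abs_ge_self order_trans real_norm_def)
qed measurable

text \<open>Integration by parts in the form needed here. The difference quotients of
  \<open>G\<close> have integral zero by translation invariance, the mean value inequality dominates
  them by \<open>B\<close>, and they converge to \<open>G'\<close>.\<close>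

lemma integral_directional_derivative:
  fixes G :: "vec3 \<Rightarrow> 'b::euclidean_space"
  assumes G: "integrable lborel G" and B: "integrable lborel B"
    and d: "\<And>x. ((\<lambda>t. G (x + t *\<^sub>R v)) has_vector_derivative G' x) (at 0)"
    and b: "\<And>x t. \<bar>t\<bar> \<le> 1 \<Longrightarrow> norm (G' (x + t *\<^sub>R v)) \<le> B x"
  shows "integrable lborel G'" "(LINT x|lborel. G' x) = 0"
proof -
  have [measurable]: "G \<in> borel_measurable borel" using borel_measurable_integrable[OF G] by simp
  have ds: "((\<lambda>t. G (x + t *\<^sub>R v)) has_vector_derivative G' (x + s *\<^sub>R v)) (at s)" for x s
  proof -
    have "((\<lambda>t. G ((x + s *\<^sub>R v) + t *\<^sub>R v)) \<circ> (\<lambda>t. t - s) has_vector_derivative 1 *\<^sub>R G' (x + s *\<^sub>R v)) (at s)"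
      by (rule vector_diff_chain_at) (auto intro!: derivative_eq_intros simp: d)
    then show ?thesis by (simp add: o_def algebra_simps)
  qed
  define Q where "Q n x = real (Suc n) *\<^sub>R (G (x + (1 / real (Suc n)) *\<^sub>R v) - G x)" for n x
  have [measurable]: "Q n \<in> borel_measurable borel" for n unfolding Q_def by measurable
  have lim: "(\<lambda>n. Q n x) \<longlonglongrightarrow> G' x" for x
  proof -
    let ?h = "\<lambda>n. 1 / real (Suc n)"
    have "((\<lambda>h. norm (G (x + (0 + h) *\<^sub>R v) - G (x + 0 *\<^sub>R v) - h *\<^sub>R G' x) / norm h) \<longlongrightarrow> 0) (at 0)"
      using d[of x] unfolding has_vector_derivative_def has_derivative_at by blast
    moreover have "filterlim ?h (at 0) sequentially"
      by (intro filterlim_atI) (use LIMSEQ_Suc[OF lim_1_over_n] in auto)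
    ultimately have "(\<lambda>n. norm (G (x + (0 + ?h n) *\<^sub>R v) - G (x + 0 *\<^sub>R v) - ?h n *\<^sub>R G' x) / norm (?h n)) \<longlonglongrightarrow> 0"
      by (rule filterlim_compose)
    moreover have "norm (G (x + (0 + ?h n) *\<^sub>R v) - G (x + 0 *\<^sub>R v) - ?h n *\<^sub>R G' x) / norm (?h n) = norm (Q n x - G' x)" for n
    proof -
      have "Q n x - G' x = real (Suc n) *\<^sub>R (G (x + (0 + ?h n) *\<^sub>R v) - G (x + 0 *\<^sub>R v) - ?h n *\<^sub>R G' x)"
        by (simp add: Q_def scaleR_diff_right)
      then show ?thesis by (simp only: norm_scaleR) (simp add: field_simps)
    qed
    ultimately have "(\<lambda>n. norm (Q n x - G' x)) \<longlonglongrightarrow> 0" by simp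
    from LIM_zero_cancel[OF tendsto_norm_zero_cancel[OF this]] show ?thesis .
  qed
  have Qb: "norm (Q n x) \<le> B x" for n x
  proof -
    let ?h = "1 / real (Suc n)"
    have "\<exists>s\<in>{0<..<?h}. norm (G (x + ?h *\<^sub>R v) - G (x + 0 *\<^sub>R v)) \<le> norm ((?h - 0) *\<^sub>R G' (x + s *\<^sub>R v))"
    proof (rule mvt_general[where f="\<lambda>t. G (x + t *\<^sub>R v)" and f'="\<lambda>s h. h *\<^sub>R G' (x + s *\<^sub>R v)"])
      show "continuous_on {0..?h} (\<lambda>t. G (x + t *\<^sub>R v))"
        using ds has_vector_derivative_continuous by (intro continuous_at_imp_continuous_on) blast
    qed (use ds in \<open>auto simp: has_vector_derivative_def\<close>)
    then obtain s where s: "0 < s" "s < ?h" "norm (G (x + ?h *\<^sub>R v) - G x) \<le> ?h * norm (G' (x + s *\<^sub>R v))" by auto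
    have "?h \<le> 1" by simp
    then have "\<bar>s\<bar> \<le> 1" using s(1,2) by linarith
    then have "norm (G' (x + s *\<^sub>R v)) \<le> B x" by (rule b)
    then have "norm (G (x + ?h *\<^sub>R v) - G x) \<le> ?h * B x" using s(3) mult_left_mono[of _ "B x" ?h] by fastforce
    then have "real (Suc n) * norm (G (x + ?h *\<^sub>R v) - G x) \<le> real (Suc n) * (?h * B x)" by (rule mult_left_mono) simp
    then show ?thesis by (simp add: Q_def)
  qed
  have Q0: "(LINT x|lborel. Q n x) = 0" for n
    unfolding Q_def using G lborel_translate[of G "(1 / real (Suc n)) *\<^sub>R v"] by simp
  have m: "G' \<in> borel_measurable lborel" by (rule borel_measurable_LIMSEQ_metric[OF _ lim]) simp
  have "norm (G' x) \<le> B x" for x using b[of 0 x] by simp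
  then show "integrable lborel G'" by (intro Bochner_Integration.integrable_bound[OF B m]) (auto intro: order_trans[OF _ abs_ge_self])
  have "(\<lambda>n. LINT x|lborel. Q n x) \<longlonglongrightarrow> (LINT x|lborel. G' x)"
    by (rule integral_dominated_convergence[OF m _ B]) (use lim Qb in auto)
  then show "(LINT x|lborel. G' x) = 0" unfolding Q0 using LIMSEQ_unique[OF _ tendsto_const] by metis
qed


section \<open>Radial integrals and their relation to the Bessel functions\<close>

lemma cosh_arsinh_norm: "cosh (arsinh (norm q)) = q0 q"
proof -
  have "(cosh (arsinh (norm q)))\<^sup>2 = (q0 q)\<^sup>2" by (simp add: cosh_square_eq sinh_arsinh_real q0_sq)
  then show ?thesis using q0_pos[of q] by (simp add: power2_eq_iff) (smt (verit) cosh_real_pos)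
qed

text \<open>The push-forward of Lebesgue measure under \<open>- arsinh (norm q)\<close> rather than \<open>arsinh (norm q)\<close>, so that
  upper rays have finite measure.\<close>

lemma radial_pushforward:
  defines "c \<equiv> 3 * unit_ball_vol 3"
  shows "distr lborel borel (\<lambda>q::vec3. - arsinh (norm q)) = density lborel (\<lambda>t. ennreal (indicator {..0} t * (c * ((sinh t)\<^sup>2 * cosh t))))"
proof (rule measure_eqI_lessThan)
  have [measurable]: "(arsinh :: real \<Rightarrow> real) \<in> borel_measurable borel" unfolding arsinh_real_def[abs_def] by measurable
  have [measurable]: "(sinh :: real \<Rightarrow> real) \<in> borel_measurable borel" "(cosh :: real \<Rightarrow> real) \<in> borel_measurable borel"
    by (intro borel_measurable_continuous_onI continuous_intros)+
  have c0: "c > 0" by (simp add: c_def)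
  have eq: "emeasure (distr lborel borel (\<lambda>q::vec3. - arsinh (norm q))) {x<..} = ennreal (if x < 0 then unit_ball_vol 3 * sinh (- x) ^ 3 else 0)" for x
  proof -
    have "emeasure (distr lborel borel (\<lambda>q::vec3. - arsinh (norm q))) {x<..} = emeasure lborel ((\<lambda>q::vec3. - arsinh (norm q)) -` {x<..})"
      by (subst emeasure_distr) auto
    also have "(\<lambda>q::vec3. - arsinh (norm q)) -` {x<..} = ball 0 (sinh (- x))"
    proof (intro set_eqI)
      fix q :: vec3
      have "x < - arsinh (norm q) \<longleftrightarrow> arsinh (norm q) < - x" by auto
      also have "\<dots> \<longleftrightarrow> sinh (arsinh (norm q)) < sinh (- x)" by (rule strict_mono_less[OF sinh_real_strict_mono, symmetric])
      finally show "q \<in> (\<lambda>q::vec3. - arsinh (norm q)) -` {x<..} \<longleftrightarrow> q \<in> ball 0 (sinh (- x))" by simp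
    qed
    also have "emeasure lborel (ball (0::vec3) (sinh (- x))) = ennreal (if x < 0 then unit_ball_vol 3 * sinh (- x) ^ 3 else 0)"
    proof (cases "x < 0")
      case True
      then show ?thesis by (subst emeasure_ball) auto
    next
      case False
      then have "sinh (- x) \<le> 0" by simp
      then have "ball (0::vec3) (sinh (- x)) = {}" by (simp only: ball_eq_empty)
      then show ?thesis using False by (simp only: emeasure_empty if_False ennreal_0)
    qed
    finally show ?thesis .
  qed
  show "emeasure (distr lborel borel (\<lambda>q::vec3. - arsinh (norm q))) {x<..} < \<infinity>" for x unfolding eq by simp
  show "emeasure (distr lborel borel (\<lambda>q::vec3. - arsinh (norm q))) {x<..} = emeasure (density lborel (\<lambda>t. ennreal (indicator {..0} t * (c * ((sinh t)\<^sup>2 * cosh t))))) {x<..}" for x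
  proof -
    have "emeasure (density lborel (\<lambda>t. ennreal (indicator {..0} t * (c * ((sinh t)\<^sup>2 * cosh t))))) {x<..}
       = (\<integral>\<^sup>+t. ennreal (indicator {..0} t * (c * ((sinh t)\<^sup>2 * cosh t))) * indicator {x<..} t \<partial>lborel)"
      by (subst emeasure_density) auto
    also have "\<dots> = ennreal (if x < 0 then unit_ball_vol 3 * sinh (- x) ^ 3 else 0)"
    proof (cases "x < 0")
      case True
      have "(\<integral>\<^sup>+t. ennreal (indicator {..0} t * (c * ((sinh t)\<^sup>2 * cosh t))) * indicator {x<..} t \<partial>lborel)
         = (\<integral>\<^sup>+t. ennreal (c * ((sinh t)\<^sup>2 * cosh t)) * indicator {x..0} t \<partial>lborel)"
        by (rule nn_integral_cong_AE, rule AE_mp[OF AE_lborel_singleton[of x]]) (auto simp: indicator_def)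
      \<comment> \<open>The antiderivative \<open>unit_ball_vol 3 * sinh t ^ 3\<close> is a signed
        ball volume; differentiating it produces the factor 3 in \<open>c\<close>.\<close>
      also have "\<dots> = ennreal (unit_ball_vol 3 * sinh 0 ^ 3 - unit_ball_vol 3 * sinh x ^ 3)"
        by (rule nn_integral_FTC_Icc[where F="\<lambda>t. unit_ball_vol 3 * sinh t ^ 3"])
           (use True c0 in \<open>auto intro!: derivative_eq_intros simp: c_def\<close>)
      finally show ?thesis using True by (simp add: power3_eq_cube)
    next
      case False
      have "(\<integral>\<^sup>+t. ennreal (indicator {..0} t * (c * ((sinh t)\<^sup>2 * cosh t))) * indicator {x<..} t \<partial>lborel) = (\<integral>\<^sup>+(t::real). 0 \<partial>lborel)"
        by (rule nn_integral_cong) (use False in \<open>auto simp: indicator_def\<close>)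
      then show ?thesis using False by simp
    qed
    finally show ?thesis unfolding eq ..
  qed
qed auto

text \<open>Polar coordinates with \<open>norm q = sinh t\<close>, in which
  \<open>q0 q = cosh t\<close>.\<close>

lemma radial_integral:
  fixes \<phi> :: "real \<Rightarrow> real"
  assumes [measurable]: "\<phi> \<in> borel_measurable borel"
  shows "(LINT q|lborel. \<phi> (q0 q)) = 3 * unit_ball_vol 3 * (LINT t:{0..}|lborel. (sinh t)\<^sup>2 * cosh t * \<phi> (cosh t))"
proof -
  have [measurable]: "(arsinh :: real \<Rightarrow> real) \<in> borel_measurable borel" unfolding arsinh_real_def[abs_def] by measurable
  have [measurable]: "(sinh :: real \<Rightarrow> real) \<in> borel_measurable borel" "(cosh :: real \<Rightarrow> real) \<in> borel_measurable borel"
    by (intro borel_measurable_continuous_onI continuous_intros)+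
  define c where "c = 3 * unit_ball_vol 3"
  have "(LINT q|lborel. \<phi> (q0 q)) = (LINT q|lborel. \<phi> (cosh (- arsinh (norm (q::vec3)))))"
    by (simp add: cosh_arsinh_norm)
  also have "\<dots> = (LINT t|distr lborel borel (\<lambda>q::vec3. - arsinh (norm q)). \<phi> (cosh t))"
    by (rule integral_distr[symmetric]) measurable
  also have "\<dots> = (LINT t|lborel. (indicator {..0} t * (c * ((sinh t)\<^sup>2 * cosh t))) *\<^sub>R \<phi> (cosh t))"
    unfolding radial_pushforward c_def[symmetric]
    by (rule integral_density) (auto simp: c_def)
  also have "\<dots> = (LINT t|lborel. (indicator {..0} (- t) * (c * ((sinh t)\<^sup>2 * cosh t))) *\<^sub>R \<phi> (cosh t))"
    by (subst lborel_integral_real_affine[where c="-1" and t=0]) auto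
  also have "\<dots> = (LINT t|lborel. c * (indicator {0..} t * ((sinh t)\<^sup>2 * cosh t * \<phi> (cosh t))))"
    by (intro Bochner_Integration.integral_cong) (auto simp: indicator_def)
  also have "\<dots> = c * (LINT t:{0..}|lborel. (sinh t)\<^sup>2 * cosh t * \<phi> (cosh t))"
    by (simp add: set_lebesgue_integral_def)
  finally show ?thesis by (simp add: c_def)
qed

text \<open>Allows functions of \<open>cosh t\<close> to be dominated by the integrable function
  \<open>1 / (1 + t\<^sup>2)\<close>.\<close>

lemma cosh_ge_quadratic: "cosh (t::real) ^ 2 \<ge> 1 + t\<^sup>2"
proof -
  have "\<bar>t\<bar> \<le> sinh \<bar>t\<bar>"
  proof -
    have "sinh 0 - 0 \<le> sinh \<bar>t\<bar> - \<bar>t\<bar>"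
      by (rule DERIV_nonneg_imp_nondecreasing[where f="\<lambda>x. sinh x - x"])
         (auto intro!: derivative_eq_intros exI simp: cosh_real_ge_1)
    then show ?thesis by simp
  qed
  then have "\<bar>t\<bar>\<^sup>2 \<le> (sinh \<bar>t\<bar>)\<^sup>2" by (intro power_mono) auto
  then show ?thesis by (simp add: cosh_square_eq)
qed

text \<open>The fundamental theorem on \<open>{0..y}\<close> leaves the boundary term
  \<open>G y\<close>, which tends to 0 by its exponential bound.\<close>

lemma half_line_integral_derivative:
  fixes G g :: "real \<Rightarrow> real"
  assumes b: "\<beta> > 0" and d: "\<And>t. (G has_real_derivative g t) (at t)" and c: "continuous_on UNIV g"
    and gb: "\<And>t. t \<ge> 0 \<Longrightarrow> \<bar>g t\<bar> \<le> K * (cosh t ^ k * exp (- \<beta> * cosh t))"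
    and Gb: "\<And>t. t \<ge> 0 \<Longrightarrow> \<bar>G t\<bar> \<le> K * (cosh t ^ k * exp (- \<beta> * cosh t))" and G0: "G 0 = 0" and K: "K \<ge> 0"
  shows "set_integrable lborel {0..} g" "(LINT t:{0..}|lborel. g t) = 0"
proof -
  have [measurable]: "g \<in> borel_measurable borel" by (rule borel_measurable_continuous_onI[OF c])
  \<comment> \<open>Two additional powers of \<open>cosh t\<close> are paid for in this constant and
    spent on the decay \<open>1 / (1 + t\<^sup>2)\<close>.\<close>
  define N where "N = K * (fact (k + 2) / \<beta> ^ (k + 2))"
  have N0: "N \<ge> 0" using K b by (simp add: N_def)
  have cb: "K * (cosh t ^ k * exp (- \<beta> * cosh t)) \<le> N * (1 / (1 + t\<^sup>2))" for t
  proof -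
    have "cosh t ^ k * exp (- \<beta> * cosh t) = (cosh t ^ (k + 2) * exp (- \<beta> * cosh t)) * (1 / cosh t ^ 2)"
      by (simp add: power_add power2_eq_square)
    also have "\<dots> \<le> (fact (k + 2) / \<beta> ^ (k + 2)) * (1 / (1 + t\<^sup>2))"
      by (intro mult_mono pow_exp_bound b divide_left_mono cosh_ge_quadratic mult_pos_pos) (use b in \<open>auto simp: add_pos_nonneg\<close>)
    finally show ?thesis unfolding N_def mult.assoc by (rule mult_left_mono[OF _ K])
  qed
  show i: "set_integrable lborel {0..} g" unfolding set_integrable_def
  proof (rule Bochner_Integration.integrable_bound)
    show "integrable lborel (\<lambda>t. N * (1 / (1 + t\<^sup>2)))" by (intro integrable_mult_right inverse_1_plus_square_integrable)
    have "norm (indicator {0..} t *\<^sub>R g t) \<le> norm (N * (1 / (1 + t\<^sup>2)))" for t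
      using order_trans[OF gb cb, of t] N0 by (auto simp: indicator_def add_nonneg_nonneg)
    then show "AE t in lborel. norm (indicator {0..} t *\<^sub>R g t) \<le> norm (N * (1 / (1 + t\<^sup>2)))" by simp
  qed measurable
  have "((\<lambda>y. LINT t|lborel. indicator {..y} t *\<^sub>R (indicator {0..} t *\<^sub>R g t)) \<longlongrightarrow> (LINT t|lborel. indicator {0..} t *\<^sub>R g t)) at_top"
    by (rule tendsto_integral_at_top) (use i in \<open>auto simp: set_integrable_def\<close>)
  moreover have "((\<lambda>y. LINT t|lborel. indicator {..y} t *\<^sub>R (indicator {0..} t *\<^sub>R g t)) \<longlongrightarrow> 0) at_top"
  proof (rule Lim_null_comparison)
    show "((\<lambda>y. N * (1 / (1 + y\<^sup>2))) \<longlongrightarrow> 0) at_top" by real_asymp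
    show "\<forall>\<^sub>F y in at_top. norm (LINT t|lborel. indicator {..y} t *\<^sub>R (indicator {0..} t *\<^sub>R g t)) \<le> N * (1 / (1 + y\<^sup>2))"
      using eventually_ge_at_top[of 0]
    proof eventually_elim
      case (elim y)
      have "(LINT t|lborel. indicator {..y} t *\<^sub>R (indicator {0..} t *\<^sub>R g t)) = (LINT t|lborel. g t * indicator {0..y} t)"
        by (intro Bochner_Integration.integral_cong) (auto simp: indicator_def)
      also have "\<dots> = G y - G 0"
        by (rule integral_FTC_Icc_real[OF elim d]) (use c in \<open>auto simp: continuous_on_eq_continuous_at\<close>)
      finally show ?case using order_trans[OF Gb cb, of y] elim G0 by simp
    qed
  qed
  ultimately show "(LINT t:{0..}|lborel. g t) = 0"
    unfolding set_lebesgue_integral_def by (intro tendsto_unique[OF trivial_limit_at_top_linorder])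
qed

text \<open>The derivatives of \<open>sinh t * exp (- \<beta> * cosh t)\<close> and of
  \<open>sinh t * cosh t * exp (- \<beta> * cosh t)\<close> integrate to zero. This converts the
  definition of the Bessel functions into the form with \<open>sinh\<close> squared that polar
  coordinates produce.\<close>

lemma K1_eq: assumes b: "\<beta> > 0"
  shows "Kfun 1 \<beta> = \<beta> * (LINT t:{0..}|lborel. (sinh t)\<^sup>2 * exp (- \<beta> * cosh t))"
    and "Kfun 2 \<beta> = \<beta> * (LINT t:{0..}|lborel. (sinh t)\<^sup>2 * cosh t * exp (- \<beta> * cosh t))"
proof -
  have [measurable]: "(sinh :: real \<Rightarrow> real) \<in> borel_measurable borel" "(cosh :: real \<Rightarrow> real) \<in> borel_measurable borel"
    by (intro borel_measurable_continuous_onI continuous_intros)+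
  have sb: "0 \<le> sinh t \<and> sinh t \<le> cosh t \<and> 1 \<le> cosh t" if "t \<ge> 0" for t :: real
    using that sinh_le_cosh_real[of t] cosh_real_ge_1[of t] by simp
  have si: "set_integrable lborel {0..} (\<lambda>t. cosh t ^ j * exp (- \<beta> * cosh t))" for j
  proof -
    have [measurable]: "(\<lambda>t::real. cosh t ^ j * exp (- \<beta> * cosh t)) \<in> borel_measurable borel" by measurable
    show ?thesis unfolding set_integrable_def
    proof (rule Bochner_Integration.integrable_bound)
      show "integrable lborel (\<lambda>t. (fact (j + 2) / \<beta> ^ (j + 2)) * (1 / (1 + t\<^sup>2)))" by (intro integrable_mult_right inverse_1_plus_square_integrable)
      have "cosh t ^ j * exp (- \<beta> * cosh t) \<le> (fact (j + 2) / \<beta> ^ (j + 2)) * (1 / (1 + t\<^sup>2))" for t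
      proof -
        have "cosh t ^ j * exp (- \<beta> * cosh t) = (cosh t ^ (j + 2) * exp (- \<beta> * cosh t)) * (1 / cosh t ^ 2)"
          by (simp add: power_add power2_eq_square)
        also have "\<dots> \<le> (fact (j + 2) / \<beta> ^ (j + 2)) * (1 / (1 + t\<^sup>2))"
          by (intro mult_mono pow_exp_bound b divide_left_mono cosh_ge_quadratic mult_pos_pos) (use b in \<open>auto simp: add_pos_nonneg\<close>)
        finally show ?thesis .
      qed
      then show "AE t in lborel. norm (indicator {0..} t *\<^sub>R (cosh t ^ j * exp (- \<beta> * cosh t))) \<le> norm ((fact (j + 2) / \<beta> ^ (j + 2)) * (1 / (1 + t\<^sup>2)))"
        using b by (intro AE_I2) (auto simp: indicator_def add_nonneg_nonneg)
    qed measurable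
  qed
  have s2: "(sinh t)\<^sup>2 = cosh t ^ 2 - 1" for t :: real by (rule sinh_square_eq)
  have si1: "set_integrable lborel {0..} (\<lambda>t. (sinh t)\<^sup>2 * exp (- \<beta> * cosh t))"
    using set_integral_diff(1)[OF si[of 2] si[of 0]] by (simp add: s2 algebra_simps)
  have si2: "set_integrable lborel {0..} (\<lambda>t. (sinh t)\<^sup>2 * cosh t * exp (- \<beta> * cosh t))"
  proof -
    have "(\<lambda>t. cosh t ^ 3 * exp (- \<beta> * cosh t) - cosh t ^ 1 * exp (- \<beta> * cosh t)) = (\<lambda>t. (sinh t)\<^sup>2 * cosh t * exp (- \<beta> * cosh t))"
      unfolding s2 by (simp add: algebra_simps power3_eq_cube power2_eq_square)
    then show ?thesis using set_integral_diff(1)[OF si[of 3] si[of 1]] by (simp only:)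
  qed
  have si3: "set_integrable lborel {0..} (\<lambda>t. cosh (2 * t) * exp (- \<beta> * cosh t))"
  proof -
    have "(\<lambda>t. 2 * (cosh t ^ 2 * exp (- \<beta> * cosh t)) - cosh t ^ 0 * exp (- \<beta> * cosh t)) = (\<lambda>t. cosh (2 * t) * exp (- \<beta> * cosh t))"
      unfolding cosh_double_cosh by (simp add: algebra_simps)
    then show ?thesis using set_integral_diff(1)[OF set_integrable_mult_right[OF si[of 2], of 2] si[of 0]] by (simp only:)
  qed
  have ab: "\<bar>x - \<beta> * y\<bar> * exp z = \<bar>x * exp z - \<beta> * (y * exp z)\<bar>" for x y z :: real
  proof -
    have "x * exp z - \<beta> * (y * exp z) = (x - \<beta> * y) * exp z" by (simp add: left_diff_distrib)
    then show ?thesis by (simp only: abs_mult abs_exp_cancel)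
  qed
  have "(LINT t:{0..}|lborel. cosh t * exp (- \<beta> * cosh t) - \<beta> * ((sinh t)\<^sup>2 * exp (- \<beta> * cosh t))) = 0"
  proof (rule half_line_integral_derivative(2)[OF b, where G="\<lambda>t. sinh t * exp (- \<beta> * cosh t)" and K="1 + \<beta>" and k=2])
    fix t :: real
    show "((\<lambda>t. sinh t * exp (- \<beta> * cosh t)) has_real_derivative cosh t * exp (- \<beta> * cosh t) - \<beta> * ((sinh t)\<^sup>2 * exp (- \<beta> * cosh t))) (at t)"
      by (auto intro!: derivative_eq_intros simp: algebra_simps power2_eq_square)
    assume t: "t \<ge> 0"
    have s: "(sinh t)\<^sup>2 \<le> cosh t ^ 2" using sb[OF t] by (intro power_mono) auto
    have c: "cosh t \<le> cosh t ^ 2" using sb[OF t] by (simp add: power2_eq_square)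
    have "\<bar>cosh t * exp (- \<beta> * cosh t) - \<beta> * ((sinh t)\<^sup>2 * exp (- \<beta> * cosh t))\<bar> = \<bar>cosh t - \<beta> * (sinh t)\<^sup>2\<bar> * exp (- \<beta> * cosh t)"
      unfolding ab[of "cosh t" "(sinh t)\<^sup>2", symmetric] ..
    also have "\<dots> \<le> ((1 + \<beta>) * cosh t ^ 2) * exp (- \<beta> * cosh t)"
    proof (rule mult_right_mono)
      have "\<beta> * (sinh t)\<^sup>2 \<le> \<beta> * cosh t ^ 2" "0 \<le> \<beta> * (sinh t)\<^sup>2" using s b by (auto intro: mult_left_mono)
      then show "\<bar>cosh t - \<beta> * (sinh t)\<^sup>2\<bar> \<le> (1 + \<beta>) * cosh t ^ 2" using c sb[OF t] unfolding distrib_right by linarith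
    qed simp
    finally show "\<bar>cosh t * exp (- \<beta> * cosh t) - \<beta> * ((sinh t)\<^sup>2 * exp (- \<beta> * cosh t))\<bar> \<le> (1 + \<beta>) * (cosh t ^ 2 * exp (- \<beta> * cosh t))" by simp
    have "0 \<le> \<beta> * cosh t ^ 2" using b by simp
    then have "sinh t \<le> (1 + \<beta>) * cosh t ^ 2" unfolding distrib_right using c sb[OF t] by linarith
    then show "\<bar>sinh t * exp (- \<beta> * cosh t)\<bar> \<le> (1 + \<beta>) * (cosh t ^ 2 * exp (- \<beta> * cosh t))"
      using sb[OF t] by (simp add: abs_mult mult.assoc[symmetric])
  qed (use b in \<open>auto intro!: continuous_intros\<close>)
  then show "Kfun 1 \<beta> = \<beta> * (LINT t:{0..}|lborel. (sinh t)\<^sup>2 * exp (- \<beta> * cosh t))"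
    using si[of 1] si1 by (subst (asm) set_integral_diff(2)) (auto simp: Kfun_def)
  have "(LINT t:{0..}|lborel. cosh (2 * t) * exp (- \<beta> * cosh t) - \<beta> * ((sinh t)\<^sup>2 * cosh t * exp (- \<beta> * cosh t))) = 0"
  proof (rule half_line_integral_derivative(2)[OF b, where G="\<lambda>t. sinh t * cosh t * exp (- \<beta> * cosh t)" and K="2 + \<beta>" and k=3])
    fix t :: real
    show "((\<lambda>t. sinh t * cosh t * exp (- \<beta> * cosh t)) has_real_derivative cosh (2 * t) * exp (- \<beta> * cosh t) - \<beta> * ((sinh t)\<^sup>2 * cosh t * exp (- \<beta> * cosh t))) (at t)"
      unfolding cosh_double by (auto intro!: derivative_eq_intros simp: algebra_simps power2_eq_square)
    assume t: "t \<ge> 0"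
    have s: "(sinh t)\<^sup>2 \<le> cosh t ^ 2" using sb[OF t] by (intro power_mono) auto
    have s3: "(sinh t)\<^sup>2 * cosh t \<le> cosh t ^ 3" using mult_right_mono[OF s, of "cosh t"] by (simp add: power3_eq_cube power2_eq_square)
    have c2: "cosh t ^ 2 \<le> cosh t ^ 3" by (rule power_increasing) (use sb[OF t] in auto)
    have s1: "sinh t * cosh t \<le> cosh t ^ 2" using sb[OF t] by (simp add: power2_eq_square mult_right_mono)
    have "\<bar>cosh (2 * t) * exp (- \<beta> * cosh t) - \<beta> * ((sinh t)\<^sup>2 * cosh t * exp (- \<beta> * cosh t))\<bar> = \<bar>cosh (2 * t) - \<beta> * ((sinh t)\<^sup>2 * cosh t)\<bar> * exp (- \<beta> * cosh t)"
      unfolding ab[of "cosh (2 * t)" "(sinh t)\<^sup>2 * cosh t", symmetric] ..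
    also have "\<dots> \<le> ((2 + \<beta>) * cosh t ^ 3) * exp (- \<beta> * cosh t)"
    proof (rule mult_right_mono)
      have "\<beta> * ((sinh t)\<^sup>2 * cosh t) \<le> \<beta> * cosh t ^ 3" "0 \<le> \<beta> * ((sinh t)\<^sup>2 * cosh t)" using s3 b sb[OF t] by (auto intro: mult_left_mono)
      moreover have "0 \<le> cosh (2 * t)" "cosh (2 * t) \<le> 2 * cosh t ^ 3" using s c2 by (auto simp: cosh_double)
      ultimately show "\<bar>cosh (2 * t) - \<beta> * ((sinh t)\<^sup>2 * cosh t)\<bar> \<le> (2 + \<beta>) * cosh t ^ 3" unfolding distrib_right by linarith
    qed simp
    finally show "\<bar>cosh (2 * t) * exp (- \<beta> * cosh t) - \<beta> * ((sinh t)\<^sup>2 * cosh t * exp (- \<beta> * cosh t))\<bar> \<le> (2 + \<beta>) * (cosh t ^ 3 * exp (- \<beta> * cosh t))" by simp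
    have "0 \<le> cosh t ^ 3" "0 \<le> \<beta> * cosh t ^ 3" using b by auto
    then have "sinh t * cosh t \<le> (2 + \<beta>) * cosh t ^ 3" using s1 c2 unfolding distrib_right by linarith
    then show "\<bar>sinh t * cosh t * exp (- \<beta> * cosh t)\<bar> \<le> (2 + \<beta>) * (cosh t ^ 3 * exp (- \<beta> * cosh t))"
      using sb[OF t] by (simp add: abs_mult mult.assoc[symmetric])
  qed (use b in \<open>auto intro!: continuous_intros\<close>)
  then show "Kfun 2 \<beta> = \<beta> * (LINT t:{0..}|lborel. (sinh t)\<^sup>2 * cosh t * exp (- \<beta> * cosh t))"
    using si3 si2 by (subst (asm) set_integral_diff(2)) (auto simp: Kfun_def)
qed

lemma Mfun_pos: assumes b: "\<beta> > 0" shows "Mfun \<beta> > 0"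
proof -
  have i: "integrable lborel (\<lambda>q. exp (- \<beta> * q0 q))" using q0_exp_integrable[OF b, of 0] by simp
  have "(LINT q|lborel. exp (- \<beta> * q0 q)) \<noteq> 0"
    by (subst integral_nonneg_eq_0_iff_AE[OF i]) (auto simp: eventually_False ae_filter_eq_bot_iff)
  moreover have "(LINT q|lborel. exp (- \<beta> * q0 q)) \<ge> 0" by simp
  ultimately show ?thesis unfolding Mfun_def by linarith
qed

text \<open>In polar coordinates both integrals are the same multiple \<open>w\<close> of a Bessel
  function, of \<open>Kfun 1\<close> and of \<open>Kfun 2\<close>; positivity of \<open>Mfun\<close>
  shows that \<open>Kfun 2\<close> does not vanish.\<close>

lemma alpha0_eq:
  assumes b: "\<beta> > 0"
  shows "(LINT q|lborel. exp (- \<beta> * q0 q) / q0 q) = alpha0 \<beta> * Mfun \<beta>"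
proof -
  define w where "w = 3 * unit_ball_vol 3 / \<beta>"
  have 1: "(LINT q|lborel. exp (- \<beta> * q0 q) / q0 q) = w * Kfun 1 \<beta>"
    using radial_integral[of "\<lambda>s. exp (- \<beta> * s) / s"] b by (simp add: K1_eq[OF b] w_def)
  have 2: "Mfun \<beta> = w * Kfun 2 \<beta>"
    using radial_integral[of "\<lambda>s. exp (- \<beta> * s)"] b by (simp add: K1_eq[OF b] w_def Mfun_def)
  have "Mfun \<beta> > 0" by (rule Mfun_pos[OF b])
  then have "Kfun 2 \<beta> \<noteq> 0" using 2 by auto
  then show ?thesis unfolding 1 2 alpha0_def by simp
qed

lemma q0_directional: "((\<lambda>t. q0 (q + t *\<^sub>R v)) has_real_derivative (q \<bullet> v) / q0 q) (at 0)"
proof -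
  have d: "((\<lambda>t. 1 + (norm (q + t *\<^sub>R v))\<^sup>2) has_real_derivative 2 * (q \<bullet> v)) (at 0)"
    unfolding power2_norm_eq_inner inner_add_left inner_add_right inner_scaleR_left inner_scaleR_right
    by (auto intro!: derivative_eq_intros simp: inner_commute)
  have "((\<lambda>t. sqrt (1 + (norm (q + t *\<^sub>R v))\<^sup>2)) has_real_derivative (inverse (sqrt (1 + (norm (q + 0 *\<^sub>R v))\<^sup>2)) / 2) * (2 * (q \<bullet> v))) (at 0)"
    by (rule DERIV_chain2[where f=sqrt and g="\<lambda>t. 1 + (norm (q + t *\<^sub>R v))\<^sup>2", OF DERIV_real_sqrt d]) (simp add: add_pos_nonneg)
  then show ?thesis unfolding q0_def by (rule DERIV_cong) (simp add: inverse_eq_divide)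
qed

text \<open>The derivative of \<open>q $ i * exp (- \<beta> * q0 q)\<close> along axis
  \<open>j\<close> integrates to zero. It consists of a diagonal term, whose integral is
  \<open>Mfun \<beta>\<close>, and of \<open>- \<beta>\<close> times the integrand of the
  claim.\<close>

lemma second_moment:
  assumes b: "\<beta> > 0"
  shows "(LINT q|lborel. q $ i * q $ j / q0 q * exp (- \<beta> * q0 q)) = (if i = j then Mfun \<beta> / \<beta> else 0)"
    and "integrable lborel (\<lambda>q. q $ i * q $ j / q0 q * exp (- \<beta> * q0 q))"
proof -
  define F where "F q = exp (- \<beta> * q0 q)" for q
  define v where "v = (axis j 1 :: vec3)"
  have nv: "norm v = 1" by (simp add: v_def)
  have xv: "x \<bullet> v = x $ j" for x by (simp add: v_def inner_axis)
  have vi: "v $ i = (if i = j then 1 else 0)" by (simp add: v_def axis_def)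
  have Fi: "integrable lborel F" unfolding F_def using q0_exp_integrable[OF b, of 0] by simp
  have Fm [measurable]: "F \<in> borel_measurable borel" unfolding F_def by measurable
  have qq: "\<bar>q $ i * q $ j / q0 q\<bar> \<le> q0 q" for q
  proof -
    have "\<bar>q $ i\<bar> * \<bar>q $ j\<bar> \<le> q0 q * q0 q" by (intro mult_mono component_le_q0) (use q0_pos[of q] in auto)
    then show ?thesis using q0_pos[of q] by (simp add: abs_mult field_simps)
  qed
  show ii: "integrable lborel (\<lambda>q. q $ i * q $ j / q0 q * exp (- \<beta> * q0 q))"
    by (rule q0_exp_dominated[OF b, where K=1 and k=1]) (measurable, use mult_right_mono[OF qq exp_ge_zero] in \<open>simp add: abs_mult\<close>)
  define G' where "G' q = (if i = j then 1 else 0) * F q - \<beta> * (q $ i * q $ j / q0 q * F q)" for q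
  have G'b: "\<bar>G' q\<bar> \<le> (1 + \<beta>) * (q0 q * F q)" for q
  proof -
    have "\<bar>(if i = j then 1 else 0) * F q\<bar> \<le> q0 q * F q" using q0_ge_1[of q] by (auto simp: F_def)
    moreover have "\<bar>\<beta> * (q $ i * q $ j / q0 q * F q)\<bar> \<le> \<beta> * (q0 q * F q)"
    proof -
      define X where "X = q $ i * q $ j / q0 q"
      have "\<beta> * (\<bar>X\<bar> * F q) \<le> \<beta> * (q0 q * F q)"
        using qq[of q] b unfolding X_def[symmetric] by (intro mult_left_mono mult_right_mono) (auto simp: F_def)
      then show ?thesis unfolding X_def[symmetric] using b by (simp add: abs_mult F_def)
    qed
    ultimately show ?thesis unfolding G'_def distrib_right by linarith
  qed
  have "(LINT q|lborel. G' q) = 0"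
  \<comment> \<open>Within distance 1 of \<open>x\<close> the value of \<open>q0\<close> at most
    doubles and the exponential grows by at most \<open>exp \<beta>\<close>; this explains the
    majorant.\<close>
  proof (rule integral_directional_derivative(2)[where G="\<lambda>q. q $ i * F q" and v=v and B="\<lambda>q. (1 + \<beta>) * (2 * exp \<beta>) * (q0 q ^ 1 * exp (- \<beta> * q0 q))"])
    show "integrable lborel (\<lambda>q. q $ i * F q)"
      by (rule q0_exp_dominated[OF b, where K=1 and k=1]) (measurable, use component_le_q0 in \<open>simp add: F_def abs_mult mult_right_mono\<close>)
    show "integrable lborel (\<lambda>q. (1 + \<beta>) * (2 * exp \<beta>) * (q0 q ^ 1 * exp (- \<beta> * q0 q)))"
      by (intro integrable_mult_right q0_exp_integrable b)
    fix x :: vec3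
    have "((\<lambda>t. (x $ i + t * v $ i) * exp (- \<beta> * q0 (x + t *\<^sub>R v))) has_real_derivative G' x) (at 0)"
      by (auto intro!: derivative_eq_intros q0_directional simp: G'_def F_def xv vi)
    then show "((\<lambda>t. (x + t *\<^sub>R v) $ i * F (x + t *\<^sub>R v)) has_vector_derivative G' x) (at 0)"
      by (simp add: F_def has_real_derivative_iff_has_vector_derivative)
    fix t :: real assume t: "\<bar>t\<bar> \<le> 1"
    then have n: "norm (t *\<^sub>R v) \<le> 1" by (simp add: nv)
    have "\<bar>G' (x + t *\<^sub>R v)\<bar> \<le> (1 + \<beta>) * (q0 (x + t *\<^sub>R v) * exp (- \<beta> * q0 (x + t *\<^sub>R v)))"
      using G'b unfolding F_def .
    also have "\<dots> \<le> (1 + \<beta>) * ((2 * q0 x) * exp (\<beta> - \<beta> * q0 x))"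
    proof (intro mult_left_mono mult_mono)
      have "\<beta> * (q0 x - 1) \<le> \<beta> * q0 (x + t *\<^sub>R v)" using q0_shift(2)[OF n, of x] b by (intro mult_left_mono) auto
      then show "exp (- \<beta> * q0 (x + t *\<^sub>R v)) \<le> exp (\<beta> - \<beta> * q0 x)" by (simp add: algebra_simps)
    qed (use q0_shift(1)[OF n, of x] q0_pos[of x] b in auto)
    also have "\<dots> = (1 + \<beta>) * (2 * exp \<beta>) * (q0 x ^ 1 * exp (- \<beta> * q0 x))" by (simp add: exp_diff exp_minus field_simps)
    finally show "norm (G' (x + t *\<^sub>R v)) \<le> (1 + \<beta>) * (2 * exp \<beta>) * (q0 x ^ 1 * exp (- \<beta> * q0 x))" by simp
  qed
  moreover have "(LINT q|lborel. G' q) = (if i = j then 1 else 0) * Mfun \<beta> - \<beta> * (LINT q|lborel. q $ i * q $ j / q0 q * exp (- \<beta> * q0 q))"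
  proof -
    have "(LINT q|lborel. G' q) = (LINT q|lborel. (if i = j then 1 else 0) * F q) - (LINT q|lborel. \<beta> * (q $ i * q $ j / q0 q * F q))"
      unfolding G'_def by (rule Bochner_Integration.integral_diff[OF integrable_mult_right[OF Fi] integrable_mult_right[OF ii[folded F_def]]])
    then show ?thesis by (simp only: integral_mult_right_zero F_def Mfun_def)
  qed
  ultimately show "(LINT q|lborel. q $ i * q $ j / q0 q * exp (- \<beta> * q0 q)) = (if i = j then Mfun \<beta> / \<beta> else 0)"
    using b by (auto simp: field_simps split: if_splits)
qed

section \<open>The collision operator is an orthogonal projection minus the identity\<close>

text \<open>The collision invariants \<open>1\<close>, \<open>q0\<close> and the components of \<open>q\<close>, indexed by \<open>Inl False\<close>, \<open>Inl True\<close> and \<open>Inr i\<close>.\<close>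

fun phi :: "bool + 3 \<Rightarrow> vec3 \<Rightarrow> real" where
  "phi (Inl False) q = 1"
| "phi (Inl True) q = q0 q"
| "phi (Inr i) q = q $ i"

lemma phi_measurable [measurable]: "phi a \<in> borel_measurable borel"
  by (cases "(a, 0::vec3)" rule: phi.cases) (auto simp: phi.simps[abs_def])

lemma phi_le: "\<bar>phi a q\<bar> \<le> q0 q"
  by (cases "(a, q)" rule: phi.cases) (use q0_ge_1[of q] component_le_q0[of q] in auto)

lemma sum_idx: "(\<Sum>a\<in>UNIV. f a) = f (Inl False) + f (Inl True) + (\<Sum>i\<in>UNIV. f (Inr i))"
  for f :: "bool + 'i::finite \<Rightarrow> 'b::comm_monoid_add"
proof -
  have "(\<Sum>a\<in>UNIV. f a) = (\<Sum>a\<in>UNIV <+> UNIV. f a)" by (simp only: UNIV_Plus_UNIV)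
  also have "\<dots> = (\<Sum>a\<in>UNIV. f (Inl a)) + (\<Sum>i\<in>UNIV. f (Inr i))" by (subst sum.Plus) (simp_all add: o_def)
  finally show ?thesis by (simp add: UNIV_bool add.commute)
qed

text \<open>The Gram matrix of the functions \<open>phi a\<close> times
  \<open>sqrt (J0 \<beta>)\<close> for the measure \<open>dq / q0\<close>.\<close>

definition gram :: "real \<Rightarrow> bool + 3 \<Rightarrow> bool + 3 \<Rightarrow> real" where
  "gram \<beta> a b = (LINT q|lborel. phi a q * phi b q / q0 q * J0 \<beta> q)"

lemma J0_nonneg: "\<beta> > 0 \<Longrightarrow> J0 \<beta> q \<ge> 0"
  using Mfun_pos[of \<beta>] by (simp add: J0_def)

lemma J0_measurable [measurable]: "J0 \<beta> \<in> borel_measurable borel" unfolding J0_def by measurable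

lemma q0_J0_integrable: assumes "\<beta> > 0" shows "integrable lborel (\<lambda>q. q0 q ^ k * J0 \<beta> q)"
  using integrable_divide[OF q0_exp_integrable[OF assms, of k], of "Mfun \<beta>"] by (simp add: J0_def)

lemma gram_integrable: assumes b: "\<beta> > 0" shows "integrable lborel (\<lambda>q. phi a q * phi b q / q0 q * J0 \<beta> q)"
proof (rule Bochner_Integration.integrable_bound[OF q0_J0_integrable[OF b, of 1]])
  have "\<bar>phi a q * phi b q / q0 q\<bar> \<le> q0 q" for q
  proof -
    have "\<bar>phi a q\<bar> * \<bar>phi b q\<bar> \<le> q0 q * q0 q" by (intro mult_mono phi_le) (use q0_pos[of q] in auto)
    then show ?thesis using q0_pos[of q] by (simp add: abs_mult field_simps)
  qed
  from mult_right_mono[OF this J0_nonneg[OF b]]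
  show "AE q in lborel. norm (phi a q * phi b q / q0 q * J0 \<beta> q) \<le> norm (q0 q ^ 1 * J0 \<beta> q)"
    using J0_nonneg[OF b] q0_pos by (intro AE_I2) (simp add: abs_mult less_imp_le)
qed measurable

lemma gram_sym: "gram \<beta> a b = gram \<beta> b a" by (simp add: gram_def mult.commute)

text \<open>The integrand changes sign under reflection.\<close>

lemma gram_odd: assumes "\<And>q. phi a (- q) = phi a q" shows "gram \<beta> a (Inr i) = 0"
proof -
  let ?f = "\<lambda>q. phi a q * phi (Inr i) q / q0 q * J0 \<beta> q"
  have e: "q0 (- q) = q0 q" "J0 \<beta> (- q) = J0 \<beta> q" for q by (simp_all add: q0_def J0_def)
  have "(LINT q|lborel. ?f (- q)) = (LINT q|lborel. ?f q)" by (rule lborel_reflect(2)) measurable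
  moreover have "(LINT q|lborel. ?f (- q)) = - (LINT q|lborel. ?f q)" by (simp add: e assms)
  ultimately show ?thesis by (simp add: gram_def)
qed

text \<open>The entry of \<open>q0\<close> with itself comes from
  \<open>q0\<^sup>2 = 1 + (norm q)\<^sup>2\<close>: it is the entry of the constant 1 plus the three
  diagonal entries \<open>1 / \<beta>\<close>, which is \<open>Psi \<beta>\<close>.\<close>

lemma gram_values: assumes b: "\<beta> > 0"
  shows "gram \<beta> (Inl False) (Inl False) = alpha0 \<beta>" "gram \<beta> (Inl False) (Inl True) = 1" "gram \<beta> (Inl True) (Inl False) = 1"
    "gram \<beta> (Inl True) (Inl True) = Psi \<beta>" "gram \<beta> (Inl x) (Inr i) = 0" "gram \<beta> (Inr i) (Inl x) = 0"
    "gram \<beta> (Inr i) (Inr j) = (if i = j then 1 / \<beta> else 0)"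
proof -
  note M = Mfun_pos[OF b]
  have "gram \<beta> (Inl False) (Inl False) = (LINT q|lborel. exp (- \<beta> * q0 q) / q0 q) / Mfun \<beta>"
    unfolding gram_def J0_def by (subst integral_divide_zero[symmetric]) (simp add: mult.commute)
  then show a: "gram \<beta> (Inl False) (Inl False) = alpha0 \<beta>" unfolding alpha0_eq[OF b] using M by simp
  have "gram \<beta> (Inl False) (Inl True) = (LINT q|lborel. exp (- \<beta> * q0 q)) / Mfun \<beta>"
    unfolding gram_def J0_def using q0_pos by (subst integral_divide_zero[symmetric]) (simp add: less_imp_neq[OF q0_pos, symmetric])
  then show "gram \<beta> (Inl False) (Inl True) = 1" using M by (simp add: Mfun_def)
  then show "gram \<beta> (Inl True) (Inl False) = 1" by (simp add: gram_sym)
  show ij: "gram \<beta> (Inr i) (Inr j) = (if i = j then 1 / \<beta> else 0)" for i j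
  proof -
    have "gram \<beta> (Inr i) (Inr j) = (LINT q|lborel. q $ i * q $ j / q0 q * exp (- \<beta> * q0 q)) / Mfun \<beta>"
      unfolding gram_def J0_def by (subst integral_divide_zero[symmetric]) simp
    then show ?thesis unfolding second_moment[OF b] using M by simp
  qed
  show "gram \<beta> (Inl x) (Inr i) = 0" for x i by (rule gram_odd) (cases x, auto simp: q0_def)
  then show "gram \<beta> (Inr i) (Inl x) = 0" by (simp add: gram_sym)
  have "gram \<beta> (Inl True) (Inl True) = (LINT q|lborel. phi (Inl False) q * phi (Inl False) q / q0 q * J0 \<beta> q + (\<Sum>i\<in>UNIV. phi (Inr i) q * phi (Inr i) q / q0 q * J0 \<beta> q))"
    unfolding gram_def
  proof (intro Bochner_Integration.integral_cong refl)
    fix q :: vec3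
    have "q0 q * q0 q = 1 + (\<Sum>i\<in>UNIV. q $ i * q $ i)"
      using q0_sq[of q] by (simp add: power2_eq_square power2_norm_eq_inner[unfolded power2_eq_square] inner_vec_def)
    then show "phi (Inl True) q * phi (Inl True) q / q0 q * J0 \<beta> q = phi (Inl False) q * phi (Inl False) q / q0 q * J0 \<beta> q + (\<Sum>i\<in>UNIV. phi (Inr i) q * phi (Inr i) q / q0 q * J0 \<beta> q)"
      by (simp add: sum_distrib_right sum_divide_distrib add_divide_distrib distrib_right)
  qed
  also have "\<dots> = gram \<beta> (Inl False) (Inl False) + (\<Sum>i\<in>UNIV. gram \<beta> (Inr i) (Inr i))"
    unfolding gram_def using gram_integrable[OF b] by (subst Bochner_Integration.integral_add) (auto intro!: Bochner_Integration.integrable_sum Bochner_Integration.integral_sum simp del: phi.simps)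
  also have "\<dots> = Psi \<beta>" unfolding a ij by (simp add: Psi_def alpha0_def)
  finally show "gram \<beta> (Inl True) (Inl True) = Psi \<beta>" .
qed

text \<open>The weight \<open>1 / q0\<close> is included, so that moments for \<open>dq / q0\<close>
  become plain Lebesgue integrals. The function is real, so \<open>mo\<close> needs no
  conjugation.\<close>

definition dfun :: "real \<Rightarrow> bool + 3 \<Rightarrow> vec3 \<Rightarrow> complex" where
  "dfun \<beta> a q = of_real (sqrt (J0 \<beta> q) * phi a q / q0 q)"

definition mo :: "real \<Rightarrow> (vec3 \<Rightarrow> complex) \<Rightarrow> bool + 3 \<Rightarrow> complex" where
  "mo \<beta> u a = (LINT q|lborel. u q * dfun \<beta> a q)"

text \<open>The coefficients in \<open>Pop\<close>, which form an inverse of the Gram matrix.\<close>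

fun Smat :: "real \<Rightarrow> bool + 3 \<Rightarrow> bool + 3 \<Rightarrow> real" where
  "Smat \<beta> (Inl False) (Inl False) = Psi \<beta> / kappa0 \<beta>"
| "Smat \<beta> (Inl False) (Inl True) = - 1 / kappa0 \<beta>"
| "Smat \<beta> (Inl True) (Inl False) = - 1 / kappa0 \<beta>"
| "Smat \<beta> (Inl True) (Inl True) = alpha0 \<beta> / kappa0 \<beta>"
| "Smat \<beta> (Inr i) (Inr j) = (if i = j then \<beta> else 0)"
| "Smat \<beta> _ _ = 0"

definition co :: "real \<Rightarrow> (vec3 \<Rightarrow> complex) \<Rightarrow> bool + 3 \<Rightarrow> complex" where
  "co \<beta> u b = (\<Sum>a\<in>UNIV. of_real (Smat \<beta> b a) * mo \<beta> u a)"

text \<open>Because \<open>dfun\<close> contains the weight \<open>1 / q0\<close>, the moment in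
  \<open>Pop\<close> that has no division by \<open>q0\<close> belongs to the invariant
  \<open>q0\<close>, and the one divided by \<open>q0\<close> to the invariant 1.\<close>

lemma Pop_eq: "Pop \<beta> f x q = (\<Sum>b\<in>UNIV. co \<beta> (f x) b * of_real (phi b q)) * of_real (sqrt (J0 \<beta> q))"
proof -
  have qn: "q0 p \<noteq> 0" for p using q0_pos[of p] by simp
  have a: "(LINT p|lborel. f x p * complex_of_real (sqrt (J0 \<beta> p))) = mo \<beta> (f x) (Inl True)"
    unfolding mo_def dfun_def by (intro Bochner_Integration.integral_cong) (auto simp: qn)
  have b: "(LINT p|lborel. f x p * complex_of_real (sqrt (J0 \<beta> p)) / complex_of_real (q0 p)) = mo \<beta> (f x) (Inl False)"
    unfolding mo_def dfun_def by (intro Bochner_Integration.integral_cong) auto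
  have c: "(LINT p|lborel. complex_of_real (p $ i) * (f x p * complex_of_real (sqrt (J0 \<beta> p))) / complex_of_real (q0 p)) = mo \<beta> (f x) (Inr i)" for i
    unfolding mo_def dfun_def by (intro Bochner_Integration.integral_cong) auto
  have k: "(\<Sum>j\<in>UNIV. complex_of_real (if i = j then \<beta> else 0) * g j) = of_real \<beta> * g i" for i :: 3 and g
  proof -
    have "(\<Sum>j\<in>UNIV. complex_of_real (if i = j then \<beta> else 0) * g j) = (\<Sum>j\<in>UNIV. if j = i then of_real \<beta> * g j else 0)"
      by (intro sum.cong) auto
    then show ?thesis by simp
  qed
  show ?thesis unfolding Pop_def Let_def a b c sum_idx co_def
    by (simp add: k) (simp add: diff_divide_distrib sum_distrib_left algebra_simps)
qed

lemma kappa0_eq: assumes "\<beta> > 0" shows "kappa0 \<beta> = alpha0 \<beta> * Psi \<beta> - 1"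
  by (simp add: kappa0_def Psi_def alpha0_def power2_eq_square algebra_simps)

text \<open>The factor \<open>cnj (co \<beta> u a)\<close> makes this true also if \<open>kappa0 \<beta> = 0\<close>, where \<open>x / 0 = 0\<close> annihilates the coefficients of
  \<open>1\<close> and \<open>q0\<close>.\<close>

lemma reproducing:
  assumes b: "\<beta> > 0"
  shows "cnj (co \<beta> u a) * (\<Sum>c\<in>UNIV. co \<beta> u c * of_real (gram \<beta> c a)) = cnj (co \<beta> u a) * mo \<beta> u a"
proof -
  have k: "(\<Sum>j\<in>UNIV. complex_of_real (if i = j then \<beta> else 0) * g j) = of_real \<beta> * g i" for i :: 3 and g
  proof -
    have "(\<Sum>j\<in>UNIV. complex_of_real (if i = j then \<beta> else 0) * g j) = (\<Sum>j\<in>UNIV. if j = i then of_real \<beta> * g j else 0)"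
      by (intro sum.cong) auto
    then show ?thesis by simp
  qed
  have k2: "(\<Sum>j\<in>UNIV. g j * complex_of_real (if j = i then 1 / \<beta> else 0)) = g i / of_real \<beta>" for i :: 3 and g
  proof -
    have "(\<Sum>j\<in>UNIV. g j * complex_of_real (if j = i then 1 / \<beta> else 0)) = (\<Sum>j\<in>UNIV. if j = i then g j / of_real \<beta> else 0)"
      by (intro sum.cong) auto
    then show ?thesis by simp
  qed
  let ?A = "mo \<beta> u (Inl True)" and ?B = "mo \<beta> u (Inl False)"
  have cF: "co \<beta> u (Inl False) = (of_real (Psi \<beta>) * ?B - ?A) / of_real (kappa0 \<beta>)"
    unfolding co_def sum_idx by (simp add: diff_divide_distrib)
  have cT: "co \<beta> u (Inl True) = (of_real (alpha0 \<beta>) * ?A - ?B) / of_real (kappa0 \<beta>)"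
    unfolding co_def sum_idx by (simp add: diff_divide_distrib)
  have cI: "co \<beta> u (Inr i) = of_real \<beta> * mo \<beta> u (Inr i)" for i
    unfolding co_def sum_idx by (simp add: k)
  show ?thesis
  proof (cases a)
    case (Inr i)
    then show ?thesis unfolding sum_idx using b by (simp add: gram_values[OF b] k2 cI)
  next
    case (Inl x)
    show ?thesis
    proof (cases "kappa0 \<beta> = 0")
      case True
      then show ?thesis using Inl by (cases x) (simp_all add: cF cT)
    next
      case False
      then have kc: "complex_of_real (kappa0 \<beta>) \<noteq> 0" by simp
      have ka: "complex_of_real (kappa0 \<beta>) = of_real (alpha0 \<beta>) * of_real (Psi \<beta>) - 1" by (simp add: kappa0_eq[OF b])
      have "(\<Sum>c\<in>UNIV. co \<beta> u c * of_real (gram \<beta> c a)) = mo \<beta> u a"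
      proof (cases x)
        case True
        have "(of_real (Psi \<beta>) * ?B - ?A) + (of_real (alpha0 \<beta>) * ?A - ?B) * of_real (Psi \<beta>) = of_real (kappa0 \<beta>) * ?A"
          unfolding ka by (simp add: algebra_simps)
        then have "(of_real (Psi \<beta>) * ?B - ?A) / of_real (kappa0 \<beta>) + (of_real (alpha0 \<beta>) * ?A - ?B) / of_real (kappa0 \<beta>) * of_real (Psi \<beta>) = ?A"
          using kc by (simp add: add_divide_distrib[symmetric])
        then show ?thesis unfolding sum_idx Inl using True by (simp add: gram_values[OF b] cF cT)
      next
        case False
        have "(of_real (Psi \<beta>) * ?B - ?A) * of_real (alpha0 \<beta>) + (of_real (alpha0 \<beta>) * ?A - ?B) = of_real (kappa0 \<beta>) * ?B"
          unfolding ka by (simp add: algebra_simps)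
        then have "(of_real (Psi \<beta>) * ?B - ?A) / of_real (kappa0 \<beta>) * of_real (alpha0 \<beta>) + (of_real (alpha0 \<beta>) * ?A - ?B) / of_real (kappa0 \<beta>) = ?B"
          using kc by (simp add: add_divide_distrib[symmetric])
        then show ?thesis unfolding sum_idx Inl using False by (simp add: gram_values[OF b] cF cT)
      qed
      then show ?thesis by simp
    qed
  qed
qed

lemma sJ_L2: assumes b: "\<beta> > 0" and [measurable]: "w \<in> borel_measurable borel" and w: "\<And>q. \<bar>w q\<bar> \<le> q0 q ^ k"
  shows "(\<lambda>q. complex_of_real (sqrt (J0 \<beta> q) * w q)) \<in> L2 lborel"
proof (rule L2_dom[OF _ q0_J0_integrable[OF b, of "2 * k"]])
  have "(cmod (complex_of_real (sqrt (J0 \<beta> q) * w q)))\<^sup>2 \<le> q0 q ^ (2 * k) * J0 \<beta> q" for q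
  proof -
    have "\<bar>w q\<bar>\<^sup>2 \<le> (q0 q ^ k)\<^sup>2" by (intro power_mono w) auto
    then have "(w q)\<^sup>2 \<le> q0 q ^ (2 * k)" by (simp add: power_mult[symmetric] mult.commute)
    then have "J0 \<beta> q * (w q)\<^sup>2 \<le> J0 \<beta> q * q0 q ^ (2 * k)" using J0_nonneg[OF b, of q] by (rule mult_left_mono)
    moreover have "(cmod (complex_of_real (sqrt (J0 \<beta> q) * w q)))\<^sup>2 = J0 \<beta> q * (w q)\<^sup>2"
      unfolding norm_of_real using J0_nonneg[OF b, of q] by (simp add: power_mult_distrib)
    ultimately show ?thesis by (simp add: mult.commute)
  qed
  then show "AE q in lborel. (cmod (complex_of_real (sqrt (J0 \<beta> q) * w q)))\<^sup>2 \<le> q0 q ^ (2 * k) * J0 \<beta> q" by simp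
qed measurable

lemma dfun_L2: assumes b: "\<beta> > 0" shows "dfun \<beta> a \<in> L2 lborel"
proof -
  have "\<bar>phi a q / q0 q\<bar> \<le> q0 q ^ 0" for q using phi_le[of a q] q0_pos[of q] by simp
  from sJ_L2[OF b _ this] show ?thesis unfolding dfun_def[abs_def] by simp
qed

text \<open>Absorbs the coefficient matrix, so that \<open>Pop\<close> divided by \<open>q0\<close>
  takes the form required by \<open>finite_rank_gen\<close>.\<close>

definition efun :: "real \<Rightarrow> bool + 3 \<Rightarrow> vec3 \<Rightarrow> complex" where
  "efun \<beta> a q = (\<Sum>b\<in>UNIV. of_real (Smat \<beta> b a) * dfun \<beta> b q)"

lemma efun_L2: assumes b: "\<beta> > 0" shows "efun \<beta> a \<in> L2 lborel"
  unfolding efun_def[abs_def] by (intro L2_sum L2_cmult dfun_L2 b)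

lemma Pop_div_q0: "Pop \<beta> f x q / of_real (q0 q) = (\<Sum>a\<in>UNIV. efun \<beta> a q * (LINT p|lborel. f x p * dfun \<beta> a p))"
proof -
  have "Pop \<beta> f x q / of_real (q0 q) = (\<Sum>b\<in>UNIV. co \<beta> (f x) b * dfun \<beta> b q)"
    unfolding Pop_eq dfun_def sum_distrib_right sum_divide_distrib by (intro sum.cong) (auto simp: mult_ac)
  also have "\<dots> = (\<Sum>b\<in>UNIV. \<Sum>a\<in>UNIV. of_real (Smat \<beta> b a) * dfun \<beta> b q * mo \<beta> (f x) a)"
    unfolding co_def sum_distrib_right by (intro sum.cong refl) (simp add: mult_ac)
  also have "\<dots> = (\<Sum>a\<in>UNIV. \<Sum>b\<in>UNIV. of_real (Smat \<beta> b a) * dfun \<beta> b q * mo \<beta> (f x) a)"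
    by (rule sum.swap)
  also have "\<dots> = (\<Sum>a\<in>UNIV. efun \<beta> a q * mo \<beta> (f x) a)"
    unfolding efun_def by (simp add: sum_distrib_right)
  finally show ?thesis by (simp add: mo_def)
qed

text \<open>Splitting the weight as a square root on both factors gives \<open>U\<close> from
  \<open>u\<close> and \<open>V\<close> from its projection. By \<open>reproducing\<close> the inner
  product of \<open>U\<close> and \<open>V\<close> is the squared norm of \<open>V\<close>, so
  Cauchy-Schwarz makes the norm of \<open>V\<close> at most that of \<open>U\<close>, and the
  quadratic form is the difference of the two squared norms.\<close>

lemma collision_dissipative:
  assumes b: "\<beta> > 0" and u: "u \<in> L2 lborel"
  shows "Re (LINT q|lborel. ((\<Sum>a\<in>UNIV. efun \<beta> a q * (LINT p|lborel. u p * dfun \<beta> a p)) - u q / of_real (q0 q)) * cnj (u q)) \<le> 0"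
proof -
  define r where "r q = complex_of_real (1 / sqrt (q0 q))" for q
  have rr: "r q * r q = of_real (1 / q0 q)" for q
    unfolding r_def of_real_mult[symmetric] using q0_pos[of q] by simp
  have [measurable]: "r \<in> borel_measurable borel" unfolding r_def by measurable
  have r1: "cmod (r q) \<le> 1" for q using q0_ge_1[of q] by (simp add: r_def norm_divide)
  define P where "P q = (\<Sum>c\<in>UNIV. co \<beta> u c * of_real (phi c q)) * complex_of_real (sqrt (J0 \<beta> q))" for q
  have PL: "P \<in> L2 lborel"
  proof -
    have "(\<lambda>q. co \<beta> u c * complex_of_real (sqrt (J0 \<beta> q) * phi c q)) \<in> L2 lborel" for c
      by (intro L2_cmult sJ_L2[OF b, where k=1]) (use phi_le in auto)
    then have "(\<lambda>q. \<Sum>c\<in>UNIV. co \<beta> u c * complex_of_real (sqrt (J0 \<beta> q) * phi c q)) \<in> L2 lborel" by (rule L2_sum)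
    then show ?thesis unfolding P_def[abs_def] sum_distrib_right by (simp add: mult_ac)
  qed
  define U V where "U q = r q * u q" and "V q = r q * P q" for q
  have UL: "U \<in> L2 lborel" unfolding U_def[abs_def] by (rule L2_mult_bounded[OF u _ r1]) simp
  have VL: "V \<in> L2 lborel" unfolding V_def[abs_def] by (rule L2_mult_bounded[OF PL _ r1]) simp
  have cr: "cnj (r q) = r q" for q by (simp add: r_def)
  have Jn: "complex_of_real (sqrt (J0 \<beta> q)) * of_real (sqrt (J0 \<beta> q)) = of_real (J0 \<beta> q)" for q
    unfolding of_real_mult[symmetric] using J0_nonneg[OF b, of q] by simp
  have uV: "(LINT q|lborel. U q * cnj (V q)) = (\<Sum>a\<in>UNIV. cnj (co \<beta> u a) * mo \<beta> u a)"
  proof -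
    have "U q * cnj (V q) = (\<Sum>a\<in>UNIV. cnj (co \<beta> u a) * (u q * dfun \<beta> a q))" for q
    proof -
      have "U q * cnj (V q) = u q * cnj (P q) * (r q * r q)" by (simp add: U_def V_def cr mult_ac)
      also have "\<dots> = (\<Sum>a\<in>UNIV. cnj (co \<beta> u a) * (u q * dfun \<beta> a q))"
        unfolding rr P_def dfun_def by (simp add: sum_distrib_left sum_distrib_right sum_divide_distrib mult_ac)
      finally show ?thesis .
    qed
    then show ?thesis unfolding mo_def
      by (simp only:) (subst Bochner_Integration.integral_sum, intro integrable_mult_right L2_mult_integrable u dfun_L2 b, simp)
  qed
  have VV: "(LINT q|lborel. V q * cnj (V q)) = (\<Sum>a\<in>UNIV. cnj (co \<beta> u a) * (\<Sum>c\<in>UNIV. co \<beta> u c * of_real (gram \<beta> c a)))"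
  proof -
    have e: "V q * cnj (V q) = (\<Sum>a\<in>UNIV. \<Sum>c\<in>UNIV. cnj (co \<beta> u a) * (co \<beta> u c * of_real (phi c q * phi a q / q0 q * J0 \<beta> q)))" for q
    proof -
      have "V q * cnj (V q) = P q * cnj (P q) * (r q * r q)" by (simp add: V_def cr mult_ac)
      also have "\<dots> = (\<Sum>a\<in>UNIV. cnj (co \<beta> u a) * of_real (phi a q)) * (\<Sum>c\<in>UNIV. co \<beta> u c * of_real (phi c q)) * (complex_of_real (sqrt (J0 \<beta> q)) * of_real (sqrt (J0 \<beta> q))) * of_real (1 / q0 q)"
        unfolding rr P_def by (simp add: mult_ac)
      also have "\<dots> = (\<Sum>a\<in>UNIV. \<Sum>c\<in>UNIV. cnj (co \<beta> u a) * (co \<beta> u c * of_real (phi c q * phi a q / q0 q * J0 \<beta> q)))"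
        unfolding Jn unfolding sum_product unfolding sum_distrib_right by (intro sum.cong refl) (simp add: mult_ac)
      finally show ?thesis .
    qed
    have i: "integrable lborel (\<lambda>q. complex_of_real (phi c q * phi a q / q0 q * J0 \<beta> q))" for a c
      by (simp only: complex_of_real_integrable_eq gram_integrable[OF b])
    have "(LINT q|lborel. V q * cnj (V q)) = (\<Sum>a\<in>UNIV. \<Sum>c\<in>UNIV. (LINT q|lborel. cnj (co \<beta> u a) * (co \<beta> u c * of_real (phi c q * phi a q / q0 q * J0 \<beta> q))))"
      unfolding e
      by (subst Bochner_Integration.integral_sum, (intro Bochner_Integration.integrable_sum integrable_mult_right i),
          intro sum.cong refl, subst Bochner_Integration.integral_sum, (intro integrable_mult_right i), rule refl)
    also have "\<dots> = (\<Sum>a\<in>UNIV. \<Sum>c\<in>UNIV. cnj (co \<beta> u a) * (co \<beta> u c * of_real (gram \<beta> c a)))"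
      unfolding gram_def by (simp only: integral_mult_right_zero integral_complex_of_real)
    finally show ?thesis by (simp only: sum_distrib_left)
  qed
  have "(LINT q|lborel. V q * cnj (V q)) = (LINT q|lborel. U q * cnj (V q))"
    unfolding uV VV by (intro sum.cong refl reproducing b)
  moreover have VVn: "(LINT q|lborel. V q * cnj (V q)) = of_real ((nrm lborel V)\<^sup>2)"
    unfolding nrm_sq integral_complex_of_real[symmetric] complex_norm_square ..
  ultimately have uVn: "(LINT q|lborel. U q * cnj (V q)) = of_real ((nrm lborel V)\<^sup>2)" by simp
  have cV: "nrm lborel (\<lambda>q. cnj (V q)) = nrm lborel V" by (simp add: nrm_def)
  have "(nrm lborel V)\<^sup>2 \<le> nrm lborel U * nrm lborel V"
    using CS[OF UL L2_cnj[OF VL]] unfolding uVn cV by (simp add: norm_power)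
  then have le: "nrm lborel V \<le> nrm lborel U"
    using nrm_nonneg[of lborel V] nrm_nonneg[of lborel U] by (cases "nrm lborel V = 0") (auto simp: power2_eq_square mult_le_cancel_right)
  have VU: "(LINT q|lborel. V q * cnj (U q)) = of_real ((nrm lborel V)\<^sup>2)"
  proof -
    have "(LINT q|lborel. V q * cnj (U q)) = (LINT q|lborel. cnj (U q * cnj (V q)))" by (simp add: mult.commute)
    also have "\<dots> = cnj (LINT q|lborel. U q * cnj (V q))" by (rule Bochner_Integration.integral_cnj)
    finally show ?thesis unfolding uVn by simp
  qed
  have UU: "(LINT q|lborel. U q * cnj (U q)) = of_real ((nrm lborel U)\<^sup>2)"
    unfolding nrm_sq integral_complex_of_real[symmetric] complex_norm_square ..
  have "((\<Sum>a\<in>UNIV. efun \<beta> a q * (LINT p|lborel. u p * dfun \<beta> a p)) - u q / of_real (q0 q)) * cnj (u q) = V q * cnj (U q) - U q * cnj (U q)" for q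
  proof -
    have "(\<Sum>a\<in>UNIV. efun \<beta> a q * (LINT p|lborel. u p * dfun \<beta> a p)) = P q * of_real (1 / q0 q)"
      using Pop_div_q0[of \<beta> "\<lambda>_. u" undefined q] by (simp add: Pop_eq P_def)
    moreover have "V q * cnj (U q) - U q * cnj (U q) = (P q - u q) * cnj (u q) * (r q * r q)"
      by (simp add: U_def V_def cr algebra_simps)
    ultimately show ?thesis unfolding rr by (simp add: algebra_simps)
  qed
  then have "(LINT q|lborel. ((\<Sum>a\<in>UNIV. efun \<beta> a q * (LINT p|lborel. u p * dfun \<beta> a p)) - u q / of_real (q0 q)) * cnj (u q))
      = (LINT q|lborel. V q * cnj (U q)) - (LINT q|lborel. U q * cnj (U q))"
    by (simp only:) (intro Bochner_Integration.integral_diff L2_mult_integrable UL VL L2_cnj)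
  also have "Re \<dots> = (nrm lborel V)\<^sup>2 - (nrm lborel U)\<^sup>2" unfolding VU UU by simp
  also have "\<dots> \<le> 0" using power_mono[OF le nrm_nonneg, of 2] by simp
  finally show ?thesis .
qed

section \<open>Test functions\<close>

lemma iter_partial_append: "iter_partial (is @ js) \<phi> = iter_partial is (iter_partial js \<phi>)"
  by (induction "is") auto

lemma test_fun_D:
  assumes "test_fun \<phi>" "i \<in> {0, 1, 2}"
  shows "continuous_on UNIV \<phi>" "((\<lambda>t. \<phi> (x + t *\<^sub>R axis (of_nat i) 1)) has_vector_derivative partial i \<phi> x) (at 0)"
proof -
  have "continuous_on UNIV (iter_partial [] \<phi>) \<and> (\<forall>i\<in>{0,1,2}. \<forall>x. ((\<lambda>t. iter_partial [] \<phi> (x + t *\<^sub>R axis (of_nat i) 1))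
             has_vector_derivative iter_partial (i # []) \<phi> x) (at 0))"
    using assms(1) unfolding test_fun_def by (metis empty_subsetI list.set(1))
  then show "continuous_on UNIV \<phi>" "((\<lambda>t. \<phi> (x + t *\<^sub>R axis (of_nat i) 1)) has_vector_derivative partial i \<phi> x) (at 0)"
    using assms(2) by auto
qed

text \<open>The derivative taken first stands last in the index list, so the conditions on
  \<open>partial i \<phi>\<close> are those on \<open>\<phi>\<close> for lists ending in
  \<open>i\<close>. The support radius is kept because \<open>\<phi>\<close> vanishes on an open
  set.\<close>

lemma test_fun_partial:
  assumes t: "test_fun \<phi>" and i: "i \<in> {0, 1, 2}" shows "test_fun (partial i \<phi>)"
proof -
  obtain R where R: "\<And>x. norm x > R \<Longrightarrow> \<phi> x = 0" using t unfolding test_fun_def by blast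
  have "partial i \<phi> x = 0" if x: "norm x > R" for x
  proof -
    let ?v = "axis (of_nat i) 1 :: vec3"
    have "open {y::vec3. norm y > R}" by (intro open_Collect_less continuous_intros)
    moreover have "continuous (at 0) (\<lambda>t. x + t *\<^sub>R ?v)" by (intro continuous_intros)
    ultimately have "eventually (\<lambda>t. x + t *\<^sub>R ?v \<in> {y. norm y > R}) (at 0)"
      using x by (intro topological_tendstoD[where l=x]) (auto simp: continuous_at)
    then have e: "eventually (\<lambda>t. \<phi> (x + t *\<^sub>R ?v) = 0) (nhds 0)"
      using R x by (auto simp: eventually_at_filter elim: eventually_mono)
    have "((\<lambda>t. \<phi> (x + t *\<^sub>R ?v)) has_vector_derivative partial i \<phi> x) (at 0) \<longleftrightarrow> ((\<lambda>t. 0) has_vector_derivative partial i \<phi> x) (at 0)"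
      by (rule has_vector_derivative_cong_ev) (use e R x in \<open>auto elim: eventually_mono\<close>)
    then have "((\<lambda>t. 0) has_vector_derivative partial i \<phi> x) (at 0)" using test_fun_D(2)[OF t i] by simp
    from vector_derivative_at[OF this] show ?thesis by simp
  qed
  moreover have a: "iter_partial is (partial i \<phi>) = iter_partial (is @ [i]) \<phi>" for "is"
    by (simp add: iter_partial_append)
  have "continuous_on UNIV (iter_partial is (partial i \<phi>)) \<and>
        (\<forall>k\<in>{0,1,2}. \<forall>x. ((\<lambda>t. iter_partial is (partial i \<phi>) (x + t *\<^sub>R axis (of_nat k) 1))
             has_vector_derivative iter_partial (k # is) (partial i \<phi>) x) (at 0))" if "set is \<subseteq> {0,1,2}" for "is"
  proof -
    have "set (is @ [i]) \<subseteq> {0,1,2}" using that i by auto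
    with t have "continuous_on UNIV (iter_partial (is @ [i]) \<phi>) \<and>
        (\<forall>k\<in>{0,1,2}. \<forall>x. ((\<lambda>t. iter_partial (is @ [i]) \<phi> (x + t *\<^sub>R axis (of_nat k) 1))
             has_vector_derivative iter_partial (k # (is @ [i])) \<phi> x) (at 0))" unfolding test_fun_def by blast
    then show ?thesis unfolding a append_Cons .
  qed
  ultimately show ?thesis unfolding test_fun_def by blast
qed

lemma test_fun_bounded:
  assumes t: "test_fun \<phi>"
  obtains K R where "K \<ge> 0" "\<And>x. cmod (\<phi> x) \<le> K * indicator (cball 0 R) x"
proof -
  obtain R where R: "\<And>x. norm x > R \<Longrightarrow> \<phi> x = 0" using t unfolding test_fun_def by blast
  have "compact (\<phi> ` cball 0 R)" by (rule compact_continuous_image) (use test_fun_D(1)[OF t, of 0] continuous_on_subset in auto)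
  then obtain K where K: "\<And>y. y \<in> \<phi> ` cball 0 R \<Longrightarrow> cmod y \<le> K" using bounded_iff compact_imp_bounded by metis
  have "cmod (\<phi> x) \<le> max K 0 * indicator (cball 0 R) x" for x
    using K[of "\<phi> x"] R[of x] by (cases "norm x \<le> R") (auto simp: indicator_def)
  then show ?thesis using that[of "max K 0" R] by auto
qed

lemma test_fun_measurable: "test_fun \<phi> \<Longrightarrow> \<phi> \<in> borel_measurable borel"
  using borel_measurable_continuous_onI test_fun_D(1)[of \<phi> 0] by auto

lemma cball_indicator_integrable: "integrable lborel (\<lambda>x. K * indicator (cball 0 R) (x::vec3) :: real)"
  by (intro integrable_mult_right integrable_real_indicator) (use emeasure_lborel_cball_finite[of 0 R] in auto)

lemma test_fun_integrable: assumes t: "test_fun \<phi>" shows "integrable lborel \<phi>" "\<phi> \<in> L2 lborel"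
proof -
  note [measurable] = test_fun_measurable[OF t]
  obtain K R where K: "K \<ge> 0" "\<And>x. cmod (\<phi> x) \<le> K * indicator (cball 0 R) x" using test_fun_bounded[OF t] by blast
  show "integrable lborel \<phi>"
    by (rule Bochner_Integration.integrable_bound[OF cball_indicator_integrable[of K R]]) (use K in auto)
  show "\<phi> \<in> L2 lborel"
  proof (rule L2_dom[OF _ cball_indicator_integrable[of "K\<^sup>2" R]])
    have "(cmod (\<phi> x))\<^sup>2 \<le> K\<^sup>2 * indicator (cball 0 R) x" for x
    proof -
      have "(cmod (\<phi> x))\<^sup>2 \<le> (K * indicator (cball 0 R) x)\<^sup>2" by (intro power_mono K) simp
      also have "\<dots> = K\<^sup>2 * indicator (cball 0 R) x" by (simp add: power_mult_distrib indicator_def)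
      finally show ?thesis .
    qed
    then show "AE x in lborel. (cmod (\<phi> x))\<^sup>2 \<le> K\<^sup>2 * indicator (cball 0 R) x" by simp
  qed measurable
qed

section \<open>Transforms of test functions and the symbol of transport\<close>

text \<open>The derivative of \<open>cis (y \<bullet> x) * \<phi> x\<close> along axis
  \<open>i\<close> integrates to zero.\<close>

lemma Fp_partial:
  assumes t: "test_fun \<phi>" and i: "i \<in> {0, 1, 2}"
  shows "Fp (partial i \<phi>) y = - \<i> * of_real (y $ of_nat i) * Fp \<phi> y"
proof -
  let ?v = "axis (of_nat i) 1 :: vec3"
  note t' = test_fun_partial[OF t i]
  obtain K R where K: "K \<ge> 0" "\<And>x. cmod (\<phi> x) \<le> K * indicator (cball 0 R) x" using test_fun_bounded[OF t] by blast
  obtain K' R' where K': "K' \<ge> 0" "\<And>x. cmod (partial i \<phi> x) \<le> K' * indicator (cball 0 R') x" using test_fun_bounded[OF t'] by blast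
  define G' where "G' x = cis (y \<bullet> x) * (\<i> * of_real (y $ of_nat i) * \<phi> x + partial i \<phi> x)" for x
  \<comment> \<open>Enlarged by 1 because the majorant must cover all shifts of \<open>x\<close> by
    at most one unit vector.\<close>
  define Q where "Q = max R R' + 1"
  define N where "N = \<bar>y $ of_nat i\<bar> * K + K'"
  have "(LINT x|lborel. G' x) = 0"
  proof (rule integral_directional_derivative(2)[where G="\<lambda>x. cis (y \<bullet> x) * \<phi> x" and v="?v" and B="\<lambda>x. N * indicator (cball 0 Q) x"])
    show "integrable lborel (\<lambda>x. cis (y \<bullet> x) * \<phi> x)" by (rule Fp_integrand[OF test_fun_integrable(1)[OF t]])
    show "integrable lborel (\<lambda>x. N * indicator (cball 0 Q) (x::vec3) :: real)" by (rule cball_indicator_integrable)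
    fix x :: vec3
    have "((\<lambda>t. cis (y \<bullet> x + t * (y $ of_nat i))) has_vector_derivative (\<i> * of_real (y $ of_nat i)) * cis (y \<bullet> x)) (at 0)"
    proof -
      have "((\<lambda>z. exp (\<i> * (of_real (y \<bullet> x) + z * of_real (y $ of_nat i)))) has_field_derivative
          exp (\<i> * (of_real (y \<bullet> x) + of_real 0 * of_real (y $ of_nat i))) * (\<i> * of_real (y $ of_nat i))) (at (of_real 0))"
        by (auto intro!: derivative_eq_intros)
      from has_vector_derivative_real_field[OF this, of UNIV]
      show ?thesis by (simp add: cis_conv_exp mult_ac)
    qed
    from has_vector_derivative_mult[OF this test_fun_D(2)[OF t i, of x]]
    show "((\<lambda>t. cis (y \<bullet> (x + t *\<^sub>R ?v)) * \<phi> (x + t *\<^sub>R ?v)) has_vector_derivative G' x) (at 0)"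
      by (simp add: G'_def inner_add_right inner_axis algebra_simps)
    fix t :: real assume t: "\<bar>t\<bar> \<le> 1"
    have n: "norm x \<le> norm (x + t *\<^sub>R ?v) + 1"
      using norm_triangle_ineq4[of "x + t *\<^sub>R ?v" "t *\<^sub>R ?v"] t by simp
    have "cmod (G' z) \<le> \<bar>y $ of_nat i\<bar> * (K * indicator (cball 0 R) z) + K' * indicator (cball 0 R') z" for z
    proof -
      have "cmod (G' z) = cmod (\<i> * of_real (y $ of_nat i) * \<phi> z + partial i \<phi> z)" by (simp add: G'_def norm_mult)
      also have "\<dots> \<le> cmod (\<i> * of_real (y $ of_nat i) * \<phi> z) + cmod (partial i \<phi> z)" by (rule norm_triangle_ineq)
      also have "\<dots> \<le> \<bar>y $ of_nat i\<bar> * (K * indicator (cball 0 R) z) + K' * indicator (cball 0 R') z"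
        by (intro add_mono K') (simp add: norm_mult mult_left_mono K)
      finally show ?thesis .
    qed
    also have "\<bar>y $ of_nat i\<bar> * (K * indicator (cball 0 R) (x + t *\<^sub>R ?v)) + K' * indicator (cball 0 R') (x + t *\<^sub>R ?v) \<le> N * indicator (cball 0 Q) x"
      using n K K' by (auto simp: indicator_def N_def Q_def)
    finally show "norm (G' (x + t *\<^sub>R ?v)) \<le> N * indicator (cball 0 Q) x" .
  qed
  moreover have "(LINT x|lborel. G' x) = \<i> * of_real (y $ of_nat i) * Fp \<phi> y + Fp (partial i \<phi>) y"
  proof -
    have "(LINT x|lborel. G' x) = (LINT x|lborel. \<i> * of_real (y $ of_nat i) * (cis (y \<bullet> x) * \<phi> x) + cis (y \<bullet> x) * partial i \<phi> x)"
      by (intro Bochner_Integration.integral_cong) (auto simp: G'_def algebra_simps)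
    also have "\<dots> = (LINT x|lborel. \<i> * of_real (y $ of_nat i) * (cis (y \<bullet> x) * \<phi> x)) + (LINT x|lborel. cis (y \<bullet> x) * partial i \<phi> x)"
      by (rule Bochner_Integration.integral_add[OF integrable_mult_right[OF Fp_integrand[OF test_fun_integrable(1)[OF t]]] Fp_integrand[OF test_fun_integrable(1)[OF t']]])
    finally show ?thesis unfolding Fp_def by (simp only: integral_mult_right_zero)
  qed
  ultimately show ?thesis by (simp add: add_eq_0_iff2)
qed

text \<open>Two derivatives along axis \<open>i\<close> multiply the transform by minus the square
  of \<open>y $ i\<close>, so the factor for a new coordinate is bought by applying the induction
  hypothesis to \<open>\<phi>\<close> and to its second derivative. Hence the induction generalises
  over \<open>\<phi>\<close>.\<close>

lemma test_fun_decay: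
  assumes "finite S" "S \<subseteq> {0, 1, 2}" "test_fun \<phi>"
  shows "\<exists>C\<ge>0. \<forall>y. cmod (Fp \<phi> y) * (\<Prod>i\<in>S. (1 + (y $ of_nat i)\<^sup>2)) \<le> C"
  using assms
proof (induction S arbitrary: \<phi> rule: finite_induct)
  case empty
  have "0 \<le> (LINT x|lborel. cmod (\<phi> x))" by simp
  then show ?case using Fp_bound[OF test_fun_integrable(1)[OF empty(2)]]
    by (intro exI[of _ "LINT x|lborel. cmod (\<phi> x)"]) simp
next
  case (insert i S)
  then have i: "i \<in> {0, 1, 2}" and S: "S \<subseteq> {0, 1, 2}" by auto
  let ?\<phi>2 = "partial i (partial i \<phi>)"
  obtain C1 where C1: "C1 \<ge> 0" "\<And>y. cmod (Fp \<phi> y) * (\<Prod>i\<in>S. (1 + (y $ of_nat i)\<^sup>2)) \<le> C1"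
    using insert.IH[OF S insert.prems(2)] by blast
  obtain C2 where C2: "C2 \<ge> 0" "\<And>y. cmod (Fp ?\<phi>2 y) * (\<Prod>i\<in>S. (1 + (y $ of_nat i)\<^sup>2)) \<le> C2"
    using insert.IH[OF S test_fun_partial[OF test_fun_partial[OF insert.prems(2) i] i]] by blast
  have "cmod (Fp \<phi> y) * (\<Prod>i\<in>insert i S. (1 + (y $ of_nat i)\<^sup>2)) \<le> C1 + C2" for y
  proof -
    have p: "(\<Prod>i\<in>S. (1 + (y $ of_nat i)\<^sup>2)) \<ge> 0" by (intro prod_nonneg) (simp add: add_nonneg_nonneg)
    have "Fp ?\<phi>2 y = - of_real ((y $ of_nat i)\<^sup>2) * Fp \<phi> y"
      unfolding Fp_partial[OF test_fun_partial[OF insert.prems(2) i] i] Fp_partial[OF insert.prems(2) i]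
      by (simp add: power2_eq_square algebra_simps)
    then have "cmod (Fp ?\<phi>2 y) = (y $ of_nat i)\<^sup>2 * cmod (Fp \<phi> y)" by (simp add: norm_mult norm_power)
    then have "cmod (Fp \<phi> y) * (\<Prod>i\<in>insert i S. (1 + (y $ of_nat i)\<^sup>2))
       = cmod (Fp \<phi> y) * (\<Prod>i\<in>S. (1 + (y $ of_nat i)\<^sup>2)) + cmod (Fp ?\<phi>2 y) * (\<Prod>i\<in>S. (1 + (y $ of_nat i)\<^sup>2))"
      using insert.hyps by (simp add: algebra_simps)
    then show ?thesis using C1(2)[of y] C2(2)[of y] by linarith
  qed
  then show ?case using C1(1) C2(1) by (intro exI[of _ "C1 + C2"]) auto
qed

text \<open>In the type \<open>3\<close> the numeral 3 equals 0, so the indices 0, 1, 2 of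
  \<open>test_fun\<close> reach every coordinate.\<close>

lemma UNIV_3': "(UNIV :: 3 set) = {0, 1, 2}"
  using UNIV_3 by auto

lemma prod_Basis_vec3: "(\<Prod>b\<in>Basis. f (y \<bullet> b)) = (\<Prod>i\<in>{0::nat, 1, 2}. f ((y::vec3) $ of_nat i))"
  for f :: "real \<Rightarrow> 'b::comm_monoid_mult"
proof -
  have B: "(Basis :: vec3 set) = (\<lambda>i. axis i 1) ` UNIV" by (auto simp: Basis_vec_def)
  have "(\<Prod>b\<in>Basis. f (y \<bullet> b)) = (\<Prod>i\<in>UNIV. f (y $ i))"
    unfolding B by (subst prod.reindex) (auto simp: inj_on_def axis_eq_axis inner_axis)
  also have "\<dots> = (\<Prod>i\<in>{0::nat, 1, 2}. f (y $ of_nat i))" unfolding UNIV_3' by simp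
  finally show ?thesis .
qed

text \<open>Quadratic decay in each of the three coordinates makes the transform integrable;
  inversion then returns \<open>\<phi>\<close> and with it all conditions of
  \<open>adm\<close>.\<close>

lemma test_fun_inv3:
  assumes t: "test_fun \<phi>"
  shows "integrable lborel (inv3 \<phi>)" "inv3 \<phi> \<in> L2 lborel" "AE x in lborel. ft3 (inv3 \<phi>) x = \<phi> x" "adm (inv3 \<phi>)"
proof -
  note [measurable] = test_fun_measurable[OF t]
  obtain C where C: "C \<ge> 0" "\<And>y. cmod (Fp \<phi> y) * (\<Prod>i\<in>{0, 1, 2}. (1 + (y $ of_nat i)\<^sup>2)) \<le> C"
    using test_fun_decay[of "{0, 1, 2}", OF _ _ t] by auto
  have b: "cmod (Fp \<phi> y) \<le> C * (\<Prod>b\<in>Basis. 1 / (1 + (y \<bullet> b)\<^sup>2))" for y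
  proof -
    have p: "0 < (\<Prod>i\<in>{0::nat, 1, 2}. (1 + (y $ of_nat i)\<^sup>2))" by (intro prod_pos) (simp add: add_pos_nonneg)
    have "(\<Prod>b\<in>Basis. 1 / (1 + (y \<bullet> b)\<^sup>2)) = 1 / (\<Prod>i\<in>{0::nat, 1, 2}. (1 + (y $ of_nat i)\<^sup>2))"
      unfolding prod_Basis_vec3[of "\<lambda>t. 1 / (1 + t\<^sup>2)"] by (simp only: prod_dividef prod.neutral_const)
    then show ?thesis using C(2)[of y] p by (simp only: mult_1_right times_divide_eq_right pos_le_divide_eq)
  qed
  have Fi: "integrable lborel (Fp \<phi>)"
  proof (rule Bochner_Integration.integrable_bound[OF integrable_mult_right[OF prod_decay_integrable, of C]])
    show "AE y in lborel. norm (Fp \<phi> y) \<le> norm (C * (\<Prod>b\<in>Basis. 1 / (1 + (y \<bullet> b)\<^sup>2)))"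
      using b by (auto intro: order_trans[OF _ abs_ge_self])
  qed measurable
  show i: "integrable lborel (inv3 \<phi>)" unfolding inv3_def using Fi by (rule integrable_divide)
  show L: "inv3 \<phi> \<in> L2 lborel" by (rule inv3_L2[OF test_fun_integrable[OF t]])
  show ae: "AE x in lborel. ft3 (inv3 \<phi>) x = \<phi> x" by (rule ft3_inv3[OF test_fun_integrable(1)[OF t] i])
  have fm: "ft3 (inv3 \<phi>) \<in> borel_measurable lborel" using ft3_measurable[of "inv3 \<phi>"] by simp
  have "AE x in lborel. \<phi> x = ft3 (inv3 \<phi>) x" using ae by eventually_elim simp
  then have "integrable lborel (ft3 (inv3 \<phi>))" "ft3 (inv3 \<phi>) \<in> L2 lborel"
    using integrable_cong_AE_imp[OF test_fun_integrable(1)[OF t] fm] ae L2_cong_AE[OF test_fun_integrable(2)[OF t] fm] by auto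
  then show "adm (inv3 \<phi>)" unfolding adm_def sq_int_iff using i L by simp
qed

text \<open>\<open>inv3 \<phi>\<close> is admissible in \<open>is_ft\<close> and its transform is
  \<open>\<phi>\<close> almost everywhere, so the defining formula applies to it.\<close>

lemma test_pairing:
  assumes ft: "is_ft f g" and t: "test_fun \<phi>"
  shows "(LINT x|lborel. f x * \<phi> x) = (LINT y|lborel. g y * inv3 \<phi> y)"
proof -
  note I = test_fun_inv3[OF t]
  have fL: "f \<in> L2 lborel" using ft by (simp add: is_ft_adm)
  note [measurable] = test_fun_measurable[OF t] L2_meas[OF fL]
  have [measurable]: "ft3 (inv3 \<phi>) \<in> borel_measurable borel" by (rule ft3_measurable) measurable
  have "(LINT x|lborel. f x * \<phi> x) = (LINT x|lborel. f x * ft3 (inv3 \<phi>) x)"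
    by (rule integral_cong_AE) (use I(3) in auto)
  then show ?thesis using ft I(4) by (simp add: is_ft_adm)
qed

text \<open>The Fourier multiplier of the operator that \<open>transport_weak\<close> describes, the
  derivative along \<open>qhat q\<close> plus multiplication by \<open>1 / q0 q\<close>.\<close>

definition symb :: "vec3 \<Rightarrow> vec3 \<Rightarrow> complex" where
  "symb q y = of_real (1 / q0 q) + \<i> * of_real (qhat q \<bullet> y)"

text \<open>Moving a derivative on to \<open>\<phi>\<close> changes its sign, and the inverse
  transform of \<open>partial i \<phi>\<close> carries the factor \<open>- \<i>\<close> times a
  coordinate of \<open>y\<close>; the two signs cancel in \<open>symb\<close>.\<close>

lemma weak_transport_symbol:
  assumes ft: "is_ft f g" and t: "test_fun \<phi>"
  shows "(LINT x|lborel. f x * (\<phi> x / complex_of_real (q0 q)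
            - (\<Sum>i\<in>{0::nat,1,2}. complex_of_real (qhat q $ of_nat i) * partial i \<phi> x)))
       = (LINT y|lborel. g y * (symb q y * inv3 \<phi> y))"
    and "(\<lambda>y. symb q y * inv3 \<phi> y) \<in> L2 lborel"
proof -
  have L: "f \<in> L2 lborel" "g \<in> L2 lborel" using ft by (auto simp: is_ft_adm)
  let ?a = "\<lambda>i::nat. complex_of_real (qhat q $ of_nat i)"
  have tp: "test_fun (partial i \<phi>)" if "i \<in> {0,1,2}" for i using test_fun_partial[OF t that] .
  have inner: "qhat q \<bullet> y = (\<Sum>i\<in>{0::nat,1,2}. qhat q $ of_nat i * y $ of_nat i)" for y
    unfolding inner_vec_def UNIV_3' by simp
  have m: "symb q y * inv3 \<phi> y = inv3 \<phi> y / complex_of_real (q0 q) - (\<Sum>i\<in>{0::nat,1,2}. ?a i * inv3 (partial i \<phi>) y)" for y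
  proof -
    have "(\<Sum>i\<in>{0::nat,1,2}. ?a i * inv3 (partial i \<phi>) y) = (\<Sum>i\<in>{0::nat,1,2}. - \<i> * inv3 \<phi> y * (?a i * of_real (y $ of_nat i)))"
      by (intro sum.cong refl) (simp add: inv3_def Fp_partial[OF t])
    also have "\<dots> = - \<i> * inv3 \<phi> y * of_real (qhat q \<bullet> y)"
      unfolding inner of_real_sum sum_distrib_left by simp
    finally show ?thesis by (simp add: symb_def algebra_simps)
  qed
  have iL: "(\<lambda>y. ?a i * inv3 (partial i \<phi>) y) \<in> L2 lborel" if "i \<in> {0,1,2}" for i
    by (intro L2_cmult test_fun_inv3 tp that)
  have c: "x / complex_of_real (q0 q) = of_real (1 / q0 q) * x" for x by simp
  show "(\<lambda>y. symb q y * inv3 \<phi> y) \<in> L2 lborel"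
    unfolding m c by (intro L2_diff L2_cmult L2_sum iL test_fun_inv3 t)
  have if1: "integrable lborel (\<lambda>x. f x * \<phi> x)" by (rule L2_mult_integrable[OF L(1) test_fun_integrable(2)[OF t]])
  have if2: "integrable lborel (\<lambda>x. f x * partial i \<phi> x)" if "i \<in> {0,1,2}" for i by (rule L2_mult_integrable[OF L(1) test_fun_integrable(2)[OF tp[OF that]]])
  have ig1: "integrable lborel (\<lambda>x. g x * inv3 \<phi> x)" by (rule L2_mult_integrable[OF L(2) test_fun_inv3(2)[OF t]])
  have ig2: "integrable lborel (\<lambda>x. g x * inv3 (partial i \<phi>) x)" if "i \<in> {0,1,2}" for i by (rule L2_mult_integrable[OF L(2) test_fun_inv3(2)[OF tp[OF that]]])
  have "(LINT x|lborel. f x * (\<phi> x / complex_of_real (q0 q) - (\<Sum>i\<in>{0::nat,1,2}. ?a i * partial i \<phi> x)))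
      = (LINT x|lborel. of_real (1 / q0 q) * (f x * \<phi> x) - (\<Sum>i\<in>{0::nat,1,2}. ?a i * (f x * partial i \<phi> x)))"
    by (intro Bochner_Integration.integral_cong refl) (simp add: algebra_simps sum_distrib_left)
  also have "\<dots> = (LINT x|lborel. of_real (1 / q0 q) * (f x * \<phi> x)) - (LINT x|lborel. (\<Sum>i\<in>{0::nat,1,2}. ?a i * (f x * partial i \<phi> x)))"
    by (intro Bochner_Integration.integral_diff integrable_mult_right if1 Bochner_Integration.integrable_sum if2)
  also have "(LINT x|lborel. (\<Sum>i\<in>{0::nat,1,2}. ?a i * (f x * partial i \<phi> x))) = (\<Sum>i\<in>{0::nat,1,2}. LINT x|lborel. ?a i * (f x * partial i \<phi> x))"
    by (intro Bochner_Integration.integral_sum integrable_mult_right if2)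
  also have "\<dots> = (\<Sum>i\<in>{0::nat,1,2}. LINT y|lborel. ?a i * (g y * inv3 (partial i \<phi>) y))"
    by (intro sum.cong refl) (simp only: integral_mult_right_zero test_pairing[OF ft tp])
  also have "\<dots> = (LINT y|lborel. (\<Sum>i\<in>{0::nat,1,2}. ?a i * (g y * inv3 (partial i \<phi>) y)))"
    by (intro Bochner_Integration.integral_sum[symmetric] integrable_mult_right ig2)
  also have "(LINT x|lborel. of_real (1 / q0 q) * (f x * \<phi> x)) = (LINT y|lborel. of_real (1 / q0 q) * (g y * inv3 \<phi> y))"
    by (simp only: integral_mult_right_zero test_pairing[OF ft t])
  also have "(LINT y|lborel. of_real (1 / q0 q) * (g y * inv3 \<phi> y)) - (LINT y|lborel. (\<Sum>i\<in>{0::nat,1,2}. ?a i * (g y * inv3 (partial i \<phi>) y)))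
    = (LINT y|lborel. of_real (1 / q0 q) * (g y * inv3 \<phi> y) - (\<Sum>i\<in>{0::nat,1,2}. ?a i * (g y * inv3 (partial i \<phi>) y)))"
    by (intro Bochner_Integration.integral_diff[symmetric] integrable_mult_right ig1 Bochner_Integration.integrable_sum ig2)
  also have "\<dots> = (LINT y|lborel. g y * (symb q y * inv3 \<phi> y))"
    unfolding m by (intro Bochner_Integration.integral_cong refl) (simp add: algebra_simps sum_distrib_left)
  finally show "(LINT x|lborel. f x * (\<phi> x / complex_of_real (q0 q)
            - (\<Sum>i\<in>{0::nat,1,2}. complex_of_real (qhat q $ of_nat i) * partial i \<phi> x)))
       = (LINT y|lborel. g y * (symb q y * inv3 \<phi> y))" .
qed

section \<open>A bump function and its dilations\<close>

text \<open>The polynomial in \<open>1 / s\<close> that accompanies \<open>exp (- (1 / s))\<close>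
  in its \<open>k\<close>-th derivative; the factor \<open>monom 1 2\<close> is the inner derivative
  of \<open>1 / s\<close> up to sign.\<close>

primrec bpoly :: "nat \<Rightarrow> real poly" where
  "bpoly 0 = 1"
| "bpoly (Suc k) = monom 1 2 * (bpoly k - pderiv (bpoly k))"

definition th :: "nat \<Rightarrow> real \<Rightarrow> real" where
  "th k s = (if s > 0 then poly (bpoly k) (1 / s) * exp (- (1 / s)) else 0)"

lemma poly_exp_tendsto_0: "((\<lambda>y. poly p y * exp (- y)) \<longlongrightarrow> 0) at_top" for p :: "real poly"
proof -
  have "((\<lambda>y. \<Sum>i\<le>degree p. coeff p i * (y ^ i / exp y)) \<longlongrightarrow> (\<Sum>i\<le>degree p. coeff p i * 0)) at_top"
    by (intro tendsto_intros tendsto_power_div_exp_0)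
  then show ?thesis by (simp add: poly_altdef exp_minus divide_inverse sum_distrib_right mult.assoc)
qed

text \<open>Only \<open>s = 0\<close> needs an argument: the quotient from the right is, in the
  variable \<open>1 / h\<close>, a polynomial times a decaying exponential.\<close>

lemma th_deriv: "(th k has_real_derivative th (Suc k) s) (at s)"
proof -
  consider "s > 0" | "s < 0" | "s = 0" by linarith
  then show ?thesis
  proof cases
    case 1
    have d: "((\<lambda>s. poly (bpoly k) (1 / s) * exp (- (1 / s))) has_real_derivative th (Suc k) s) (at s)"
      using 1 by (auto intro!: derivative_eq_intros DERIV_chain2[OF poly_DERIV] simp: th_def poly_monom field_simps power2_eq_square)
    have "eventually (\<lambda>s. s > 0) (nhds s)" using 1 by (intro eventually_nhds_in_open[where s="{0<..}", simplified]) auto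
    then have "eventually (\<lambda>s. th k s = poly (bpoly k) (1 / s) * exp (- (1 / s))) (nhds s)"
      by eventually_elim (simp add: th_def)
    from DERIV_cong_ev[OF refl this refl] show ?thesis using d by simp
  next
    case 2
    have "eventually (\<lambda>s. s < 0) (nhds s)" using 2 by (intro eventually_nhds_in_open[where s="{..<0}", simplified]) auto
    then have "eventually (\<lambda>s. th k s = 0) (nhds s)" by eventually_elim (simp add: th_def)
    then have "(th k has_real_derivative 0) (at s) \<longleftrightarrow> ((\<lambda>_. 0) has_real_derivative (0::real)) (at s)"
      by (intro DERIV_cong_ev refl)
    then show ?thesis using 2 by (simp add: th_def)
  next
    case 3
    have "((\<lambda>h. poly (bpoly k) (1 / h) * exp (- (1 / h)) * (1 / h)) \<longlongrightarrow> 0) (at_right 0)"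
    proof -
      have "((\<lambda>y. poly (bpoly k * [:0, 1:]) y * exp (- y)) \<longlongrightarrow> 0) at_top" by (rule poly_exp_tendsto_0)
      then have "((\<lambda>h. poly (bpoly k * [:0, 1:]) (inverse h) * exp (- inverse h)) \<longlongrightarrow> 0) (at_right 0)"
        by (rule filterlim_compose[OF _ filterlim_inverse_at_top_right])
      then show ?thesis by (simp add: inverse_eq_divide mult_ac)
    qed
    then have r: "((\<lambda>h. (th k (0 + h) - th k 0) / h) \<longlongrightarrow> 0) (at_right 0)"
    proof (rule Lim_transform_eventually)
      have "eventually (\<lambda>h::real. h > 0) (at_right 0)" by (rule eventually_at_right_less)
      then show "\<forall>\<^sub>F h in at_right 0. poly (bpoly k) (1 / h) * exp (- (1 / h)) * (1 / h) = (th k (0 + h) - th k 0) / h"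
        by eventually_elim (simp add: th_def)
    qed
    have l: "((\<lambda>h. (th k (0 + h) - th k 0) / h) \<longlongrightarrow> 0) (at_left 0)"
    proof (rule tendsto_eventually)
      have "eventually (\<lambda>h::real. h < 0) (at_left 0)" by (simp add: eventually_at_filter)
      then show "\<forall>\<^sub>F h in at_left 0. (th k (0 + h) - th k 0) / h = 0" by eventually_elim (simp add: th_def)
    qed
    have "((\<lambda>h. (th k (0 + h) - th k 0) / h) \<longlongrightarrow> 0) (at 0)" using l r by (rule filterlim_split_at)
    then show ?thesis using 3 by (simp add: DERIV_def th_def)
  qed
qed

text \<open>\<open>leib k a b\<close> is the \<open>k\<close>-th derivative of \<open>f a * g b\<close> for families \<open>f\<close>, \<open>g\<close> of successive derivatives;
  expanding the product rule this way avoids binomial coefficients.\<close>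

fun leib :: "(nat \<Rightarrow> real \<Rightarrow> real) \<Rightarrow> (nat \<Rightarrow> real \<Rightarrow> real) \<Rightarrow> nat \<Rightarrow> nat \<Rightarrow> nat \<Rightarrow> real \<Rightarrow> real" where
  "leib f g 0 a b s = f a s * g b s"
| "leib f g (Suc k) a b s = leib f g k (Suc a) b s + leib f g k a (Suc b) s"

lemma leib_deriv:
  assumes "\<And>k s. (f k has_real_derivative f (Suc k) s) (at s)" "\<And>k s. (g k has_real_derivative g (Suc k) s) (at s)"
  shows "(leib f g k a b has_real_derivative leib f g (Suc k) a b s) (at s)"
proof (induction k arbitrary: a b)
  case 0
  have "((\<lambda>s. f a s * g b s) has_real_derivative f (Suc a) s * g b s + f a s * g (Suc b) s) (at s)"
    by (rule derivative_eq_intros assms refl | simp)+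
  then show ?case by (simp add: fun_eq_iff[symmetric])
next
  case (Suc k)
  have "((\<lambda>s. leib f g k (Suc a) b s + leib f g k a (Suc b) s) has_real_derivative leib f g (Suc k) (Suc a) b s + leib f g (Suc k) a (Suc b) s) (at s)"
    by (rule DERIV_add[OF Suc Suc])
  then show ?case by simp
qed

text \<open>The \<open>k\<close>-th derivative of \<open>th 0 (1 + s) * th 0 (1 - s)\<close>, which
  vanishes outside the unit interval around 0; the powers of \<open>- 1\<close> come from the inner
  derivative of \<open>1 - s\<close>.\<close>

definition bump :: "nat \<Rightarrow> real \<Rightarrow> real" where
  "bump k = leib (\<lambda>k s. th k (1 + s)) (\<lambda>k s. (- 1) ^ k * th k (1 - s)) k 0 0"

lemma bump_deriv: "(bump k has_real_derivative bump (Suc k) s) (at s)"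
  unfolding bump_def
proof (rule leib_deriv)
  fix k s
  show "((\<lambda>s. th k (1 + s)) has_real_derivative th (Suc k) (1 + s)) (at s)"
    by (rule DERIV_chain2[OF th_deriv, THEN DERIV_cong]) (auto intro!: derivative_eq_intros)
  have "((\<lambda>s. th k (1 - s)) has_real_derivative - th (Suc k) (1 - s)) (at s)"
    by (rule DERIV_chain2[OF th_deriv, THEN DERIV_cong]) (auto intro!: derivative_eq_intros)
  from DERIV_cmult[OF this, of "(- 1) ^ k"]
  show "((\<lambda>s. (- 1) ^ k * th k (1 - s)) has_real_derivative (- 1) ^ Suc k * th (Suc k) (1 - s)) (at s)" by simp
qed

lemma bump_0: "bump 0 s = th 0 (1 + s) * th 0 (1 - s)" by (simp add: bump_def)

lemma bump_pos: "\<bar>s\<bar> < 1 \<Longrightarrow> bump 0 s > 0" by (auto simp: bump_0 th_def)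
lemma bump_nonneg: "bump 0 s \<ge> 0" by (auto simp: bump_0 th_def)
lemma bump_outside: "\<bar>s\<bar> \<ge> 1 \<Longrightarrow> bump 0 s = 0" by (auto simp: bump_0 th_def)

text \<open>A product of one-dimensional bumps, centred at \<open>a\<close> and contracted by
  \<open>r\<close>, with \<open>k0\<close>, \<open>k1\<close>, \<open>k2\<close> derivatives taken
  along the axes; the power of \<open>r\<close> is due to the chain rule.\<close>

definition bump3 :: "real \<Rightarrow> vec3 \<Rightarrow> nat \<Rightarrow> nat \<Rightarrow> nat \<Rightarrow> vec3 \<Rightarrow> complex" where
  "bump3 r a k0 k1 k2 x = of_real (r ^ (k0 + k1 + k2) *
     (bump k0 (r * (x $ 0 - a $ 0)) * bump k1 (r * (x $ 1 - a $ 1)) * bump k2 (r * (x $ 2 - a $ 2))))"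

lemma bump3_partial:
  "((\<lambda>t. bump3 r a k0 k1 k2 (x + t *\<^sub>R axis 0 1)) has_vector_derivative bump3 r a (Suc k0) k1 k2 x) (at 0)"
  "((\<lambda>t. bump3 r a k0 k1 k2 (x + t *\<^sub>R axis 1 1)) has_vector_derivative bump3 r a k0 (Suc k1) k2 x) (at 0)"
  "((\<lambda>t. bump3 r a k0 k1 k2 (x + t *\<^sub>R axis 2 1)) has_vector_derivative bump3 r a k0 k1 (Suc k2) x) (at 0)"
proof -
  have d: "((\<lambda>t. bump k (r * (y + t - b))) has_real_derivative r * bump (Suc k) (r * (y - b))) (at 0)" for k y b
    by (rule DERIV_chain2[OF bump_deriv, THEN DERIV_cong]) (auto intro!: derivative_eq_intros)
  have ne: "(0::3) \<noteq> 1" "(0::3) \<noteq> 2" "(1::3) \<noteq> 2" by simp_all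
  have 1: "((\<lambda>t. complex_of_real (c1 * ((bump k (r * (y + t - b))) * c2))) has_vector_derivative
     of_real (c1 * (r * bump (Suc k) (r * (y - b)) * c2))) (at 0)" for c1 c2 k y b
    by (intro has_vector_derivative_of_real) (auto intro!: derivative_eq_intros d)
  show "((\<lambda>t. bump3 r a k0 k1 k2 (x + t *\<^sub>R axis 0 1)) has_vector_derivative bump3 r a (Suc k0) k1 k2 x) (at 0)"
    using 1[of "r ^ (k0 + k1 + k2)" k0 "x $ 0" "a $ 0" "bump k1 (r * (x $ 1 - a $ 1)) * bump k2 (r * (x $ 2 - a $ 2))"] ne
    by (simp add: bump3_def axis_def mult_ac del: of_real_mult of_real_power)
  show "((\<lambda>t. bump3 r a k0 k1 k2 (x + t *\<^sub>R axis 1 1)) has_vector_derivative bump3 r a k0 (Suc k1) k2 x) (at 0)"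
    using 1[of "r ^ (k0 + k1 + k2)" k1 "x $ 1" "a $ 1" "bump k0 (r * (x $ 0 - a $ 0)) * bump k2 (r * (x $ 2 - a $ 2))"] ne
    by (simp add: bump3_def axis_def mult_ac del: of_real_mult of_real_power)
  show "((\<lambda>t. bump3 r a k0 k1 k2 (x + t *\<^sub>R axis 2 1)) has_vector_derivative bump3 r a k0 k1 (Suc k2) x) (at 0)"
    using 1[of "r ^ (k0 + k1 + k2)" k2 "x $ 2" "a $ 2" "bump k0 (r * (x $ 0 - a $ 0)) * bump k1 (r * (x $ 1 - a $ 1))"] ne
    by (simp add: bump3_def axis_def mult_ac del: of_real_mult of_real_power)
qed

lemma bump3_iter:
  assumes "set is \<subseteq> {0, 1, 2}"
  shows "iter_partial is (bump3 r a 0 0 0) = bump3 r a (count_list is 0) (count_list is 1) (count_list is 2)"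
  using assms
proof (induction "is")
  case (Cons i "is")
  then have IH: "iter_partial is (bump3 r a 0 0 0) = bump3 r a (count_list is 0) (count_list is 1) (count_list is 2)" and i: "i \<in> {0, 1, 2}"
    by auto
  show ?case unfolding iter_partial.simps IH
  proof
    fix x
    show "partial i (bump3 r a (count_list is 0) (count_list is 1) (count_list is 2)) x
       = bump3 r a (count_list (i # is) 0) (count_list (i # is) 1) (count_list (i # is) 2) x"
      using i vector_derivative_at[OF bump3_partial(1)] vector_derivative_at[OF bump3_partial(2)] vector_derivative_at[OF bump3_partial(3)]
      by (auto simp: partial_def)
  qed
qed simp

lemma bump_continuous: "continuous_on UNIV (bump k)"
  by (auto simp: continuous_on_eq_continuous_at intro: DERIV_isCont[OF bump_deriv])

lemma bump3_test: assumes r: "r > 0" shows "test_fun (bump3 r a 0 0 0)"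
  unfolding test_fun_def
proof (intro conjI allI impI ballI)
  fix "is" :: "nat list" assume s: "set is \<subseteq> {0, 1, 2}"
  show "continuous_on UNIV (iter_partial is (bump3 r a 0 0 0))"
    unfolding bump3_iter[OF s] unfolding bump3_def
    by (intro continuous_intros continuous_on_compose2[OF bump_continuous]) auto
  fix i x assume i: "i \<in> {0::nat, 1, 2}"
  then have s': "set (i # is) \<subseteq> {0, 1, 2}" using s by auto
  show "((\<lambda>t. iter_partial is (bump3 r a 0 0 0) (x + t *\<^sub>R axis (of_nat i) 1)) has_vector_derivative iter_partial (i # is) (bump3 r a 0 0 0) x) (at 0)"
    unfolding bump3_iter[OF s] bump3_iter[OF s'] using i bump3_partial by auto
next
  \<comment> \<open>The support lies in a cube of half side \<open>1 / r\<close> around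
    \<open>a\<close>, whose points are within \<open>3 / r\<close> of \<open>a\<close> by the
    estimate of the norm through the sum of coordinates.\<close>
  have "bump3 r a 0 0 0 x = 0" if x: "norm x > norm a + 3 / r" for x
  proof (rule ccontr)
    assume nz: "bump3 r a 0 0 0 x \<noteq> 0"
    have "\<bar>x $ i - a $ i\<bar> < 1 / r" for i
    proof -
      have "\<bar>r * (x $ i - a $ i)\<bar> < 1" if "bump 0 (r * (x $ i - a $ i)) \<noteq> 0" for i using that bump_outside by (meson not_less)
      then have "\<bar>r * (x $ i - a $ i)\<bar> < 1" if "i \<in> {0,1,2}" using that nz by (auto simp: bump3_def)
      then have "\<bar>r * (x $ i - a $ i)\<bar> < 1" using UNIV_3' by auto
      then have "r * \<bar>x $ i - a $ i\<bar> < 1" unfolding abs_mult using r by simp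
      then show ?thesis using r by (simp add: pos_less_divide_eq mult.commute)
    qed
    then have "(\<Sum>i\<in>UNIV. \<bar>(x - a) $ i\<bar>) \<le> (\<Sum>i\<in>(UNIV::3 set). 1 / r)" by (intro sum_mono) (simp add: less_imp_le)
    then have "norm (x - a) \<le> 3 / r" using norm_le_l1_cart[of "x - a"] by simp
    then show False using x norm_triangle_ineq2[of x a] by linarith
  qed
  then show "\<exists>R. \<forall>x. R < norm x \<longrightarrow> bump3 r a 0 0 0 x = 0" by blast
qed

lemma Fp_bump3: assumes r: "r > 0"
  shows "Fp (bump3 r a 0 0 0) y = of_real ((1 / r) ^ 3) * cis (y \<bullet> a) * Fp (bump3 1 0 0 0 0) ((1 / r) *\<^sub>R y)"
proof -
  note [measurable] = test_fun_measurable[OF bump3_test[OF r, of a]] test_fun_measurable[OF bump3_test[OF zero_less_one, of 0]]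
  have "Fp (bump3 r a 0 0 0) y = (LINT x|lborel. cis (y \<bullet> (x + a)) * bump3 r a 0 0 0 (x + a))"
    unfolding Fp_def by (rule lborel_translate(2)[symmetric]) measurable
  also have "\<dots> = \<bar>1 / r\<bar> ^ 3 *\<^sub>R (LINT x|lborel. cis (y \<bullet> ((1 / r) *\<^sub>R x + a)) * bump3 r a 0 0 0 ((1 / r) *\<^sub>R x + a))"
    by (rule lborel_scale(2)) (use r in auto)
  also have "(LINT x|lborel. cis (y \<bullet> ((1 / r) *\<^sub>R x + a)) * bump3 r a 0 0 0 ((1 / r) *\<^sub>R x + a))
     = (LINT x|lborel. cis (y \<bullet> a) * (cis (((1 / r) *\<^sub>R y) \<bullet> x) * bump3 1 0 0 0 0 x))"
    using r by (intro Bochner_Integration.integral_cong refl) (simp add: bump3_def inner_add_right cis_mult[symmetric] mult_ac)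
  also have "\<dots> = cis (y \<bullet> a) * Fp (bump3 1 0 0 0 0) ((1 / r) *\<^sub>R y)" unfolding Fp_def by simp
  finally show ?thesis using r by (simp add: scaleR_conv_of_real mult_ac)
qed

lemma Fp_bump3_0: "Fp (bump3 1 0 0 0 0) 0 \<noteq> 0"
proof -
  define b where "b x = bump 0 (x $ 0) * bump 0 (x $ 1) * bump 0 (x $ 2)" for x :: vec3
  have B: "bump3 1 0 0 0 0 x = of_real (b x)" for x by (simp add: bump3_def b_def)
  have bi: "integrable lborel b"
    using test_fun_integrable(1)[OF bump3_test[OF zero_less_one, of 0]] unfolding B[abs_def] complex_of_real_integrable_eq .
  have b0: "b x \<ge> 0" for x by (simp add: b_def bump_nonneg)
  have "(LINT x|lborel. b x) \<noteq> 0"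
  proof
    assume "(LINT x|lborel. b x) = 0"
    then have ae: "AE x in lborel. b x = 0" using integral_nonneg_eq_0_iff_AE[OF bi] b0 by auto
    have "AE x in lborel. x \<notin> ball (0::vec3) 1"
      using ae
    proof eventually_elim
      case (elim x)
      show ?case
      proof
        assume "x \<in> ball 0 1"
        then have "\<bar>x $ i\<bar> < 1" for i using component_le_norm_cart[of x i] by (simp add: le_less_trans)
        then have "b x > 0" unfolding b_def by (intro mult_pos_pos bump_pos)
        then show False using elim by simp
      qed
    qed
    then have "emeasure lborel (ball (0::vec3) 1) = 0" by (subst (asm) AE_iff_null_sets[symmetric]) auto
    moreover have "emeasure lborel (ball (0::vec3) 1) > 0" by (subst emeasure_ball) auto
    ultimately show False by simp
  qed
  moreover have "Fp (bump3 1 0 0 0 0) 0 = of_real (LINT x|lborel. b x)" unfolding Fp_def B by simp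
  ultimately show ?thesis by simp
qed

lemma Fp_continuous: assumes u: "integrable lborel u" shows "(\<lambda>n. Fp u ((1 / real (Suc n)) *\<^sub>R y)) \<longlonglongrightarrow> Fp u 0"
  unfolding Fp_def
proof (rule integral_dominated_convergence[where w="\<lambda>x. cmod (u x)"])
  note [measurable] = borel_measurable_integrable[OF u]
  show "(\<lambda>x. cis (0 \<bullet> x) * u x) \<in> borel_measurable lborel" by measurable
  show "(\<lambda>x. cis (((1 / real (Suc n)) *\<^sub>R y) \<bullet> x) * u x) \<in> borel_measurable lborel" for n by measurable
  show "AE x in lborel. (\<lambda>n. cis (((1 / real (Suc n)) *\<^sub>R y) \<bullet> x) * u x) \<longlonglongrightarrow> cis (0 \<bullet> x) * u x"
  proof (rule AE_I2)
    fix x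
    have "(\<lambda>n. cis ((1 / real (Suc n)) * (y \<bullet> x))) \<longlonglongrightarrow> cis (0 * (y \<bullet> x))"
      unfolding cis_conv_exp by (intro tendsto_intros LIMSEQ_Suc[OF lim_1_over_n])
    from tendsto_mult[OF this tendsto_const[of "u x"]]
    show "(\<lambda>n. cis (((1 / real (Suc n)) *\<^sub>R y) \<bullet> x) * u x) \<longlonglongrightarrow> cis (0 \<bullet> x) * u x" by simp
  qed
qed (use u in \<open>auto simp: norm_mult\<close>)

text \<open>Translating the test function multiplies its transform by a character, so the transform of \<open>H * inv3 \<phi>\<close> vanishes;
  dilating it makes the transform nonzero at any given point.\<close>

lemma test_fun_separation:
  fixes H :: "vec3 \<Rightarrow> complex"
  assumes [measurable]: "H \<in> borel_measurable borel"
    and i: "\<And>\<phi>. test_fun \<phi> \<Longrightarrow> integrable lborel (\<lambda>y. H y * inv3 \<phi> y)"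
    and z: "\<And>\<phi>. test_fun \<phi> \<Longrightarrow> (LINT y|lborel. H y * inv3 \<phi> y) = 0"
  shows "AE y in lborel. H y = 0"
proof -
  define u where "u r y = H y * Fp (bump3 1 0 0 0 0) ((1 / r) *\<^sub>R y)" for r and y :: vec3
  have P0: "(2 * pi) ^ 3 \<noteq> 0" by simp
  have B: "inv3 (bump3 r a 0 0 0) y = of_real ((1 / r) ^ 3 / (2 * pi) ^ 3) * (cis (a \<bullet> y) * Fp (bump3 1 0 0 0 0) ((1 / r) *\<^sub>R y))" if "r > 0" for r a y
    unfolding inv3_def Fp_bump3[OF that] by (simp add: inner_commute)
  have ui: "integrable lborel (u r)" if r: "r > 0" for r
  proof -
    have "integrable lborel (\<lambda>y. of_real (r ^ 3 * (2 * pi) ^ 3) * (H y * inv3 (bump3 r 0 0 0 0) y))"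
      by (intro integrable_mult_right i bump3_test r)
    moreover have "of_real (r ^ 3 * (2 * pi) ^ 3) * (H y * inv3 (bump3 r 0 0 0 0) y) = u r y" for y
      unfolding B[OF r] u_def using r by (simp add: power_divide)
    ultimately show ?thesis by simp
  qed
  have Fu: "Fp (u r) a = 0" if r: "r > 0" for r a
  proof -
    have "Fp (u r) a = (LINT y|lborel. of_real (r ^ 3 * (2 * pi) ^ 3) * (H y * inv3 (bump3 r a 0 0 0) y))"
      unfolding Fp_def B[OF r] u_def using r by (intro Bochner_Integration.integral_cong refl) (simp add: power_divide)
    also have "\<dots> = 0" using z[OF bump3_test[OF r, of a]] by simp
    finally show ?thesis .
  qed
  have "AE y in lborel. u r y = 0" if r: "r > 0" for r
  proof (rule gauss_separation)
    show "u r \<in> borel_measurable borel" using borel_measurable_integrable[OF ui[OF r]] by simp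
    show "integrable lborel (\<lambda>x. u r x * of_real (gk 1 x))"
      by (rule Bochner_Integration.integrable_bound[OF ui[OF r]])
         (use borel_measurable_integrable[OF ui[OF r]] gk_le_1[of 1] in \<open>auto simp: norm_mult intro!: mult_left_le\<close>)
    fix e :: real and z assume e: "e > 0"
    have "(LINT x|lborel. u r x * gt e z x) = (LINT x|lborel. u r x * ft3 (gm e z) x)" by (simp only: ft3_gm[OF e])
    also have "\<dots> = (LINT x|lborel. ft3 (u r) x * gm e z x)" by (rule ft3_mult_formula[OF ui[OF r] gm_integrable[OF e], symmetric])
    also have "\<dots> = 0" unfolding ft3_eq Fu[OF r] by simp
    finally show "(LINT x|lborel. u r x * of_real (gk e (x - z))) = 0" by (simp add: gt_def)
  qed
  then have "AE y in lborel. \<forall>n. u (real (Suc n)) y = 0" by (subst AE_all_countable) simp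
  then show ?thesis
  proof eventually_elim
    case (elim y)
    have "eventually (\<lambda>n. Fp (bump3 1 0 0 0 0) ((1 / real (Suc n)) *\<^sub>R y) \<noteq> 0) sequentially"
      using Fp_continuous[OF test_fun_integrable(1)[OF bump3_test[OF zero_less_one]]] Fp_bump3_0 tendsto_imp_eventually_ne by blast
    then obtain n where "Fp (bump3 1 0 0 0 0) ((1 / real (Suc n)) *\<^sub>R y) \<noteq> 0" by (auto simp: eventually_sequentially)
    then show ?case using elim[rule_format, of n] by (simp add: u_def)
  qed
qed

text \<open>The product of the unbounded symbol with \<open>g\<close> is not known to be square
  integrable, so \<open>h - symb q * g\<close> is treated with \<open>test_fun_separation\<close>,
  which asks only for measurability and integrability against the
  \<open>inv3 \<phi>\<close>.\<close>

lemma transport_section: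
  assumes f: "is_ft f g" and w: "is_ft w h"
  shows "(\<forall>\<phi>. test_fun \<phi> \<longrightarrow> (LINT x|lborel. w x * \<phi> x) = (LINT x|lborel. f x * (\<phi> x / complex_of_real (q0 q)
            - (\<Sum>i\<in>{0::nat,1,2}. complex_of_real (qhat q $ of_nat i) * partial i \<phi> x))))
     \<longleftrightarrow> (AE y in lborel. h y = symb q y * g y)" (is "?L \<longleftrightarrow> ?R")
proof -
  have L: "g \<in> L2 lborel" "h \<in> L2 lborel" using f w by (auto simp: is_ft_adm)
  note [measurable] = L2_meas[OF L(1)] L2_meas[OF L(2)]
  have [measurable]: "symb q \<in> borel_measurable borel" unfolding symb_def by measurable
  have ih: "integrable lborel (\<lambda>y. h y * inv3 \<phi> y)" if "test_fun \<phi>" for \<phi> by (rule L2_mult_integrable[OF L(2) test_fun_inv3(2)[OF that]])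
  have ig: "integrable lborel (\<lambda>y. g y * (symb q y * inv3 \<phi> y))" if "test_fun \<phi>" for \<phi> by (rule L2_mult_integrable[OF L(1) weak_transport_symbol(2)[OF f that]])
  have eq: "?L \<longleftrightarrow> (\<forall>\<phi>. test_fun \<phi> \<longrightarrow> (LINT y|lborel. h y * inv3 \<phi> y) = (LINT y|lborel. g y * (symb q y * inv3 \<phi> y)))"
    by (simp only: weak_transport_symbol(1)[OF f] test_pairing[OF w] cong: imp_cong)
  show ?thesis
  proof
    assume ?R
    show ?L unfolding eq
    proof (intro allI impI integral_cong_AE)
      fix \<phi> assume t: "test_fun \<phi>"
      note [measurable] = test_fun_measurable[OF t]
      show "(\<lambda>y. h y * inv3 \<phi> y) \<in> borel_measurable lborel" "(\<lambda>y. g y * (symb q y * inv3 \<phi> y)) \<in> borel_measurable lborel" by measurable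
      show "AE y in lborel. h y * inv3 \<phi> y = g y * (symb q y * inv3 \<phi> y)" using \<open>?R\<close> by eventually_elim simp
    qed
  next
    assume ?L
    have "AE y in lborel. h y - symb q y * g y = 0"
    proof (rule test_fun_separation)
      fix \<phi> assume t: "test_fun \<phi>"
      have e: "(h y - symb q y * g y) * inv3 \<phi> y = h y * inv3 \<phi> y - g y * (symb q y * inv3 \<phi> y)" for y by (simp add: algebra_simps)
      show "integrable lborel (\<lambda>y. (h y - symb q y * g y) * inv3 \<phi> y)" unfolding e using ih[OF t] ig[OF t] by simp
      show "(LINT y|lborel. (h y - symb q y * g y) * inv3 \<phi> y) = 0"
        unfolding e Bochner_Integration.integral_diff[OF ih[OF t] ig[OF t]] using \<open>?L\<close> t unfolding eq by simp
    qed measurable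
    then show ?R by eventually_elim simp
  qed
qed

section \<open>Uniqueness of a semigroup with a given generator\<close>

text \<open>For \<open>e > 0\<close> the set of times with \<open>\<phi> s \<le> e * s\<close> is
  compact and contains 0. At its maximum the condition on increments would allow a further step,
  unless the maximum is \<open>t\<close>.\<close>

lemma continuous_small_increments:
  fixes \<phi> :: "real \<Rightarrow> real"
  assumes t: "0 \<le> t" and c: "continuous_on {0..t} \<phi>" and 0: "\<phi> 0 \<le> 0"
    and inc: "\<And>s e. 0 \<le> s \<Longrightarrow> s < t \<Longrightarrow> e > 0 \<Longrightarrow> \<exists>\<eta>>0. \<forall>h. 0 < h \<and> h < \<eta> \<longrightarrow> \<phi> (s + h) \<le> \<phi> s + e * h"
  shows "\<phi> t \<le> 0"
proof -
  have bound: "\<phi> t \<le> e * t" if e: "e > 0" for e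
  proof -
    define Z where "Z = {s \<in> {0..t}. \<phi> s - e * s \<le> 0}"
    have "closed Z" unfolding Z_def
      by (intro continuous_on_closed_Collect_le continuous_intros c closed_atLeastAtMost)
    moreover have "bounded Z" by (rule bounded_subset[of "{0..t}"]) (auto simp: Z_def)
    ultimately have "compact Z" by (simp add: compact_eq_bounded_closed)
    moreover have "0 \<in> Z" using t 0 by (simp add: Z_def)
    ultimately obtain s where s: "s \<in> Z" "\<And>r. r \<in> Z \<Longrightarrow> r \<le> s" using compact_attains_sup[of Z] by blast
    have "s = t"
    proof (rule ccontr)
      assume "s \<noteq> t"
      then have st: "0 \<le> s" "s < t" using s(1) by (auto simp: Z_def)
      obtain \<eta> where \<eta>: "\<eta> > 0" "\<And>h. 0 < h \<Longrightarrow> h < \<eta> \<Longrightarrow> \<phi> (s + h) \<le> \<phi> s + e * h" using inc[OF st e] by blast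
      define h where "h = min (\<eta> / 2) (t - s)"
      have h: "0 < h" "h < \<eta>" "s + h \<le> t" using \<eta> st by (auto simp: h_def)
      have "\<phi> (s + h) - e * (s + h) \<le> 0" using \<eta>(2)[OF h(1,2)] s(1) by (simp add: Z_def algebra_simps)
      then have "s + h \<in> Z" using h st by (auto simp: Z_def)
      then show False using s(2)[of "s + h"] h by simp
    qed
    then show ?thesis using s(1) by (simp add: Z_def)
  qed
  show ?thesis
  proof (rule field_le_epsilon)
    fix e :: real assume e: "e > 0"
    \<comment> \<open>The denominator \<open>t + 1\<close> is positive also for
      \<open>t = 0\<close>.\<close>
    have "\<phi> t \<le> e / (t + 1) * t" by (rule bound) (use e t in simp)
    also have "\<dots> \<le> e" using e t by (simp add: divide_simps)
    finally show "\<phi> t \<le> 0 + e" by simp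
  qed
qed

lemma at_right_0_D:
  fixes f :: "real \<Rightarrow> real"
  assumes "(f \<longlongrightarrow> (0::real)) (at_right 0)" "e > 0"
  shows "\<exists>\<eta>>0. \<forall>h. 0 < h \<and> h < \<eta> \<longrightarrow> f h < e"
proof -
  have "\<exists>b>0. \<forall>y>0. y < b \<longrightarrow> f y < e"
    using order_tendstoD(2)[OF assms] unfolding eventually_at_right_field .
  then show ?thesis by auto
qed

text \<open>Functions stand for their classes, so every identity is asserted up to norm zero. The
  bound in \<open>Sb\<close> depends on the time, with no uniformity assumed.\<close>

locale L2_semigroup =
  fixes N :: "'a measure" and S :: "real \<Rightarrow> ('a \<Rightarrow> complex) \<Rightarrow> 'a \<Rightarrow> complex"
  assumes SL: "t \<ge> 0 \<Longrightarrow> u \<in> L2 N \<Longrightarrow> S t u \<in> L2 N"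
    and Sb: "t \<ge> 0 \<Longrightarrow> \<exists>C. \<forall>u\<in>L2 N. nrm N (S t u) \<le> C * nrm N u"
    and Slin: "t \<ge> 0 \<Longrightarrow> u \<in> L2 N \<Longrightarrow> v \<in> L2 N \<Longrightarrow> nrm N (\<lambda>x. S t (\<lambda>x. a * u x + b * v x) x - (a * S t u x + b * S t v x)) = 0"
    and S0: "u \<in> L2 N \<Longrightarrow> nrm N (\<lambda>x. S 0 u x - u x) = 0"
    and Sadd: "s \<ge> 0 \<Longrightarrow> t \<ge> 0 \<Longrightarrow> u \<in> L2 N \<Longrightarrow> nrm N (\<lambda>x. S (s + t) u x - S s (S t u) x) = 0"
    and Scont: "u \<in> L2 N \<Longrightarrow> ((\<lambda>t. nrm N (\<lambda>x. S t u x - u x)) \<longlongrightarrow> 0) (at_right 0)"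
begin

lemma lin_nrm:
  assumes "t \<ge> 0" "u \<in> L2 N" "v \<in> L2 N" "w \<in> L2 N"
  shows "nrm N (\<lambda>x. S t (\<lambda>x. a * u x + b * v x) x - w x) = nrm N (\<lambda>x. (a * S t u x + b * S t v x) - w x)"
proof -
  let ?p = "S t (\<lambda>x. a * u x + b * v x)" and ?q = "\<lambda>x. a * S t u x + b * S t v x"
  have L: "?p \<in> L2 N" "?q \<in> L2 N" using assms by (auto intro!: SL L2_add L2_cmult)
  have z: "nrm N (\<lambda>x. ?p x - ?q x) = 0" by (rule Slin[OF assms(1-3)])
  have "nrm N (\<lambda>x. ?p x - w x) \<le> nrm N (\<lambda>x. ?q x - w x)" using nrm_triangle3[OF L(1) L(2) assms(4)] z by simp
  moreover have "nrm N (\<lambda>x. ?q x - w x) \<le> nrm N (\<lambda>x. ?p x - w x)"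
    using nrm_triangle3[OF L(2) L(1) assms(4)] z nrm_minus_commute[of N ?p ?q] by simp
  ultimately show ?thesis by simp
qed

lemma diff_bound:
  assumes "t \<ge> 0" "u \<in> L2 N" "v \<in> L2 N" and C: "\<And>u. u \<in> L2 N \<Longrightarrow> nrm N (S t u) \<le> C * nrm N u"
  shows "nrm N (\<lambda>x. S t u x - S t v x) \<le> C * nrm N (\<lambda>x. u x - v x)"
  using lin_nrm[OF assms(1-3) L2_zero, of 1 "-1"] C[OF L2_diff[OF assms(2,3)]] by simp

lemma add_nrm:
  assumes "s \<ge> 0" "t \<ge> 0" "u \<in> L2 N" "w \<in> L2 N"
  shows "nrm N (\<lambda>x. S (s + t) u x - w x) = nrm N (\<lambda>x. S s (S t u) x - w x)"
proof -
  have L: "S (s + t) u \<in> L2 N" "S s (S t u) \<in> L2 N" using assms by (auto intro!: SL)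
  have z: "nrm N (\<lambda>x. S (s + t) u x - S s (S t u) x) = 0" by (rule Sadd[OF assms(1-3)])
  have "nrm N (\<lambda>x. S (s + t) u x - w x) \<le> nrm N (\<lambda>x. S s (S t u) x - w x)" using nrm_triangle3[OF L(1) L(2) assms(4)] z by simp
  moreover have "nrm N (\<lambda>x. S s (S t u) x - w x) \<le> nrm N (\<lambda>x. S (s + t) u x - w x)"
    using nrm_triangle3[OF L(2) L(1) assms(4)] z nrm_minus_commute[of N "S (s + t) u" "S s (S t u)"] by simp
  ultimately show ?thesis by simp
qed

text \<open>Uniform boundedness near 0 by a gliding hump. The increments \<open>v k\<close> are chosen so large for \<open>S (h k)\<close> that
  they dominate the contribution of the previous ones, which is controlled by strong continuity, and so small that the
  later ones contribute at most 1 to \<open>S (h k)\<close>.\<close>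

lemma locally_bounded: "\<exists>\<delta>>0. \<exists>K\<ge>1. \<forall>h u. 0 \<le> h \<and> h \<le> \<delta> \<and> u \<in> L2 N \<longrightarrow> nrm N (S h u) \<le> K * nrm N u"
proof (rule ccontr)
  assume neg: "\<not> ?thesis"
  have bad: "\<exists>h u. 0 \<le> h \<and> h \<le> \<delta> \<and> u \<in> L2 N \<and> nrm N (S h u) > K * nrm N u" if "\<delta> > 0" "K \<ge> 1" for \<delta> K
    using neg that by (meson not_le)
  \<comment> \<open>A state is a pair of the current sum and a bound for the norm of the next
    increment; \<open>v\<close>, \<open>h\<close> and \<open>C\<close> are that increment, a time at
    which it becomes large and a norm bound of \<open>S h\<close>.\<close>
  define Q where "Q k s s' v h C \<longleftrightarrow> v \<in> L2 N \<and> nrm N v \<le> snd s \<and> 0 \<le> h \<and> h \<le> 1 / real (Suc k)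
     \<and> nrm N (S h (fst s)) \<le> nrm N (fst s) + 1 \<and> real k + nrm N (fst s) + 2 \<le> nrm N (S h v) \<and> 0 \<le> C
     \<and> (\<forall>u\<in>L2 N. nrm N (S h u) \<le> C * nrm N u) \<and> fst s' = (\<lambda>x. fst s x + v x) \<and> snd s' = min (snd s / 2) (1 / (2 * (C + 1)))"
    for k :: nat and s s' :: "('a \<Rightarrow> complex) \<times> real" and v h C
  have step: "\<exists>s'. (fst s' \<in> L2 N \<and> 0 < snd s' \<and> snd s' \<le> (1/2) ^ Suc k) \<and> (\<exists>v h C. Q k s s' v h C)"
    if s: "fst s \<in> L2 N" "0 < snd s" "snd s \<le> (1/2) ^ k" for k s
  proof -
    obtain x \<rho> where sx: "s = (x, \<rho>)" by (cases s)
    have x: "x \<in> L2 N" "\<rho> > 0" "\<rho> \<le> (1/2)^k" using s sx by auto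
    obtain \<eta> where \<eta>: "\<eta> > 0" "\<And>h. 0 < h \<Longrightarrow> h < \<eta> \<Longrightarrow> nrm N (\<lambda>y. S h x y - x y) < 1"
      using at_right_0_D[OF Scont[OF x(1)], of 1] by auto
    \<comment> \<open>The increment \<open>v\<close> will be \<open>u\<close> rescaled to norm
      \<open>\<rho>\<close>; this \<open>K\<close> forces its image at time \<open>h\<close> to have
      norm at least \<open>k + nrm N x + 2\<close>.\<close>
    define K where "K = max 1 ((real k + nrm N x + 2) / \<rho>)"
    obtain h u where hu: "0 \<le> h" "h \<le> min (\<eta> / 2) (1 / real (Suc k))" "u \<in> L2 N" "nrm N (S h u) > K * nrm N u"
      using bad[of "min (\<eta> / 2) (1 / real (Suc k))" K] \<eta>(1) by (auto simp: K_def)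
    obtain C0 where C0: "\<forall>u\<in>L2 N. nrm N (S h u) \<le> C0 * nrm N u" using Sb[OF hu(1)] by blast
    define C where "C = max C0 0"
    have C: "C \<ge> 0" "\<forall>u\<in>L2 N. nrm N (S h u) \<le> C * nrm N u"
    proof -
      show "C \<ge> 0" by (simp add: C_def)
      show "\<forall>u\<in>L2 N. nrm N (S h u) \<le> C * nrm N u"
      proof
        fix u assume u: "u \<in> L2 N"
        have "C0 * nrm N u \<le> C * nrm N u" by (intro mult_right_mono) (auto simp: C_def)
        then show "nrm N (S h u) \<le> C * nrm N u" using C0 u by force
      qed
    qed
    have un: "nrm N u > 0"
    proof (rule ccontr)
      assume "\<not> nrm N u > 0"
      then have "nrm N u = 0" using nrm_nonneg[of N u] by linarith
      then show False using C(2) hu(3,4) by force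
    qed
    define c where "c = complex_of_real (\<rho> / nrm N u)"
    define v where "v y = c * u y" for y
    have vL: "v \<in> L2 N" unfolding v_def[abs_def] by (rule L2_cmult[OF hu(3)])
    have cn: "cmod c = \<rho> / nrm N u" using x(2) by (simp add: c_def norm_divide)
    have vn: "nrm N v = \<rho>" unfolding v_def[abs_def] nrm_scale cn using un by simp
    have "nrm N (S h v) = cmod c * nrm N (S h u)"
    proof -
      have "nrm N (\<lambda>y. S h (\<lambda>y. c * u y + 0 * u y) y - 0) = nrm N (\<lambda>y. (c * S h u y + 0 * S h u y) - 0)"
        by (rule lin_nrm[OF hu(1) hu(3) hu(3) L2_zero])
      then show ?thesis unfolding v_def[abs_def] by (simp add: nrm_scale)
    qed
    also have "\<dots> \<ge> cmod c * (K * nrm N u)" using hu(4) by (intro mult_left_mono) auto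
    also have "cmod c * (K * nrm N u) = \<rho> * K" unfolding cn using un by simp
    also have "\<rho> * K \<ge> \<rho> * ((real k + nrm N x + 2) / \<rho>)" using x(2) by (intro mult_left_mono) (auto simp: K_def)
    finally have Sv: "nrm N (S h v) \<ge> real k + nrm N x + 2" using x(2) by simp
    have Sx: "nrm N (S h x) \<le> nrm N x + 1"
    proof -
      have "nrm N (\<lambda>y. S h x y - x y) \<le> 1"
        using \<eta>(2)[of h] hu(1,2) \<eta>(1) S0[OF x(1)] by (cases "h = 0") auto
      then show ?thesis using nrm_le_diff[OF SL[OF hu(1) x(1)] x(1)] by linarith
    qed
    \<comment> \<open>Halving makes the later increments sum to at most twice the new bound. With
      \<open>1 / (2 * (C + 1))\<close> their total, multiplied by \<open>C\<close>, stays below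
      1.\<close>
    let ?s' = "(\<lambda>y. x y + v y, min (\<rho> / 2) (1 / (2 * (C + 1))))"
    have "Q k s ?s' v h C" unfolding Q_def sx using vL vn hu(1,2) Sx Sv C by auto
    moreover have "fst ?s' \<in> L2 N" using L2_add[OF x(1) vL] by simp
    moreover have "0 < snd ?s'" using x C(1) by simp
    moreover have "snd ?s' \<le> (1/2) ^ Suc k" using x(3) by simp
    ultimately show ?thesis by blast
  qed
  have "\<exists>s. \<forall>k. (fst (s k) \<in> L2 N \<and> 0 < snd (s k) \<and> snd (s k) \<le> (1/2) ^ k) \<and> (\<exists>v h C. Q k (s k) (s (Suc k)) v h C)"
  proof (rule dependent_nat_choice)
    show "\<exists>s. fst s \<in> L2 N \<and> 0 < snd s \<and> snd s \<le> (1/2 :: real) ^ 0" by (intro exI[of _ "(\<lambda>_. 0, 1)"]) simp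
    show "\<exists>s'. (fst s' \<in> L2 N \<and> 0 < snd s' \<and> snd s' \<le> (1/2) ^ Suc k) \<and> (\<exists>v h C. Q k s s' v h C)"
      if "fst s \<in> L2 N \<and> 0 < snd s \<and> snd s \<le> (1/2) ^ k" for s k using step that by blast
  qed
  then obtain s where s: "\<And>k. fst (s k) \<in> L2 N" "\<And>k. 0 < snd (s k)" "\<And>k. snd (s k) \<le> (1/2) ^ k"
    and "\<forall>k. \<exists>v h C. Q k (s k) (s (Suc k)) v h C" by blast
  then obtain v h C where Q: "\<And>k. Q k (s k) (s (Suc k)) (v k) (h k) (C k)" by metis
  define x \<rho> where "x k = fst (s k)" and "\<rho> k = snd (s k)" for k
  have xL: "x k \<in> L2 N" and vL: "v k \<in> L2 N" and vn: "nrm N (v k) \<le> \<rho> k" and h: "0 \<le> h k" "h k \<le> 1 / real (Suc k)"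
    and Sx: "nrm N (S (h k) (x k)) \<le> nrm N (x k) + 1" and Sv: "real k + nrm N (x k) + 2 \<le> nrm N (S (h k) (v k))"
    and C: "0 \<le> C k" "\<And>u. u \<in> L2 N \<Longrightarrow> nrm N (S (h k) u) \<le> C k * nrm N u"
    and xS: "x (Suc k) = (\<lambda>y. x k y + v k y)" and \<rho>S: "\<rho> (Suc k) = min (\<rho> k / 2) (1 / (2 * (C k + 1)))" for k
    using Q[of k] s(1)[of k] unfolding Q_def x_def \<rho>_def by auto
  have \<rho>: "0 < \<rho> k" "\<rho> k \<le> (1/2)^k" for k using s by (auto simp: \<rho>_def)
  have v2: "(nrm N (v k))\<^sup>2 \<le> 1 * (1/4)^k" for k
  proof -
    have "nrm N (v k) \<le> (1/2)^k" using vn[of k] \<rho>(2)[of k] by linarith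
    then have "(nrm N (v k))\<^sup>2 \<le> ((1/2)^k)\<^sup>2" by (intro power_mono) auto
    then show ?thesis by (simp add: power2_eq_square power_mult_distrib[symmetric])
  qed
  from L2_series[OF vL v2] obtain z where z: "z \<in> L2 N" "(\<lambda>n. nrm N (\<lambda>y. (\<Sum>k<n. v k y) - z y)) \<longlonglongrightarrow> 0" by blast
  have xs: "x n = (\<lambda>y. x 0 y + (\<Sum>k<n. v k y))" for n
    by (induction n) (auto simp: xS fun_eq_iff)
  define w where "w y = x 0 y + z y" for y
  have wL: "w \<in> L2 N" unfolding w_def[abs_def] by (rule L2_add[OF xL z(1)])
  have xw: "(\<lambda>n. nrm N (\<lambda>y. x n y - w y)) \<longlonglongrightarrow> 0" 
  proof -
    have "(\<lambda>y. x n y - w y) = (\<lambda>y. (\<Sum>k<n. v k y) - z y)" for n by (subst xs) (simp add: w_def)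
    then show ?thesis using z(2) by simp
  qed
  \<comment> \<open>As each bound is at most half of its predecessor, it is at most twice its own
    difference to the next one, and the increments telescope.\<close>
  have tail: "nrm N (\<lambda>y. x (Suc k + n) y - x (Suc k) y) \<le> 2 * \<rho> (Suc k) - 2 * \<rho> (Suc k + n)" for k n
  proof (induction n)
    case (Suc n)
    have "nrm N (\<lambda>y. x (Suc k + Suc n) y - x (Suc k) y) \<le> nrm N (\<lambda>y. x (Suc k + Suc n) y - x (Suc k + n) y) + nrm N (\<lambda>y. x (Suc k + n) y - x (Suc k) y)"
      by (rule nrm_triangle3[OF xL xL xL])
    also have "nrm N (\<lambda>y. x (Suc k + Suc n) y - x (Suc k + n) y) \<le> \<rho> (Suc k + n)" using vn[of "Suc k + n"] xS[of "Suc k + n"] by simp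
    also have "\<rho> (Suc k + n) \<le> 2 * \<rho> (Suc k + n) - 2 * \<rho> (Suc k + Suc n)" using \<rho>S[of "Suc k + n"] by simp
    finally show ?case using Suc by simp
  qed simp
  have wx: "nrm N (\<lambda>y. w y - x (Suc k) y) \<le> 2 * \<rho> (Suc k)" for k
  proof -
    have "nrm N (\<lambda>y. w y - x (Suc k) y) \<le> 2 * \<rho> (Suc k) + nrm N (\<lambda>y. x (n + Suc k) y - w y)" for n
      using nrm_triangle3[OF wL xL[of "n + Suc k"] xL[of "Suc k"]] tail[of k n] \<rho>(1)[of "Suc k + n"] nrm_minus_commute[of N w "x (n + Suc k)"]
      by (simp add: add.commute)
    moreover have "(\<lambda>n. 2 * \<rho> (Suc k) + nrm N (\<lambda>y. x (n + Suc k) y - w y)) \<longlonglongrightarrow> 2 * \<rho> (Suc k) + 0"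
      by (intro tendsto_intros LIMSEQ_ignore_initial_segment[OF xw])
    ultimately show ?thesis using LIMSEQ_le_const[of "\<lambda>n. 2 * \<rho> (Suc k) + nrm N (\<lambda>y. x (n + Suc k) y - w y)" "2 * \<rho> (Suc k) + 0"] by auto
  qed
  \<comment> \<open>The image of \<open>v k\<close> has norm at least
    \<open>k + nrm N (x k) + 2\<close>; at most \<open>nrm N (x k) + 1\<close> is lost to the
    previous sum and 1 to the later increments.\<close>
  have big: "real k \<le> nrm N (S (h k) w)" for k
  proof -
    have "nrm N (S (h k) (v k)) \<le> nrm N (S (h k) (x (Suc k))) + nrm N (S (h k) (x k))"
    proof -
      have "nrm N (\<lambda>y. S (h k) (\<lambda>y. 1 * x (Suc k) y + (- 1) * x k y) y - 0) = nrm N (\<lambda>y. (1 * S (h k) (x (Suc k)) y + (- 1) * S (h k) (x k) y) - 0)"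
        by (rule lin_nrm[OF h(1) xL xL L2_zero])
      then have "nrm N (S (h k) (v k)) = nrm N (\<lambda>y. S (h k) (x (Suc k)) y - S (h k) (x k) y)" by (simp add: xS)
      then show ?thesis using nrm_triangle_diff[OF SL[OF h(1) xL] SL[OF h(1) xL], of k "Suc k" k k] by simp
    qed
    moreover have "nrm N (S (h k) (x (Suc k))) \<le> nrm N (S (h k) w) + 1"
    proof -
      have "nrm N (\<lambda>y. S (h k) (x (Suc k)) y - S (h k) w y) \<le> C k * nrm N (\<lambda>y. x (Suc k) y - w y)"
        by (rule diff_bound[OF h(1) xL wL C(2)])
      also have "\<dots> \<le> C k * (2 * \<rho> (Suc k))" using wx[of k] nrm_minus_commute[of N w "x (Suc k)"] by (intro mult_left_mono C(1)) simp
      also have "\<dots> \<le> C k * (2 * (1 / (2 * (C k + 1))))" by (intro mult_left_mono C(1)) (use \<rho>S[of k] in auto)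
      also have "\<dots> \<le> 1" using C(1)[of k] by (simp add: divide_simps)
      finally show ?thesis using nrm_le_diff[OF SL[OF h(1) xL] SL[OF h(1) wL], of k "Suc k" k] by simp
    qed
    ultimately show ?thesis using Sv[of k] Sx[of k] by linarith
  qed
  obtain \<eta> where \<eta>: "\<eta> > 0" "\<And>h. 0 < h \<Longrightarrow> h < \<eta> \<Longrightarrow> nrm N (\<lambda>y. S h w y - w y) < 1"
    using at_right_0_D[OF Scont[OF wL], of 1] by auto
  obtain k1 :: nat where k1: "1 / \<eta> < real k1" using reals_Archimedean2 by blast
  obtain k2 :: nat where k2: "nrm N w + 1 < real k2" using reals_Archimedean2 by blast
  define k where "k = max k1 k2"
  have "1 / \<eta> < real (Suc k)" "nrm N w + 1 < real k" using k1 k2 by (auto simp: k_def)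
  then have "1 / real (Suc k) < \<eta>" using \<eta>(1) by (simp add: field_simps)
  then have hk: "h k < \<eta>" using h(2)[of k] by linarith
  \<comment> \<open>Strong continuity at the single vector \<open>w\<close> contradicts
    \<open>big\<close>, since \<open>h k\<close> tends to 0. The time \<open>h k = 0\<close> may
    occur and is covered by \<open>S0\<close>.\<close>
  have "nrm N (\<lambda>y. S (h k) w y - w y) \<le> 1"
    using \<eta>(2)[of "h k"] hk h(1)[of k] S0[OF wL] by (cases "h k = 0") auto
  then have "nrm N (S (h k) w) \<le> nrm N w + 1" using nrm_le_diff[OF SL[OF h(1) wL] wL, of k] by linarith
  then show False using big[of k] \<open>nrm N w + 1 < real k\<close> by linarith
qed

text \<open>Each step of length \<open>\<delta>\<close> multiplies the constant by \<open>K\<close>,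
  and finitely many steps reach \<open>t\<close>.\<close>

lemma bounded_on_interval: "\<exists>K\<ge>1. \<forall>s u. 0 \<le> s \<and> s \<le> t \<and> u \<in> L2 N \<longrightarrow> nrm N (S s u) \<le> K * nrm N u"
proof -
  obtain \<delta> K where d: "\<delta> > 0" "K \<ge> 1" "\<And>h u. 0 \<le> h \<Longrightarrow> h \<le> \<delta> \<Longrightarrow> u \<in> L2 N \<Longrightarrow> nrm N (S h u) \<le> K * nrm N u"
    using locally_bounded by blast
  have b: "nrm N (S s u) \<le> K ^ Suc n * nrm N u" if "0 \<le> s" "s \<le> real (Suc n) * \<delta>" "u \<in> L2 N" for n s u
    using that
  proof (induction n arbitrary: s u)
    case 0 then show ?case using d(3) by simp
  next
    case (Suc n)
    show ?case
    proof (cases "s \<le> \<delta>")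
      case True
      have "K * nrm N u \<le> K ^ Suc (Suc n) * nrm N u"
        using d(2) power_increasing[of 1 "Suc (Suc n)" K] by (intro mult_right_mono) auto
      then show ?thesis using d(3)[of s u] Suc.prems True by linarith
    next
      case False
      define r where "r = s - \<delta>"
      have r: "0 \<le> r" "r \<le> real (Suc n) * \<delta>" "s = \<delta> + r" using False Suc.prems by (auto simp: r_def algebra_simps)
      have Lr: "S r u \<in> L2 N" by (rule SL[OF r(1) Suc.prems(3)])
      have "nrm N (S s u) = nrm N (S \<delta> (S r u))"
        using add_nrm[of \<delta> r u "\<lambda>_. 0"] d(1) r Suc.prems(3) by simp
      also have "\<dots> \<le> K * nrm N (S r u)" using d Lr by simp
      also have "\<dots> \<le> K * (K ^ Suc n * nrm N u)" using Suc.IH[OF r(1,2) Suc.prems(3)] d(2) by (intro mult_left_mono) auto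
      finally show ?thesis by simp
    qed
  qed
  obtain n :: nat where "t / \<delta> < real n" using reals_Archimedean2 by blast
  then have "t < real n * \<delta>" using d(1) by (simp add: field_simps)
  then have t: "t \<le> real (Suc n) * \<delta>" using d(1) by (simp add: algebra_simps)
  show ?thesis
  proof (intro exI[of _ "K ^ Suc n"] conjI allI impI)
    show "1 \<le> K ^ Suc n" using d(2) by (rule one_le_power)
    show "nrm N (S s u) \<le> K ^ Suc n * nrm N u" if "0 \<le> s \<and> s \<le> t \<and> u \<in> L2 N" for s u using b[of s n u] that t by auto
  qed
qed

lemma increment_bound:
  assumes K: "\<And>s u. 0 \<le> s \<Longrightarrow> s \<le> t \<Longrightarrow> u \<in> L2 N \<Longrightarrow> nrm N (S s u) \<le> K * nrm N u"
    and u: "u \<in> L2 N" and s: "0 \<le> s" "s \<le> t" "0 \<le> h"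
  shows "nrm N (\<lambda>x. S (s + h) u x - S s u x) \<le> K * nrm N (\<lambda>x. S h u x - u x)"
  using add_nrm[OF s(1,3) u SL[OF s(1) u]] diff_bound[OF s(1) SL[OF s(3) u] u K[OF s(1,2)]] by simp

end

section \<open>Difference quotients and the comparison of two semigroups\<close>

definition quot :: "(real \<Rightarrow> ('a \<Rightarrow> complex) \<Rightarrow> 'a \<Rightarrow> complex) \<Rightarrow> real \<Rightarrow> ('a \<Rightarrow> complex) \<Rightarrow> 'a \<Rightarrow> complex" where
  "quot S h u x = of_real (1 / h) * (S h u x - u x)"

lemma (in L2_semigroup) quot_L2: "h \<ge> 0 \<Longrightarrow> u \<in> L2 N \<Longrightarrow> quot S h u \<in> L2 N"
  unfolding quot_def[abs_def] by (intro L2_cmult L2_diff SL)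

text \<open>\<open>S s\<close> commutes with the quotients up to norm zero and is bounded. Hence
  orbits that start in the domain remain in it.\<close>

lemma (in L2_semigroup) quot_invariant:
  assumes s: "s \<ge> 0" and u: "u \<in> L2 N" and v: "v \<in> L2 N"
    and q: "((\<lambda>h. nrm N (\<lambda>x. quot S h u x - v x)) \<longlongrightarrow> 0) (at_right 0)"
  shows "((\<lambda>h. nrm N (\<lambda>x. quot S h (S s u) x - S s v x)) \<longlongrightarrow> 0) (at_right 0)"
proof -
  obtain C where C: "\<And>u. u \<in> L2 N \<Longrightarrow> nrm N (S s u) \<le> C * nrm N u" using Sb[OF s] by blast
  have le: "nrm N (\<lambda>x. quot S h (S s u) x - S s v x) \<le> C * nrm N (\<lambda>x. quot S h u x - v x)" if h: "h > 0" for h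
  proof -
    have h0: "h \<ge> 0" using h by simp
    have L: "S s u \<in> L2 N" "S h u \<in> L2 N" "S s v \<in> L2 N" "S s (S h u) \<in> L2 N" "S h (S s u) \<in> L2 N" "quot S h u \<in> L2 N" "quot S h (S s u) \<in> L2 N" "S s (quot S h u) \<in> L2 N"
      using s h0 u v by (auto intro!: SL quot_L2)
    let ?c = "complex_of_real (1 / h)"
    have 1: "nrm N (\<lambda>x. S s (quot S h u) x - quot S h (S s u) x) = nrm N (\<lambda>x. (?c * S s (S h u) x + (- ?c) * S s u x) - quot S h (S s u) x)"
      using lin_nrm[OF s L(2) u L(7), of ?c "- ?c"] by (simp add: quot_def[abs_def] algebra_simps)
    also have "\<dots> = nrm N (\<lambda>x. ?c * (S s (S h u) x - S h (S s u) x))"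
      by (simp add: quot_def algebra_simps)
    also have "\<dots> = cmod ?c * nrm N (\<lambda>x. S s (S h u) x - S h (S s u) x)" by (rule nrm_scale)
    also have "nrm N (\<lambda>x. S s (S h u) x - S h (S s u) x) = 0"
      using add_nrm[OF s h0 u L(5)] add_nrm[OF h0 s u L(5)] by (simp add: add.commute)
    finally have z: "nrm N (\<lambda>x. S s (quot S h u) x - quot S h (S s u) x) = 0" by simp
    have "nrm N (\<lambda>x. quot S h (S s u) x - S s v x) \<le> nrm N (\<lambda>x. quot S h (S s u) x - S s (quot S h u) x) + nrm N (\<lambda>x. S s (quot S h u) x - S s v x)"
      by (rule nrm_triangle3[OF L(7,8,3)])
    also have "\<dots> \<le> 0 + C * nrm N (\<lambda>x. quot S h u x - v x)"
      using z nrm_minus_commute[of N "quot S h (S s u)" "S s (quot S h u)"] diff_bound[OF s L(6) v C] by simp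
    finally show ?thesis by simp
  qed
  show ?thesis
  proof (rule Lim_null_comparison)
    have "((\<lambda>h. C * nrm N (\<lambda>x. quot S h u x - v x)) \<longlongrightarrow> C * 0) (at_right 0)" by (intro tendsto_intros q)
    then show "((\<lambda>h. C * nrm N (\<lambda>x. quot S h u x - v x)) \<longlongrightarrow> 0) (at_right 0)" by simp
    show "\<forall>\<^sub>F h in at_right 0. norm (nrm N (\<lambda>x. quot S h (S s u) x - S s v x)) \<le> C * nrm N (\<lambda>x. quot S h u x - v x)"
      using eventually_at_right_less[of 0] by eventually_elim (use le in simp)
  qed
qed

text \<open>With \<open>y = S s u\<close> the difference at time \<open>s + h\<close> splits into
  that of \<open>S h y\<close> and \<open>T h y\<close> and into \<open>T h\<close> applied to the
  difference at time \<open>s\<close>. The base point \<open>y\<close> is in the domain by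
  \<open>quot_invariant\<close> and \<open>mem\<close>; \<open>dense\<close> and a bound of
  \<open>S t\<close> extend the result to all vectors.\<close>

lemma semigroup_unique:
  assumes "L2_semigroup N S" "L2_semigroup N T"
    and contr: "\<And>t u. t \<ge> 0 \<Longrightarrow> u \<in> L2 N \<Longrightarrow> nrm N (T t u) \<le> nrm N u"
    and Dom: "Dom \<subseteq> L2 N"
    and gen: "\<And>u. u \<in> Dom \<Longrightarrow> \<exists>v\<in>L2 N. ((\<lambda>h. nrm N (\<lambda>x. quot S h u x - v x)) \<longlongrightarrow> 0) (at_right 0) \<and>
          ((\<lambda>h. nrm N (\<lambda>x. quot T h u x - v x)) \<longlongrightarrow> 0) (at_right 0)"
    and mem: "\<And>u v. u \<in> L2 N \<Longrightarrow> v \<in> L2 N \<Longrightarrow> ((\<lambda>h. nrm N (\<lambda>x. quot S h u x - v x)) \<longlongrightarrow> 0) (at_right 0) \<Longrightarrow> u \<in> Dom"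
    and dense: "\<And>u e. u \<in> L2 N \<Longrightarrow> e > 0 \<Longrightarrow> \<exists>v\<in>Dom. nrm N (\<lambda>x. u x - v x) < e"
    and u: "u \<in> L2 N" and t: "t \<ge> 0"
  shows "nrm N (\<lambda>x. S t u x - T t u x) = 0"
proof -
  interpret S: L2_semigroup N S by fact
  interpret T: L2_semigroup N T by fact
  have onDom: "nrm N (\<lambda>x. S t u x - T t u x) \<le> 0" if uD: "u \<in> Dom" and t: "t \<ge> 0" for u t
  proof -
    have u: "u \<in> L2 N" using uD Dom by blast
    define \<phi> where "\<phi> s = nrm N (\<lambda>x. S s u x - T s u x)" for s
    obtain K where K: "K \<ge> 1" "\<And>s u. 0 \<le> s \<Longrightarrow> s \<le> t \<Longrightarrow> u \<in> L2 N \<Longrightarrow> nrm N (S s u) \<le> K * nrm N u"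
      using S.bounded_on_interval[of t] by blast
    \<comment> \<open>A modulus that does not depend on the starting time: continuity from the right
      at 0 thereby gives continuity from both sides on the whole interval.\<close>
    define \<omega> where "\<omega> h = K * nrm N (\<lambda>x. S h u x - u x) + nrm N (\<lambda>x. T h u x - u x)" for h
    have \<omega>0: "(\<omega> \<longlongrightarrow> 0) (at_right 0)"
    proof -
      have "((\<lambda>h. K * nrm N (\<lambda>x. S h u x - u x) + nrm N (\<lambda>x. T h u x - u x)) \<longlongrightarrow> K * 0 + 0) (at_right 0)"
        by (intro tendsto_intros S.Scont T.Scont u)
      then show ?thesis by (simp add: \<omega>_def[abs_def])
    qed
    have mod: "\<bar>\<phi> (s + h) - \<phi> s\<bar> \<le> \<omega> h" if s: "0 \<le> s" "s \<le> t" "0 \<le> h" for s h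
    proof -
      have L: "S (s + h) u \<in> L2 N" "S s u \<in> L2 N" "T (s + h) u \<in> L2 N" "T s u \<in> L2 N" using s u by (auto intro!: S.SL T.SL)
      have a: "nrm N (\<lambda>x. S (s + h) u x - S s u x) \<le> K * nrm N (\<lambda>x. S h u x - u x)"
        by (rule S.increment_bound[OF K(2) u s])
      have b: "nrm N (\<lambda>x. T (s + h) u x - T s u x) \<le> 1 * nrm N (\<lambda>x. T h u x - u x)"
        by (rule T.increment_bound[OF _ u s]) (use contr in auto)
      have "\<phi> (s + h) \<le> nrm N (\<lambda>x. S (s + h) u x - S s u x) + (\<phi> s + nrm N (\<lambda>x. T s u x - T (s + h) u x))"
        unfolding \<phi>_def using nrm_triangle3[OF L(1,2,3)] nrm_triangle3[OF L(2,4,3)] by linarith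
      moreover have "\<phi> s \<le> nrm N (\<lambda>x. S s u x - S (s + h) u x) + (\<phi> (s + h) + nrm N (\<lambda>x. T (s + h) u x - T s u x))"
        unfolding \<phi>_def using nrm_triangle3[OF L(2,1,4)] nrm_triangle3[OF L(1,3,4)] by linarith
      ultimately show ?thesis
        using a b nrm_minus_commute[of N "T s u" "T (s + h) u"] nrm_minus_commute[of N "S s u" "S (s + h) u"]
        by (simp add: \<omega>_def)
    qed
    have "\<phi> t \<le> 0"
    proof (rule continuous_small_increments[OF t])
      show "continuous_on {0..t} \<phi>"
      proof (subst continuous_on_iff, intro ballI allI impI)
        fix s e :: real assume s: "s \<in> {0..t}" and e: "e > 0"
        obtain \<eta> where \<eta>: "\<eta> > 0" "\<And>h. 0 < h \<Longrightarrow> h < \<eta> \<Longrightarrow> \<omega> h < e" using at_right_0_D[OF \<omega>0 e] by blast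
        have "dist (\<phi> r) (\<phi> s) < e" if r: "r \<in> {0..t}" "dist r s < \<eta>" for r
        proof -
          consider "r = s" | "r < s" | "s < r" by linarith
          then show ?thesis
          proof cases
            case 1 then show ?thesis using e by simp
          next
            case 2
            then show ?thesis using mod[of r "s - r"] \<eta>(2)[of "s - r"] r s by (simp add: dist_real_def abs_minus_commute)
          next
            case 3
            then show ?thesis using mod[of s "r - s"] \<eta>(2)[of "r - s"] r s by (simp add: dist_real_def)
          qed
        qed
        then show "\<exists>d>0. \<forall>x'\<in>{0..t}. dist x' s < d \<longrightarrow> dist (\<phi> x') (\<phi> s) < e" using \<eta>(1) by blast
      qed
      show "\<phi> 0 \<le> 0"
      proof -
        have "\<phi> 0 \<le> nrm N (\<lambda>x. S 0 u x - u x) + nrm N (\<lambda>x. u x - T 0 u x)"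
          unfolding \<phi>_def by (rule nrm_triangle3) (auto intro!: S.SL T.SL u)
        then show ?thesis using S.S0[OF u] T.S0[OF u] nrm_minus_commute[of N u "T 0 u"] by simp
      qed
      fix s e :: real assume s: "0 \<le> s" "s < t" and e: "e > 0"
      define y where "y = S s u"
      have yL: "y \<in> L2 N" unfolding y_def by (rule S.SL[OF s(1) u])
      obtain v0 where v0: "v0 \<in> L2 N" "((\<lambda>h. nrm N (\<lambda>x. quot S h u x - v0 x)) \<longlongrightarrow> 0) (at_right 0)" using gen[OF uD] by blast
      have "y \<in> Dom" unfolding y_def by (rule mem[OF yL[unfolded y_def] S.SL[OF s(1) v0(1)] S.quot_invariant[OF s(1) u v0]])
      then obtain v where v: "v \<in> L2 N" "((\<lambda>h. nrm N (\<lambda>x. quot S h y x - v x)) \<longlongrightarrow> 0) (at_right 0)"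
        "((\<lambda>h. nrm N (\<lambda>x. quot T h y x - v x)) \<longlongrightarrow> 0) (at_right 0)" using gen by blast
      have "((\<lambda>h. nrm N (\<lambda>x. quot S h y x - v x) + nrm N (\<lambda>x. quot T h y x - v x)) \<longlongrightarrow> 0 + 0) (at_right 0)"
        by (intro tendsto_intros v)
      then have "((\<lambda>h. nrm N (\<lambda>x. quot S h y x - v x) + nrm N (\<lambda>x. quot T h y x - v x)) \<longlongrightarrow> 0) (at_right 0)" by simp
      from at_right_0_D[OF this e]
      obtain \<eta> where \<eta>: "\<eta> > 0" "\<And>h. 0 < h \<Longrightarrow> h < \<eta> \<Longrightarrow> nrm N (\<lambda>x. quot S h y x - v x) + nrm N (\<lambda>x. quot T h y x - v x) < e"
        by blast
      have "\<phi> (s + h) \<le> \<phi> s + e * h" if h: "0 < h" "h < \<eta>" for h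
      proof -
        have h0: "h \<ge> 0" using h by simp
        have L: "S h y \<in> L2 N" "T h y \<in> L2 N" "T s u \<in> L2 N" "T h (T s u) \<in> L2 N" "T (s + h) u \<in> L2 N" "quot S h y \<in> L2 N" "quot T h y \<in> L2 N"
          using h0 s u yL by (auto intro!: S.SL T.SL S.quot_L2 T.quot_L2)
        have "\<phi> (s + h) = nrm N (\<lambda>x. S h y x - T (s + h) u x)"
          unfolding \<phi>_def y_def using S.add_nrm[OF h0 s(1) u L(5)] by (simp add: add.commute)
        also have "\<dots> = nrm N (\<lambda>x. T (s + h) u x - S h y x)" by (rule nrm_minus_commute)
        also have "\<dots> = nrm N (\<lambda>x. T h (T s u) x - S h y x)"
          using T.add_nrm[OF h0 s(1) u L(1)] by (simp add: add.commute)
        also have "\<dots> \<le> nrm N (\<lambda>x. T h (T s u) x - T h y x) + nrm N (\<lambda>x. T h y x - S h y x)"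
          by (rule nrm_triangle3[OF L(4,2,1)])
        also have "nrm N (\<lambda>x. T h (T s u) x - T h y x) \<le> 1 * nrm N (\<lambda>x. T s u x - y x)"
          by (rule T.diff_bound[OF h0 L(3) yL]) (use contr h0 in auto)
        also have "1 * nrm N (\<lambda>x. T s u x - y x) = \<phi> s" unfolding \<phi>_def y_def using nrm_minus_commute[of N "T s u" "S s u"] by simp
        also have "nrm N (\<lambda>x. T h y x - S h y x) = h * nrm N (\<lambda>x. quot T h y x - quot S h y x)"
        proof -
          have "(\<lambda>x. T h y x - S h y x) = (\<lambda>x. of_real h * (quot T h y x - quot S h y x))"
            using h by (auto simp: quot_def field_simps)
          then show ?thesis using h by (simp only: nrm_scale) simp
        qed
        also have "nrm N (\<lambda>x. quot T h y x - quot S h y x) \<le> nrm N (\<lambda>x. quot T h y x - v x) + nrm N (\<lambda>x. v x - quot S h y x)"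
          by (rule nrm_triangle3[OF L(7) v(1) L(6)])
        also have "\<dots> \<le> e" using \<eta>(2)[OF h] nrm_minus_commute[of N v "quot S h y"] by simp
        finally show ?thesis using h by (simp add: mult_left_mono mult.commute)
      qed
      then show "\<exists>\<eta>>0. \<forall>h. 0 < h \<and> h < \<eta> \<longrightarrow> \<phi> (s + h) \<le> \<phi> s + e * h" using \<eta>(1) by blast
    qed
    then show ?thesis by (simp add: \<phi>_def)
  qed
  obtain K where K: "K \<ge> 1" "\<And>s u. 0 \<le> s \<Longrightarrow> s \<le> t \<Longrightarrow> u \<in> L2 N \<Longrightarrow> nrm N (S s u) \<le> K * nrm N u"
    using S.bounded_on_interval[of t] by blast
  have "nrm N (\<lambda>x. S t u x - T t u x) \<le> 0 + e" if e: "e > 0" for e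
  proof -
    have "e / (K + 1) > 0" using e K(1) by simp
    then obtain v where v: "v \<in> Dom" "nrm N (\<lambda>x. u x - v x) < e / (K + 1)" using dense[OF u] by blast
    have vL: "v \<in> L2 N" using v(1) Dom by blast
    have L: "S t u \<in> L2 N" "S t v \<in> L2 N" "T t u \<in> L2 N" "T t v \<in> L2 N" using t u vL by (auto intro!: S.SL T.SL)
    have "nrm N (\<lambda>x. S t u x - T t u x) \<le> nrm N (\<lambda>x. S t u x - S t v x) + (nrm N (\<lambda>x. S t v x - T t v x) + nrm N (\<lambda>x. T t v x - T t u x))"
      using nrm_triangle3[OF L(1,2,3)] nrm_triangle3[OF L(2,4,3)] by linarith
    also have "\<dots> \<le> K * nrm N (\<lambda>x. u x - v x) + (0 + 1 * nrm N (\<lambda>x. v x - u x))"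
    proof (intro add_mono)
      show "nrm N (\<lambda>x. S t u x - S t v x) \<le> K * nrm N (\<lambda>x. u x - v x)" by (rule S.diff_bound[OF t u vL K(2)[OF t order_refl]])
      show "nrm N (\<lambda>x. S t v x - T t v x) \<le> 0" by (rule onDom[OF v(1) t])
      show "nrm N (\<lambda>x. T t v x - T t u x) \<le> 1 * nrm N (\<lambda>x. v x - u x)"
        by (rule T.diff_bound[OF t vL u]) (use contr t in auto)
    qed
    also have "\<dots> = (K + 1) * nrm N (\<lambda>x. u x - v x)" using nrm_minus_commute[of N u v] by (simp add: algebra_simps)
    also have "\<dots> \<le> (K + 1) * (e / (K + 1))" using v(2) K(1) by (intro mult_left_mono) auto
    finally show ?thesis using K(1) by simp
  qed
  then have "nrm N (\<lambda>x. S t u x - T t u x) \<le> 0" by (rule field_le_epsilon)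
  then show ?thesis using nrm_nonneg[of N "\<lambda>x. S t u x - T t u x"] by linarith
qed

section \<open>The weighted phase space on the Fourier side\<close>

definition wt :: "real \<Rightarrow> vec3 \<Rightarrow> real" where "wt l y = (1 + norm y) powr l"

text \<open>With the weight moved into the measure, \<open>hl_norm\<close> becomes an unweighted
  \<open>nrm\<close> and the general lemmas on \<open>L2\<close> apply.\<close>

definition MW :: "real \<Rightarrow> (vec3 \<times> vec3) measure" where
  "MW l = density P6 (\<lambda>z. ennreal (wt l (fst z)))"

lemma wt_nonneg [simp]: "wt l y \<ge> 0" by (simp add: wt_def)
lemma wt_measurable [measurable]: "wt l \<in> borel_measurable borel" unfolding wt_def by measurable
lemma wt_ge_1: "l \<ge> 0 \<Longrightarrow> wt l y \<ge> 1" unfolding wt_def by (rule ge_one_powr_ge_zero) auto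
lemma wt_pos: "wt l y > 0" unfolding wt_def using norm_ge_zero[of y] by (simp add: add_nonneg_eq_0_iff)

lemma MW_measurable [simp]: "borel_measurable (MW l) = borel_measurable P6"
  by (intro measurable_cong_sets) (auto simp: MW_def)

lemma AE_MW: "(AE z in MW l. P z) \<longleftrightarrow> (AE z in P6. P z)"
  unfolding MW_def by (subst AE_density) (auto simp: wt_pos)

lemma MW_nn: assumes [measurable]: "u \<in> borel_measurable P6"
  shows "(\<integral>\<^sup>+z. ennreal ((cmod (u z))\<^sup>2) \<partial>MW l) = (\<integral>\<^sup>+y. ennreal (wt l y) * (\<integral>\<^sup>+q. ennreal ((cmod (u (y, q)))\<^sup>2) \<partial>lborel) \<partial>lborel)"
proof -
  have "(\<integral>\<^sup>+z. ennreal ((cmod (u z))\<^sup>2) \<partial>MW l) = (\<integral>\<^sup>+z. ennreal (wt l (fst z)) * ennreal ((cmod (u z))\<^sup>2) \<partial>P6)"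
    unfolding MW_def by (rule nn_integral_density) measurable
  also have "\<dots> = (\<integral>\<^sup>+y. (\<integral>\<^sup>+q. ennreal (wt l y) * ennreal ((cmod (u (y, q)))\<^sup>2) \<partial>lborel) \<partial>lborel)"
    by (subst lborel.nn_integral_fst[symmetric]) auto
  also have "\<dots> = (\<integral>\<^sup>+y. ennreal (wt l y) * (\<integral>\<^sup>+q. ennreal ((cmod (u (y, q)))\<^sup>2) \<partial>lborel) \<partial>lborel)"
    by (intro nn_integral_cong nn_integral_cmult) measurable
  finally show ?thesis .
qed

lemma MW_L2_iff: "u \<in> L2 (MW l) \<longleftrightarrow> u \<in> borel_measurable P6 \<and> integrable P6 (\<lambda>z. wt l (fst z) * (cmod (u z))\<^sup>2)"
proof (cases "u \<in> borel_measurable P6")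
  case True
  note [measurable] = True
  have "integrable (MW l) (\<lambda>z. (cmod (u z))\<^sup>2) \<longleftrightarrow> integrable P6 (\<lambda>z. wt l (fst z) *\<^sub>R (cmod (u z))\<^sup>2)"
    unfolding MW_def by (rule integrable_density) auto
  then show ?thesis using True by (simp add: L2_def)
qed (simp add: L2_def)

lemma MW_L2_P6: assumes "l \<ge> 0" "u \<in> L2 (MW l)" shows "u \<in> L2 P6"
proof -
  have u: "u \<in> borel_measurable P6" "integrable P6 (\<lambda>z. wt l (fst z) * (cmod (u z))\<^sup>2)" using assms(2) by (auto simp: MW_L2_iff)
  have "(cmod (u z))\<^sup>2 \<le> wt l (fst z) * (cmod (u z))\<^sup>2" for z
    using mult_right_mono[OF wt_ge_1[OF assms(1)], of "(cmod (u z))\<^sup>2"] by simp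
  then show ?thesis using L2_dom[OF u] by auto
qed

lemma MW_sections:
  assumes u: "u \<in> L2 (MW l)"
  shows "AE y in lborel. (\<lambda>q. u (y, q)) \<in> L2 lborel"
    and "integrable lborel (\<lambda>y. wt l y * (nrm lborel (\<lambda>q. u (y, q)))\<^sup>2)"
    and "(nrm (MW l) u)\<^sup>2 = (LINT y|lborel. wt l y * (nrm lborel (\<lambda>q. u (y, q)))\<^sup>2)"
proof -
  have um [measurable]: "u \<in> borel_measurable P6" using u by (simp add: MW_L2_iff)
  have fin: "(\<integral>\<^sup>+y. ennreal (wt l y) * (\<integral>\<^sup>+q. ennreal ((cmod (u (y, q)))\<^sup>2) \<partial>lborel) \<partial>lborel) = ennreal ((nrm (MW l) u)\<^sup>2)"
    using nrm_nn[OF u] MW_nn[OF um] by simp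
  then have "AE y in lborel. ennreal (wt l y) * (\<integral>\<^sup>+q. ennreal ((cmod (u (y, q)))\<^sup>2) \<partial>lborel) \<noteq> \<infinity>"
    by (intro nn_integral_noteq_infinite) auto
  then show A: "AE y in lborel. (\<lambda>q. u (y, q)) \<in> L2 lborel"
  proof eventually_elim
    case (elim y)
    then have "(\<integral>\<^sup>+q. ennreal ((cmod (u (y, q)))\<^sup>2) \<partial>lborel) \<noteq> \<infinity>"
      using wt_pos[of l y] by (auto simp: ennreal_mult_eq_top_iff)
    then show ?case unfolding L2_nn_iff by (auto simp: top.not_eq_extremum)
  qed
  have nm [measurable]: "(\<lambda>y. nrm lborel (\<lambda>q. u (y, q))) \<in> borel_measurable lborel" unfolding nrm_def by measurable
  have "(\<integral>\<^sup>+y. ennreal (wt l y) * (\<integral>\<^sup>+q. ennreal ((cmod (u (y, q)))\<^sup>2) \<partial>lborel) \<partial>lborel)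
      = (\<integral>\<^sup>+y. ennreal (wt l y * (nrm lborel (\<lambda>q. u (y, q)))\<^sup>2) \<partial>lborel)"
    by (rule nn_integral_cong_AE) (use A in eventually_elim, simp add: nrm_nn ennreal_mult')
  then have e: "(\<integral>\<^sup>+y. ennreal (wt l y * (nrm lborel (\<lambda>q. u (y, q)))\<^sup>2) \<partial>lborel) = ennreal ((nrm (MW l) u)\<^sup>2)" using fin by simp
  show i: "integrable lborel (\<lambda>y. wt l y * (nrm lborel (\<lambda>q. u (y, q)))\<^sup>2)"
    by (rule integrableI_nonneg) (use e in auto)
  show "(nrm (MW l) u)\<^sup>2 = (LINT y|lborel. wt l y * (nrm lborel (\<lambda>q. u (y, q)))\<^sup>2)"
    using e nn_integral_eq_integral[OF i] by simp
qed

text \<open>The bound \<open>b\<close> depends on the frequency alone, so estimates at almost every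
  fixed frequency integrate to an estimate in \<open>MW l\<close>.\<close>

lemma MW_L2I:
  assumes um [measurable]: "u \<in> borel_measurable P6" and i: "integrable lborel (\<lambda>y. wt l y * (b y)\<^sup>2)"
    and b: "AE y in lborel. (\<lambda>q. u (y, q)) \<in> L2 lborel \<and> nrm lborel (\<lambda>q. u (y, q)) \<le> b y"
  shows "u \<in> L2 (MW l)" "(nrm (MW l) u)\<^sup>2 \<le> (LINT y|lborel. wt l y * (b y)\<^sup>2)"
proof -
  have "(\<integral>\<^sup>+z. ennreal ((cmod (u z))\<^sup>2) \<partial>MW l) \<le> (\<integral>\<^sup>+y. ennreal (wt l y * (b y)\<^sup>2) \<partial>lborel)"
    unfolding MW_nn[OF um]
  proof (rule nn_integral_mono_AE)
    show "AE y in lborel. ennreal (wt l y) * (\<integral>\<^sup>+q. ennreal ((cmod (u (y, q)))\<^sup>2) \<partial>lborel) \<le> ennreal (wt l y * (b y)\<^sup>2)"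
      using b
    proof eventually_elim
      case (elim y)
      then have "(nrm lborel (\<lambda>q. u (y, q)))\<^sup>2 \<le> (b y)\<^sup>2" by (intro power_mono) auto
      then have "wt l y * (nrm lborel (\<lambda>q. u (y, q)))\<^sup>2 \<le> wt l y * (b y)\<^sup>2" by (rule mult_left_mono) simp
      then show ?case using elim by (simp add: nrm_nn ennreal_mult'[symmetric])
    qed
  qed
  also have "\<dots> = ennreal (LINT y|lborel. wt l y * (b y)\<^sup>2)" by (rule nn_integral_eq_integral[OF i]) simp
  finally have le: "(\<integral>\<^sup>+z. ennreal ((cmod (u z))\<^sup>2) \<partial>MW l) \<le> ennreal (LINT y|lborel. wt l y * (b y)\<^sup>2)" .
  show uL: "u \<in> L2 (MW l)" unfolding L2_nn_iff using le um by (auto intro: le_less_trans)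
  have "0 \<le> (LINT y|lborel. wt l y * (b y)\<^sup>2)" by simp
  then show "(nrm (MW l) u)\<^sup>2 \<le> (LINT y|lborel. wt l y * (b y)\<^sup>2)" using le unfolding nrm_nn[OF uL] by simp
qed

text \<open>The integral of the absolute difference is evaluated by Tonelli; measurability of both
  functions is what permits the passage from sections to the product.\<close>

lemma AE_P6I:
  assumes um [measurable]: "u \<in> borel_measurable P6" and vm [measurable]: "v \<in> borel_measurable P6"
    and e: "AE y in lborel. AE q in lborel. u (y, q) = (v (y, q) :: complex)"
  shows "AE z in P6. u z = v z"
proof -
  have "(\<integral>\<^sup>+z. ennreal (cmod (u z - v z)) \<partial>P6) = (\<integral>\<^sup>+y. (\<integral>\<^sup>+q. ennreal (cmod (u (y, q) - v (y, q))) \<partial>lborel) \<partial>lborel)"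
    by (subst lborel.nn_integral_fst[symmetric]) auto
  also have "\<dots> = (\<integral>\<^sup>+y. 0 \<partial>(lborel :: vec3 measure))"
  proof (rule nn_integral_cong_AE)
    show "AE y in lborel. (\<integral>\<^sup>+q. ennreal (cmod (u (y, q) - v (y, q))) \<partial>lborel) = 0"
      using e
    proof eventually_elim
      case (elim y)
      have "(\<integral>\<^sup>+q. ennreal (cmod (u (y, q) - v (y, q))) \<partial>lborel) = (\<integral>\<^sup>+q. 0 \<partial>(lborel :: vec3 measure))"
        by (rule nn_integral_cong_AE) (use elim in eventually_elim, simp)
      then show ?case by simp
    qed
  qed
  finally have "AE z in P6. ennreal (cmod (u z - v z)) = 0" by (subst nn_integral_0_iff_AE[symmetric]) auto
  then show ?thesis by eventually_elim (simp add: ennreal_eq_0_iff)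
qed

lemma AE_P6I_snd:
  assumes um [measurable]: "u \<in> borel_measurable P6" and vm [measurable]: "v \<in> borel_measurable P6"
    and e: "AE q in lborel. AE y in lborel. u (y, q) = (v (y, q) :: complex)"
  shows "AE z in P6. u z = v z"
proof -
  have "(\<integral>\<^sup>+z. ennreal (cmod (u z - v z)) \<partial>P6) = (\<integral>\<^sup>+q. (\<integral>\<^sup>+y. ennreal (cmod (u (y, q) - v (y, q))) \<partial>lborel) \<partial>lborel)"
    by (subst lborel_pair.nn_integral_snd[symmetric]) auto
  also have "\<dots> = (\<integral>\<^sup>+q. 0 \<partial>(lborel :: vec3 measure))"
  proof (rule nn_integral_cong_AE)
    show "AE q in lborel. (\<integral>\<^sup>+y. ennreal (cmod (u (y, q) - v (y, q))) \<partial>lborel) = 0"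
      using e
    proof eventually_elim
      case (elim q)
      have "(\<integral>\<^sup>+y. ennreal (cmod (u (y, q) - v (y, q))) \<partial>lborel) = (\<integral>\<^sup>+y. 0 \<partial>(lborel :: vec3 measure))"
        by (rule nn_integral_cong_AE) (use elim in eventually_elim, simp)
      then show ?case by simp
    qed
  qed
  finally have "AE z in P6. ennreal (cmod (u z - v z)) = 0" by (subst nn_integral_0_iff_AE[symmetric]) auto
  then show ?thesis by eventually_elim (simp add: ennreal_eq_0_iff)
qed

section \<open>Elements of the phase space and their transforms\<close>

text \<open>A relation between functions and their transforms on pairs, replacing the choice of a
  transform made in \<open>hl_norm\<close>.\<close>

definition rep :: "real \<Rightarrow> pfun \<Rightarrow> (vec3 \<times> vec3 \<Rightarrow> complex) \<Rightarrow> bool" where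
  "rep l f u \<longleftrightarrow> Hl_rep l f (curry u)"

lemma rep_iff: "rep l f u \<longleftrightarrow> case_prod f \<in> borel_measurable P6 \<and> u \<in> L2 (MW l) \<and>
    (AE q in lborel. is_ft (\<lambda>x. f x q) (\<lambda>y. u (y, q)))"
proof -
  have "(\<lambda>(y, q). (1 + norm y) powr l * (cmod (curry u y q))\<^sup>2) = (\<lambda>z. wt l (fst z) * (cmod (u z))\<^sup>2)"
    by (auto simp: wt_def)
  then show ?thesis unfolding rep_def Hl_rep_def MW_L2_iff by auto
qed

lemma Hl_iff: "f \<in> Hl l \<longleftrightarrow> (\<exists>u. rep l f u)"
proof
  assume "f \<in> Hl l"
  then obtain g where "Hl_rep l f g" by (auto simp: Hl_def)
  then have "rep l f (case_prod g)" by (simp add: rep_def)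
  then show "\<exists>u. rep l f u" by blast
qed (auto simp: Hl_def rep_def)

lemma rep_unique: assumes "rep l f u" "rep l f v" shows "AE z in P6. u z = v z"
proof (rule AE_P6I_snd)
  show "u \<in> borel_measurable P6" "v \<in> borel_measurable P6" using assms by (auto simp: rep_iff MW_L2_iff)
  have "AE q in lborel. is_ft (\<lambda>x. f x q) (\<lambda>y. u (y, q))" "AE q in lborel. is_ft (\<lambda>x. f x q) (\<lambda>y. v (y, q))"
    using assms by (auto simp: rep_iff)
  then show "AE q in lborel. AE y in lborel. u (y, q) = v (y, q)" by eventually_elim (rule is_ft_unique_ft)
qed

text \<open>The transform chosen in \<open>hl_norm\<close> is immaterial, since two transforms of
  \<open>f\<close> agree almost everywhere.\<close>

lemma rep_norm: assumes "rep l f u" shows "hl_norm l f = nrm (MW l) u"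
proof -
  define g where "g = (SOME g. Hl_rep l f g)"
  have g: "Hl_rep l f g" unfolding g_def using assms unfolding rep_def by (rule someI[where P="Hl_rep l f"])
  then have r: "rep l f (case_prod g)" by (simp add: rep_def)
  have gm [measurable]: "case_prod g \<in> borel_measurable P6" using r by (simp add: rep_iff MW_L2_iff)
  have "hl_norm l f = sqrt (LINT z|P6. wt l (fst z) *\<^sub>R (cmod (case_prod g z))\<^sup>2)"
    unfolding hl_norm_def Let_def g_def[symmetric] by (intro arg_cong[where f=sqrt] Bochner_Integration.integral_cong) (auto simp: wt_def)
  also have "\<dots> = nrm (MW l) (case_prod g)"
    unfolding nrm_def MW_def by (subst integral_density) auto
  also have "\<dots> = nrm (MW l) u"
    by (rule nrm_cong_AE) (use r assms rep_unique[OF r assms] in \<open>auto simp: rep_iff MW_L2_iff AE_MW\<close>)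
  finally show ?thesis .
qed

lemma rep_lin: assumes "rep l f u" "rep l g v" shows "rep l (flin a f b g) (\<lambda>z. a * u z + b * v z)"
proof -
  have [measurable]: "case_prod f \<in> borel_measurable P6" "case_prod g \<in> borel_measurable P6" using assms by (auto simp: rep_iff)
  have "case_prod (flin a f b g) = (\<lambda>z. a * case_prod f z + b * case_prod g z)" by (auto simp: flin_def)
  then have "case_prod (flin a f b g) \<in> borel_measurable P6" by simp
  moreover have "AE q in lborel. is_ft (\<lambda>x. f x q) (\<lambda>y. u (y, q))" "AE q in lborel. is_ft (\<lambda>x. g x q) (\<lambda>y. v (y, q))"
    using assms by (auto simp: rep_iff)
  then have "AE q in lborel. is_ft (\<lambda>x. flin a f b g x q) (\<lambda>y. a * u (y, q) + b * v (y, q))"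
    by eventually_elim (simp add: flin_def is_ft_lin)
  ultimately show ?thesis using assms by (auto simp: rep_iff intro!: L2_add L2_cmult)
qed

lemma rep_sub: assumes "rep l f u" "rep l g v" shows "rep l (fsub f g) (\<lambda>z. u z - v z)"
  using rep_lin[OF assms, of 1 "-1"] by (simp add: flin_def fsub_def)

lemma rep_scale: assumes "rep l f u" shows "rep l (fscale c f) (\<lambda>z. c * u z)"
  using rep_lin[OF assms assms, of c 0] by (simp add: flin_def fscale_def)

lemma rep_dist: assumes "rep l f u" "rep l g v" shows "hl_dist l f g = nrm (MW l) (\<lambda>z. u z - v z)"
  unfolding hl_dist_def by (rule rep_norm[OF rep_sub[OF assms]])

lemma rep_L2: "rep l f u \<Longrightarrow> u \<in> L2 (MW l)" by (simp add: rep_iff)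

lemma is_ft_cong_AE:
  assumes "is_ft f g" and gm: "g' \<in> borel_measurable lborel" and e: "AE x in lborel. g x = g' x"
  shows "is_ft f g'"
proof -
  have L: "g \<in> L2 lborel" using assms(1) by (simp add: is_ft_adm)
  have g'm[measurable]: "g' \<in> borel_measurable borel" and [measurable]: "g \<in> borel_measurable borel" using gm L2_meas[OF L] by auto
  have "(LINT x|lborel. g' x * \<phi> x) = (LINT x|lborel. g x * \<phi> x)" if "adm \<phi>" for \<phi>
  proof -
    have [measurable]: "\<phi> \<in> borel_measurable borel" using that L2_meas by (auto simp: adm_def sq_int_iff)
    show ?thesis by (rule integral_cong_AE) (use e in auto)
  qed
  then show ?thesis using assms(1) L2_cong_AE[OF L gm e] by (simp add: is_ft_adm)
qed

lemma rep_cong_AE: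
  assumes r: "rep l f u" and vL: "v \<in> L2 (MW l)" and e: "AE z in P6. u z = v z" shows "rep l f v"
proof -
  have [measurable]: "v \<in> borel_measurable P6" using vL by (simp add: MW_L2_iff)
  have "AE q in lborel. is_ft (\<lambda>x. f x q) (\<lambda>y. u (y, q))" using r by (simp add: rep_iff)
  then have "AE q in lborel. is_ft (\<lambda>x. f x q) (\<lambda>y. v (y, q))"
    using AE_pair_snd[OF e]
  proof eventually_elim
    case (elim q)
    show ?case by (rule is_ft_cong_AE[OF elim(1) _ elim(2)]) measurable
  qed
  then show ?thesis using r vL by (simp add: rep_iff)
qed

lemma rep_exists: assumes "l \<ge> 0" "u \<in> L2 (MW l)" shows "\<exists>f. rep l f u"
proof -
  have "case_prod (curry u) \<in> L2 P6" using MW_L2_P6[OF assms] by simp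
  from is_ft_exists[OF this] obtain f where f: "case_prod f \<in> L2 P6" "AE q in lborel. is_ft (\<lambda>x. f x q) (\<lambda>y. curry u y q)" by blast
  then have "rep l f u" using assms(2) L2_meas[OF f(1)] by (simp add: rep_iff)
  then show ?thesis by blast
qed

text \<open>\<open>rep\<close> gives square integrability of almost every section only. The inverse
  transform built in \<open>is_ft_exists\<close> is jointly square integrable and agrees with
  \<open>f\<close> almost everywhere.\<close>

lemma rep_fun_L2: assumes l: "l \<ge> 0" and r: "rep l f u" shows "case_prod f \<in> L2 P6"
proof -
  have "case_prod (curry u) \<in> L2 P6" using MW_L2_P6[OF l rep_L2[OF r]] by simp
  from is_ft_exists[OF this] obtain f' where f': "case_prod f' \<in> L2 P6" "AE q in lborel. is_ft (\<lambda>x. f' x q) (\<lambda>y. curry u y q)" by blast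
  have fm: "case_prod f \<in> borel_measurable P6" and a: "AE q in lborel. is_ft (\<lambda>x. f x q) (\<lambda>y. u (y, q))" using r by (auto simp: rep_iff)
  have "AE z in P6. case_prod f' z = case_prod f z"
  proof (rule AE_P6I_snd[OF L2_meas[OF f'(1)] fm])
    show "AE q in lborel. AE x in lborel. case_prod f' (x, q) = case_prod f (x, q)"
      using a f'(2) by eventually_elim (simp, rule is_ft_unique_fun, auto)
  qed
  then show ?thesis by (rule L2_cong_AE[OF f'(1) fm])
qed

lemma tensor_L2:
  assumes [measurable]: "\<phi> \<in> borel_measurable borel" "d \<in> borel_measurable borel" and L: "\<phi> \<in> L2 lborel" "d \<in> L2 lborel"
  shows "(\<lambda>(x, p). \<phi> x * d p) \<in> L2 P6"
  unfolding L2_nn_iff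
proof
  show "(\<lambda>(x, p). \<phi> x * d p) \<in> borel_measurable P6" by measurable
  have "(\<integral>\<^sup>+z. ennreal ((cmod (case z of (x, p) \<Rightarrow> \<phi> x * d p))\<^sup>2) \<partial>P6) = (\<integral>\<^sup>+x. (\<integral>\<^sup>+p. ennreal ((cmod (\<phi> x))\<^sup>2) * ennreal ((cmod (d p))\<^sup>2) \<partial>lborel) \<partial>lborel)"
    by (subst lborel.nn_integral_fst[symmetric]) (auto simp: norm_mult power_mult_distrib ennreal_mult')
  also have "\<dots> = ennreal ((nrm lborel \<phi>)\<^sup>2) * ennreal ((nrm lborel d)\<^sup>2)"
    by (simp add: nn_integral_cmult nn_integral_multc nrm_nn[OF L(1)] nrm_nn[OF L(2)])
  also have "\<dots> < \<infinity>" by (simp add: ennreal_mult[symmetric])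
  finally show "(\<integral>\<^sup>+z. ennreal ((cmod (case z of (x, p) \<Rightarrow> \<phi> x * d p))\<^sup>2) \<partial>P6) < \<infinity>" .
qed

lemma moment_L2:
  assumes u: "u \<in> L2 P6" and d: "d \<in> L2 lborel"
  shows "(\<lambda>x. LINT p|lborel. u (x, p) * d p) \<in> L2 lborel"
    and "\<phi> \<in> L2 lborel \<Longrightarrow> (LINT x|lborel. (LINT p|lborel. u (x, p) * d p) * \<phi> x) = (LINT p|lborel. d p * (LINT x|lborel. u (x, p) * \<phi> x))"
proof -
  have [measurable]: "u \<in> borel_measurable P6" "d \<in> borel_measurable borel" using L2_meas[OF u] L2_meas[OF d] by auto
  show "(\<lambda>x. LINT p|lborel. u (x, p) * d p) \<in> L2 lborel"
    unfolding L2_nn_iff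
  proof
    have "(\<integral>\<^sup>+x. ennreal ((cmod (LINT p|lborel. u (x, p) * d p))\<^sup>2) \<partial>lborel) \<le> (\<integral>\<^sup>+x. ennreal ((nrm lborel d)\<^sup>2) * (\<integral>\<^sup>+p. ennreal ((cmod (u (x, p)))\<^sup>2) \<partial>lborel) \<partial>lborel)"
    proof (rule nn_integral_mono_AE)
      show "AE x in lborel. ennreal ((cmod (LINT p|lborel. u (x, p) * d p))\<^sup>2) \<le> ennreal ((nrm lborel d)\<^sup>2) * (\<integral>\<^sup>+p. ennreal ((cmod (u (x, p)))\<^sup>2) \<partial>lborel)"
        using L2_sections'[OF u]
      proof eventually_elim
        case (elim x)
        have "(cmod (LINT p|lborel. u (x, p) * d p))\<^sup>2 \<le> (nrm lborel (\<lambda>p. u (x, p)) * nrm lborel d)\<^sup>2"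
          by (intro power_mono CS[OF elim d]) simp
        then show ?case by (simp add: nrm_nn[OF elim] ennreal_mult'[symmetric] power_mult_distrib mult.commute)
      qed
    qed
    also have "\<dots> = ennreal ((nrm lborel d)\<^sup>2) * ennreal ((nrm P6 u)\<^sup>2)"
      by (subst nn_integral_cmult, measurable) (subst lborel.nn_integral_fst, auto simp: nrm_nn[OF u])
    also have "\<dots> < \<infinity>" by (simp add: ennreal_mult[symmetric])
    finally show "(\<integral>\<^sup>+x. ennreal ((cmod (LINT p|lborel. u (x, p) * d p))\<^sup>2) \<partial>lborel) < \<infinity>" .
  qed measurable
  assume p: "\<phi> \<in> L2 lborel"
  have [measurable]: "\<phi> \<in> borel_measurable borel" using L2_meas[OF p] by simp
  have i: "integrable P6 (\<lambda>(x, p). u (x, p) * (\<phi> x * d p))"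
    using L2_mult_integrable[OF u tensor_L2[OF _ _ p d]] by (simp add: case_prod_beta')
  have "(LINT x|lborel. (LINT p|lborel. u (x, p) * d p) * \<phi> x) = (LINT x|lborel. (LINT p|lborel. u (x, p) * (\<phi> x * d p)))"
    by (intro Bochner_Integration.integral_cong refl) (subst integral_mult_left_zero[symmetric], simp add: mult_ac)
  also have "\<dots> = (LINT p|lborel. (LINT x|lborel. u (x, p) * (\<phi> x * d p)))"
    by (rule lborel_pair.Fubini_integral[OF i, symmetric])
  also have "\<dots> = (LINT p|lborel. d p * (LINT x|lborel. u (x, p) * \<phi> x))"
    by (intro Bochner_Integration.integral_cong refl) (subst integral_mult_right_zero[symmetric], simp add: mult_ac)
  finally show "(LINT x|lborel. (LINT p|lborel. u (x, p) * d p) * \<phi> x) = (LINT p|lborel. d p * (LINT x|lborel. u (x, p) * \<phi> x))" .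
qed

text \<open>Integration over the momentum commutes with the transform in \<open>x\<close>: paired
  with a test function, both moments become integrals over \<open>p\<close> of the pairings at fixed
  \<open>p\<close>.\<close>

lemma is_ft_moment:
  assumes l: "l \<ge> 0" and r: "rep l f u" and d: "d \<in> L2 lborel"
  shows "is_ft (\<lambda>x. LINT p|lborel. f x p * d p) (\<lambda>y. LINT p|lborel. u (y, p) * d p)"
  unfolding is_ft_adm
proof (intro conjI allI impI)
  have f: "case_prod f \<in> L2 P6" and u: "u \<in> L2 P6" using rep_fun_L2[OF l r] MW_L2_P6[OF l rep_L2[OF r]] by auto
  show "(\<lambda>x. LINT p|lborel. f x p * d p) \<in> L2 lborel" using moment_L2(1)[OF f d] by simp
  show "(\<lambda>y. LINT p|lborel. u (y, p) * d p) \<in> L2 lborel" by (rule moment_L2(1)[OF u d])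
  fix \<phi> assume a: "adm \<phi>"
  then have p: "\<phi> \<in> L2 lborel" "ft3 \<phi> \<in> L2 lborel" by (auto simp: adm_def sq_int_iff)
  have [measurable]: "case_prod f \<in> borel_measurable P6" "u \<in> borel_measurable P6" "d \<in> borel_measurable borel" "\<phi> \<in> borel_measurable borel" "ft3 \<phi> \<in> borel_measurable borel"
    using L2_meas[OF f] L2_meas[OF u] L2_meas[OF d] L2_meas[OF p(1)] L2_meas[OF p(2)] by auto
  have "(LINT p|lborel. d p * (LINT y|lborel. u (y, p) * \<phi> y)) = (LINT p|lborel. d p * (LINT x|lborel. f x p * ft3 \<phi> x))"
  proof (rule integral_cong_AE)
    have "AE q in lborel. is_ft (\<lambda>x. f x q) (\<lambda>y. u (y, q))" using r by (simp add: rep_iff)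
    then show "AE p in lborel. d p * (LINT y|lborel. u (y, p) * \<phi> y) = d p * (LINT x|lborel. f x p * ft3 \<phi> x)"
      by eventually_elim (use a in \<open>simp add: is_ft_adm\<close>)
  qed measurable
  then show "(LINT y|lborel. (LINT p|lborel. u (y, p) * d p) * \<phi> y) = (LINT x|lborel. (LINT p|lborel. f x p * d p) * ft3 \<phi> x)"
    using moment_L2(2)[OF u d p(1)] moment_L2(2)[OF f d p(2)] by simp
qed

lemma is_ft_sum:
  assumes "finite I" "\<And>i. i \<in> I \<Longrightarrow> is_ft (f i) (g i)"
  shows "is_ft (\<lambda>x. \<Sum>i\<in>I. c i * f i x) (\<lambda>x. \<Sum>i\<in>I. c i * g i x)"
  using assms
proof (induction I rule: finite_induct)
  case empty
  show ?case by (simp add: is_ft_adm)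
next
  case (insert i I)
  then have "is_ft (\<lambda>x. c i * f i x + 1 * (\<Sum>i\<in>I. c i * f i x)) (\<lambda>x. c i * g i x + 1 * (\<Sum>i\<in>I. c i * g i x))"
    by (intro is_ft_lin) auto
  then show ?case using insert by simp
qed

section \<open>The semigroup on the Fourier side\<close>

definition sec :: "(vec3 \<times> vec3 \<Rightarrow> complex) \<Rightarrow> vec3 \<Rightarrow> vec3 \<Rightarrow> complex" where
  "sec u y = (\<lambda>q. u (y, q))"

lemmas sec_L2 = MW_sections(1)[folded sec_def] and sec_integrable = MW_sections(2)[folded sec_def]
  and sec_nrm = MW_sections(3)[folded sec_def] and sec_L2I = MW_L2I[folded sec_def]

lemma symb_measurable [measurable]: "(\<lambda>z. symb (snd z) (fst z)) \<in> borel_measurable P6" "(\<lambda>q. symb q y) \<in> borel_measurable borel"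
  unfolding symb_def qhat_def by measurable

lemma symb_bound: "cmod (symb q y) \<le> 1 + norm y"
proof -
  have "norm (qhat q) \<le> 1" using norm_le_q0[of q] q0_pos[of q] by (simp add: qhat_def field_simps)
  then have "\<bar>qhat q \<bullet> y\<bar> \<le> norm y" using Cauchy_Schwarz_ineq2[of "qhat q" y] mult_right_mono[of "norm (qhat q)" 1 "norm y"] by simp
  moreover have "1 / q0 q \<le> 1" "0 \<le> 1 / q0 q" using q0_ge_1[of q] by auto
  moreover have "cmod (symb q y) \<le> cmod (of_real (1 / q0 q)) + cmod (\<i> * of_real (qhat q \<bullet> y))"
    unfolding symb_def by (rule norm_triangle_ineq)
  ultimately show ?thesis by (simp only: norm_mult norm_of_real norm_ii)
qed

lemma efun_measurable [measurable]: "efun \<beta> a \<in> borel_measurable borel"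
  and dfun_measurable [measurable]: "dfun \<beta> a \<in> borel_measurable borel"
  unfolding efun_def[abs_def] dfun_def[abs_def] by measurable

lemma nrm_0_AE: assumes "u \<in> L2 (MW l)" "v \<in> L2 (MW l)"
  shows "nrm (MW l) (\<lambda>z. u z - v z) = 0 \<longleftrightarrow> (AE z in P6. u z = v z)"
  unfolding nrm_eq_0[OF L2_diff[OF assms]] AE_MW by simp

lemma nrm_0_sec: assumes "u \<in> L2 (MW l)" "v \<in> L2 (MW l)" and e: "AE y in lborel. sec u y = sec v y"
  shows "nrm (MW l) (\<lambda>z. u z - v z) = 0"
  unfolding nrm_0_AE[OF assms(1,2)]
proof (rule AE_P6I)
  show "u \<in> borel_measurable P6" "v \<in> borel_measurable P6" using assms by (auto simp: MW_L2_iff)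
  show "AE y in lborel. AE q in lborel. u (y, q) = v (y, q)"
    using e by eventually_elim (simp add: sec_def fun_eq_iff)
qed

text \<open>Dominated convergence over the frequencies; it is applied to sequences of times, which
  characterise the one-sided limit.\<close>

lemma sec_tendsto_0:
  assumes w: "\<And>h. 0 < h \<Longrightarrow> h \<le> 1 \<Longrightarrow> w h \<in> L2 (MW l)"
    and B: "integrable lborel (\<lambda>y. wt l y * (B y)\<^sup>2)"
    and b: "\<And>h. 0 < h \<Longrightarrow> h \<le> 1 \<Longrightarrow> AE y in lborel. nrm lborel (sec (w h) y) \<le> B y"
    and lim: "AE y in lborel. ((\<lambda>h. nrm lborel (sec (w h) y)) \<longlongrightarrow> 0) (at_right 0)"
  shows "((\<lambda>h. nrm (MW l) (w h)) \<longlongrightarrow> 0) (at_right (0::real))"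
  unfolding tendsto_at_iff_sequentially
proof (intro allI impI)
  fix X :: "nat \<Rightarrow> real" assume X: "\<forall>i. X i \<in> {0<..} - {0}" "X \<longlonglongrightarrow> 0"
  \<comment> \<open>The hypotheses concern times up to 1; the truncation changes only finitely many
    terms.\<close>
  define Y where "Y i = min (X i) 1" for i
  have Y: "0 < Y i" "Y i \<le> 1" for i using X by (auto simp: Y_def)
  have "Y \<longlonglongrightarrow> min 0 1" unfolding Y_def by (intro tendsto_intros X)
  then have Y0: "Y \<longlonglongrightarrow> 0" by simp
  have [measurable]: "w (Y i) \<in> borel_measurable P6" for i using w[OF Y] by (simp add: MW_L2_iff)
  have [measurable]: "(\<lambda>y. nrm lborel (sec (w (Y i)) y)) \<in> borel_measurable lborel" for i unfolding nrm_def sec_def by measurable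
  have "(\<lambda>i. LINT y|lborel. wt l y * (nrm lborel (sec (w (Y i)) y))\<^sup>2) \<longlonglongrightarrow> (LINT y|(lborel::vec3 measure). 0)"
  proof (rule integral_dominated_convergence[OF _ _ B])
    show "AE y in lborel. (\<lambda>i. wt l y * (nrm lborel (sec (w (Y i)) y))\<^sup>2) \<longlonglongrightarrow> 0"
      using lim
    proof eventually_elim
      case (elim y)
      have "(\<lambda>i. nrm lborel (sec (w (Y i)) y)) \<longlonglongrightarrow> 0"
        using elim[unfolded tendsto_at_iff_sequentially, rule_format, of Y] Y Y0 by (auto simp: o_def less_imp_neq[symmetric])
      then have "(\<lambda>i. wt l y * (nrm lborel (sec (w (Y i)) y))\<^sup>2) \<longlonglongrightarrow> wt l y * 0\<^sup>2" by (intro tendsto_intros)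
      then show ?case by simp
    qed
    show "AE y in lborel. norm (wt l y * (nrm lborel (sec (w (Y i)) y))\<^sup>2) \<le> wt l y * (B y)\<^sup>2" for i
      using b[OF Y] by eventually_elim (auto intro!: mult_left_mono power_mono)
  qed measurable
  then have "(\<lambda>i. (nrm (MW l) (w (Y i)))\<^sup>2) \<longlonglongrightarrow> 0" by (simp add: sec_nrm[OF w[OF Y]])
  from tendsto_real_sqrt[OF this] have "(\<lambda>i. nrm (MW l) (w (Y i))) \<longlonglongrightarrow> 0" by simp
  moreover have "eventually (\<lambda>i. X i < 1) sequentially" using order_tendstoD(2)[OF X(2), of 1] by simp
  then have "eventually (\<lambda>i. nrm (MW l) (w (Y i)) = ((\<lambda>h. nrm (MW l) (w h)) \<circ> X) i) sequentially"
    by eventually_elim (simp add: Y_def)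
  ultimately show "((\<lambda>h. nrm (MW l) (w h)) \<circ> X) \<longlonglongrightarrow> 0" by (rule Lim_transform_eventually)
qed

text \<open>The transform of \<open>Pop\<close> divided by \<open>q0\<close>; it has the same form
  as on the phase space because it acts in the momentum only.\<close>

definition Kg :: "real \<Rightarrow> (vec3 \<times> vec3 \<Rightarrow> complex) \<Rightarrow> vec3 \<times> vec3 \<Rightarrow> complex" where
  "Kg \<beta> u z = (\<Sum>a\<in>UNIV. efun \<beta> a (snd z) * (LINT p|lborel. u (fst z, p) * dfun \<beta> a p))"

locale bgk =
  fixes \<beta> l :: real
  assumes b: "\<beta> > 0" and l: "l \<ge> 0"
begin

text \<open>Transport contributes \<open>- \<i> * (qhat q \<bullet> y)\<close> times the squared
  modulus of \<open>u\<close>. Its integral is imaginary, so the real part is that of the collision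
  term.\<close>

sublocale fr: finite_rank_gen lborel "\<lambda>q. symb q y" "efun \<beta>" "dfun \<beta>" UNIV "1 + norm y" for y
proof
  fix u :: "vec3 \<Rightarrow> complex" assume u: "u \<in> L2 lborel"
  let ?K = "\<lambda>q. \<Sum>a\<in>UNIV. efun \<beta> a q * (LINT p|lborel. u p * dfun \<beta> a p)"
  have KL: "?K \<in> L2 lborel"
    using L2_sum[of UNIV "\<lambda>a q. (LINT p|lborel. u p * dfun \<beta> a p) * efun \<beta> a q", OF L2_cmult[OF efun_L2[OF b]]] by (simp add: mult.commute)
  have 1: "(\<lambda>q. of_real (1 / q0 q) * u q) \<in> L2 lborel"
    by (rule L2_mult_bounded[OF u, where B=1]) (simp_all add: norm_divide le_divide_eq abs_of_pos[OF q0_pos] q0_pos q0_ge_1)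
  have qm: "(\<lambda>q. complex_of_real (qhat q \<bullet> y)) \<in> borel_measurable lborel" unfolding qhat_def by measurable
  have 2: "(\<lambda>q. of_real (qhat q \<bullet> y) * u q) \<in> L2 lborel"
  proof (rule L2_mult_bounded[OF u qm, where B="norm y"])
    fix q
    have "norm (qhat q) \<le> 1" using norm_le_q0[of q] q0_pos[of q] by (simp add: qhat_def field_simps)
    then show "cmod (complex_of_real (qhat q \<bullet> y)) \<le> norm y"
      using Cauchy_Schwarz_ineq2[of "qhat q" y] mult_right_mono[of "norm (qhat q)" 1 "norm y"] by simp
  qed
  note c = L2_cnj[OF u]
  have e: "(?K q - symb q y * u q) * cnj (u q) = (?K q - u q / of_real (q0 q)) * cnj (u q) - \<i> * of_real ((qhat q \<bullet> y) * (cmod (u q))\<^sup>2)" for q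
    by (simp only: of_real_mult complex_norm_square) (simp add: symb_def algebra_simps)
  have i1: "integrable lborel (\<lambda>q. (?K q - u q / of_real (q0 q)) * cnj (u q))"
    using L2_mult_integrable[OF L2_diff[OF KL 1] c] by simp
  have i2: "integrable lborel (\<lambda>q. complex_of_real ((qhat q \<bullet> y) * (cmod (u q))\<^sup>2))"
    using L2_mult_integrable[OF 2 c] by (simp only: of_real_mult complex_norm_square mult.assoc)
  have "Re (LINT q|lborel. (?K q - symb q y * u q) * cnj (u q)) = Re (LINT q|lborel. (?K q - u q / of_real (q0 q)) * cnj (u q))"
    unfolding e Bochner_Integration.integral_diff[OF i1 integrable_mult_right[OF i2]] by (simp only: integral_mult_right_zero integral_complex_of_real) simp
  then show "Re (LINT q|lborel. (?K q - symb q y * u q) * cnj (u q)) \<le> 0"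
    using collision_dissipative[OF b u] by simp
qed (use symb_bound in \<open>auto intro: efun_L2[OF b] dfun_L2[OF b]\<close>)

definition Ag :: "(vec3 \<times> vec3 \<Rightarrow> complex) \<Rightarrow> vec3 \<times> vec3 \<Rightarrow> complex" where
  "Ag u z = fr.A (fst z) (sec u (fst z)) (snd z)"

definition Tg :: "real \<Rightarrow> (vec3 \<times> vec3 \<Rightarrow> complex) \<Rightarrow> vec3 \<times> vec3 \<Rightarrow> complex" where
  "Tg t u z = fr.T (fst z) t (sec u (fst z)) (snd z)"

lemma sec_Ag: "sec (Ag u) y = fr.A y (sec u y)" by (simp add: sec_def[of "Ag u"] Ag_def)
lemma sec_Tg: "sec (Tg t u) y = fr.T y t (sec u y)" by (simp add: sec_def[of "Tg t u"] Tg_def)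

lemma Ag_eq: "Ag u z = Kg \<beta> u z - symb (snd z) (fst z) * u z"
  by (simp add: Ag_def fr.A_def Kg_def sec_def)

lemma Kg_measurable [measurable]: assumes [measurable]: "u \<in> borel_measurable P6" shows "Kg \<beta> u \<in> borel_measurable P6"
  unfolding Kg_def[abs_def] by measurable

lemma Ag_measurable [measurable]: assumes [measurable]: "u \<in> borel_measurable P6" shows "Ag u \<in> borel_measurable P6"
  unfolding Ag_eq[abs_def] by measurable

lemma Ag_iter: "sec ((Ag ^^ n) u) y = (fr.A y ^^ n) (sec u y)"
  by (induction n) (simp_all add: sec_Ag)

text \<open>Each frequency has its own exponential; as one series in the iterates of
  \<open>Ag\<close>, with the frequency as a variable, it is seen to be jointly measurable.\<close>

lemma Tg_eq: "Tg t u z = (\<Sum>n. of_real (t ^ n / fact n) * (Ag ^^ n) u z)"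
proof -
  have "(fr.A (fst z) ^^ n) (sec u (fst z)) (snd z) = (Ag ^^ n) u z" for n
    unfolding Ag_iter[symmetric] by (simp add: sec_def)
  then show ?thesis unfolding Tg_def fr.T_def by simp
qed

lemma Tg_measurable [measurable]: assumes u: "u \<in> borel_measurable P6" shows "Tg t u \<in> borel_measurable P6"
proof -
  have [measurable]: "(Ag ^^ n) u \<in> borel_measurable P6" for n by (induction n) (use u in auto)
  show ?thesis unfolding Tg_eq[abs_def] by measurable
qed

lemma Tg_L2: assumes t: "t \<ge> 0" and u: "u \<in> L2 (MW l)"
  shows "Tg t u \<in> L2 (MW l)" "nrm (MW l) (Tg t u) \<le> nrm (MW l) u"
proof -
  have m: "Tg t u \<in> borel_measurable P6" by (rule Tg_measurable) (use u in \<open>simp add: MW_L2_iff\<close>)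
  have a: "AE y in lborel. sec (Tg t u) y \<in> L2 lborel \<and> nrm lborel (sec (Tg t u) y) \<le> nrm lborel (sec u y)"
    using sec_L2[OF u] unfolding sec_Tg by eventually_elim (use t in \<open>auto intro: fr.TL fr.T_contraction\<close>)
  show "Tg t u \<in> L2 (MW l)" by (rule sec_L2I(1)[OF m sec_integrable[OF u] a])
  have "(nrm (MW l) (Tg t u))\<^sup>2 \<le> (nrm (MW l) u)\<^sup>2"
    unfolding sec_nrm[OF u] by (rule sec_L2I(2)[OF m sec_integrable[OF u] a])
  then show "nrm (MW l) (Tg t u) \<le> nrm (MW l) u" by (rule power2_le_imp_le) simp
qed

lemma scaled_sec_integrable: assumes u: "u \<in> L2 (MW l)" shows "integrable lborel (\<lambda>y. wt l y * (c * nrm lborel (sec u y))\<^sup>2)"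
proof -
  have "integrable lborel (\<lambda>y. c\<^sup>2 * (wt l y * (nrm lborel (sec u y))\<^sup>2))" using sec_integrable[OF u] by simp
  then show ?thesis by (simp add: power_mult_distrib mult_ac)
qed

sublocale Tg: L2_semigroup "MW l" Tg
proof
  fix t s :: real and u v :: "vec3 \<times> vec3 \<Rightarrow> complex" and a b' :: complex
  show "Tg t u \<in> L2 (MW l)" if "t \<ge> 0" "u \<in> L2 (MW l)" using that by (rule Tg_L2)
  show "\<exists>C. \<forall>u\<in>L2 (MW l). nrm (MW l) (Tg t u) \<le> C * nrm (MW l) u" if "t \<ge> 0"
    using Tg_L2(2)[OF that] by (intro exI[of _ 1]) simp
  show "nrm (MW l) (\<lambda>x. Tg t (\<lambda>x. a * u x + b' * v x) x - (a * Tg t u x + b' * Tg t v x)) = 0"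
    if t: "t \<ge> 0" and u: "u \<in> L2 (MW l)" and v: "v \<in> L2 (MW l)"
  proof (rule nrm_0_sec)
    show "Tg t (\<lambda>x. a * u x + b' * v x) \<in> L2 (MW l)" "(\<lambda>x. a * Tg t u x + b' * Tg t v x) \<in> L2 (MW l)"
      using t u v by (auto intro!: Tg_L2 L2_add L2_cmult)
    show "AE y in lborel. sec (Tg t (\<lambda>x. a * u x + b' * v x)) y = sec (\<lambda>x. a * Tg t u x + b' * Tg t v x) y"
      using sec_L2[OF u] sec_L2[OF v]
    proof eventually_elim
      case (elim y)
      have "sec (\<lambda>x. a * Tg t u x + b' * Tg t v x) y = (\<lambda>q. a * sec (Tg t u) y q + b' * sec (Tg t v) y q)"
        "sec (\<lambda>x. a * u x + b' * v x) y = (\<lambda>q. a * sec u y q + b' * sec v y q)" by (simp_all add: sec_def)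
      then show ?case unfolding sec_Tg using fr.T_lin[OF elim t] by simp
    qed
  qed
  show "nrm (MW l) (\<lambda>x. Tg 0 u x - u x) = 0" if u: "u \<in> L2 (MW l)"
    by (rule nrm_0_sec[OF Tg_L2(1)[OF order_refl u] u]) (simp add: sec_Tg fr.T_0)
  show "nrm (MW l) (\<lambda>x. Tg (s + t) u x - Tg s (Tg t u) x) = 0" if s: "s \<ge> 0" and t: "t \<ge> 0" and u: "u \<in> L2 (MW l)"
  proof (rule nrm_0_sec)
    show "Tg (s + t) u \<in> L2 (MW l)" "Tg s (Tg t u) \<in> L2 (MW l)" using s t u by (auto intro!: Tg_L2)
    show "AE y in lborel. sec (Tg (s + t) u) y = sec (Tg s (Tg t u)) y"
      using sec_L2[OF u] unfolding sec_Tg by eventually_elim (simp add: fr.T_semigroup s t)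
  qed
  show "((\<lambda>t. nrm (MW l) (\<lambda>x. Tg t u x - u x)) \<longlongrightarrow> 0) (at_right 0)" if u: "u \<in> L2 (MW l)"
  \<comment> \<open>The majorant comes from contraction. The increment bound gives the limit at each
    frequency, but \<open>u\<close> need not be in the domain, so it cannot serve as a majorant
    here.\<close>
  proof (rule sec_tendsto_0[where B="\<lambda>y. 2 * nrm lborel (sec u y)"])
    have s: "sec (\<lambda>x. Tg h u x - u x) y = (\<lambda>q. fr.T y h (sec u y) q - sec u y q)" for h y
      using sec_Tg[of h u y] by (simp add: sec_def fun_eq_iff)
    show "(\<lambda>x. Tg h u x - u x) \<in> L2 (MW l)" if "0 < h" for h using that u by (auto intro!: L2_diff Tg_L2)
    show "integrable lborel (\<lambda>y. wt l y * (2 * nrm lborel (sec u y))\<^sup>2)" by (rule scaled_sec_integrable[OF u])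
    show "AE y in lborel. nrm lborel (sec (\<lambda>x. Tg h u x - u x) y) \<le> 2 * nrm lborel (sec u y)" if "0 < h" for h
      using sec_L2[OF u] unfolding s
    proof eventually_elim
      case (elim y)
      have h: "h \<ge> 0" using that by simp
      show ?case using nrm_triangle_diff[OF fr.TL[OF elim h] elim, of y] fr.T_contraction[OF elim h, of y] by linarith
    qed
    show "AE y in lborel. ((\<lambda>h. nrm lborel (sec (\<lambda>x. Tg h u x - u x) y)) \<longlongrightarrow> 0) (at_right 0)"
      using sec_L2[OF u] unfolding s
    proof eventually_elim
      case (elim y)
      show ?case
      proof (rule Lim_null_comparison)
        have "((\<lambda>h. h * nrm lborel (fr.A y (sec u y))) \<longlongrightarrow> 0 * nrm lborel (fr.A y (sec u y))) (at_right 0)" by (intro tendsto_intros)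
        then show "((\<lambda>h. h * nrm lborel (fr.A y (sec u y))) \<longlongrightarrow> 0) (at_right 0)" by simp
        show "\<forall>\<^sub>F h in at_right 0. norm (nrm lborel (\<lambda>q. fr.T y h (sec u y) q - sec u y q)) \<le> h * nrm lborel (fr.A y (sec u y))"
          using eventually_at_right_less[of 0] by eventually_elim (simp add: fr.T_increment[OF elim])
      qed
    qed
  qed
qed

lemma sec_quot: "sec (quot Tg h u) y = (\<lambda>q. of_real (1 / h) * (fr.T y h (sec u y) q - sec u y q))"
  using sec_Tg[of h u y] by (simp add: sec_def quot_def fun_eq_iff)

text \<open>\<open>fr.T_increment\<close> bounds the quotients by \<open>Ag u\<close> at every
  frequency, which gives an integrable majorant because \<open>Ag u\<close> is assumed square
  integrable.\<close>

lemma Tg_generator: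
  assumes u: "u \<in> L2 (MW l)" and Au: "Ag u \<in> L2 (MW l)"
  shows "((\<lambda>h. nrm (MW l) (\<lambda>z. quot Tg h u z - Ag u z)) \<longlongrightarrow> 0) (at_right 0)"
proof (rule sec_tendsto_0[where B="\<lambda>y. 2 * nrm lborel (sec (Ag u) y)"])
  have s: "sec (\<lambda>z. quot Tg h u z - Ag u z) y = (\<lambda>q. of_real (1 / h) * (fr.T y h (sec u y) q - sec u y q) - fr.A y (sec u y) q)" for h y
    unfolding sec_Ag[symmetric] using sec_quot[of h u y] by (simp add: sec_def fun_eq_iff)
  show "(\<lambda>z. quot Tg h u z - Ag u z) \<in> L2 (MW l)" if "0 < h" for h using that u Au by (auto intro!: L2_diff Tg.quot_L2)
  show "integrable lborel (\<lambda>y. wt l y * (2 * nrm lborel (sec (Ag u) y))\<^sup>2)" by (rule scaled_sec_integrable[OF Au])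
  show "AE y in lborel. nrm lborel (sec (\<lambda>z. quot Tg h u z - Ag u z) y) \<le> 2 * nrm lborel (sec (Ag u) y)" if h: "0 < h" for h
    using sec_L2[OF u] unfolding s sec_Ag
  proof eventually_elim
    case (elim y)
    have h0: "h \<ge> 0" using h by simp
    have dL: "(\<lambda>q. fr.T y h (sec u y) q - sec u y q) \<in> L2 lborel" by (intro L2_diff fr.TL elim h0)
    have "nrm lborel (\<lambda>q. of_real (1 / h) * (fr.T y h (sec u y) q - sec u y q)) = (1 / h) * nrm lborel (\<lambda>q. fr.T y h (sec u y) q - sec u y q)"
      unfolding nrm_scale using h by (simp add: norm_divide)
    also have "\<dots> \<le> (1 / h) * (h * nrm lborel (fr.A y (sec u y)))"
      using h by (intro mult_left_mono fr.T_increment elim) auto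
    finally have "nrm lborel (\<lambda>q. of_real (1 / h) * (fr.T y h (sec u y) q - sec u y q)) \<le> nrm lborel (fr.A y (sec u y))" using h by simp
    then show ?case using nrm_triangle_diff[OF L2_cmult[OF dL, of "of_real (1 / h)"] fr.AL[OF elim, of y]] by linarith
  qed
  show "AE y in lborel. ((\<lambda>h. nrm lborel (sec (\<lambda>z. quot Tg h u z - Ag u z) y)) \<longlongrightarrow> 0) (at_right 0)"
    using sec_L2[OF u] unfolding s
  proof eventually_elim
    case (elim y)
    show ?case
    proof (rule Lim_null_comparison)
      have "((\<lambda>h. fr.D y * h * nrm lborel (sec u y)) \<longlongrightarrow> fr.D y * 0 * nrm lborel (sec u y)) (at_right 0)" by (intro tendsto_intros)
      then show "((\<lambda>h. fr.D y * h * nrm lborel (sec u y)) \<longlongrightarrow> 0) (at_right 0)" by simp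
      have "eventually (\<lambda>h::real. h < 1) (at_right 0)" by (rule eventually_at_right_real[THEN eventually_mono, of 0 1]) auto
      then show "\<forall>\<^sub>F h in at_right 0. norm (nrm lborel (\<lambda>q. of_real (1 / h) * (fr.T y h (sec u y) q - sec u y q) - fr.A y (sec u y) q)) \<le> fr.D y * h * nrm lborel (sec u y)"
        using eventually_at_right_less[of 0]
      proof eventually_elim
        case (elim h)
        then show ?case using fr.T_quotient[OF \<open>sec u y \<in> L2 lborel\<close>, of h y] by simp
      qed
    qed
  qed
qed

text \<open>Nothing is known in advance about the weighted norm of \<open>Ag u\<close>. At each
  frequency the quotients converge to it, so Fatou bounds the weighted integral of the squared
  distance between \<open>Ag u\<close> and \<open>v\<close> by the limit 0.\<close>

lemma Tg_generator_unique:
  assumes u: "u \<in> L2 (MW l)" and v: "v \<in> L2 (MW l)"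
    and q: "((\<lambda>h. nrm (MW l) (\<lambda>z. quot Tg h u z - v z)) \<longlongrightarrow> 0) (at_right 0)"
  shows "AE z in P6. v z = Ag u z"
proof -
  define h where "h k = 1 / real (Suc k)" for k
  have h: "0 < h k" "h k \<le> 1" "h k \<ge> 0" for k by (auto simp: h_def)
  have h0: "h \<longlonglongrightarrow> 0" unfolding h_def by (rule LIMSEQ_Suc[OF lim_1_over_n])
  have um [measurable]: "u \<in> borel_measurable P6" and vm [measurable]: "v \<in> borel_measurable P6" using u v by (auto simp: MW_L2_iff)
  let ?w = "\<lambda>k z. quot Tg (h k) u z - v z"
  have wL: "?w k \<in> L2 (MW l)" for k using u v h(3) by (auto intro!: L2_diff Tg.quot_L2)
  have [measurable]: "?w k \<in> borel_measurable P6" for k using wL[of k] by (simp add: MW_L2_iff)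
  have [measurable]: "(\<lambda>y. nrm lborel (sec (?w k) y)) \<in> borel_measurable lborel" for k unfolding nrm_def sec_def by measurable
  have [measurable]: "(\<lambda>y. nrm lborel (\<lambda>q. sec (Ag u) y q - sec v y q)) \<in> borel_measurable lborel" unfolding nrm_def sec_def by measurable
  have q': "(\<lambda>k. nrm (MW l) (?w k)) \<longlonglongrightarrow> 0"
    using q[unfolded tendsto_at_iff_sequentially, rule_format, of h] h(1) h0 by (auto simp: o_def less_imp_neq[symmetric])
  have sw: "sec (?w k) y = (\<lambda>q. sec (quot Tg (h k) u) y q - sec v y q)" for k y by (simp add: sec_def)
  have lim: "AE y in lborel. (\<lambda>k. nrm lborel (sec (?w k) y)) \<longlonglongrightarrow> nrm lborel (\<lambda>q. sec (Ag u) y q - sec v y q)"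
    using sec_L2[OF u] sec_L2[OF v]
  proof eventually_elim
    case (elim y)
    have A: "sec (Ag u) y \<in> L2 lborel" unfolding sec_Ag by (rule fr.AL[OF elim(1)])
    have Q: "sec (quot Tg (h k) u) y \<in> L2 lborel" for k unfolding sec_quot by (intro L2_cmult L2_diff fr.TL elim h)
    have d: "nrm lborel (\<lambda>q. sec (quot Tg (h k) u) y q - sec (Ag u) y q) \<le> fr.D y * h k * nrm lborel (sec u y)" for k
      unfolding sec_quot sec_Ag by (rule fr.T_quotient[OF elim(1) h(1,2)])
    have "norm (nrm lborel (sec (?w k) y) - nrm lborel (\<lambda>q. sec (Ag u) y q - sec v y q)) \<le> fr.D y * h k * nrm lborel (sec u y)" for k
      unfolding sw using nrm_triangle3[OF Q A elim(2), of k] nrm_triangle3[OF A Q elim(2), of k] d[of k]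
        nrm_minus_commute[of lborel "sec (Ag u) y" "sec (quot Tg (h k) u) y"] by (simp add: abs_le_iff)
    then have n: "\<forall>\<^sub>F k in sequentially. norm (nrm lborel (sec (?w k) y) - nrm lborel (\<lambda>q. sec (Ag u) y q - sec v y q)) \<le> fr.D y * h k * nrm lborel (sec u y)"
      by (intro always_eventually allI)
    have "(\<lambda>k. fr.D y * h k * nrm lborel (sec u y)) \<longlonglongrightarrow> fr.D y * 0 * nrm lborel (sec u y)" by (intro tendsto_intros h0)
    then have z: "(\<lambda>k. fr.D y * h k * nrm lborel (sec u y)) \<longlonglongrightarrow> 0" by simp
    from LIM_zero_cancel[OF Lim_null_comparison[OF n z]] show ?case .
  qed
  have "(\<integral>\<^sup>+y. ennreal (wt l y * (nrm lborel (\<lambda>q. sec (Ag u) y q - sec v y q))\<^sup>2) \<partial>lborel)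
      = (\<integral>\<^sup>+y. liminf (\<lambda>k. ennreal (wt l y * (nrm lborel (sec (?w k) y))\<^sup>2)) \<partial>lborel)"
  proof (rule nn_integral_cong_AE)
    show "AE y in lborel. ennreal (wt l y * (nrm lborel (\<lambda>q. sec (Ag u) y q - sec v y q))\<^sup>2) = liminf (\<lambda>k. ennreal (wt l y * (nrm lborel (sec (?w k) y))\<^sup>2))"
      using lim
    proof eventually_elim
      case (elim y)
      have "(\<lambda>k. ennreal (wt l y * (nrm lborel (sec (?w k) y))\<^sup>2)) \<longlonglongrightarrow> ennreal (wt l y * (nrm lborel (\<lambda>q. sec (Ag u) y q - sec v y q))\<^sup>2)"
        by (intro tendsto_intros elim)
      from lim_imp_Liminf[OF _ this] show ?case by simp
    qed
  qed
  also have "\<dots> \<le> liminf (\<lambda>k. \<integral>\<^sup>+y. ennreal (wt l y * (nrm lborel (sec (?w k) y))\<^sup>2) \<partial>lborel)"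
    by (rule nn_integral_liminf) measurable
  also have "(\<lambda>k. \<integral>\<^sup>+y. ennreal (wt l y * (nrm lborel (sec (?w k) y))\<^sup>2) \<partial>lborel) = (\<lambda>k. ennreal ((nrm (MW l) (?w k))\<^sup>2))"
    using nn_integral_eq_integral[OF sec_integrable[OF wL]] sec_nrm[OF wL] by simp
  also have "liminf \<dots> = 0"
  proof -
    have "(\<lambda>k. ennreal ((nrm (MW l) (?w k))\<^sup>2)) \<longlonglongrightarrow> ennreal (0\<^sup>2)" by (intro tendsto_intros q')
    from lim_imp_Liminf[OF _ this] show ?thesis by simp
  qed
  finally have "(\<integral>\<^sup>+y. ennreal (wt l y * (nrm lborel (\<lambda>q. sec (Ag u) y q - sec v y q))\<^sup>2) \<partial>lborel) = 0" by simp
  then have "AE y in lborel. ennreal (wt l y * (nrm lborel (\<lambda>q. sec (Ag u) y q - sec v y q))\<^sup>2) = 0"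
    by (subst (asm) nn_integral_0_iff_AE) auto
  then have "AE y in lborel. AE q in lborel. v (y, q) = Ag u (y, q)"
    using sec_L2[OF u] sec_L2[OF v]
  proof eventually_elim
    case (elim y)
    have A: "sec (Ag u) y \<in> L2 lborel" unfolding sec_Ag by (rule fr.AL[OF elim(2)])
    have "wt l y * (nrm lborel (\<lambda>q. sec (Ag u) y q - sec v y q))\<^sup>2 = 0" using elim(1) mult_nonneg_nonneg[OF less_imp_le[OF wt_pos] zero_le_power2, of l y "nrm lborel (\<lambda>q. sec (Ag u) y q - sec v y q)"] by (simp only: ennreal_eq_0_iff order_antisym)
    then have "nrm lborel (\<lambda>q. sec (Ag u) y q - sec v y q) = 0" using wt_pos[of l y] by simp
    then have "AE q in lborel. sec (Ag u) y q - sec v y q = 0" by (simp only: nrm_eq_0[OF L2_diff[OF A elim(3)]])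
    then show ?case by eventually_elim (simp add: sec_def)
  qed
  then show ?thesis by (intro AE_P6I) measurable
qed

text \<open>The constant \<open>c\<close> is independent of the frequency, so the collision part is
  bounded on the weighted space.\<close>

lemma Kg_L2: assumes u: "u \<in> L2 (MW l)" shows "Kg \<beta> u \<in> L2 (MW l)"
proof -
  have m: "Kg \<beta> u \<in> borel_measurable P6" by (rule Kg_measurable) (use u in \<open>simp add: MW_L2_iff\<close>)
  define c where "c = (\<Sum>a\<in>UNIV. nrm lborel (dfun \<beta> a) * nrm lborel (efun \<beta> a))"
  show ?thesis
  proof (rule sec_L2I(1)[OF m scaled_sec_integrable[OF u, of c]])
    show "AE y in lborel. sec (Kg \<beta> u) y \<in> L2 lborel \<and> nrm lborel (sec (Kg \<beta> u) y) \<le> c * nrm lborel (sec u y)"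
      using sec_L2[OF u]
    proof eventually_elim
      case (elim y)
      let ?m = "\<lambda>a. LINT p|lborel. sec u y p * dfun \<beta> a p"
      have e: "sec (Kg \<beta> u) y = (\<lambda>q. \<Sum>a\<in>UNIV. ?m a * efun \<beta> a q)" by (simp add: sec_def Kg_def mult.commute)
      have "nrm lborel (\<lambda>q. \<Sum>a\<in>UNIV. ?m a * efun \<beta> a q) \<le> (\<Sum>a\<in>UNIV. nrm lborel (\<lambda>q. ?m a * efun \<beta> a q))"
        by (intro nrm_sum L2_cmult efun_L2 b)
      also have "\<dots> \<le> (\<Sum>a\<in>UNIV. (nrm lborel (sec u y) * nrm lborel (dfun \<beta> a)) * nrm lborel (efun \<beta> a))"
        unfolding nrm_scale by (intro sum_mono mult_right_mono CS elim dfun_L2 b) simp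
      also have "\<dots> = c * nrm lborel (sec u y)" by (simp add: c_def sum_distrib_left mult_ac)
      finally show ?case unfolding e by (auto intro!: L2_sum L2_cmult efun_L2 b)
    qed
  qed
qed

text \<open>The collision part is bounded, hence the domain is that of transport alone.\<close>

lemma Ag_L2_iff: assumes u: "u \<in> L2 (MW l)"
  shows "Ag u \<in> L2 (MW l) \<longleftrightarrow> (\<lambda>z. symb (snd z) (fst z) * u z) \<in> L2 (MW l)"
proof
  assume "Ag u \<in> L2 (MW l)"
  from L2_diff[OF Kg_L2[OF u] this] show "(\<lambda>z. symb (snd z) (fst z) * u z) \<in> L2 (MW l)" by (simp add: Ag_eq)
next
  assume "(\<lambda>z. symb (snd z) (fst z) * u z) \<in> L2 (MW l)"
  from L2_diff[OF Kg_L2[OF u] this] show "Ag u \<in> L2 (MW l)" by (simp add: Ag_eq[abs_def])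
qed

text \<open>Cutting off frequencies above \<open>n\<close> makes the symbol bounded by
  \<open>1 + n\<close>, and the cut functions converge by dominated convergence.\<close>

lemma domain_dense:
  assumes u: "u \<in> L2 (MW l)" and e: "e > 0"
  shows "\<exists>v\<in>{v \<in> L2 (MW l). Ag v \<in> L2 (MW l)}. nrm (MW l) (\<lambda>z. u z - v z) < e"
proof -
  define v where "v n z = (if norm (fst z) \<le> real n then u z else 0)" for n :: nat and z
  have um [measurable]: "u \<in> borel_measurable P6" using u by (simp add: MW_L2_iff)
  have vm [measurable]: "v n \<in> borel_measurable P6" for n unfolding v_def by measurable
  have vL: "v n \<in> L2 (MW l)" for n
    by (rule L2_dom[OF _ L2_integrable[OF u]]) (auto simp: v_def)
  have "(\<lambda>z. symb (snd z) (fst z) * v n z) \<in> L2 (MW l)" for n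
  proof (rule L2_dom[OF _ L2_integrable[OF L2_cmult[OF u, of "of_real (1 + real n)"]]])
    show "(\<lambda>z. symb (snd z) (fst z) * v n z) \<in> borel_measurable (MW l)" by simp
    have "cmod (symb (snd z) (fst z) * v n z) \<le> cmod (of_real (1 + real n) * u z)" for z
    proof (cases "norm (fst z) \<le> real n")
      case True
      then have "cmod (symb (snd z) (fst z)) \<le> 1 + real n" using symb_bound[of "snd z" "fst z"] by linarith
      then have "cmod (symb (snd z) (fst z)) * cmod (u z) \<le> (1 + real n) * cmod (u z)" by (rule mult_right_mono) simp
      then show ?thesis using True by (simp only: v_def norm_mult norm_of_real if_True)
    qed (simp add: v_def)
    then show "AE z in MW l. (cmod (symb (snd z) (fst z) * v n z))\<^sup>2 \<le> (cmod (of_real (1 + real n) * u z))\<^sup>2"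
      by (intro AE_I2 power_mono) auto
  qed
  then have AL: "Ag (v n) \<in> L2 (MW l)" for n using Ag_L2_iff[OF vL] by simp
  have "(\<lambda>n. LINT z|MW l. (cmod (u z - v n z))\<^sup>2) \<longlonglongrightarrow> (LINT z|MW l. 0)"
  proof (rule integral_dominated_convergence[OF _ _ L2_integrable[OF u]])
    show "AE z in MW l. (\<lambda>n. (cmod (u z - v n z))\<^sup>2) \<longlonglongrightarrow> 0"
    proof (rule AE_I2)
      fix z :: "vec3 \<times> vec3"
      have "eventually (\<lambda>n. real n > norm (fst z)) sequentially"
        using filterlim_real_sequentially by (auto simp: filterlim_at_top_dense)
      then have "eventually (\<lambda>n. (cmod (u z - v n z))\<^sup>2 = 0) sequentially" by eventually_elim (simp add: v_def)
      then show "(\<lambda>n. (cmod (u z - v n z))\<^sup>2) \<longlonglongrightarrow> 0" by (rule tendsto_eventually)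
    qed
    show "AE z in MW l. norm ((cmod (u z - v n z))\<^sup>2) \<le> (cmod (u z))\<^sup>2" for n by (auto simp: v_def)
  qed auto
  then have "(\<lambda>n. (nrm (MW l) (\<lambda>z. u z - v n z))\<^sup>2) \<longlonglongrightarrow> 0" by (simp add: nrm_sq)
  from tendsto_real_sqrt[OF this] have "(\<lambda>n. nrm (MW l) (\<lambda>z. u z - v n z)) \<longlonglongrightarrow> 0" by simp
  from order_tendstoD(2)[OF this e] obtain n where "nrm (MW l) (\<lambda>z. u z - v n z) < e" by (auto simp: eventually_sequentially)
  then show ?thesis using vL AL by blast
qed

section \<open>The semigroup on the phase space\<close>

lemma rep_collision: assumes r: "rep l f u" shows "rep l (\<lambda>x q. Pop \<beta> f x q / of_real (q0 q)) (Kg \<beta> u)"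
proof -
  have [measurable]: "case_prod f \<in> borel_measurable P6" using r by (simp add: rep_iff)
  have "case_prod (\<lambda>x q. Pop \<beta> f x q / of_real (q0 q)) = (\<lambda>z. \<Sum>a\<in>UNIV. efun \<beta> a (snd z) * (LINT p|lborel. case_prod f (fst z, p) * dfun \<beta> a p))"
    by (auto simp: Pop_div_q0)
  then have "case_prod (\<lambda>x q. Pop \<beta> f x q / of_real (q0 q)) \<in> borel_measurable P6" by (simp only:) measurable
  moreover have "is_ft (\<lambda>x. Pop \<beta> f x q / of_real (q0 q)) (\<lambda>y. Kg \<beta> u (y, q))" for q
    unfolding Pop_div_q0 Kg_def fst_conv snd_conv by (rule is_ft_sum) (auto intro!: is_ft_moment[OF l r] dfun_L2 b)
  ultimately show ?thesis using Kg_L2[OF rep_L2[OF r]] by (simp add: rep_iff)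
qed

lemma transport_iff: assumes f: "rep l f u" and w: "rep l w v"
  shows "transport_weak f w \<longleftrightarrow> (AE z in P6. v z = symb (snd z) (fst z) * u z)"
proof -
  have [measurable]: "u \<in> borel_measurable P6" "v \<in> borel_measurable P6" using rep_L2[OF f] rep_L2[OF w] by (auto simp: MW_L2_iff)
  have fq: "AE q in lborel. is_ft (\<lambda>x. f x q) (\<lambda>y. u (y, q))" and wq: "AE q in lborel. is_ft (\<lambda>x. w x q) (\<lambda>y. v (y, q))"
    using f w by (auto simp: rep_iff)
  have "transport_weak f w \<longleftrightarrow> (AE q in lborel. AE y in lborel. v (y, q) = symb q y * u (y, q))"
    unfolding transport_weak_def
    by (rule eventually_subst) (use fq wq in eventually_elim, rule transport_section)
  also have "\<dots> \<longleftrightarrow> (AE z in P6. v z = symb (snd z) (fst z) * u z)"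
  proof
    assume "AE q in lborel. AE y in lborel. v (y, q) = symb q y * u (y, q)"
    then show "AE z in P6. v z = symb (snd z) (fst z) * u z" by (intro AE_P6I_snd) auto
  next
    assume "AE z in P6. v z = symb (snd z) (fst z) * u z"
    from AE_pair_snd[OF this] show "AE q in lborel. AE y in lborel. v (y, q) = symb q y * u (y, q)" by simp
  qed
  finally show ?thesis .
qed

lemma domB_iff: assumes r: "rep l f u" shows "f \<in> domB l \<longleftrightarrow> Ag u \<in> L2 (MW l)"
proof -
  have u: "u \<in> L2 (MW l)" by (rule rep_L2[OF r])
  then have [measurable]: "u \<in> borel_measurable P6" by (simp add: MW_L2_iff)
  have fH: "f \<in> Hl l" using r Hl_iff by blast
  show ?thesis unfolding Ag_L2_iff[OF u]
  proof
    assume "f \<in> domB l"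
    then obtain w where w: "w \<in> Hl l" "transport_weak f w" by (auto simp: domB_def)
    then obtain v where v: "rep l w v" using Hl_iff by blast
    have "AE z in MW l. v z = symb (snd z) (fst z) * u z" using w(2) unfolding transport_iff[OF r v] AE_MW .
    then show "(\<lambda>z. symb (snd z) (fst z) * u z) \<in> L2 (MW l)" by (intro L2_cong_AE[OF rep_L2[OF v]]) auto
  next
    assume L: "(\<lambda>z. symb (snd z) (fst z) * u z) \<in> L2 (MW l)"
    then obtain w where w: "rep l w (\<lambda>z. symb (snd z) (fst z) * u z)" using rep_exists[OF l] by blast
    then have "transport_weak f w" "w \<in> Hl l" using transport_iff[OF r w] Hl_iff by auto
    then show "f \<in> domB l" using fH by (auto simp: domB_def)
  qed
qed

text \<open>The function \<open>w\<close> chosen in \<open>Bop\<close> is determined up to null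
  sets, as its transform must be the symbol times \<open>u\<close>.\<close>

lemma rep_Bop: assumes r: "rep l f u" and f: "f \<in> domB l" shows "rep l (Bop \<beta> l f) (Ag u)"
proof -
  define w where "w = (SOME w. w \<in> Hl l \<and> transport_weak f w)"
  have w: "w \<in> Hl l \<and> transport_weak f w"
    unfolding w_def using f by (intro someI_ex[of "\<lambda>w. w \<in> Hl l \<and> transport_weak f w"]) (auto simp: domB_def)
  then obtain v where v: "rep l w v" using Hl_iff by blast
  have "AE z in P6. v z = symb (snd z) (fst z) * u z" using w transport_iff[OF r v] by simp
  moreover have "(\<lambda>z. symb (snd z) (fst z) * u z) \<in> L2 (MW l)"
    using f unfolding domB_iff[OF r] Ag_L2_iff[OF rep_L2[OF r]] .
  ultimately have "rep l w (\<lambda>z. symb (snd z) (fst z) * u z)" using rep_cong_AE[OF v] by blast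
  from rep_sub[OF rep_collision[OF r] this]
  show ?thesis by (simp add: Bop_def Let_def w_def[symmetric] fsub_def Ag_eq[abs_def])
qed

definition U :: "pfun \<Rightarrow> vec3 \<times> vec3 \<Rightarrow> complex" where "U f = (SOME u. rep l f u)"
definition F :: "(vec3 \<times> vec3 \<Rightarrow> complex) \<Rightarrow> pfun" where "F u = (SOME f. rep l f u)"

lemma rep_U: "f \<in> Hl l \<Longrightarrow> rep l f (U f)"
  unfolding U_def Hl_iff by (rule someI_ex[of "rep l f"])

lemma rep_F: "u \<in> L2 (MW l) \<Longrightarrow> rep l (F u) u"
  unfolding F_def by (rule someI_ex[of "\<lambda>f. rep l f u"]) (rule rep_exists[OF l])

definition TS :: "real \<Rightarrow> pfun \<Rightarrow> pfun" where "TS t f = F (Tg t (U f))"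

text \<open>The choices in \<open>U\<close> and \<open>F\<close> do not matter: two transforms of
  \<open>f\<close> differ by norm zero, and by contraction so do their images.\<close>

lemma rep_TS: assumes t: "t \<ge> 0" and r: "rep l f u" shows "rep l (TS t f) (Tg t u)"
proof -
  have u: "u \<in> L2 (MW l)" by (rule rep_L2[OF r])
  have rU: "rep l f (U f)" by (rule rep_U) (use r Hl_iff in blast)
  have UL: "U f \<in> L2 (MW l)" by (rule rep_L2[OF rU])
  have "nrm (MW l) (\<lambda>z. Tg t (U f) z - Tg t u z) \<le> 1 * nrm (MW l) (\<lambda>z. U f z - u z)"
    by (rule Tg.diff_bound[OF t UL u]) (use Tg_L2(2)[OF t] in simp)
  also have "nrm (MW l) (\<lambda>z. U f z - u z) = 0" using rep_unique[OF rU r] nrm_0_AE[OF UL u] by simp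
  finally have "nrm (MW l) (\<lambda>z. Tg t (U f) z - Tg t u z) = 0" using nrm_nonneg[of "MW l" "\<lambda>z. Tg t (U f) z - Tg t u z"] by linarith
  then have "AE z in P6. Tg t (U f) z = Tg t u z" using nrm_0_AE[OF Tg_L2(1)[OF t UL] Tg_L2(1)[OF t u]] by simp
  then show ?thesis unfolding TS_def by (rule rep_cong_AE[OF rep_F[OF Tg_L2(1)[OF t UL]] Tg_L2(1)[OF t u]])
qed

lemma rep_quot: assumes "rep l g v" "rep l f u" shows "rep l (fscale (complex_of_real (1 / h)) (fsub g f)) (\<lambda>z. of_real (1 / h) * (v z - u z))"
  by (rule rep_scale[OF rep_sub[OF assms]])

lemma TS_C0: "C0_semigroup l TS"
  unfolding C0_semigroup_def
proof (intro conjI allI impI ballI)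
  fix t s :: real and f g :: pfun and a b' :: complex
  show "TS t f \<in> Hl l" if "0 \<le> t" "f \<in> Hl l" using rep_TS[OF that(1) rep_U[OF that(2)]] Hl_iff by blast
  show "\<exists>C. \<forall>f\<in>Hl l. hl_norm l (TS t f) \<le> C * hl_norm l f" if t: "0 \<le> t"
  proof (intro exI[of _ 1] ballI)
    fix f assume f: "f \<in> Hl l"
    show "hl_norm l (TS t f) \<le> 1 * hl_norm l f"
      unfolding rep_norm[OF rep_U[OF f]] rep_norm[OF rep_TS[OF t rep_U[OF f]]] using Tg_L2(2)[OF t rep_L2[OF rep_U[OF f]]] by simp
  qed
  show "hl_dist l (TS t (flin a f b' g)) (flin a (TS t f) b' (TS t g)) = 0" if t: "0 \<le> t" and f: "f \<in> Hl l" and g: "g \<in> Hl l"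
    using rep_dist[OF rep_TS[OF t rep_lin[OF rep_U[OF f] rep_U[OF g]]] rep_lin[OF rep_TS[OF t rep_U[OF f]] rep_TS[OF t rep_U[OF g]]]]
      Tg.Slin[OF t rep_L2[OF rep_U[OF f]] rep_L2[OF rep_U[OF g]]] by simp
  show "hl_dist l (TS 0 f) f = 0" if f: "f \<in> Hl l"
    using rep_dist[OF rep_TS[OF order_refl rep_U[OF f]] rep_U[OF f]] Tg.S0[OF rep_L2[OF rep_U[OF f]]] by simp
  show "hl_dist l (TS (s + t) f) (TS s (TS t f)) = 0" if s: "0 \<le> s" and t: "0 \<le> t" and f: "f \<in> Hl l"
    using rep_dist[OF rep_TS[OF add_nonneg_nonneg[OF s t] rep_U[OF f]] rep_TS[OF s rep_TS[OF t rep_U[OF f]]]]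
      Tg.Sadd[OF s t rep_L2[OF rep_U[OF f]]] by simp
  show "((\<lambda>t. hl_dist l (TS t f) f) \<longlongrightarrow> 0) (at_right 0)" if f: "f \<in> Hl l"
  proof (rule Lim_transform_eventually[OF Tg.Scont[OF rep_L2[OF rep_U[OF f]]]])
    show "\<forall>\<^sub>F t in at_right 0. nrm (MW l) (\<lambda>x. Tg t (U f) x - U f x) = hl_dist l (TS t f) f"
      using eventually_at_right_less[of 0] by eventually_elim (simp add: rep_dist[OF rep_TS[OF _ rep_U[OF f]] rep_U[OF f]])
  qed
qed

lemma TS_quot: assumes h: "h \<ge> 0" and f: "rep l f u" and v: "rep l g v"
  shows "hl_dist l (fscale (complex_of_real (1 / h)) (fsub (TS h f) f)) g = nrm (MW l) (\<lambda>z. quot Tg h u z - v z)"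
  unfolding rep_dist[OF rep_quot[OF rep_TS[OF h f] f] v] quot_def ..

lemma TS_quot_tendsto: assumes f: "rep l f u" and v: "rep l g v"
  shows "((\<lambda>h. hl_dist l (fscale (complex_of_real (1 / h)) (fsub (TS h f) f)) g) \<longlongrightarrow> 0) (at_right 0)
     \<longleftrightarrow> ((\<lambda>h. nrm (MW l) (\<lambda>z. quot Tg h u z - v z)) \<longlongrightarrow> 0) (at_right 0)"
proof (rule tendsto_cong)
  show "\<forall>\<^sub>F h in at_right 0. hl_dist l (fscale (complex_of_real (1 / h)) (fsub (TS h f) f)) g = nrm (MW l) (\<lambda>z. quot Tg h u z - v z)"
    using eventually_at_right_less[of 0] by eventually_elim (rule TS_quot[OF _ f v], simp)
qed

lemma TS_generates: "generates l TS (Bop \<beta> l) (domB l)"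
  unfolding generates_def
proof (intro conjI ballI)
  show D: "domB l \<subseteq> Hl l" by (auto simp: domB_def)
  fix f assume f: "f \<in> Hl l"
  note r = rep_U[OF f] note u = rep_L2[OF r]
  show "f \<in> domB l \<longleftrightarrow> (\<exists>v\<in>Hl l. ((\<lambda>t. hl_dist l (fscale (complex_of_real (1 / t)) (fsub (TS t f) f)) v) \<longlongrightarrow> 0) (at_right 0))"
  proof
    assume fd: "f \<in> domB l"
    have "((\<lambda>t. hl_dist l (fscale (complex_of_real (1 / t)) (fsub (TS t f) f)) (Bop \<beta> l f)) \<longlongrightarrow> 0) (at_right 0)"
      unfolding TS_quot_tendsto[OF r rep_Bop[OF r fd]] by (rule Tg_generator[OF u]) (use fd domB_iff[OF r] in simp)
    moreover have "Bop \<beta> l f \<in> Hl l" using rep_Bop[OF r fd] Hl_iff by blast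
    ultimately show "\<exists>v\<in>Hl l. ((\<lambda>t. hl_dist l (fscale (complex_of_real (1 / t)) (fsub (TS t f) f)) v) \<longlongrightarrow> 0) (at_right 0)" by blast
  next
    assume "\<exists>v\<in>Hl l. ((\<lambda>t. hl_dist l (fscale (complex_of_real (1 / t)) (fsub (TS t f) f)) v) \<longlongrightarrow> 0) (at_right 0)"
    then obtain g where g: "g \<in> Hl l" "((\<lambda>t. hl_dist l (fscale (complex_of_real (1 / t)) (fsub (TS t f) f)) g) \<longlongrightarrow> 0) (at_right 0)" by blast
    note v = rep_L2[OF rep_U[OF g(1)]]
    have e: "AE z in MW l. U g z = Ag (U f) z"
      unfolding AE_MW by (rule Tg_generator_unique[OF u v g(2)[unfolded TS_quot_tendsto[OF r rep_U[OF g(1)]]]])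
    have [measurable]: "U f \<in> borel_measurable P6" using u by (simp add: MW_L2_iff)
    have "Ag (U f) \<in> L2 (MW l)" by (rule L2_cong_AE[OF v _ e]) simp
    then show "f \<in> domB l" using domB_iff[OF r] by simp
  qed
next
  fix f assume fd: "f \<in> domB l"
  then have f: "f \<in> Hl l" by (auto simp: domB_def)
  note r = rep_U[OF f]
  show "Bop \<beta> l f \<in> Hl l" using rep_Bop[OF r fd] Hl_iff by blast
  show "((\<lambda>t. hl_dist l (fscale (complex_of_real (1 / t)) (fsub (TS t f) f)) (Bop \<beta> l f)) \<longlongrightarrow> 0) (at_right 0)"
    unfolding TS_quot_tendsto[OF r rep_Bop[OF r fd]] by (rule Tg_generator[OF rep_L2[OF r]]) (use fd domB_iff[OF r] in simp)
qed

section \<open>Uniqueness on the phase space\<close>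

text \<open>The competing semigroup is carried to the Fourier side, where
  \<open>semigroup_unique\<close> applies; domain and generator are translated by
  \<open>domB_iff\<close> and \<open>rep_Bop\<close>.\<close>

lemma TS_unique:
  assumes C: "C0_semigroup l T'" and G: "generates l T' (Bop \<beta> l) (domB l)" and t: "t \<ge> 0" and f0: "f0 \<in> Hl l"
  shows "hl_dist l (T' t f0) (TS t f0) = 0"
proof -
  have TH: "T' t f \<in> Hl l" if "t \<ge> 0" "f \<in> Hl l" for t f using C that by (auto simp: C0_semigroup_def)
  have Tb: "\<exists>C. \<forall>f\<in>Hl l. hl_norm l (T' t f) \<le> C * hl_norm l f" if "t \<ge> 0" for t using C that by (auto simp: C0_semigroup_def)
  have Tl: "hl_dist l (T' t (flin a f b g)) (flin a (T' t f) b (T' t g)) = 0" if "t \<ge> 0" "f \<in> Hl l" "g \<in> Hl l" for t a f b g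
    using C that unfolding C0_semigroup_def by blast
  have T0: "hl_dist l (T' 0 f) f = 0" if "f \<in> Hl l" for f using C that by (auto simp: C0_semigroup_def)
  have Ta: "hl_dist l (T' (s + t) f) (T' s (T' t f)) = 0" if "s \<ge> 0" "t \<ge> 0" "f \<in> Hl l" for s t f using C that by (auto simp: C0_semigroup_def)
  have Tc: "((\<lambda>t. hl_dist l (T' t f) f) \<longlongrightarrow> 0) (at_right 0)" if "f \<in> Hl l" for f using C that by (auto simp: C0_semigroup_def)
  have H: "rep l f u \<Longrightarrow> f \<in> Hl l" for f u using Hl_iff by blast
  have UL: "f \<in> Hl l \<Longrightarrow> U f \<in> L2 (MW l)" for f by (rule rep_L2[OF rep_U])
  have dU: "hl_dist l f g = nrm (MW l) (\<lambda>z. U f z - U g z)" if "f \<in> Hl l" "g \<in> Hl l" for f g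
    using that by (intro rep_dist rep_U)
  have tri: "hl_dist l f k = 0" if "f \<in> Hl l" "g \<in> Hl l" "k \<in> Hl l" "hl_dist l f g = 0" "hl_dist l g k = 0" for f g k
    using nrm_triangle3[OF UL[OF that(1)] UL[OF that(2)] UL[OF that(3)]] that by (intro order_antisym[OF _ nrm_nonneg[of "MW l" "\<lambda>z. U f z - U k z", folded dU[OF that(1,3)]]]) (simp add: dU)
  have comm: "hl_dist l f g = hl_dist l g f" if "f \<in> Hl l" "g \<in> Hl l" for f g
    unfolding dU[OF that] dU[OF that(2,1)] by (rule nrm_minus_commute)
  \<comment> \<open>\<open>U\<close> and \<open>F\<close> change representatives, so
    \<open>T' t\<close> must respect equality up to norm zero. This follows from its boundedness and
    linearity, applied to the difference of the two functions.\<close>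
  have cong: "hl_dist l (T' t f) (T' t g) = 0" if t: "t \<ge> 0" and f: "f \<in> Hl l" and g: "g \<in> Hl l" and d: "hl_dist l f g = 0" for t f g
  proof -
    let ?k = "flin 1 f (- 1) g"
    have k: "rep l ?k (\<lambda>z. 1 * U f z + (- 1) * U g z)" by (rule rep_lin[OF rep_U[OF f] rep_U[OF g]])
    have "hl_norm l ?k = 0" unfolding rep_norm[OF k] using d by (simp add: dU f g)
    then have z: "hl_norm l (T' t ?k) \<le> 0" using Tb[OF t] H[OF k] by fastforce
    have TkH: "T' t ?k \<in> Hl l" by (rule TH[OF t H[OF k]])
    let ?a = "U (T' t ?k)" and ?b = "\<lambda>z. 1 * U (T' t f) z + (- 1) * U (T' t g) z"
    have bL: "?b \<in> L2 (MW l)" by (intro L2_add L2_cmult UL TH t f g)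
    have "nrm (MW l) ?a \<le> 0" using z rep_norm[OF rep_U[OF TkH]] by simp
    moreover have "nrm (MW l) (\<lambda>z. ?a z - ?b z) = 0"
      using Tl[OF t f g, of 1 "- 1"] rep_dist[OF rep_U[OF TkH] rep_lin[OF rep_U[OF TH[OF t f]] rep_U[OF TH[OF t g]], of 1 "- 1"]] by simp
    ultimately have "nrm (MW l) ?b \<le> 0" using nrm_le_diff[OF bL UL[OF TkH]] nrm_minus_commute[of "MW l" ?a ?b] by simp
    then have "nrm (MW l) ?b = 0" by (rule order_antisym[OF _ nrm_nonneg])
    then show ?thesis by (simp add: dU TH t f g)
  qed
  define S where "S t u = U (T' t (F u))" for t u
  have FH: "F u \<in> Hl l" if "u \<in> L2 (MW l)" for u by (rule H[OF rep_F[OF that]])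
  have repS: "rep l (T' t (F u)) (S t u)" if "t \<ge> 0" "u \<in> L2 (MW l)" for t u
    unfolding S_def by (intro rep_U TH FH that)
  have Fd: "hl_dist l (F u) f = 0" if "rep l f u" for f u
    using rep_dist[OF rep_F[OF rep_L2[OF that]] that] by simp
  have S: "L2_semigroup (MW l) S"
  proof
    fix t s :: real and u v :: "vec3 \<times> vec3 \<Rightarrow> complex" and a b' :: complex
    show SL: "S t u \<in> L2 (MW l)" if "t \<ge> 0" "u \<in> L2 (MW l)" for t u by (rule rep_L2[OF repS[OF that]])
    show "\<exists>C. \<forall>u\<in>L2 (MW l). nrm (MW l) (S t u) \<le> C * nrm (MW l) u" if t: "t \<ge> 0"
    proof -
      obtain C where C: "\<forall>f\<in>Hl l. hl_norm l (T' t f) \<le> C * hl_norm l f" using Tb[OF t] by blast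
      have "nrm (MW l) (S t u) \<le> C * nrm (MW l) u" if u: "u \<in> L2 (MW l)" for u
        using C FH[OF u] rep_norm[OF repS[OF t u]] rep_norm[OF rep_F[OF u]] by auto
      then show ?thesis by blast
    qed
    show "nrm (MW l) (\<lambda>x. S t (\<lambda>x. a * u x + b' * v x) x - (a * S t u x + b' * S t v x)) = 0"
      if t: "t \<ge> 0" and u: "u \<in> L2 (MW l)" and v: "v \<in> L2 (MW l)"
    proof -
      let ?w = "\<lambda>x. a * u x + b' * v x"
      have wL: "?w \<in> L2 (MW l)" by (intro L2_add L2_cmult u v)
      note rl = rep_lin[OF rep_F[OF u] rep_F[OF v], of a b']
      note rl' = rep_lin[OF repS[OF t u] repS[OF t v], of a b']
      have "hl_dist l (T' t (F ?w)) (T' t (flin a (F u) b' (F v))) = 0"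
        by (rule cong[OF t FH[OF wL] H[OF rl] Fd[OF rl]])
      then have "hl_dist l (T' t (F ?w)) (flin a (T' t (F u)) b' (T' t (F v))) = 0"
        by (rule tri[OF TH[OF t FH[OF wL]] TH[OF t H[OF rl]] H[OF rl'] _ Tl[OF t FH[OF u] FH[OF v]]])
      then show ?thesis unfolding rep_dist[OF repS[OF t wL] rl'] .
    qed
    show "nrm (MW l) (\<lambda>x. S 0 u x - u x) = 0" if u: "u \<in> L2 (MW l)"
      using T0[OF FH[OF u]] unfolding rep_dist[OF repS[OF order_refl u] rep_F[OF u]] .
    show "nrm (MW l) (\<lambda>x. S (s + t) u x - S s (S t u) x) = 0" if s: "s \<ge> 0" and t: "t \<ge> 0" and u: "u \<in> L2 (MW l)"
    proof -
      note r = repS[OF t u]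
      have L: "S t u \<in> L2 (MW l)" by (rule SL[OF t u])
      have "hl_dist l (T' s (T' t (F u))) (T' s (F (S t u))) = 0"
        by (rule cong[OF s H[OF r] FH[OF L]]) (use Fd[OF r] comm[OF H[OF r] FH[OF L]] in simp)
      then have "hl_dist l (T' (s + t) (F u)) (T' s (F (S t u))) = 0"
        by (intro tri[OF TH[OF add_nonneg_nonneg[OF s t] FH[OF u]] TH[OF s TH[OF t FH[OF u]]] TH[OF s FH[OF L]] Ta[OF s t FH[OF u]]])
      then show ?thesis unfolding rep_dist[OF repS[OF add_nonneg_nonneg[OF s t] u] repS[OF s L]] .
    qed
    show "((\<lambda>t. nrm (MW l) (\<lambda>x. S t u x - u x)) \<longlongrightarrow> 0) (at_right 0)" if u: "u \<in> L2 (MW l)"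
    proof (rule Lim_transform_eventually[OF Tc[OF FH[OF u]]])
      show "\<forall>\<^sub>F t in at_right 0. hl_dist l (T' t (F u)) (F u) = nrm (MW l) (\<lambda>x. S t u x - u x)"
        using eventually_at_right_less[of 0] by eventually_elim (rule rep_dist[OF repS[OF _ u] rep_F[OF u]], simp)
    qed
  qed
  have quotS: "((\<lambda>h. hl_dist l (fscale (complex_of_real (1 / h)) (fsub (T' h (F u)) (F u))) g) \<longlongrightarrow> 0) (at_right 0)
     \<longleftrightarrow> ((\<lambda>h. nrm (MW l) (\<lambda>z. quot S h u z - v z)) \<longlongrightarrow> 0) (at_right 0)" if u: "u \<in> L2 (MW l)" and v: "rep l g v" for u g v
  proof (rule tendsto_cong)
    show "\<forall>\<^sub>F h in at_right 0. hl_dist l (fscale (complex_of_real (1 / h)) (fsub (T' h (F u)) (F u))) g = nrm (MW l) (\<lambda>z. quot S h u z - v z)"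
      using eventually_at_right_less[of 0]
    proof eventually_elim
      case (elim h)
      then have "h \<ge> 0" by simp
      from rep_dist[OF rep_quot[OF repS[OF this u] rep_F[OF u]] v] show ?case by (simp only: quot_def)
    qed
  qed
  have Gm: "f \<in> domB l \<longleftrightarrow> (\<exists>v\<in>Hl l. ((\<lambda>t. hl_dist l (fscale (complex_of_real (1 / t)) (fsub (T' t f) f)) v) \<longlongrightarrow> 0) (at_right 0))"
    if "f \<in> Hl l" for f using G that unfolding generates_def by blast
  have Gl: "((\<lambda>t. hl_dist l (fscale (complex_of_real (1 / t)) (fsub (T' t f) f)) (Bop \<beta> l f)) \<longlongrightarrow> 0) (at_right 0)"
    if "f \<in> domB l" for f using G that unfolding generates_def by blast
  let ?u = "U f0"
  have uL: "?u \<in> L2 (MW l)" by (rule UL[OF f0])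
  have z: "nrm (MW l) (\<lambda>x. S t ?u x - Tg t ?u x) = 0"
  proof (rule semigroup_unique[OF S Tg.L2_semigroup_axioms Tg_L2(2), where Dom="{v \<in> L2 (MW l). Ag v \<in> L2 (MW l)}"])
    show "\<exists>v\<in>L2 (MW l). ((\<lambda>h. nrm (MW l) (\<lambda>x. quot S h u x - v x)) \<longlongrightarrow> 0) (at_right 0) \<and>
          ((\<lambda>h. nrm (MW l) (\<lambda>x. quot Tg h u x - v x)) \<longlongrightarrow> 0) (at_right 0)" if "u \<in> {v \<in> L2 (MW l). Ag v \<in> L2 (MW l)}" for u
    proof -
      have u: "u \<in> L2 (MW l)" "Ag u \<in> L2 (MW l)" using that by auto
      have fd: "F u \<in> domB l" using domB_iff[OF rep_F[OF u(1)]] u(2) by simp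
      have "((\<lambda>h. nrm (MW l) (\<lambda>x. quot S h u x - Ag u x)) \<longlongrightarrow> 0) (at_right 0)"
        using Gl[OF fd] unfolding quotS[OF u(1) rep_Bop[OF rep_F[OF u(1)] fd]] .
      then show ?thesis using Tg_generator[OF u] u(2) by blast
    qed
    show "u \<in> {v \<in> L2 (MW l). Ag v \<in> L2 (MW l)}"
      if u: "u \<in> L2 (MW l)" and v: "v \<in> L2 (MW l)" and q: "((\<lambda>h. nrm (MW l) (\<lambda>x. quot S h u x - v x)) \<longlongrightarrow> 0) (at_right 0)" for u v
    proof -
      have "((\<lambda>h. hl_dist l (fscale (complex_of_real (1 / h)) (fsub (T' h (F u)) (F u))) (F v)) \<longlongrightarrow> 0) (at_right 0)"
        using q unfolding quotS[OF u rep_F[OF v]] .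
      then have "F u \<in> domB l" unfolding Gm[OF FH[OF u]] using FH[OF v] by blast
      then show ?thesis using domB_iff[OF rep_F[OF u]] u by simp
    qed
  qed (use uL t domain_dense in auto)
  have "hl_dist l (T' t (F ?u)) (TS t f0) = 0"
    unfolding rep_dist[OF repS[OF t uL] rep_TS[OF t rep_U[OF f0]]] by (rule z)
  moreover have "hl_dist l (T' t f0) (T' t (F ?u)) = 0"
    by (rule cong[OF t f0 FH[OF uL]]) (use Fd[OF rep_U[OF f0]] comm[OF f0 FH[OF uL]] in simp)
  ultimately show ?thesis
    by (intro tri[OF TH[OF t f0] TH[OF t FH[OF uL]] H[OF rep_TS[OF t rep_U[OF f0]]]])
qed

end

theorem theorem5p2:
  fixes \<beta>0 l :: real and f0 :: pfun
  assumes "\<beta>0 > 0" and "l \<ge> 0" and "f0 \<in> Hl l"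
  shows "\<exists>f :: real \<Rightarrow> pfun.
           (\<exists>T. C0_semigroup l T \<and> generates l T (Bop \<beta>0 l) (domB l) \<and> (\<forall>t\<ge>0. f t = T t f0)) \<and>
           (\<forall>t\<ge>0. f t \<in> Hl l \<and> hl_norm l (f t) \<le> hl_norm l f0) \<and>
           (\<forall>T'. C0_semigroup l T' \<and> generates l T' (Bop \<beta>0 l) (domB l) \<longrightarrow>
                 (\<forall>t\<ge>0. hl_dist l (T' t f0) (f t) = 0))"
proof -
  interpret bgk \<beta>0 l using assms by unfold_locales
  show ?thesis
  proof (intro exI[of _ "\<lambda>t. TS t f0"] conjI allI impI)
    show "\<exists>T. C0_semigroup l T \<and> generates l T (Bop \<beta>0 l) (domB l) \<and> (\<forall>t\<ge>0. TS t f0 = T t f0)"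
      using TS_C0 TS_generates by blast
    fix t :: real assume t: "0 \<le> t"
    note r = rep_U[OF assms(3)]
    show "TS t f0 \<in> Hl l" using rep_TS[OF t r] Hl_iff by blast
    show "hl_norm l (TS t f0) \<le> hl_norm l f0"
      unfolding rep_norm[OF r] rep_norm[OF rep_TS[OF t r]] by (rule Tg_L2(2)[OF t rep_L2[OF r]])
    fix T' assume "C0_semigroup l T' \<and> generates l T' (Bop \<beta>0 l) (domB l)"
    then show "hl_dist l (T' t f0) (TS t f0) = 0" using TS_unique[OF _ _ t assms(3)] by blast
  qed
qed

end
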